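(* Let $\Gamma$ and $\Lambda$ be countable discrete groups that are von Neumann equivalent. Then: (a) $\Gamma$ is amenable if and only if $\Lambda$ is amenable; (b) $\Gamma$ has Kazhdan's property (T) if and only if $\Lambda$ has property (T); (c) $\Gamma$ has the Haagerup property if and only if $\Lambda$ has the Haagerup property.
   Context: A fundamental domain for an action $\Gamma \curvearrowright^{\sigma} \mathcal M$ of a discrete group on a von Neumann algebra (by automorphisms) is a projection $p\in\mathcal M$ such that the projections $\{\sigma_\gamma(p)\}_{\gamma\in\Gamma}$ form a partition of unity, i.e. they are pairwise orthogonal and $\sum_{\gamma\in\Gamma}\sigma_\gamma(p)=1$ in the strong operator topology. Two groups $\Gamma$ and $\Lambda$ are von Neumann equivalent, written $\Gamma\sim_{vNE}\Lambda$, if there exists a (non-zero) von Neumann algebra $\mathcal M$ with a semi-finite normal faithful trace ${\rm Tr}$ and commuting trace-preserving actions of $\Gamma$ and $\Lambda$ on $\mathcal M$ such that the $\Gamma$-action and the $\Lambda$-action each admit a fundamental domain of finite trace. *)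

theory Defs
  imports Complex_Main
    "HOL-Library.Countable_Set"
    "HOL-Library.Extended_Nonnegative_Real"
    "HOL-Algebra.Module"
    "HOL-Algebra.Group_Action"
begin

section \<open>Complex Hilbert spaces\<close>

text \<open>Hilbert spaces are carrier-based, so that one can quantify over Hilbert spaces of different
  dimensions. The multiplicative fields inherited from \<^type>\<open>ring\<close> via the record
  \<^type>\<open>module\<close> play no role.\<close>

definition complex_ring :: "complex ring" where
  "complex_ring = \<lparr>carrier = UNIV, mult = (*), one = 1, zero = 0, add = (+)\<rparr>"

record 'h inner_module = "(complex, 'h) module" +
  hinner :: "'h \<Rightarrow> 'h \<Rightarrow> complex"

definition hnorm :: "('h, 'm) inner_module_scheme \<Rightarrow> 'h \<Rightarrow> real" where
  "hnorm H x = sqrt (Re (hinner H x x))"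

text \<open>The inner product is linear in the first argument.\<close>

locale hilbert_space = Module.module complex_ring H for H :: "'h inner_module" (structure) +
  assumes hinner_add: "\<lbrakk>x \<in> carrier H; y \<in> carrier H; z \<in> carrier H\<rbrakk> \<Longrightarrow>
        hinner H (x \<oplus> y) z = hinner H x z + hinner H y z"
    and hinner_smult: "\<lbrakk>x \<in> carrier H; y \<in> carrier H\<rbrakk> \<Longrightarrow>
        hinner H (a \<odot> x) y = a * hinner H x y"
    and hinner_commute: "\<lbrakk>x \<in> carrier H; y \<in> carrier H\<rbrakk> \<Longrightarrow>
        hinner H y x = cnj (hinner H x y)"
    and hinner_ge_zero: "x \<in> carrier H \<Longrightarrow> Re (hinner H x x) \<ge> 0"
    and hinner_eq_zero: "\<lbrakk>x \<in> carrier H; hinner H x x = 0\<rbrakk> \<Longrightarrow> x = \<zero>"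
    and complete: "\<lbrakk>\<And>n. X n \<in> carrier H;
        \<And>e. e > 0 \<Longrightarrow> \<exists>N. \<forall>m\<ge>N. \<forall>n\<ge>N. hnorm H (X m \<ominus> X n) < e\<rbrakk> \<Longrightarrow>
        \<exists>l\<in>carrier H. (\<lambda>n::nat. hnorm H (X n \<ominus> l)) \<longlonglongrightarrow> 0"


section \<open>Bounded operators\<close>

text \<open>Operators are extensional functions on the carrier, so that equality of operators
  is equality in HOL.\<close>

definition bounded_ops :: "'h inner_module \<Rightarrow> ('h \<Rightarrow> 'h) set" where
  "bounded_ops H = {T \<in> carrier H \<rightarrow>\<^sub>E carrier H.
     (\<forall>x\<in>carrier H. \<forall>y\<in>carrier H. T (x \<oplus>\<^bsub>H\<^esub> y) = T x \<oplus>\<^bsub>H\<^esub> T y) \<and>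
     (\<forall>a. \<forall>x\<in>carrier H. T (a \<odot>\<^bsub>H\<^esub> x) = a \<odot>\<^bsub>H\<^esub> T x) \<and>
     (\<exists>C. \<forall>x\<in>carrier H. hnorm H (T x) \<le> C * hnorm H x)}"

definition op_zero :: "'h inner_module \<Rightarrow> 'h \<Rightarrow> 'h" where
  "op_zero H = (\<lambda>x\<in>carrier H. \<zero>\<^bsub>H\<^esub>)"

definition op_one :: "'h inner_module \<Rightarrow> 'h \<Rightarrow> 'h" where
  "op_one H = (\<lambda>x\<in>carrier H. x)"

definition op_add :: "'h inner_module \<Rightarrow> ('h \<Rightarrow> 'h) \<Rightarrow> ('h \<Rightarrow> 'h) \<Rightarrow> 'h \<Rightarrow> 'h" where
  "op_add H S T = (\<lambda>x\<in>carrier H. S x \<oplus>\<^bsub>H\<^esub> T x)"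

definition op_scale :: "'h inner_module \<Rightarrow> complex \<Rightarrow> ('h \<Rightarrow> 'h) \<Rightarrow> 'h \<Rightarrow> 'h" where
  "op_scale H a T = (\<lambda>x\<in>carrier H. a \<odot>\<^bsub>H\<^esub> T x)"

definition op_mult :: "'h inner_module \<Rightarrow> ('h \<Rightarrow> 'h) \<Rightarrow> ('h \<Rightarrow> 'h) \<Rightarrow> 'h \<Rightarrow> 'h" where
  "op_mult H S T = compose (carrier H) S T"

definition adj :: "'h inner_module \<Rightarrow> ('h \<Rightarrow> 'h) \<Rightarrow> 'h \<Rightarrow> 'h" where
  "adj H T = (THE S. S \<in> bounded_ops H \<and>
     (\<forall>x\<in>carrier H. \<forall>y\<in>carrier H. hinner H (T x) y = hinner H x (S y)))"

definition positive_op :: "'h inner_module \<Rightarrow> ('h \<Rightarrow> 'h) \<Rightarrow> bool" where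
  "positive_op H T \<longleftrightarrow> T \<in> bounded_ops H \<and>
     (\<forall>x\<in>carrier H. Im (hinner H (T x) x) = 0 \<and> Re (hinner H (T x) x) \<ge> 0)"

definition op_le :: "'h inner_module \<Rightarrow> ('h \<Rightarrow> 'h) \<Rightarrow> ('h \<Rightarrow> 'h) \<Rightarrow> bool" where
  "op_le H S T \<longleftrightarrow> positive_op H (op_add H T (op_scale H (-1) S))"


section \<open>Von Neumann algebras and traces\<close>

locale von_neumann_algebra = hilbert_space H for H :: "'h inner_module" (structure) +
  fixes M :: "('h \<Rightarrow> 'h) set"
  assumes M_bounded: "M \<subseteq> bounded_ops H"
    and M_one: "op_one H \<in> M"
    and M_add: "\<lbrakk>S \<in> M; T \<in> M\<rbrakk> \<Longrightarrow> op_add H S T \<in> M"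
    and M_scale: "T \<in> M \<Longrightarrow> op_scale H a T \<in> M"
    and M_mult: "\<lbrakk>S \<in> M; T \<in> M\<rbrakk> \<Longrightarrow> op_mult H S T \<in> M"
    and M_adj: "T \<in> M \<Longrightarrow> adj H T \<in> M"
    and M_closed: \<comment> \<open>closed in the weak operator topology\<close>
      "\<lbrakk>T \<in> bounded_ops H;
        \<And>F e. \<lbrakk>finite F; F \<subseteq> carrier H \<times> carrier H; e > 0\<rbrakk> \<Longrightarrow>
          \<exists>S\<in>M. \<forall>(x, y)\<in>F. cmod (hinner H (S x) y - hinner H (T x) y) < e\<rbrakk> \<Longrightarrow> T \<in> M"

definition pos_cone :: "'h inner_module \<Rightarrow> ('h \<Rightarrow> 'h) set \<Rightarrow> ('h \<Rightarrow> 'h) set" where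
  "pos_cone H M = {T \<in> M. positive_op H T}"

text \<open>A trace is a function from the positive cone to \<open>[0, \<infinity>]\<close>; its values elsewhere are irrelevant.
  In \<open>Tr_normal\<close>, \<open>D\<close> is an increasing net with least upper bound \<open>s\<close>.\<close>

locale semifinite_trace = von_neumann_algebra H M
  for H :: "'h inner_module" (structure) and M +
  fixes Tr :: "('h \<Rightarrow> 'h) \<Rightarrow> ennreal"
  assumes Tr_add: "\<lbrakk>S \<in> pos_cone H M; T \<in> pos_cone H M\<rbrakk> \<Longrightarrow> Tr (op_add H S T) = Tr S + Tr T"
    and Tr_scale: "\<lbrakk>T \<in> pos_cone H M; c \<ge> 0\<rbrakk> \<Longrightarrow>
        Tr (op_scale H (complex_of_real c) T) = ennreal c * Tr T"
    and Tr_tracial: "T \<in> M \<Longrightarrow> Tr (op_mult H (adj H T) T) = Tr (op_mult H T (adj H T))"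
    and Tr_faithful: "\<lbrakk>T \<in> pos_cone H M; Tr T = 0\<rbrakk> \<Longrightarrow> T = op_zero H"
    and Tr_normal: "\<lbrakk>D \<subseteq> pos_cone H M; D \<noteq> {};
        \<And>S T. \<lbrakk>S \<in> D; T \<in> D\<rbrakk> \<Longrightarrow> \<exists>R\<in>D. op_le H S R \<and> op_le H T R;
        s \<in> pos_cone H M; \<And>T. T \<in> D \<Longrightarrow> op_le H T s;
        \<And>t. \<lbrakk>t \<in> pos_cone H M; \<And>T. T \<in> D \<Longrightarrow> op_le H T t\<rbrakk> \<Longrightarrow> op_le H s t\<rbrakk> \<Longrightarrow>
        Tr s = (SUP T\<in>D. Tr T)"
    and Tr_semifinite: "\<lbrakk>T \<in> pos_cone H M; T \<noteq> op_zero H\<rbrakk> \<Longrightarrow>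
        \<exists>S\<in>pos_cone H M. S \<noteq> op_zero H \<and> op_le H S T \<and> Tr S < \<infinity>"


section \<open>Actions and von Neumann equivalence\<close>

text \<open>An action by *-automorphisms. Bijectivity is part of \<^locale>\<open>group_action\<close>.\<close>

locale vN_action = group_action G M \<sigma>
  for G :: "'g monoid" and H :: "'h inner_module" and M :: "('h \<Rightarrow> 'h) set"
    and \<sigma> :: "'g \<Rightarrow> ('h \<Rightarrow> 'h) \<Rightarrow> ('h \<Rightarrow> 'h)" +
  assumes act_add: "\<lbrakk>g \<in> carrier G; S \<in> M; T \<in> M\<rbrakk> \<Longrightarrow>
        \<sigma> g (op_add H S T) = op_add H (\<sigma> g S) (\<sigma> g T)"
    and act_scale: "\<lbrakk>g \<in> carrier G; T \<in> M\<rbrakk> \<Longrightarrow> \<sigma> g (op_scale H a T) = op_scale H a (\<sigma> g T)"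
    and act_mult: "\<lbrakk>g \<in> carrier G; S \<in> M; T \<in> M\<rbrakk> \<Longrightarrow>
        \<sigma> g (op_mult H S T) = op_mult H (\<sigma> g S) (\<sigma> g T)"
    and act_adj: "\<lbrakk>g \<in> carrier G; T \<in> M\<rbrakk> \<Longrightarrow> \<sigma> g (adj H T) = adj H (\<sigma> g T)"

definition trace_preserving ::
  "'g monoid \<Rightarrow> 'h inner_module \<Rightarrow> ('h \<Rightarrow> 'h) set \<Rightarrow> (('h \<Rightarrow> 'h) \<Rightarrow> ennreal) \<Rightarrow>
   ('g \<Rightarrow> ('h \<Rightarrow> 'h) \<Rightarrow> ('h \<Rightarrow> 'h)) \<Rightarrow> bool" where
  "trace_preserving G H M Tr \<sigma> \<longleftrightarrow> (\<forall>g\<in>carrier G. \<forall>T\<in>pos_cone H M. Tr (\<sigma> g T) = Tr T)"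

definition fundamental_domain ::
  "'g monoid \<Rightarrow> 'h inner_module \<Rightarrow> ('h \<Rightarrow> 'h) set \<Rightarrow>
   ('g \<Rightarrow> ('h \<Rightarrow> 'h) \<Rightarrow> ('h \<Rightarrow> 'h)) \<Rightarrow> ('h \<Rightarrow> 'h) \<Rightarrow> bool" where
  "fundamental_domain G H M \<sigma> p \<longleftrightarrow>
     p \<in> M \<and> adj H p = p \<and> op_mult H p p = p \<and>
     (\<forall>g\<in>carrier G. \<forall>h\<in>carrier G. g \<noteq> h \<longrightarrow> op_mult H (\<sigma> g p) (\<sigma> h p) = op_zero H) \<and>
     (\<forall>x\<in>carrier H.
        ((\<lambda>F. hnorm H ((\<Oplus>\<^bsub>H\<^esub>g\<in>F. \<sigma> g p x) \<ominus>\<^bsub>H\<^esub> x)) \<longlongrightarrow> 0)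
          (finite_subsets_at_top (carrier G)))"

text \<open>The type argument is the type underlying the Hilbert space on which the von Neumann algebra
  acts. HOL cannot quantify existentially over it inside the definition; when it occurs as a type
  variable only in a hypothesis of a theorem, the hypothesis has the intended existential meaning.\<close>

definition vN_equivalent :: "'h itself \<Rightarrow> 'a monoid \<Rightarrow> 'b monoid \<Rightarrow> bool" where
  "vN_equivalent (_ :: 'h itself) \<Gamma> \<Lambda> \<longleftrightarrow>
     (\<exists>(H :: 'h inner_module) M Tr \<sigma> \<tau>.
        semifinite_trace H M Tr \<and> op_one H \<noteq> op_zero H \<and>
        vN_action \<Gamma> H M \<sigma> \<and> trace_preserving \<Gamma> H M Tr \<sigma> \<and>
        vN_action \<Lambda> H M \<tau> \<and> trace_preserving \<Lambda> H M Tr \<tau> \<and>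
        (\<forall>g\<in>carrier \<Gamma>. \<forall>l\<in>carrier \<Lambda>. \<forall>T\<in>M. \<sigma> g (\<tau> l T) = \<tau> l (\<sigma> g T)) \<and>
        (\<exists>p. fundamental_domain \<Gamma> H M \<sigma> p \<and> Tr p < \<infinity>) \<and>
        (\<exists>q. fundamental_domain \<Lambda> H M \<tau> q \<and> Tr q < \<infinity>))"


section \<open>Amenability\<close>

definition bounded_on :: "'a monoid \<Rightarrow> ('a \<Rightarrow> real) \<Rightarrow> bool" where
  "bounded_on G f \<longleftrightarrow> (\<exists>C. \<forall>x\<in>carrier G. \<bar>f x\<bar> \<le> C)"

text \<open>A left-invariant mean on the bounded real functions. Positivity and linearity force
  \<open>m f\<close> to depend only on the restriction of \<open>f\<close> to the carrier.\<close>

definition amenable :: "'a monoid \<Rightarrow> bool" where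
  "amenable G \<longleftrightarrow> (\<exists>m :: ('a \<Rightarrow> real) \<Rightarrow> real.
     (\<forall>f h. bounded_on G f \<longrightarrow> bounded_on G h \<longrightarrow> m (\<lambda>x. f x + h x) = m f + m h) \<and>
     (\<forall>c f. bounded_on G f \<longrightarrow> m (\<lambda>x. c * f x) = c * m f) \<and>
     (\<forall>f. bounded_on G f \<longrightarrow> (\<forall>x\<in>carrier G. f x \<ge> 0) \<longrightarrow> m f \<ge> 0) \<and>
     m (\<lambda>_. 1) = 1 \<and>
     (\<forall>g\<in>carrier G. \<forall>f. bounded_on G f \<longrightarrow> m (\<lambda>x. f (g \<otimes>\<^bsub>G\<^esub> x)) = m f))"


section \<open>Property (T)\<close>

text \<open>Bijective linear maps preserving the inner product are exactly the unitaries; bijectivity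
  is part of \<^locale>\<open>group_action\<close>.\<close>

locale unitary_rep = hilbert_space H + group_action G "carrier H" \<pi>
  for G :: "'g monoid" and H :: "'h inner_module" and \<pi> :: "'g \<Rightarrow> 'h \<Rightarrow> 'h" +
  assumes rep_bounded: "g \<in> carrier G \<Longrightarrow> \<pi> g \<in> bounded_ops H"
    and rep_hinner: "\<lbrakk>g \<in> carrier G; x \<in> carrier H; y \<in> carrier H\<rbrakk> \<Longrightarrow>
        hinner H (\<pi> g x) (\<pi> g y) = hinner H x y"

definition almost_invariant_vectors ::
  "'g monoid \<Rightarrow> 'h inner_module \<Rightarrow> ('g \<Rightarrow> 'h \<Rightarrow> 'h) \<Rightarrow> bool" where
  "almost_invariant_vectors G H \<pi> \<longleftrightarrow>
     (\<forall>F e. finite F \<longrightarrow> F \<subseteq> carrier G \<longrightarrow> e > 0 \<longrightarrow>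
        (\<exists>\<xi>\<in>carrier H. hnorm H \<xi> = 1 \<and> (\<forall>g\<in>F. hnorm H (\<pi> g \<xi> \<ominus>\<^bsub>H\<^esub> \<xi>) < e)))"

definition invariant_vector ::
  "'g monoid \<Rightarrow> 'h inner_module \<Rightarrow> ('g \<Rightarrow> 'h \<Rightarrow> 'h) \<Rightarrow> bool" where
  "invariant_vector G H \<pi> \<longleftrightarrow>
     (\<exists>\<xi>\<in>carrier H. \<xi> \<noteq> \<zero>\<^bsub>H\<^esub> \<and> (\<forall>g\<in>carrier G. \<pi> g \<xi> = \<xi>))"

text \<open>The type argument \<open>'u\<close> is a universe: the definition ranges over all Hilbert spaces whose
  underlying set is a set of elements of \<open>'u\<close>. Property (T) itself is the condition for all
  types \<open>'u\<close>. For countable groups the universe is immaterial once \<open>'u\<close> has at least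
  the cardinality of the continuum (pass to cyclic subrepresentations). Below that cardinality
  only the zero Hilbert space exists in \<open>'u\<close>, and the condition is vacuous.\<close>

definition property_T :: "'u itself \<Rightarrow> 'a monoid \<Rightarrow> bool" where
  "property_T (_ :: 'u itself) G \<longleftrightarrow>
     (\<forall>(H :: 'u inner_module) \<pi>. unitary_rep G H \<pi> \<longrightarrow>
        almost_invariant_vectors G H \<pi> \<longrightarrow> invariant_vector G H \<pi>)"


section \<open>The Haagerup property\<close>

definition positive_definite :: "'a monoid \<Rightarrow> ('a \<Rightarrow> complex) \<Rightarrow> bool" where
  "positive_definite G \<phi> \<longleftrightarrow>
     (\<forall>S c. finite S \<longrightarrow> S \<subseteq> carrier G \<longrightarrow>
        (let q = (\<Sum>g\<in>S. \<Sum>h\<in>S. cnj (c g) * c h * \<phi> (inv\<^bsub>G\<^esub> g \<otimes>\<^bsub>G\<^esub> h))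
         in Im q = 0 \<and> Re q \<ge> 0))"

definition vanishes_at_infinity :: "'a monoid \<Rightarrow> ('a \<Rightarrow> complex) \<Rightarrow> bool" where
  "vanishes_at_infinity G \<phi> \<longleftrightarrow> (\<forall>e>0. finite {g \<in> carrier G. cmod (\<phi> g) \<ge> e})"

text \<open>Sequences of functions suffice as we only deal with countable groups.\<close>

definition haagerup_property :: "'a monoid \<Rightarrow> bool" where
  "haagerup_property G \<longleftrightarrow> (\<exists>\<phi> :: nat \<Rightarrow> 'a \<Rightarrow> complex.
     (\<forall>n. positive_definite G (\<phi> n) \<and> \<phi> n \<one>\<^bsub>G\<^esub> = 1 \<and> vanishes_at_infinity G (\<phi> n)) \<and>
     (\<forall>g\<in>carrier G. (\<lambda>n. \<phi> n g) \<longlonglongrightarrow> 1))"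

end

theory Submission
  imports Defs "HOL-Analysis.Analysis"
begin

text \<open>A semifinite trace makes the operators \<open>x\<close> with \<open>Tr (x\<^sup>* x) < \<infinity>\<close> a Hilbert algebra \<open>N\<close>, with inner product
  \<open>\<langle>x, y\<rangle> = Tr (y\<^sup>* x)\<close>, on which \<open>G\<close> and \<open>L\<close> act by commuting isometries. The fundamental domains are projections
  \<open>p\<close> (of \<open>G\<close>) and \<open>q\<close> (of \<open>L\<close>) in \<open>N\<close>. Everything rests on one construction: for each \<open>g \<in> G\<close> the projections
  \<open>\<tau>\<^sub>l \<sigma>\<^sub>g q\<close> (\<open>l \<in> L\<close>) form a partition of unity, and a bounded function \<open>w\<close> on \<open>L\<close> is turned into the
  functions \<open>g \<mapsto> \<Sum>\<^sub>l w l \<langle>u \<tau>\<^sub>l \<sigma>\<^sub>g q, v\<rangle>\<close> on \<open>G\<close>.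

  With \<open>u = v = p\<close> an invariant mean on \<open>G\<close> pulls back to an invariant mean on \<open>L\<close>. With \<open>u = v = q\<close> a positive definite
  function on \<open>L\<close> induces one on \<open>G\<close>, and this preserves vanishing at infinity and convergence to \<open>1\<close>. For property (T),
  almost invariant vectors \<open>\<xi>\<^sub>n\<close> of a representation \<open>\<pi>\<close> of \<open>L\<close> induce positive definite functions on \<open>G\<close> tending to \<open>1\<close>.
  By property (T) of \<open>G\<close> the GNS vector of one of them is close to the invariant vectors, so that suitable
  averages over \<open>G\<close> of the functions obtained from \<open>l \<mapsto> \<langle>\<pi>\<^sub>l \<xi>\<^sub>n, k\<rangle>\<close> with \<open>u = v = p\<close> converge to a nonzero bounded
  \<open>L\<close>-invariant conjugate linear functional of \<open>k\<close>; it is represented by an invariant vector.\<close>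

section \<open>Positive kernels\<close>

text \<open>If the algebra is that of a measure space, almost every point lies in exactly one
  translate l g q, and the functions on G integrate the value of w at this l: they are averages of w
  along a cocycle. A general algebra has neither points nor a cocycle, but these averages survive.
  All three properties are therefore transferred at the level of scalar functions and Gram kernels.
  Two obstacles shape the argument. Translating w by s in L replaces p by another fundamental domain
  \<open>\<tau> s p\<close> of G. Up to a small error this changes the function on G by a finite sum
  of differences h(tg) - h(g), which an invariant average annihilates. For property (T) the
  invariant mean is replaced by convex combinations that minimise a norm. They are invariant only
  asymptotically and only in the norm of one induced kernel, so the functions to be averaged must
  first be bounded by that norm. Finally, property (T) speaks of Hilbert spaces inside the type
  \<open>'u\<close>, so the representation of G that is constructed has to fit there; a nonzero
  vector of the given representation of L provides the room.\<close>

definition sesq :: "('i \<Rightarrow> 'i \<Rightarrow> complex) \<Rightarrow> 'i set \<Rightarrow> ('i \<Rightarrow> complex) \<Rightarrow> ('i \<Rightarrow> complex) \<Rightarrow> complex" where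
  "sesq k S c d = (\<Sum>i\<in>S. \<Sum>j\<in>S. c i * cnj (d j) * k i j)"

definition pos_kernel :: "'i set \<Rightarrow> ('i \<Rightarrow> 'i \<Rightarrow> complex) \<Rightarrow> bool" where
  "pos_kernel X k \<longleftrightarrow> (\<forall>S c. finite S \<longrightarrow> S \<subseteq> X \<longrightarrow> Im (sesq k S c c) = 0 \<and> Re (sesq k S c c) \<ge> 0)"

lemma pos_kernelD:
  assumes "pos_kernel X k" "finite S" "S \<subseteq> X"
  shows "Im (sesq k S c c) = 0" "Re (sesq k S c c) \<ge> 0"
  using assms unfolding pos_kernel_def by blast+

lemma pos_kernel_subset: "pos_kernel X k \<Longrightarrow> Y \<subseteq> X \<Longrightarrow> pos_kernel Y k"
  unfolding pos_kernel_def by blast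

lemma pos_kernel_diag:
  assumes "pos_kernel X k" "x \<in> X"
  shows "Im (k x x) = 0" "Re (k x x) \<ge> 0"
  using pos_kernelD[OF assms(1), of "{x}" "\<lambda>_. 1"] assms(2) by (auto simp: sesq_def)

text \<open>Reality of the form on the coefficient vectors (1, 1) and (\<i>, 1) gives the imaginary
  and the real part of the identity.\<close>

lemma pos_kernel_hermitian:
  assumes k: "pos_kernel X k" and x: "x \<in> X" "y \<in> X"
  shows "k y x = cnj (k x y)"
proof (cases "x = y")
  case True
  then show ?thesis using pos_kernel_diag[OF k x(1)] by (simp add: complex_eq_iff)
next
  case False
  have d: "Im (k x x) = 0" "Im (k y y) = 0" using pos_kernel_diag[OF k] x by auto
  have "Im (sesq k {x,y} (\<lambda>_. 1) (\<lambda>_. 1)) = 0" using pos_kernelD[OF k, of "{x,y}"] x by auto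
  then have 1: "Im (k x y) + Im (k y x) = 0" using d False by (simp add: sesq_def)
  have "Im (sesq k {x,y} (\<lambda>z. if z = x then \<i> else 1) (\<lambda>z. if z = x then \<i> else 1)) = 0"
    using pos_kernelD[OF k, of "{x,y}"] x by blast
  then have 2: "Re (k x y) - Re (k y x) = 0" using d False by (simp add: sesq_def)
  from 1 2 show ?thesis by (simp add: complex_eq_iff)
qed

section \<open>Cauchy-Schwarz inequality for positive kernels\<close>

lemma sesq_cnj:
  assumes k: "pos_kernel X k" and S: "S \<subseteq> X"
  shows "sesq k S d c = cnj (sesq k S c d)"
proof -
  have "sesq k S d c = (\<Sum>i\<in>S. \<Sum>j\<in>S. d j * cnj (c i) * k j i)"
    unfolding sesq_def by (rule sum.swap)
  also have "\<dots> = (\<Sum>i\<in>S. \<Sum>j\<in>S. cnj (c i * cnj (d j) * k i j))"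
  proof (intro sum.cong refl)
    fix i j assume "i \<in> S" "j \<in> S"
    then have "k j i = cnj (k i j)" using pos_kernel_hermitian[OF k, of i j] S by blast
    then show "d j * cnj (c i) * k j i = cnj (c i * cnj (d j) * k i j)" by simp
  qed
  finally show ?thesis by (simp add: sesq_def)
qed

lemma sesq_combine:
  "sesq k S (\<lambda>i. a i + t * b i) (\<lambda>i. a i + t * b i) =
    sesq k S a a + t * sesq k S b a + cnj t * sesq k S a b + t * cnj t * sesq k S b b"
  unfolding sesq_def sum_distrib_left sum.distrib[symmetric]
  by (intro sum.cong refl) (simp add: algebra_simps)

lemma pos_kernel_CS_aux:
  assumes k: "pos_kernel X k" and S: "finite S" "S \<subseteq> X"
  shows "(cmod (sesq k S a b))\<^sup>2 \<le> Re (sesq k S a a) * Re (sesq k S b b)"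
proof -
  define A B P where "A = Re (sesq k S a a)" and "B = Re (sesq k S b b)" and "P = sesq k S a b"
  have A: "sesq k S a a = of_real A" and B: "sesq k S b b = of_real B" and A0: "A \<ge> 0" and B0: "B \<ge> 0"
    using pos_kernelD[OF k S] by (auto simp: A_def B_def complex_eq_iff)
  have Pc: "sesq k S b a = cnj P" using sesq_cnj[OF k S(2)] P_def by blast
  have *: "0 \<le> A + 2 * Re (cnj t * P) + (cmod t)\<^sup>2 * B" for t
  proof -
    have "0 \<le> Re (sesq k S (\<lambda>i. a i + t * b i) (\<lambda>i. a i + t * b i))"
      using pos_kernelD[OF k S] by blast
    also have "\<dots> = A + 2 * Re (cnj t * P) + (cmod t)\<^sup>2 * B"
      unfolding sesq_combine A B Pc P_def[symmetric] complex_norm_square[symmetric] cmod_power2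
      by (simp add: algebra_simps complex_mult_cnj power2_eq_square)
    finally show ?thesis .
  qed
  show ?thesis
  proof (cases "B = 0")
    case True
    have "P = 0"
    proof (rule ccontr)
      assume P: "P \<noteq> 0"
      \<comment> \<open>With B = 0 the form is affine in t, and this multiple of P is taken just so
        large that its value becomes -1.\<close>
      define r where "r = (A + 1) / (2 * (cmod P)\<^sup>2)"
      have "cnj (- of_real r * P) * P = - of_real (r * (cmod P)\<^sup>2)"
        using complex_norm_square[of P] by (simp add: mult.commute mult.left_commute)
      then have e: "Re (cnj (- of_real r * P) * P) = - (r * (cmod P)\<^sup>2)" by (simp only: uminus_complex.sel Re_complex_of_real)
      have "0 \<le> A - 2 * (r * (cmod P)\<^sup>2)"
        using *[of "- of_real r * P"] unfolding e True by simp
      moreover have "2 * (r * (cmod P)\<^sup>2) = A + 1" using P by (simp add: r_def)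
      ultimately show False by simp
    qed
    then show ?thesis using A0 B0 by (simp add: P_def A_def B_def)
  next
    case False
    then have B1: "B > 0" using B0 by simp
    \<comment> \<open>The form is quadratic in t with its minimum at t = -P/B.\<close>
    have "cnj (- P / of_real B) * P = - of_real ((cmod P)\<^sup>2 / B)"
      using complex_norm_square[of P] by (simp add: mult.commute)
    then have e: "Re (cnj (- P / of_real B) * P) = - ((cmod P)\<^sup>2 / B)" by (simp only: uminus_complex.sel Re_complex_of_real)
    have "0 \<le> A - 2 * ((cmod P)\<^sup>2 / B) + (cmod P / B)\<^sup>2 * B"
      using *[of "- P / of_real B"] B1 unfolding e by (simp add: norm_divide)
    also have "\<dots> = A - (cmod P)\<^sup>2 / B" using B1 by (simp add: field_simps power2_eq_square)
    finally have "(cmod P)\<^sup>2 \<le> A * B" using B1 by (simp add: field_simps)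
    then show ?thesis by (simp add: A_def B_def P_def)
  qed
qed

lemma sesq_extend:
  assumes "finite S" "I \<subseteq> S"
  shows "sesq k S (\<lambda>i. if i \<in> I then c i else 0) (\<lambda>i. if i \<in> I then d i else 0) = sesq k I c d"
proof -
  have *: "S \<inter> I = I" using assms by auto
  have "sesq k S (\<lambda>i. if i \<in> I then c i else 0) (\<lambda>i. if i \<in> I then d i else 0) =
    (\<Sum>i\<in>S. if i \<in> I then (\<Sum>j\<in>S. if j \<in> I then c i * cnj (d j) * k i j else 0) else 0)"
    unfolding sesq_def by (intro sum.cong refl) (auto intro!: sum.cong)
  then show ?thesis using assms * by (simp add: sum.inter_restrict[symmetric] sesq_def)
qed

text \<open>The two combinations may have different supports: extended by zero, both live on the
  union. Rectangular blocks of a kernel are estimated in this way.\<close>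

lemma pos_kernel_CS:
  assumes k: "pos_kernel X k" and I: "finite I" "I \<subseteq> X" and J: "finite J" "J \<subseteq> X"
  shows "(cmod (\<Sum>i\<in>I. \<Sum>j\<in>J. a i * cnj (b j) * k i j))\<^sup>2 \<le> Re (sesq k I a a) * Re (sesq k J b b)"
proof -
  let ?S = "I \<union> J"
  let ?a = "\<lambda>i. if i \<in> I then a i else 0" and ?b = "\<lambda>i. if i \<in> J then b i else 0"
  have SI: "?S \<inter> I = I" and SJ: "?S \<inter> J = J" by auto
  have "sesq k ?S ?a ?b = (\<Sum>i\<in>?S. if i \<in> I then (\<Sum>j\<in>?S. if j \<in> J then a i * cnj (b j) * k i j else 0) else 0)"
    unfolding sesq_def by (intro sum.cong refl) (auto intro!: sum.cong)
  also have "\<dots> = (\<Sum>i\<in>I. \<Sum>j\<in>J. a i * cnj (b j) * k i j)"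
    using I J SI SJ by (simp add: sum.inter_restrict[symmetric])
  finally show ?thesis
    using pos_kernel_CS_aux[OF k, of ?S ?a ?b] I J sesq_extend[of ?S I k a a] sesq_extend[of ?S J k b b] by simp
qed

lemma pos_kernel_CS_single:
  assumes k: "pos_kernel X k" and I: "finite I" "I \<subseteq> X" and y: "y \<in> X"
  shows "(cmod (\<Sum>i\<in>I. a i * k i y))\<^sup>2 \<le> Re (sesq k I a a) * Re (k y y)"
  using pos_kernel_CS[OF k I, of "{y}" a "\<lambda>_. 1"] y by (simp add: sesq_def)

lemma pos_kernel_CS_point:
  assumes k: "pos_kernel X k" and x: "x \<in> X" and y: "y \<in> X"
  shows "(cmod (k x y))\<^sup>2 \<le> Re (k x x) * Re (k y y)"
  using pos_kernel_CS_single[OF k, of "{x}" y "\<lambda>_. 1"] assms by (simp add: sesq_def)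

text \<open>The map may identify indices; the coefficients on a fibre then add up. So families of
  vectors with repetitions still have positive Gram kernels.\<close>

lemma sesq_image:
  assumes "finite S"
  shows "sesq (\<lambda>i j. k (f i) (f j)) S c d =
    sesq k (f ` S) (\<lambda>x. \<Sum>i | i \<in> S \<and> f i = x. c i) (\<lambda>x. \<Sum>i | i \<in> S \<and> f i = x. d i)"
proof -
  let ?F = "\<lambda>x. {i. i \<in> S \<and> f i = x}"
  have f: "finite (?F x)" for x using assms by simp
  have "sesq (\<lambda>i j. k (f i) (f j)) S c d = (\<Sum>i\<in>S. \<Sum>y\<in>f ` S. \<Sum>j\<in>?F y. c i * cnj (d j) * k (f i) (f j))"
    unfolding sesq_def by (intro sum.cong refl sum.image_gen assms)
  also have "\<dots> = (\<Sum>y\<in>f ` S. \<Sum>i\<in>S. \<Sum>j\<in>?F y. c i * cnj (d j) * k (f i) (f j))" by (rule sum.swap)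
  also have "\<dots> = (\<Sum>y\<in>f ` S. \<Sum>x\<in>f ` S. \<Sum>i\<in>?F x. \<Sum>j\<in>?F y. c i * cnj (d j) * k (f i) (f j))"
    by (intro sum.cong refl sum.image_gen assms)
  also have "\<dots> = (\<Sum>x\<in>f ` S. \<Sum>y\<in>f ` S. \<Sum>i\<in>?F x. \<Sum>j\<in>?F y. c i * cnj (d j) * k (f i) (f j))" by (rule sum.swap)
  also have "\<dots> = (\<Sum>x\<in>f ` S. \<Sum>y\<in>f ` S. \<Sum>i\<in>?F x. \<Sum>j\<in>?F y. c i * cnj (d j) * k x y)"
    by (intro sum.cong refl) auto
  also have "\<dots> = (\<Sum>x\<in>f ` S. \<Sum>y\<in>f ` S. (\<Sum>i\<in>?F x. c i) * cnj (\<Sum>j\<in>?F y. d j) * k x y)"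
    by (simp only: cnj_sum sum_product) (simp only: sum_distrib_right)
  finally show ?thesis unfolding sesq_def .
qed

lemma pos_kernel_pullback:
  assumes "pos_kernel X k" "f ` I \<subseteq> X"
  shows "pos_kernel I (\<lambda>i j. k (f i) (f j))"
  unfolding pos_kernel_def
proof (intro allI impI)
  fix S c assume S: "finite S" "S \<subseteq> I"
  have "f ` S \<subseteq> X" using S(2) assms(2) by blast
  then show "Im (sesq (\<lambda>i j. k (f i) (f j)) S c c) = 0 \<and> 0 \<le> Re (sesq (\<lambda>i j. k (f i) (f j)) S c c)"
    by (subst (1 2) sesq_image[OF S(1)]) (intro conjI pos_kernelD[OF assms(1)] finite_imageI S(1))
qed

lemma pos_kernel_cong:
  assumes "pos_kernel X k" "\<And>x y. x \<in> X \<Longrightarrow> y \<in> X \<Longrightarrow> l x y = k x y"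
  shows "pos_kernel X l"
proof -
  have "sesq l S c c = sesq k S c c" if "S \<subseteq> X" for S c
    unfolding sesq_def using assms(2) that by (intro sum.cong refl) (auto simp: subset_eq)
  then show ?thesis using assms(1) unfolding pos_kernel_def by metis
qed

text \<open>Positivity involves finitely many values at a time and is a closed condition, so
  pointwise limits along any proper filter inherit it. The filter of finite subsets covers infinite
  sums.\<close>

lemma pos_kernel_limit:
  assumes k: "\<forall>\<^sub>F n in F. pos_kernel X (k n)" and F: "F \<noteq> bot"
    and l: "\<And>x y. x \<in> X \<Longrightarrow> y \<in> X \<Longrightarrow> ((\<lambda>n. k n x y) \<longlongrightarrow> l x y) F"
  shows "pos_kernel X l"
  unfolding pos_kernel_def
proof (intro allI impI)
  fix S c assume S: "finite S" "S \<subseteq> X"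
  have *: "((\<lambda>n. sesq (k n) S c c) \<longlongrightarrow> sesq l S c c) F"
    unfolding sesq_def using S l by (intro tendsto_intros) auto
  have "\<forall>\<^sub>F n in F. Im (sesq (k n) S c c) = 0" "\<forall>\<^sub>F n in F. 0 \<le> Re (sesq (k n) S c c)"
    using k by (auto elim!: eventually_mono simp: pos_kernelD[OF _ S])
  then have "Im (sesq l S c c) = 0" "0 \<le> Re (sesq l S c c)"
    using tendsto_unique[OF F tendsto_Im[OF *] tendsto_eventually] tendsto_lowerbound[OF tendsto_Re[OF *] _ F] by blast+
  then show "Im (sesq l S c c) = 0 \<and> 0 \<le> Re (sesq l S c c)" by simp
qed

section \<open>Schur products of positive kernels\<close>

lemma sesq_rank_one: "sesq (\<lambda>i j. v i * cnj (v j)) S c c = of_real ((cmod (\<Sum>i\<in>S. c i * v i))\<^sup>2)"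
proof -
  have "sesq (\<lambda>i j. v i * cnj (v j)) S c c = (\<Sum>i\<in>S. c i * v i) * cnj (\<Sum>i\<in>S. c i * v i)"
    unfolding sesq_def by (simp add: sum_product algebra_simps)
  then show ?thesis by (simp add: complex_norm_square del: of_real_power)
qed

lemma pos_kernel_scale:
  assumes "pos_kernel X k" "r \<ge> 0"
  shows "pos_kernel X (\<lambda>i j. of_real r * k i j)"
proof -
  have "sesq (\<lambda>i j. of_real r * k i j) S c c = of_real r * sesq k S c c" for S c
    unfolding sesq_def sum_distrib_left by (intro sum.cong refl) (simp add: algebra_simps)
  then show ?thesis using assms unfolding pos_kernel_def by simp
qed

text \<open>Induction on the index set: subtracting from \<open>k\<close> its rank one part \<open>v\<close> at a point \<open>s\<close>
  (a Schur complement) leaves a positive kernel that vanishes on the row of \<open>s\<close>.\<close>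

lemma schur_aux:
  assumes "finite S" "pos_kernel S k" "pos_kernel S l"
  shows "Im (sesq (\<lambda>i j. k i j * l i j) S c c) = 0 \<and> Re (sesq (\<lambda>i j. k i j * l i j) S c c) \<ge> 0"
  using assms
proof (induction S arbitrary: k rule: finite_induct)
  case empty
  then show ?case by (simp add: sesq_def)
next
  case (insert s S)
  let ?S = "insert s S"
  define \<kappa> where "\<kappa> = Re (k s s)"
  have ks: "k s s = of_real \<kappa>" "\<kappa> \<ge> 0"
    using pos_kernel_diag[OF insert.prems(1), of s] by (auto simp: \<kappa>_def complex_eq_iff)
  \<comment> \<open>If the diagonal entry at \<open>s\<close> is 0, Cauchy-Schwarz makes the whole
    column vanish and there is nothing to subtract.\<close>
  define v where "v i = (if \<kappa> = 0 then 0 else k i s / of_real (sqrt \<kappa>))" for i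
  define k' where "k' i j = k i j - v i * cnj (v j)" for i j
  have herm: "k j i = cnj (k i j)" if "i \<in> ?S" "j \<in> ?S" for i j
    using pos_kernel_hermitian[OF insert.prems(1)] that by blast
  have row: "k' i s = 0" "k' s i = 0" if i: "i \<in> ?S" for i
  proof -
    have sq: "complex_of_real (sqrt \<kappa>) * of_real (sqrt \<kappa>) = of_real \<kappa>"
      using ks(2) by (simp flip: of_real_mult)
    have "k' i s = 0 \<and> k' s i = 0"
    proof (cases "\<kappa> = 0")
      case True
      have "(cmod (k i s))\<^sup>2 \<le> 0" using pos_kernel_CS_point[OF insert.prems(1) i, of s] True by (simp add: \<kappa>_def)
      then have "k i s = 0" by simp
      then show ?thesis using herm[OF i, of s] by (simp add: k'_def v_def True)
    next
      case False
      then show ?thesis using herm[OF i, of s] sq by (simp add: k'_def v_def ks(1) field_simps)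
    qed
    then show "k' i s = 0" "k' s i = 0" by auto
  qed
  have split: "sesq k T d d = sesq k' T d d + sesq (\<lambda>i j. v i * cnj (v j)) T d d" for T d
    unfolding sesq_def k'_def by (simp add: algebra_simps sum.distrib[symmetric])
  have k': "pos_kernel ?S k'"
    unfolding pos_kernel_def
  proof (intro allI impI)
    fix T d assume T: "finite T" "T \<subseteq> ?S"
    \<comment> \<open>The Schur complement is positive because Cauchy-Schwarz against the point
      \<open>s\<close> bounds the subtracted rank one form by the form of \<open>k\<close>.\<close>
    have "(cmod (\<Sum>i\<in>T. d i * v i))\<^sup>2 \<le> Re (sesq k T d d)"
    proof (cases "\<kappa> = 0")
      case True
      then show ?thesis using pos_kernelD(2)[OF insert.prems(1) T] by (simp add: v_def)
    next
      case False
      have "(\<Sum>i\<in>T. d i * v i) = (\<Sum>i\<in>T. d i * k i s) / of_real (sqrt \<kappa>)"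
        using False by (simp add: v_def sum_divide_distrib)
      then have "(cmod (\<Sum>i\<in>T. d i * v i))\<^sup>2 = (cmod (\<Sum>i\<in>T. d i * k i s))\<^sup>2 / \<kappa>"
        using ks(2) by (simp add: norm_divide power_divide)
      also have "\<dots> \<le> Re (sesq k T d d)"
        using pos_kernel_CS_single[OF insert.prems(1) T, of s d] False ks(2)
        by (simp add: field_simps flip: \<kappa>_def)
      finally show ?thesis .
    qed
    then show "Im (sesq k' T d d) = 0 \<and> 0 \<le> Re (sesq k' T d d)"
      using pos_kernelD[OF insert.prems(1) T, of d] split[of T d] by (auto simp: sesq_rank_one)
  qed
  \<comment> \<open>Multiplying \<open>l\<close> by the rank one part merely changes the
    coefficients in the form of \<open>l\<close>. The rest vanishes on the row of \<open>s\<close>,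
    so it falls under the induction hypothesis.\<close>
  have "sesq (\<lambda>i j. k i j * l i j) ?S c c =
      sesq (\<lambda>i j. k' i j * l i j) ?S c c + sesq l ?S (\<lambda>i. c i * v i) (\<lambda>i. c i * v i)"
    unfolding sesq_def k'_def by (simp only: sum.distrib[symmetric]) (intro sum.cong refl, simp add: algebra_simps)
  moreover have "sesq (\<lambda>i j. k' i j * l i j) ?S c c = sesq (\<lambda>i j. k' i j * l i j) S c c"
    unfolding sesq_def using insert.hyps row by simp
  moreover have "Im (sesq (\<lambda>i j. k' i j * l i j) S c c) = 0 \<and> Re (sesq (\<lambda>i j. k' i j * l i j) S c c) \<ge> 0"
    using insert.IH[of k'] insert.prems(2) k' by (meson pos_kernel_subset subset_insertI)
  moreover have "Im (sesq l ?S (\<lambda>i. c i * v i) (\<lambda>i. c i * v i)) = 0 \<and> Re (sesq l ?S (\<lambda>i. c i * v i) (\<lambda>i. c i * v i)) \<ge> 0"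
    by (intro conjI pos_kernelD[OF insert.prems(2)]) (use insert.hyps(1) in auto)
  ultimately show ?case by simp
qed

lemma pos_kernel_mult:
  assumes "pos_kernel X k" "pos_kernel X l"
  shows "pos_kernel X (\<lambda>i j. k i j * l i j)"
  unfolding pos_kernel_def
proof (intro allI impI)
  fix S c assume "finite S" "S \<subseteq> X"
  then show "Im (sesq (\<lambda>i j. k i j * l i j) S c c) = 0 \<and> 0 \<le> Re (sesq (\<lambda>i j. k i j * l i j) S c c)"
    by (intro schur_aux pos_kernel_subset[OF assms(1)] pos_kernel_subset[OF assms(2)])
qed

section \<open>Hilbert algebras and couplings\<close>

lemma has_sum_minus:
  fixes f g :: "'i \<Rightarrow> complex"
  assumes "(f has_sum a) A" "(g has_sum b) A"
  shows "((\<lambda>i. f i - g i) has_sum (a - b)) A"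
  using has_sum_add[of f A a "\<lambda>i. - g i" "- b"] assms by (simp add: has_sum_uminus)

lemma has_sum_finite_sum:
  fixes f :: "'j \<Rightarrow> 'i \<Rightarrow> complex"
  assumes "finite F" "\<And>j. j \<in> F \<Longrightarrow> (f j has_sum s j) A"
  shows "((\<lambda>i. \<Sum>j\<in>F. f j i) has_sum (\<Sum>j\<in>F. s j)) A"
  using assms by (induction F rule: finite_induct) (simp_all add: has_sum_add)

text \<open>No linear operations on \<open>N\<close> are needed; \<open>ip_diff_ex\<close> provides differences up to the kernel of \<open>ip\<close>.\<close>

locale hilbert_algebra =
  fixes N :: "'v set" and mul :: "'v \<Rightarrow> 'v \<Rightarrow> 'v" (infixl "\<cdot>" 70)
    and star :: "'v \<Rightarrow> 'v" and ip :: "'v \<Rightarrow> 'v \<Rightarrow> complex"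
  assumes mul_closed [intro, simp]: "\<lbrakk>x \<in> N; y \<in> N\<rbrakk> \<Longrightarrow> x \<cdot> y \<in> N"
    and star_closed [intro, simp]: "x \<in> N \<Longrightarrow> star x \<in> N"
    and mul_assoc: "\<lbrakk>x \<in> N; y \<in> N; z \<in> N\<rbrakk> \<Longrightarrow> x \<cdot> y \<cdot> z = x \<cdot> (y \<cdot> z)"
    and star_mul: "\<lbrakk>x \<in> N; y \<in> N\<rbrakk> \<Longrightarrow> star (x \<cdot> y) = star y \<cdot> star x"
    and star_star [simp]: "x \<in> N \<Longrightarrow> star (star x) = x"
    and ip_pos: "pos_kernel N ip"
    and ip_mul_left: "\<lbrakk>x \<in> N; y \<in> N; z \<in> N\<rbrakk> \<Longrightarrow> ip (x \<cdot> y) z = ip y (star x \<cdot> z)"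
    and ip_mul_right: "\<lbrakk>x \<in> N; y \<in> N; z \<in> N\<rbrakk> \<Longrightarrow> ip (x \<cdot> y) z = ip x (z \<cdot> star y)"
    and ip_diff_ex: "\<lbrakk>x \<in> N; y \<in> N\<rbrakk> \<Longrightarrow> \<exists>z\<in>N. \<forall>w\<in>N. ip z w = ip x w - ip y w"
begin

section \<open>Norms and partitions of unity\<close>

definition nrm :: "'v \<Rightarrow> real" where
  "nrm x = sqrt (Re (ip x x))"

lemma ip_cnj: "x \<in> N \<Longrightarrow> y \<in> N \<Longrightarrow> ip y x = cnj (ip x y)"
  using pos_kernel_hermitian[OF ip_pos] by blast

lemma nrm_nonneg [simp]: "x \<in> N \<Longrightarrow> 0 \<le> nrm x"
  using pos_kernel_diag[OF ip_pos] by (simp add: nrm_def)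

lemma ip_self: "x \<in> N \<Longrightarrow> ip x x = of_real ((nrm x)\<^sup>2)"
  using pos_kernel_diag[OF ip_pos, of x] by (simp add: nrm_def complex_eq_iff)

lemma Re_ip_self: "x \<in> N \<Longrightarrow> Re (ip x x) = (nrm x)\<^sup>2"
  by (metis ip_self Re_complex_of_real)

lemma ip_CS:
  assumes "x \<in> N" "y \<in> N"
  shows "cmod (ip x y) \<le> nrm x * nrm y"
proof (rule power2_le_imp_le)
  show "(cmod (ip x y))\<^sup>2 \<le> (nrm x * nrm y)\<^sup>2"
    using pos_kernel_CS_point[OF ip_pos assms] assms by (simp add: Re_ip_self power_mult_distrib)
qed (use assms in simp)

text \<open>The locale has no zero, so orthogonality is tested by inner products after an arbitrary
  left factor. That the projections sum to 1 is demanded on the diagonal only;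
  \<open>partition_has_sum\<close> recovers the other inner products.\<close>

definition partition :: "'i set \<Rightarrow> ('i \<Rightarrow> 'v) \<Rightarrow> bool" where
  "partition I e \<longleftrightarrow>
    (\<forall>i\<in>I. e i \<in> N \<and> star (e i) = e i \<and> e i \<cdot> e i = e i) \<and>
    (\<forall>i\<in>I. \<forall>j\<in>I. i \<noteq> j \<longrightarrow> (\<forall>x\<in>N. \<forall>y\<in>N. ip (x \<cdot> e i \<cdot> e j) y = 0)) \<and>
    (\<forall>x\<in>N. ((\<lambda>i. ip (x \<cdot> e i) x) has_sum ip x x) I)"

lemma partitionD:
  assumes "partition I e" "i \<in> I"
  shows "e i \<in> N" "star (e i) = e i" "e i \<cdot> e i = e i"
  using assms unfolding partition_def by auto

lemma partition_ip:
  assumes e: "partition I e" "i \<in> I" and x: "x \<in> N" "y \<in> N"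
  shows "ip (x \<cdot> e i) y = ip x (y \<cdot> e i)" "ip (x \<cdot> e i) (y \<cdot> e i) = ip (x \<cdot> e i) y"
proof -
  note d = partitionD[OF e]
  show 1: "ip (x \<cdot> e i) y = ip x (y \<cdot> e i)" using ip_mul_right[of x "e i" y] x d by simp
  have "ip (x \<cdot> e i) (y \<cdot> e i) = ip x (y \<cdot> e i \<cdot> e i)" using ip_mul_right[of x "e i" "y \<cdot> e i"] x d by simp
  then show "ip (x \<cdot> e i) (y \<cdot> e i) = ip (x \<cdot> e i) y" using 1 x d by (simp add: mul_assoc)
qed

lemma partition_orth:
  assumes e: "partition I e" "i \<in> I" "j \<in> I" "i \<noteq> j" and x: "x \<in> N" "y \<in> N"
  shows "ip (x \<cdot> e i) (y \<cdot> e j) = 0"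
proof -
  note d = partitionD[OF e(1)]
  have "ip (x \<cdot> e i) (y \<cdot> e j) = ip (x \<cdot> e i \<cdot> e j) y"
    using ip_mul_right[of "x \<cdot> e i" "e j" y] x d e by simp
  also have "\<dots> = 0" using e x unfolding partition_def by blast
  finally show ?thesis .
qed

lemma partition_nrm_has_sum:
  assumes e: "partition I e" and x: "x \<in> N"
  shows "((\<lambda>i. (nrm (x \<cdot> e i))\<^sup>2) has_sum (nrm x)\<^sup>2) I"
proof -
  have "((\<lambda>i. Re (ip (x \<cdot> e i) x)) has_sum Re (ip x x)) I"
    using e x unfolding partition_def by (intro has_sum_Re) blast
  moreover have "Re (ip (x \<cdot> e i) x) = (nrm (x \<cdot> e i))\<^sup>2" if "i \<in> I" for i
    using partition_ip(2)[OF e that x x] Re_ip_self[of "x \<cdot> e i"] partitionD[OF e that] x by simp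
  ultimately show ?thesis unfolding Re_ip_self[OF x] by (simp cong: has_sum_cong)
qed

lemma cut_ex:
  assumes e: "partition I e" and x: "x \<in> N" and F: "finite F" "F \<subseteq> I"
  shows "\<exists>z\<in>N. \<forall>w\<in>N. ip z w = ip x w - (\<Sum>i\<in>F. ip (x \<cdot> e i) w)"
  using F
proof (induction F rule: finite_induct)
  case empty
  then show ?case using x by auto
next
  case (insert i F)
  then obtain z where z: "z \<in> N" "\<And>w. w \<in> N \<Longrightarrow> ip z w = ip x w - (\<Sum>i\<in>F. ip (x \<cdot> e i) w)" by auto
  have "x \<cdot> e i \<in> N" using partitionD[OF e, of i] insert.prems x by simp
  then obtain z' where "z' \<in> N" "\<forall>w\<in>N. ip z' w = ip z w - ip (x \<cdot> e i) w"
    using ip_diff_ex[OF z(1)] by metis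
  then show ?case using z(2) insert.hyps by (intro bexI[of _ z']) (auto simp: algebra_simps)
qed

text \<open>This stands for x (1 - sum of the e_i over F). As \<open>N\<close> comes with neither a
  unit nor sums, the element is known only through its inner products, which fix it up to vectors of
  norm zero.\<close>

definition cut :: "('i \<Rightarrow> 'v) \<Rightarrow> 'i set \<Rightarrow> 'v \<Rightarrow> 'v" where
  "cut e F x = (SOME z. z \<in> N \<and> (\<forall>w\<in>N. ip z w = ip x w - (\<Sum>i\<in>F. ip (x \<cdot> e i) w)))"

lemma cut:
  assumes "partition I e" "x \<in> N" "finite F" "F \<subseteq> I"
  shows "cut e F x \<in> N" "w \<in> N \<Longrightarrow> ip (cut e F x) w = ip x w - (\<Sum>i\<in>F. ip (x \<cdot> e i) w)"
proof -
  have "\<exists>z. z \<in> N \<and> (\<forall>w\<in>N. ip z w = ip x w - (\<Sum>i\<in>F. ip (x \<cdot> e i) w))"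
    using cut_ex[OF assms] by blast
  from someI_ex[OF this] show "cut e F x \<in> N"
    "w \<in> N \<Longrightarrow> ip (cut e F x) w = ip x w - (\<Sum>i\<in>F. ip (x \<cdot> e i) w)"
    unfolding cut_def by blast+
qed

lemma ip_cut_right:
  assumes "partition I e" "x \<in> N" "finite F" "F \<subseteq> I" "w \<in> N"
  shows "ip w (cut e F x) = ip w x - (\<Sum>i\<in>F. ip w (x \<cdot> e i))"
proof -
  have "ip w (cut e F x) = cnj (ip x w - (\<Sum>i\<in>F. ip (x \<cdot> e i) w))"
    using cut[OF assms(1-4)] ip_cnj[of "cut e F x" w] assms(5) by simp
  also have "\<dots> = cnj (ip x w) - (\<Sum>i\<in>F. cnj (ip (x \<cdot> e i) w))" by simp
  also have "\<dots> = ip w x - (\<Sum>i\<in>F. ip w (x \<cdot> e i))"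
    using assms partitionD(1)[OF assms(1)]
    by (intro arg_cong2[where f = "(-)"] sum.cong refl) (auto simp: ip_cnj[symmetric] subset_eq)
  finally show ?thesis .
qed

text \<open>Pythagoras: the pieces \<open>x \<cdot> e i\<close> are orthogonal to each other and to
  the remainder.\<close>

lemma nrm_cut:
  assumes e: "partition I e" and x: "x \<in> N" and F: "finite F" "F \<subseteq> I"
  shows "(nrm (cut e F x))\<^sup>2 = (nrm x)\<^sup>2 - (\<Sum>i\<in>F. (nrm (x \<cdot> e i))\<^sup>2)"
proof -
  note c = cut[OF assms] and r = ip_cut_right[OF assms]
  have N: "x \<cdot> e i \<in> N" if "i \<in> F" for i using x partitionD(1)[OF e] that F by auto
  have *: "ip (x \<cdot> e i) (cut e F x) = 0" if i: "i \<in> F" for i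
  proof -
    have "ip (x \<cdot> e i) (cut e F x) = ip (x \<cdot> e i) x - (\<Sum>j\<in>F. ip (x \<cdot> e i) (x \<cdot> e j))"
      using r N[OF i] by blast
    also have "(\<Sum>j\<in>F. ip (x \<cdot> e i) (x \<cdot> e j)) = (\<Sum>j\<in>F. if i = j then ip (x \<cdot> e i) x else 0)"
    proof (intro sum.cong refl)
      fix j assume "j \<in> F"
      then show "ip (x \<cdot> e i) (x \<cdot> e j) = (if i = j then ip (x \<cdot> e i) x else 0)"
        using partition_orth[OF e, of i j x x] partition_ip(2)[OF e, of i x x] i F x by (auto simp: subset_eq)
    qed
    finally show ?thesis using F i by simp
  qed
  have "of_real ((nrm (cut e F x))\<^sup>2) = ip x (cut e F x)"
    using c(2)[OF c(1)] * c(1) by (simp add: ip_self[symmetric] del: of_real_power)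
  also have "\<dots> = ip x x - (\<Sum>i\<in>F. ip x (x \<cdot> e i))" using r x by blast
  also have "(\<Sum>i\<in>F. ip x (x \<cdot> e i)) = (\<Sum>i\<in>F. of_real ((nrm (x \<cdot> e i))\<^sup>2))"
    using partition_ip[OF e _ x x] F N by (intro sum.cong refl) (metis ip_self subsetD)
  finally have "complex_of_real ((nrm (cut e F x))\<^sup>2) = of_real ((nrm x)\<^sup>2 - (\<Sum>i\<in>F. (nrm (x \<cdot> e i))\<^sup>2))"
    using x by (simp add: ip_self[symmetric] of_real_diff del: of_real_power)
  then show ?thesis using of_real_eq_iff by blast
qed

lemma nrm_cut_tendsto:
  assumes e: "partition I e" and x: "x \<in> N"
  shows "((\<lambda>F. nrm (cut e F x)) \<longlongrightarrow> 0) (finite_subsets_at_top I)"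
proof -
  have "((\<lambda>F. sqrt ((nrm x)\<^sup>2 - (\<Sum>i\<in>F. (nrm (x \<cdot> e i))\<^sup>2))) \<longlongrightarrow> sqrt ((nrm x)\<^sup>2 - (nrm x)\<^sup>2)) (finite_subsets_at_top I)"
    using partition_nrm_has_sum[OF e x] unfolding has_sum_def by (intro tendsto_intros)
  moreover have "\<forall>\<^sub>F F in finite_subsets_at_top I. sqrt ((nrm x)\<^sup>2 - (\<Sum>i\<in>F. (nrm (x \<cdot> e i))\<^sup>2)) = nrm (cut e F x)"
  proof (rule eventually_finite_subsets_at_top_weakI)
    fix F assume F: "finite F" "F \<subseteq> I"
    show "sqrt ((nrm x)\<^sup>2 - (\<Sum>i\<in>F. (nrm (x \<cdot> e i))\<^sup>2)) = nrm (cut e F x)"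
      using nrm_cut[OF e x F] cut(1)[OF e x F] by (metis nrm_nonneg real_sqrt_abs abs_of_nonneg)
  qed
  ultimately show ?thesis by (simp add: tendsto_cong)
qed

lemma nrm_cut_small:
  assumes "partition I e" "x \<in> N" "\<epsilon> > 0"
  obtains F where "finite F" "F \<subseteq> I" "\<And>F'. finite F' \<Longrightarrow> F \<subseteq> F' \<Longrightarrow> F' \<subseteq> I \<Longrightarrow> nrm (cut e F' x) < \<epsilon>"
proof -
  have "\<forall>\<^sub>F F in finite_subsets_at_top I. nrm (cut e F x) < \<epsilon>"
    using nrm_cut_tendsto[OF assms(1,2)] assms(3) order_tendstoD(2) by blast
  then obtain F where "finite F" "F \<subseteq> I"
    "\<forall>F'. finite F' \<and> F \<subseteq> F' \<and> F' \<subseteq> I \<longrightarrow> nrm (cut e F' x) < \<epsilon>"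
    unfolding eventually_finite_subsets_at_top by metis
  then show ?thesis by (intro that) auto
qed

text \<open>Each projection can be inserted into both arguments, so Cauchy-Schwarz bounds the terms
  by products of two square summable sequences. This absolute bound is what allows arbitrary bounded
  weights in \<open>wip\<close>.\<close>

lemma partition_abs_sum_le:
  assumes e: "partition I e" and x: "x \<in> N" "y \<in> N" and F: "finite F" "F \<subseteq> I"
  shows "(\<Sum>i\<in>F. cmod (ip (x \<cdot> e i) y)) \<le> nrm x * nrm y"
proof -
  have N: "x \<cdot> e i \<in> N" "y \<cdot> e i \<in> N" if "i \<in> F" for i using x partitionD(1)[OF e] that F by auto
  have sq: "(\<Sum>i\<in>F. (nrm (z \<cdot> e i))\<^sup>2) \<le> (nrm z)\<^sup>2" if "z \<in> N" for z
    using nrm_cut[OF e that F] zero_le_power2[of "nrm (cut e F z)"] by linarith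
  have "(\<Sum>i\<in>F. cmod (ip (x \<cdot> e i) y)) = (\<Sum>i\<in>F. cmod (ip (x \<cdot> e i) (y \<cdot> e i)))"
    using partition_ip(2)[OF e _ x] F by (intro sum.cong refl) (metis subsetD)
  also have "\<dots> \<le> (\<Sum>i\<in>F. nrm (x \<cdot> e i) * nrm (y \<cdot> e i))"
    using N by (intro sum_mono ip_CS)
  also have "\<dots> \<le> nrm x * nrm y"
  proof (rule power2_le_imp_le)
    have "(\<Sum>i\<in>F. nrm (x \<cdot> e i) * nrm (y \<cdot> e i))\<^sup>2 \<le> (\<Sum>i\<in>F. (nrm (x \<cdot> e i))\<^sup>2) * (\<Sum>i\<in>F. (nrm (y \<cdot> e i))\<^sup>2)"
      by (rule Cauchy_Schwarz_ineq_sum)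
    also have "\<dots> \<le> (nrm x)\<^sup>2 * (nrm y)\<^sup>2" by (intro mult_mono sq x sum_nonneg zero_le_power2)
    finally show "(\<Sum>i\<in>F. nrm (x \<cdot> e i) * nrm (y \<cdot> e i))\<^sup>2 \<le> (nrm x * nrm y)\<^sup>2" by (simp add: power_mult_distrib)
  qed (use x in simp)
  finally show ?thesis .
qed

text \<open>The error of a partial sum is the inner product of the remainder
  \<open>cut e F x\<close> with \<open>y\<close>, and the remainder tends to 0 in norm.\<close>

lemma partition_has_sum:
  assumes e: "partition I e" and x: "x \<in> N" "y \<in> N"
  shows "((\<lambda>i. ip (x \<cdot> e i) y) has_sum ip x y) I"
proof -
  have 1: "((\<lambda>F. nrm (cut e F x) * nrm y) \<longlongrightarrow> 0) (finite_subsets_at_top I)"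
    using tendsto_mult_right[OF nrm_cut_tendsto[OF e x(1)], of "nrm y"] by simp
  have 2: "\<forall>\<^sub>F F in finite_subsets_at_top I. norm (ip x y - (\<Sum>i\<in>F. ip (x \<cdot> e i) y)) \<le> nrm (cut e F x) * nrm y"
  proof (rule eventually_finite_subsets_at_top_weakI)
    fix F assume F: "finite F" "F \<subseteq> I"
    show "norm (ip x y - (\<Sum>i\<in>F. ip (x \<cdot> e i) y)) \<le> nrm (cut e F x) * nrm y"
      unfolding cut(2)[OF e x(1) F x(2), symmetric] by (rule ip_CS[OF cut(1)[OF e x(1) F] x(2)])
  qed
  have "((\<lambda>F. ip x y - (\<Sum>i\<in>F. ip (x \<cdot> e i) y)) \<longlongrightarrow> 0) (finite_subsets_at_top I)"
    by (rule Lim_null_comparison[OF 2 1])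
  from tendsto_diff[OF tendsto_const[of "ip x y"] this] show ?thesis unfolding has_sum_def by simp
qed

text \<open>The inner product of x (sum of the w_i e_i) with y. The operator in parentheses is
  bounded but in general lies outside \<open>N\<close>.\<close>

definition wip :: "'i set \<Rightarrow> ('i \<Rightarrow> 'v) \<Rightarrow> ('i \<Rightarrow> complex) \<Rightarrow> 'v \<Rightarrow> 'v \<Rightarrow> complex" where
  "wip I e w x y = (\<Sum>\<^sub>\<infinity>i\<in>I. w i * ip (x \<cdot> e i) y)"

lemma wip_abs_summable:
  assumes e: "partition I e" and x: "x \<in> N" "y \<in> N" and w: "\<And>i. i \<in> I \<Longrightarrow> cmod (w i) \<le> C"
  shows "(\<lambda>i. cmod (w i * ip (x \<cdot> e i) y)) summable_on I"
    "(\<Sum>\<^sub>\<infinity>i\<in>I. cmod (w i * ip (x \<cdot> e i) y)) \<le> \<bar>C\<bar> * nrm x * nrm y"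
proof -
  have *: "(\<Sum>i\<in>F. cmod (w i * ip (x \<cdot> e i) y)) \<le> \<bar>C\<bar> * nrm x * nrm y" if F: "finite F" "F \<subseteq> I" for F
  proof -
    have "(\<Sum>i\<in>F. cmod (w i * ip (x \<cdot> e i) y)) \<le> (\<Sum>i\<in>F. \<bar>C\<bar> * cmod (ip (x \<cdot> e i) y))"
      unfolding norm_mult
    proof (intro sum_mono mult_right_mono norm_ge_zero)
      fix i assume "i \<in> F"
      then have "cmod (w i) \<le> C" using F w by blast
      then show "cmod (w i) \<le> \<bar>C\<bar>" by linarith
    qed
    also have "\<dots> \<le> \<bar>C\<bar> * (nrm x * nrm y)"
      unfolding sum_distrib_left[symmetric] by (intro mult_left_mono partition_abs_sum_le[OF e x F]) simp
    finally show ?thesis by (simp add: mult.assoc)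
  qed
  show s: "(\<lambda>i. cmod (w i * ip (x \<cdot> e i) y)) summable_on I"
    by (rule nonneg_bdd_above_summable_on) (auto intro!: bdd_aboveI2 *)
  show "(\<Sum>\<^sub>\<infinity>i\<in>I. cmod (w i * ip (x \<cdot> e i) y)) \<le> \<bar>C\<bar> * nrm x * nrm y"
    by (rule infsum_le_finite_sums[OF s *])
qed

lemma wip_has_sum:
  assumes "partition I e" "x \<in> N" "y \<in> N" "\<And>i. i \<in> I \<Longrightarrow> cmod (w i) \<le> C"
  shows "((\<lambda>i. w i * ip (x \<cdot> e i) y) has_sum wip I e w x y) I"
  unfolding wip_def using abs_summable_summable[OF wip_abs_summable(1)[of I e x y w C]] assms by simp

lemma wip_bound:
  assumes "partition I e" "x \<in> N" "y \<in> N" "\<And>i. i \<in> I \<Longrightarrow> cmod (w i) \<le> C"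
  shows "cmod (wip I e w x y) \<le> \<bar>C\<bar> * nrm x * nrm y"
  using norm_infsum_bound[OF wip_abs_summable(1)[of I e x y w C]] wip_abs_summable(2)[of I e x y w C] assms
  unfolding wip_def by fastforce

lemma wip_one:
  assumes "partition I e" "x \<in> N" "y \<in> N"
  shows "wip I e (\<lambda>_. 1) x y = ip x y"
  using infsumI[OF partition_has_sum[OF assms]] by (simp add: wip_def)

lemma wip_add:
  assumes "partition I e" "x \<in> N" "y \<in> N" "\<And>i. i \<in> I \<Longrightarrow> cmod (w i) \<le> C" "\<And>i. i \<in> I \<Longrightarrow> cmod (w' i) \<le> C'"
  shows "wip I e (\<lambda>i. w i + w' i) x y = wip I e w x y + wip I e w' x y"
  using has_sum_add[OF wip_has_sum[of I e x y w C] wip_has_sum[of I e x y w' C']] assms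
  unfolding wip_def by (intro infsumI) (simp add: algebra_simps)

lemma wip_cmult: "wip I e (\<lambda>i. c * w i) x y = c * wip I e w x y"
  unfolding wip_def using infsum_cmult_right'[of c "\<lambda>i. w i * ip (x \<cdot> e i) y" I] by (simp add: mult.assoc)

lemma wip_cong:
  assumes "\<And>i. i \<in> I \<Longrightarrow> w i = w' i"
  shows "wip I e w x y = wip I e w' x y"
  unfolding wip_def using assms by (intro infsum_cong) simp

lemma wip_cut_left:
  assumes e: "partition I e" and f: "partition J f" and x: "x \<in> N" "y \<in> N" and w: "\<And>i. i \<in> I \<Longrightarrow> cmod (w i) \<le> C"
    and F: "finite F" "F \<subseteq> J"
  shows "wip I e w (cut f F x) y = wip I e w x y - (\<Sum>j\<in>F. wip I e w (x \<cdot> f j) y)"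
proof -
  have N: "x \<cdot> f j \<in> N" if "j \<in> F" for j using x partitionD(1)[OF f] that F by auto
  have "((\<lambda>i. w i * ip (x \<cdot> e i) y - (\<Sum>j\<in>F. w i * ip (x \<cdot> f j \<cdot> e i) y)) has_sum
      wip I e w x y - (\<Sum>j\<in>F. wip I e w (x \<cdot> f j) y)) I"
    using wip_has_sum[OF e _ x(2) w] N x by (intro has_sum_minus has_sum_finite_sum F(1)) auto
  moreover have "w i * ip (x \<cdot> e i) y - (\<Sum>j\<in>F. w i * ip (x \<cdot> f j \<cdot> e i) y) = w i * ip (cut f F x \<cdot> e i) y"
    if i: "i \<in> I" for i
  proof -
    note d = partitionD[OF e i]
    \<comment> \<open>The remainder is known only through its inner products, so \<open>e i\<close>
      is moved to the other argument before the remainder is expanded, and moved back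
      afterwards.\<close>
    have "ip (cut f F x \<cdot> e i) y = ip x (y \<cdot> e i) - (\<Sum>j\<in>F. ip (x \<cdot> f j) (y \<cdot> e i))"
      using cut[OF f x(1) F] partition_ip(1)[OF e i _ x(2)] d x by simp
    also have "\<dots> = ip (x \<cdot> e i) y - (\<Sum>j\<in>F. ip (x \<cdot> f j \<cdot> e i) y)"
      using partition_ip(1)[OF e i _ x(2)] N x by simp
    finally have "ip (cut f F x \<cdot> e i) y = \<dots>" .
    then show ?thesis by (simp add: sum_distrib_left right_diff_distrib)
  qed
  ultimately have "((\<lambda>i. w i * ip (cut f F x \<cdot> e i) y) has_sum
      wip I e w x y - (\<Sum>j\<in>F. wip I e w (x \<cdot> f j) y)) I" by (simp cong: has_sum_cong)
  then show ?thesis unfolding wip_def[of I e w "cut f F x" y] by (rule infsumI)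
qed

lemma wip_cut_right:
  assumes e: "partition I e" and f: "partition J f" and x: "x \<in> N" "y \<in> N" and w: "\<And>i. i \<in> I \<Longrightarrow> cmod (w i) \<le> C"
    and F: "finite F" "F \<subseteq> J"
  shows "wip I e w x (cut f F y) = wip I e w x y - (\<Sum>j\<in>F. wip I e w x (y \<cdot> f j))"
proof -
  have N: "y \<cdot> f j \<in> N" if "j \<in> F" for j using x partitionD(1)[OF f] that F by auto
  have "((\<lambda>i. w i * ip (x \<cdot> e i) y - (\<Sum>j\<in>F. w i * ip (x \<cdot> e i) (y \<cdot> f j))) has_sum
      wip I e w x y - (\<Sum>j\<in>F. wip I e w x (y \<cdot> f j))) I"
    using wip_has_sum[OF e x(1) _ w] N x by (intro has_sum_minus has_sum_finite_sum F(1)) auto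
  moreover have "w i * ip (x \<cdot> e i) y - (\<Sum>j\<in>F. w i * ip (x \<cdot> e i) (y \<cdot> f j)) = w i * ip (x \<cdot> e i) (cut f F y)"
    if i: "i \<in> I" for i
    using ip_cut_right[OF f x(2) F, of "x \<cdot> e i"] partitionD[OF e i] x by (simp add: sum_distrib_left right_diff_distrib)
  ultimately have "((\<lambda>i. w i * ip (x \<cdot> e i) (cut f F y)) has_sum
      wip I e w x y - (\<Sum>j\<in>F. wip I e w x (y \<cdot> f j))) I" by (simp cong: has_sum_cong)
  then show ?thesis unfolding wip_def[of I e w x "cut f F y"] by (rule infsumI)
qed

end

section \<open>Isometric actions and couplings\<close>

locale isometric_action = hilbert_algebra N mul star ip + group G
  for N :: "'v set" and mul (infixl "\<cdot>" 70) and star ip and G :: "'g monoid" (structure) +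
  fixes \<sigma> :: "'g \<Rightarrow> 'v \<Rightarrow> 'v"
  assumes act_closed [intro, simp]: "\<lbrakk>g \<in> carrier G; x \<in> N\<rbrakk> \<Longrightarrow> \<sigma> g x \<in> N"
    and act_mul: "\<lbrakk>g \<in> carrier G; x \<in> N; y \<in> N\<rbrakk> \<Longrightarrow> \<sigma> g (x \<cdot> y) = \<sigma> g x \<cdot> \<sigma> g y"
    and act_star: "\<lbrakk>g \<in> carrier G; x \<in> N\<rbrakk> \<Longrightarrow> \<sigma> g (star x) = star (\<sigma> g x)"
    and act_ip: "\<lbrakk>g \<in> carrier G; x \<in> N; y \<in> N\<rbrakk> \<Longrightarrow> ip (\<sigma> g x) (\<sigma> g y) = ip x y"
    and act_comp: "\<lbrakk>g \<in> carrier G; h \<in> carrier G; x \<in> N\<rbrakk> \<Longrightarrow> \<sigma> (g \<otimes> h) x = \<sigma> g (\<sigma> h x)"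
    and act_one: "x \<in> N \<Longrightarrow> \<sigma> \<one> x = x"
begin

lemma act_inv: "g \<in> carrier G \<Longrightarrow> x \<in> N \<Longrightarrow> \<sigma> g (\<sigma> (inv g) x) = x"
  "g \<in> carrier G \<Longrightarrow> x \<in> N \<Longrightarrow> \<sigma> (inv g) (\<sigma> g x) = x"
  by (simp_all flip: act_comp add: act_one)

lemma nrm_act: "g \<in> carrier G \<Longrightarrow> x \<in> N \<Longrightarrow> nrm (\<sigma> g x) = nrm x"
  by (simp add: nrm_def act_ip)

lemma partition_act:
  assumes e: "partition I e" and g: "g \<in> carrier G"
  shows "partition I (\<lambda>i. \<sigma> g (e i))"
proof -
  note d = partitionD[OF e]
  have 1: "x \<cdot> \<sigma> g (e i) = \<sigma> g (\<sigma> (inv g) x \<cdot> e i)" if "i \<in> I" "x \<in> N" for i x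
    using that d g by (simp add: act_mul act_inv)
  have 2: "x \<cdot> \<sigma> g (e i) \<cdot> \<sigma> g (e j) = \<sigma> g (\<sigma> (inv g) x \<cdot> e i \<cdot> e j)" if "i \<in> I" "j \<in> I" "x \<in> N" for i j x
    using that d g by (simp add: act_mul act_inv)
  have 3: "ip (\<sigma> g x) y = ip x (\<sigma> (inv g) y)" if "x \<in> N" "y \<in> N" for x y
    using act_ip[of g x "\<sigma> (inv g) y"] that g by (simp add: act_inv)
  have "((\<lambda>i. ip (x \<cdot> \<sigma> g (e i)) x) has_sum ip x x) I" if x: "x \<in> N" for x
  proof -
    have "((\<lambda>i. ip (\<sigma> (inv g) x \<cdot> e i) (\<sigma> (inv g) x)) has_sum ip (\<sigma> (inv g) x) (\<sigma> (inv g) x)) I"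
      using partition_has_sum[OF e] x g by simp
    also have "ip (\<sigma> (inv g) x) (\<sigma> (inv g) x) = ip x x" using x g by (simp add: act_ip)
    finally show ?thesis using x g d by (simp add: 1 3 cong: has_sum_cong)
  qed
  moreover have "ip (x \<cdot> \<sigma> g (e i) \<cdot> \<sigma> g (e j)) y = 0" if "i \<in> I" "j \<in> I" "i \<noteq> j" "x \<in> N" "y \<in> N" for i j x y
  proof -
    have "ip (\<sigma> (inv g) x \<cdot> e i \<cdot> e j) (\<sigma> (inv g) y) = 0"
      using e that g unfolding partition_def by simp
    then show ?thesis using that g d by (simp add: 2 3)
  qed
  ultimately show ?thesis
    unfolding partition_def using d g by (auto simp: act_mul[symmetric] act_star[symmetric])
qed

end

locale coupling =
  G: isometric_action N mul star ip G \<sigma> + L: isometric_action N mul star ip L \<tau>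
  for N :: "'v set" and mul (infixl "\<cdot>" 70) and star ip
    and G :: "'a monoid" and \<sigma> and L :: "'b monoid" and \<tau> +
  fixes p q
  assumes act_commute: "\<lbrakk>g \<in> carrier G; l \<in> carrier L; x \<in> N\<rbrakk> \<Longrightarrow> \<sigma> g (\<tau> l x) = \<tau> l (\<sigma> g x)"
    and fund_p: "G.partition (carrier G) (\<lambda>g. \<sigma> g p)" and p_N: "p \<in> N"
    and fund_q: "G.partition (carrier L) (\<lambda>l. \<tau> l q)" and q_N: "q \<in> N"
    and p_nonzero: "ip p p \<noteq> 0" and q_nonzero: "ip q q \<noteq> 0"
begin

text \<open>The hypotheses are symmetric in the two groups, so each property is transferred in one
  direction only, and the converse is the transfer for the swapped coupling.\<close>

lemma coupling_swap: "coupling N mul star ip L \<tau> G \<sigma> q p"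
  using act_commute fund_p fund_q p_nonzero q_nonzero p_N q_N
  by unfold_locales auto

lemma p_proj: "p \<in> N" "star p = p" "p \<cdot> p = p"
  using G.partitionD[OF fund_p, of "\<one>\<^bsub>G\<^esub>"] p_N by (auto simp: G.act_one)

lemma q_proj: "q \<in> N" "star q = q" "q \<cdot> q = q"
  using G.partitionD[OF fund_q, of "\<one>\<^bsub>L\<^esub>"] q_N by (auto simp: L.act_one)

lemma partition_q: "g \<in> carrier G \<Longrightarrow> G.partition (carrier L) (\<lambda>l. \<tau> l (\<sigma> g q))"
  using G.partition_act[OF fund_q, of g] act_commute q_proj unfolding G.partition_def
  by (simp cong: has_sum_cong)

lemma partition_p: "s \<in> carrier L \<Longrightarrow> G.partition (carrier G) (\<lambda>t. \<sigma> t (\<tau> s p))"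
  using L.partition_act[OF fund_p, of s] act_commute p_proj unfolding G.partition_def
  by (simp cong: has_sum_cong)

text \<open>The vectors \<open>u\<close> and \<open>v\<close> stay free so that they can be cut
  along the translates of a fundamental domain and moved by either group.\<close>

definition T :: "('b \<Rightarrow> complex) \<Rightarrow> 'v \<Rightarrow> 'v \<Rightarrow> 'a \<Rightarrow> complex" where
  "T w u v g = G.wip (carrier L) (\<lambda>l. \<tau> l (\<sigma> g q)) w u v"

lemma T_translate_L:
  assumes s: "s \<in> carrier L" and g: "g \<in> carrier G" and u: "u \<in> N" "v \<in> N"
  shows "T (\<lambda>l. w (s \<otimes>\<^bsub>L\<^esub> l)) u v g = T w (\<tau> s u) (\<tau> s v) g"
proof -
  have bij: "bij_betw (\<lambda>l. s \<otimes>\<^bsub>L\<^esub> l) (carrier L) (carrier L)"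
    by (rule bij_betwI[where g = "\<lambda>l. inv\<^bsub>L\<^esub> s \<otimes>\<^bsub>L\<^esub> l"]) (use s in \<open>auto simp: L.m_assoc[symmetric]\<close>)
  have "T w (\<tau> s u) (\<tau> s v) g = (\<Sum>\<^sub>\<infinity>l\<in>carrier L. w (s \<otimes>\<^bsub>L\<^esub> l) * ip (\<tau> s u \<cdot> \<tau> (s \<otimes>\<^bsub>L\<^esub> l) (\<sigma> g q)) (\<tau> s v))"
    unfolding T_def G.wip_def by (rule infsum_reindex_bij_betw[OF bij, symmetric])
  also have "\<dots> = T (\<lambda>l. w (s \<otimes>\<^bsub>L\<^esub> l)) u v g"
    unfolding T_def G.wip_def
    using s g u q_proj by (intro infsum_cong) (simp add: L.act_comp L.act_mul[symmetric] L.act_ip)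
  finally show ?thesis by simp
qed

text \<open>The element t carries the part of \<open>r\<close> under the translate of
  \<open>p\<close> by its inverse to the part of \<open>p\<close> under the translate of
  \<open>r\<close> by t. The projections need not commute: one copy of \<open>r\<close> is absorbed,
  and one copy of \<open>p\<close> split off, by moving them across the inner product.\<close>

lemma T_middle:
  assumes t: "t \<in> carrier G" and g: "g \<in> carrier G" and r: "r \<in> N" "star r = r" "r \<cdot> r = r"
  shows "T w (r \<cdot> \<sigma> (inv\<^bsub>G\<^esub> t) p) r g = T w p (p \<cdot> \<sigma> t r) (t \<otimes>\<^bsub>G\<^esub> g)"
  unfolding T_def G.wip_def
proof (intro infsum_cong)
  fix l assume l: "l \<in> carrier L"
  define e where "e = \<tau> l (\<sigma> g q)"
  have e: "e \<in> N" using l g q_proj by (simp add: e_def)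
  have e': "\<tau> l (\<sigma> (t \<otimes>\<^bsub>G\<^esub> g) q) = \<sigma> t e"
    using l g t q_proj by (simp add: e_def G.act_comp act_commute)
  let ?p = "\<sigma> (inv\<^bsub>G\<^esub> t) p"
  have P: "?p \<in> N" using t p_proj by simp
  have "ip (r \<cdot> ?p \<cdot> e) r = ip (?p \<cdot> e) r"
    using G.ip_mul_left[of r "?p \<cdot> e" r] r P e by (simp add: G.mul_assoc)
  also have "\<dots> = ip (\<sigma> t (?p \<cdot> e)) (\<sigma> t r)" using G.act_ip[of t "?p \<cdot> e" r] t P e r by simp
  also have "\<sigma> t (?p \<cdot> e) = p \<cdot> (p \<cdot> \<sigma> t e)"
    using t P e p_proj by (simp add: G.act_mul G.act_inv G.mul_assoc[symmetric])
  also have "ip (p \<cdot> (p \<cdot> \<sigma> t e)) (\<sigma> t r) = ip (p \<cdot> \<sigma> t e) (p \<cdot> \<sigma> t r)"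
    using G.ip_mul_left[of p "p \<cdot> \<sigma> t e" "\<sigma> t r"] t r e p_proj by simp
  finally show "w l * ip (r \<cdot> ?p \<cdot> \<tau> l (\<sigma> g q)) r = w l * ip (p \<cdot> \<tau> l (\<sigma> (t \<otimes>\<^bsub>G\<^esub> g) q)) (p \<cdot> \<sigma> t r)"
    by (simp add: e' e_def[symmetric])
qed

lemma T_bound:
  assumes "g \<in> carrier G" "u \<in> N" "v \<in> N" "\<And>l. l \<in> carrier L \<Longrightarrow> cmod (w l) \<le> C"
  shows "cmod (T w u v g) \<le> \<bar>C\<bar> * G.nrm u * G.nrm v"
  unfolding T_def by (rule G.wip_bound[OF partition_q[OF assms(1)] assms(2,3)]) (rule assms(4))

text \<open>Both \<open>p\<close> and \<open>r = \<tau> s p\<close> are fundamental domains of \<open>G\<close>. Cutting \<open>p\<close> along the translates of \<open>r\<close> and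
  \<open>r\<close> along the translates of \<open>p\<close> produces pieces that are matched by the elements of \<open>G\<close>.\<close>

lemma T_change_domain:
  assumes s: "s \<in> carrier L" and \<epsilon>: "\<epsilon> > 0"
  obtains B where "finite B" "B \<subseteq> carrier G"
    "\<And>w C g. \<lbrakk>\<And>l. l \<in> carrier L \<Longrightarrow> cmod (w l) \<le> C; g \<in> carrier G\<rbrakk> \<Longrightarrow>
      cmod (T (\<lambda>l. w (s \<otimes>\<^bsub>L\<^esub> l)) p p g - T w p p g -
        (\<Sum>t\<in>B. T w p (p \<cdot> \<sigma> t (\<tau> s p)) (t \<otimes>\<^bsub>G\<^esub> g) - T w p (p \<cdot> \<sigma> t (\<tau> s p)) g)) \<le> \<bar>C\<bar> * \<epsilon>"
proof -
  define r where "r = \<tau> s p"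
  have r: "r \<in> N" "star r = r" "r \<cdot> r = r"
    using s p_proj by (simp_all add: r_def flip: L.act_star L.act_mul)
  note P = fund_p and R = partition_p[OF s, folded r_def]
  \<comment> \<open>Two remainders of norm below \<delta> will be paired with \<open>p\<close> and
    \<open>r\<close> respectively; the 1 keeps the denominator positive.\<close>
  define \<delta> where "\<delta> = \<epsilon> / (G.nrm p + G.nrm r + 1)"
  have \<delta>: "\<delta> > 0" "\<delta> * (G.nrm p + G.nrm r) \<le> \<epsilon>"
  proof -
    have "0 \<le> G.nrm p + G.nrm r" using r p_proj by simp
    then show "\<delta> > 0" "\<delta> * (G.nrm p + G.nrm r) \<le> \<epsilon>" using \<epsilon> by (auto simp: \<delta>_def field_simps)
  qed
  obtain B1 where B1: "finite B1" "B1 \<subseteq> carrier G"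
    "\<And>F. finite F \<Longrightarrow> B1 \<subseteq> F \<Longrightarrow> F \<subseteq> carrier G \<Longrightarrow> G.nrm (G.cut (\<lambda>t. \<sigma> t r) F p) < \<delta>"
    using G.nrm_cut_small[OF R p_N \<delta>(1)] by blast
  obtain B2 where B2: "finite B2" "B2 \<subseteq> carrier G"
    "\<And>F. finite F \<Longrightarrow> B2 \<subseteq> F \<Longrightarrow> F \<subseteq> carrier G \<Longrightarrow> G.nrm (G.cut (\<lambda>t. \<sigma> t p) F r) < \<delta>"
    using G.nrm_cut_small[OF P r(1) \<delta>(1)] by blast
  \<comment> \<open>A piece of \<open>p\<close> with index t is matched by the piece of
    \<open>r\<close> whose index is the inverse of t, so the finite set found for \<open>r\<close>
    enters inverted.\<close>
  define B where "B = B1 \<union> (\<lambda>t. inv\<^bsub>G\<^esub> t) ` B2"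
  define B' where "B' = (\<lambda>t. inv\<^bsub>G\<^esub> t) ` B"
  have B: "finite B" "B \<subseteq> carrier G" "B1 \<subseteq> B" using B1 B2 by (auto simp: B_def)
  have "B2 \<subseteq> B'"
  proof
    fix t assume "t \<in> B2"
    then show "t \<in> B'" unfolding B'_def B_def using B2 by (intro image_eqI[of _ _ "inv\<^bsub>G\<^esub> t"]) auto
  qed
  then have B': "finite B'" "B' \<subseteq> carrier G" "B2 \<subseteq> B'" using B by (auto simp: B'_def)
  have injB: "inj_on (\<lambda>t. inv\<^bsub>G\<^esub> t) B" using B G.inv_inj by (meson inj_on_subset)
  show ?thesis
  proof (rule that[OF B(1,2)])
    fix w C g assume w: "\<And>l. l \<in> carrier L \<Longrightarrow> cmod (w l) \<le> C" and g: "g \<in> carrier G"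
    let ?cp = "G.cut (\<lambda>t. \<sigma> t r) B p" and ?cr = "G.cut (\<lambda>t. \<sigma> t p) B' r"
    have 1: "T w p ?cp g = T w p p g - (\<Sum>t\<in>B. T w p (p \<cdot> \<sigma> t r) g)"
      unfolding T_def by (rule G.wip_cut_right[OF partition_q[OF g] R p_N p_N _ B(1,2)]) (rule w)
    have "T w ?cr r g = T w r r g - (\<Sum>t\<in>B'. T w (r \<cdot> \<sigma> t p) r g)"
      unfolding T_def by (rule G.wip_cut_left[OF partition_q[OF g] P r(1) r(1) _ B'(1,2)]) (rule w)
    also have "(\<Sum>t\<in>B'. T w (r \<cdot> \<sigma> t p) r g) = (\<Sum>t\<in>B. T w (r \<cdot> \<sigma> (inv\<^bsub>G\<^esub> t) p) r g)"
      unfolding B'_def by (simp add: sum.reindex[OF injB])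
    also have "\<dots> = (\<Sum>t\<in>B. T w p (p \<cdot> \<sigma> t r) (t \<otimes>\<^bsub>G\<^esub> g))"
      using T_middle[OF _ g r] B(2) by (intro sum.cong refl) blast
    finally have 2: "T w ?cr r g = T w r r g - (\<Sum>t\<in>B. T w p (p \<cdot> \<sigma> t r) (t \<otimes>\<^bsub>G\<^esub> g))" .
    have c: "?cp \<in> N" "?cr \<in> N" using G.cut(1)[OF R p_N B(1,2)] G.cut(1)[OF P r(1) B'(1,2)] by auto
    have "cmod (T w p ?cp g) \<le> \<bar>C\<bar> * G.nrm p * G.nrm ?cp" by (rule T_bound[OF g p_N c(1)]) (rule w)
    also have "\<dots> \<le> \<bar>C\<bar> * G.nrm p * \<delta>"
      using B1(3)[OF B(1,3,2)] p_N by (intro mult_left_mono) auto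
    finally have 3: "cmod (T w p ?cp g) \<le> \<bar>C\<bar> * G.nrm p * \<delta>" .
    have "cmod (T w ?cr r g) \<le> \<bar>C\<bar> * G.nrm ?cr * G.nrm r" by (rule T_bound[OF g c(2) r(1)]) (rule w)
    also have "\<dots> \<le> \<bar>C\<bar> * \<delta> * G.nrm r"
      using B2(3)[OF B'(1,3,2)] r(1) by (intro mult_left_mono mult_right_mono) auto
    finally have 4: "cmod (T w ?cr r g) \<le> \<bar>C\<bar> * \<delta> * G.nrm r" .
    \<comment> \<open>Translating the weight by s replaces both copies of \<open>p\<close> by
      \<open>r\<close>. The matched pieces account for the sum over \<open>B\<close>, and the two
      remainders for the error.\<close>
    have "T (\<lambda>l. w (s \<otimes>\<^bsub>L\<^esub> l)) p p g = T w r r g" using T_translate_L[OF s g p_N p_N] by (simp add: r_def)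
    then have "T (\<lambda>l. w (s \<otimes>\<^bsub>L\<^esub> l)) p p g - T w p p g -
        (\<Sum>t\<in>B. T w p (p \<cdot> \<sigma> t r) (t \<otimes>\<^bsub>G\<^esub> g) - T w p (p \<cdot> \<sigma> t r) g) = T w ?cr r g - T w p ?cp g"
      using 1 2 by (simp add: sum_subtractf)
    moreover have "cmod (T w ?cr r g - T w p ?cp g) \<le> \<bar>C\<bar> * (\<delta> * (G.nrm p + G.nrm r))"
      using norm_triangle_ineq4[of "T w ?cr r g" "T w p ?cp g"] 3 4 by (simp add: algebra_simps)
    moreover have "\<bar>C\<bar> * (\<delta> * (G.nrm p + G.nrm r)) \<le> \<bar>C\<bar> * \<epsilon>" using \<delta>(2) by (intro mult_left_mono) auto
    ultimately show "cmod (T (\<lambda>l. w (s \<otimes>\<^bsub>L\<^esub> l)) p p g - T w p p g -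
        (\<Sum>t\<in>B. T w p (p \<cdot> \<sigma> t (\<tau> s p)) (t \<otimes>\<^bsub>G\<^esub> g) - T w p (p \<cdot> \<sigma> t (\<tau> s p)) g)) \<le> \<bar>C\<bar> * \<epsilon>"
      unfolding r_def[symmetric] by (metis order_trans)
  qed
qed

end

section \<open>Amenability\<close>

locale invariant_mean = group G for G :: "'a monoid" (structure) +
  fixes m :: "('a \<Rightarrow> real) \<Rightarrow> real"
  assumes mean_add: "\<lbrakk>bounded_on G f; bounded_on G h\<rbrakk> \<Longrightarrow> m (\<lambda>x. f x + h x) = m f + m h"
    and mean_cmult: "bounded_on G f \<Longrightarrow> m (\<lambda>x. c * f x) = c * m f"
    and mean_nonneg: "\<lbrakk>bounded_on G f; \<And>x. x \<in> carrier G \<Longrightarrow> 0 \<le> f x\<rbrakk> \<Longrightarrow> 0 \<le> m f"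
    and mean_one: "m (\<lambda>_. 1) = 1"
    and mean_translate: "\<lbrakk>g \<in> carrier G; bounded_on G f\<rbrakk> \<Longrightarrow> m (\<lambda>x. f (g \<otimes> x)) = m f"
begin

lemma bounded_on_const [simp]: "bounded_on G (\<lambda>_. c)"
  unfolding bounded_on_def by auto

lemma bounded_on_cmult: "bounded_on G f \<Longrightarrow> bounded_on G (\<lambda>x. c * f x)"
  unfolding bounded_on_def by (auto simp: abs_mult) (metis abs_ge_zero mult_left_mono)

lemma bounded_on_add:
  assumes "bounded_on G f" "bounded_on G h"
  shows "bounded_on G (\<lambda>x. f x + h x)"
proof -
  obtain C D where "\<forall>x\<in>carrier G. \<bar>f x\<bar> \<le> C" "\<forall>x\<in>carrier G. \<bar>h x\<bar> \<le> D"
    using assms unfolding bounded_on_def by blast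
  then have "\<bar>f x + h x\<bar> \<le> C + D" if "x \<in> carrier G" for x
    using that abs_triangle_ineq[of "f x" "h x"] by fastforce
  then show ?thesis unfolding bounded_on_def by blast
qed

lemma bounded_on_diff:
  "bounded_on G f \<Longrightarrow> bounded_on G h \<Longrightarrow> bounded_on G (\<lambda>x. f x - h x)"
  using bounded_on_add[of f "\<lambda>x. (-1) * h x"] bounded_on_cmult[of h "-1"] by simp

lemma bounded_on_sum:
  "finite B \<Longrightarrow> (\<And>t. t \<in> B \<Longrightarrow> bounded_on G (f t)) \<Longrightarrow> bounded_on G (\<lambda>x. \<Sum>t\<in>B. f t x)"
  by (induction B rule: finite_induct) (auto intro: bounded_on_add)

lemma mean_const: "m (\<lambda>_. c) = c"
  using mean_cmult[of "\<lambda>_. 1" c] mean_one by simp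

lemma mean_diff: "bounded_on G f \<Longrightarrow> bounded_on G h \<Longrightarrow> m (\<lambda>x. f x - h x) = m f - m h"
  using mean_add[of f "\<lambda>x. (-1) * h x"] mean_cmult[of h "-1"] bounded_on_cmult[of h "-1"] by simp

lemma mean_mono:
  assumes "bounded_on G f" "bounded_on G h" "\<And>x. x \<in> carrier G \<Longrightarrow> f x \<le> h x"
  shows "m f \<le> m h"
  using mean_nonneg[of "\<lambda>x. h x - f x"] mean_diff[of h f] bounded_on_diff[of h f] assms by simp

lemma mean_cong:
  assumes "bounded_on G f" "\<And>x. x \<in> carrier G \<Longrightarrow> f x = h x"
  shows "m f = m h"
proof -
  have "bounded_on G h" using assms unfolding bounded_on_def by simp
  then show ?thesis using mean_mono[of f h] mean_mono[of h f] assms by simp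
qed

lemma mean_abs_le:
  assumes "bounded_on G f" "\<And>x. x \<in> carrier G \<Longrightarrow> \<bar>f x\<bar> \<le> c"
  shows "\<bar>m f\<bar> \<le> c"
proof -
  have "f x \<le> c" "- c \<le> f x" if "x \<in> carrier G" for x using assms(2)[OF that] by linarith+
  then show ?thesis
    using mean_mono[of f "\<lambda>_. c"] mean_mono[of "\<lambda>_. - c" f] assms(1) by (simp add: mean_const)
qed

lemma mean_sum_zero:
  "finite B \<Longrightarrow> (\<And>t. t \<in> B \<Longrightarrow> bounded_on G (f t)) \<Longrightarrow> (\<And>t. t \<in> B \<Longrightarrow> m (f t) = 0) \<Longrightarrow>
    m (\<lambda>x. \<Sum>t\<in>B. f t x) = 0"
  by (induction B rule: finite_induct) (auto simp: mean_const mean_add bounded_on_sum)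

end

lemma amenable_iff:
  assumes "group G"
  shows "amenable G \<longleftrightarrow> (\<exists>m. invariant_mean G m)"
proof -
  have "invariant_mean G m \<longleftrightarrow>
     (\<forall>f h. bounded_on G f \<longrightarrow> bounded_on G h \<longrightarrow> m (\<lambda>x. f x + h x) = m f + m h) \<and>
     (\<forall>c f. bounded_on G f \<longrightarrow> m (\<lambda>x. c * f x) = c * m f) \<and>
     (\<forall>f. bounded_on G f \<longrightarrow> (\<forall>x\<in>carrier G. f x \<ge> 0) \<longrightarrow> m f \<ge> 0) \<and>
     m (\<lambda>_. 1) = 1 \<and>
     (\<forall>g\<in>carrier G. \<forall>f. bounded_on G f \<longrightarrow> m (\<lambda>x. f (g \<otimes>\<^bsub>G\<^esub> x)) = m f)" for m
    unfolding invariant_mean_def invariant_mean_axioms_def by (simp add: assms Ball_def atomize_all atomize_imp)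
      (intro conj_cong refl iffI allI impI; simp)
  then show ?thesis unfolding amenable_def by simp
qed

context coupling
begin

text \<open>Translating f by s changes the function \<open>F f\<close>, within any \<epsilon>, by a
  finite sum of differences between functions on G and their translates. These have mean 0, and
  \<epsilon> is arbitrary.\<close>

lemma amenable_transfer:
  assumes "amenable G"
  shows "amenable L"
proof -
  obtain m where "invariant_mean G m" using assms amenable_iff[OF G.is_group] by blast
  then interpret m: invariant_mean G m .
  define F where "F f g = Re (T (\<lambda>l. of_real (f l)) p p g)" for f g
  define c where "c = (G.nrm p)\<^sup>2"
  have c: "c > 0" using p_nonzero p_N by (auto simp: c_def G.ip_self)
  have R_bdd: "bounded_on G (\<lambda>g. Re (T w u v g))" if "u \<in> N" "v \<in> N" "\<And>l. l \<in> carrier L \<Longrightarrow> cmod (w l) \<le> C" for w u v C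
    unfolding bounded_on_def
  proof (intro exI ballI)
    fix g assume "g \<in> carrier G"
    then show "\<bar>Re (T w u v g)\<bar> \<le> \<bar>C\<bar> * G.nrm u * G.nrm v"
      using T_bound[of g u v w C] that abs_Re_le_cmod[of "T w u v g"] by fastforce
  qed
  define K where "K f = (SOME C. \<forall>x\<in>carrier L. \<bar>f x\<bar> \<le> C)" for f :: "'b \<Rightarrow> real"
  have K: "cmod (of_real (f l)) \<le> K f" if "bounded_on L f" "l \<in> carrier L" for f l
    using someI_ex[OF that(1)[unfolded bounded_on_def]] that(2) unfolding K_def by simp
  have F_bdd: "bounded_on G (F f)" if "bounded_on L f" for f
    unfolding F_def by (rule R_bdd[OF p_N p_N]) (rule K[OF that])
  have F_add: "F (\<lambda>x. f x + h x) g = F f g + F h g" if "bounded_on L f" "bounded_on L h" "g \<in> carrier G" for f h g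
    using G.wip_add[OF partition_q[OF that(3)] p_N p_N K[OF that(1)] K[OF that(2)]] by (simp add: F_def T_def)
  have F_cmult: "F (\<lambda>x. a * f x) g = a * F f g" for a f g
    by (simp add: F_def T_def G.wip_cmult)
  have F_nonneg: "0 \<le> F f g" if f: "bounded_on L f" "\<And>x. x \<in> carrier L \<Longrightarrow> 0 \<le> f x" and g: "g \<in> carrier G" for f g
  proof -
    from has_sum_Re[OF G.wip_has_sum[OF partition_q[OF g] p_N p_N K[OF f(1)]]]
    have "((\<lambda>l. Re (of_real (f l) * ip (p \<cdot> \<tau> l (\<sigma> g q)) p)) has_sum F f g) (carrier L)"
      by (simp add: F_def T_def)
    then show ?thesis
    proof (rule has_sum_nonneg)
      fix l assume l: "l \<in> carrier L"
      let ?x = "p \<cdot> \<tau> l (\<sigma> g q)"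
      have x: "?x \<in> N" using l g p_N q_N by simp
      \<comment> \<open>The product of two positive operators need not be positive, but this
        coefficient is a squared norm; hence nonnegative weights give a nonnegative sum.\<close>
      have "ip ?x p = ip ?x ?x" using G.partition_ip(2)[OF partition_q[OF g] l p_N p_N] by simp
      then have "Re (ip ?x p) \<ge> 0" using G.Re_ip_self[OF x] by simp
      then show "0 \<le> Re (of_real (f l) * ip ?x p)" using f(2)[OF l] by simp
    qed
  qed
  have F_one: "F (\<lambda>_. 1) g = c" if "g \<in> carrier G" for g
    using G.wip_one[OF partition_q[OF that] p_N p_N] G.Re_ip_self[OF p_N] by (simp add: F_def T_def c_def)
  have F_inv: "m (F (\<lambda>x. f (s \<otimes>\<^bsub>L\<^esub> x))) = m (F f)" if s: "s \<in> carrier L" and f: "bounded_on L f" for s f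
  proof -
    define C where "C = K f"
    have C: "cmod (of_real (f l)) \<le> C" if "l \<in> carrier L" for l using K[OF f that] by (simp add: C_def)
    have fs: "bounded_on L (\<lambda>x. f (s \<otimes>\<^bsub>L\<^esub> x))" using f s unfolding bounded_on_def by auto
    have "\<bar>m (F (\<lambda>x. f (s \<otimes>\<^bsub>L\<^esub> x))) - m (F f)\<bar> \<le> \<bar>C\<bar> * \<epsilon>" if \<epsilon>: "\<epsilon> > 0" for \<epsilon>
    proof -
      obtain B where B: "finite B" "B \<subseteq> carrier G"
        "\<And>w C g. \<lbrakk>\<And>l. l \<in> carrier L \<Longrightarrow> cmod (w l) \<le> C; g \<in> carrier G\<rbrakk> \<Longrightarrow>
        cmod (T (\<lambda>l. w (s \<otimes>\<^bsub>L\<^esub> l)) p p g - T w p p g -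
          (\<Sum>t\<in>B. T w p (p \<cdot> \<sigma> t (\<tau> s p)) (t \<otimes>\<^bsub>G\<^esub> g) - T w p (p \<cdot> \<sigma> t (\<tau> s p)) g)) \<le> \<bar>C\<bar> * \<epsilon>"
        using T_change_domain[OF s \<epsilon>] by blast
      let ?w = "\<lambda>l. of_real (f l) :: complex"
      define S where "S t g = Re (T ?w p (p \<cdot> \<sigma> t (\<tau> s p)) g)" for t g
      have S: "bounded_on G (S t)" if "t \<in> carrier G" for t
        unfolding S_def by (rule R_bdd[OF p_N _ C]) (use that s p_N in auto)
      have S': "bounded_on G (\<lambda>g. S t (t \<otimes>\<^bsub>G\<^esub> g))" if "t \<in> carrier G" for t
        using S[OF that] that unfolding bounded_on_def by auto
      have dS: "bounded_on G (\<lambda>g. S t (t \<otimes>\<^bsub>G\<^esub> g) - S t g)" if "t \<in> B" for t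
        using m.bounded_on_diff[OF S' S] that B(2) by blast
      have "m (\<lambda>g. S t (t \<otimes>\<^bsub>G\<^esub> g) - S t g) = 0" if "t \<in> B" for t
        using m.mean_diff[OF S' S, of t t] m.mean_translate[OF _ S, of t] that B(2) by auto
      then have 0: "m (\<lambda>g. \<Sum>t\<in>B. S t (t \<otimes>\<^bsub>G\<^esub> g) - S t g) = 0"
        by (intro m.mean_sum_zero B(1) dS)
      have b1: "bounded_on G (\<lambda>g. F (\<lambda>x. f (s \<otimes>\<^bsub>L\<^esub> x)) g - F f g)"
        by (rule m.bounded_on_diff[OF F_bdd[OF fs] F_bdd[OF f]])
      have b2: "bounded_on G (\<lambda>g. \<Sum>t\<in>B. S t (t \<otimes>\<^bsub>G\<^esub> g) - S t g)" by (rule m.bounded_on_sum[OF B(1) dS])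
      have "m (F (\<lambda>x. f (s \<otimes>\<^bsub>L\<^esub> x))) - m (F f) =
          m (\<lambda>g. F (\<lambda>x. f (s \<otimes>\<^bsub>L\<^esub> x)) g - F f g - (\<Sum>t\<in>B. S t (t \<otimes>\<^bsub>G\<^esub> g) - S t g))"
        using m.mean_diff[OF b1 b2] m.mean_diff[OF F_bdd[OF fs] F_bdd[OF f]] 0 by simp
      also have "\<bar>\<dots>\<bar> \<le> \<bar>C\<bar> * \<epsilon>"
      proof (rule m.mean_abs_le[OF m.bounded_on_diff[OF b1 b2]])
        fix g assume g: "g \<in> carrier G"
        have "F (\<lambda>x. f (s \<otimes>\<^bsub>L\<^esub> x)) g - F f g - (\<Sum>t\<in>B. S t (t \<otimes>\<^bsub>G\<^esub> g) - S t g) =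
          Re (T (\<lambda>l. ?w (s \<otimes>\<^bsub>L\<^esub> l)) p p g - T ?w p p g -
          (\<Sum>t\<in>B. T ?w p (p \<cdot> \<sigma> t (\<tau> s p)) (t \<otimes>\<^bsub>G\<^esub> g) - T ?w p (p \<cdot> \<sigma> t (\<tau> s p)) g))"
          by (simp add: F_def S_def)
        then show "\<bar>F (\<lambda>x. f (s \<otimes>\<^bsub>L\<^esub> x)) g - F f g - (\<Sum>t\<in>B. S t (t \<otimes>\<^bsub>G\<^esub> g) - S t g)\<bar> \<le> \<bar>C\<bar> * \<epsilon>"
          by (simp only:) (rule order_trans[OF abs_Re_le_cmod B(3)[OF C g]])
      qed
      finally show ?thesis .
    qed
    note * = this
    have "\<bar>m (F (\<lambda>x. f (s \<otimes>\<^bsub>L\<^esub> x))) - m (F f)\<bar> \<le> 0"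
    proof (rule field_le_epsilon)
      fix e :: real assume e: "e > 0"
      have "\<bar>m (F (\<lambda>x. f (s \<otimes>\<^bsub>L\<^esub> x))) - m (F f)\<bar> \<le> \<bar>C\<bar> * (e / (\<bar>C\<bar> + 1))" by (rule *) (use e in simp)
      also have "\<dots> \<le> e" using e by (simp add: field_simps)
      finally show "\<bar>m (F (\<lambda>x. f (s \<otimes>\<^bsub>L\<^esub> x))) - m (F f)\<bar> \<le> 0 + e" by simp
    qed
    then show ?thesis by simp
  qed
  have "invariant_mean L (\<lambda>f. m (F f) / c)"
  proof
    fix f h assume fh: "bounded_on L f" "bounded_on L h"
    have "m (F (\<lambda>x. f x + h x)) = m (\<lambda>g. F f g + F h g)"
      using F_add[OF fh] fh by (intro m.mean_cong[symmetric] m.bounded_on_add F_bdd) auto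
    also have "\<dots> = m (F f) + m (F h)" by (intro m.mean_add F_bdd fh)
    finally show "m (F (\<lambda>x. f x + h x)) / c = m (F f) / c + m (F h) / c" by (simp add: add_divide_distrib)
  next
    fix f a assume f: "bounded_on L f"
    have "F (\<lambda>x. a * f x) = (\<lambda>g. a * F f g)" using F_cmult by blast
    then show "m (F (\<lambda>x. a * f x)) / c = a * (m (F f) / c)" using m.mean_cmult[OF F_bdd[OF f]] by simp
  next
    fix f assume "bounded_on L f" "\<And>x. x \<in> carrier L \<Longrightarrow> 0 \<le> f x"
    then show "0 \<le> m (F f) / c" using F_nonneg c by (intro divide_nonneg_pos m.mean_nonneg F_bdd) auto
  next
    have "m (F (\<lambda>_. 1)) = m (\<lambda>_. c)" using F_one by (intro m.mean_cong[symmetric]) auto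
    then show "m (F (\<lambda>_. 1)) / c = 1" using c by (simp add: m.mean_const)
  next
    fix g f assume "g \<in> carrier L" "bounded_on L f"
    then show "m (F (\<lambda>x. f (g \<otimes>\<^bsub>L\<^esub> x))) / c = m (F f) / c" using F_inv by simp
  qed
  then show ?thesis using amenable_iff[OF L.is_group] by blast
qed

end

section \<open>The Haagerup property\<close>

text \<open>\<open>positive_definite\<close> conjugates the coefficient of the first index and
  \<open>sesq\<close> that of the second, so the kernel takes its arguments in reverse
  order.\<close>

lemma positive_definite_iff:
  "positive_definite G \<phi> \<longleftrightarrow> pos_kernel (carrier G) (\<lambda>b a. \<phi> (inv\<^bsub>G\<^esub> a \<otimes>\<^bsub>G\<^esub> b))"
proof -
  have "(\<Sum>g\<in>S. \<Sum>h\<in>S. cnj (c g) * c h * \<phi> (inv\<^bsub>G\<^esub> g \<otimes>\<^bsub>G\<^esub> h)) =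
      sesq (\<lambda>b a. \<phi> (inv\<^bsub>G\<^esub> a \<otimes>\<^bsub>G\<^esub> b)) S c c" for S c
    unfolding sesq_def by (subst sum.swap) (simp add: mult.commute)
  then show ?thesis unfolding positive_definite_def pos_kernel_def Let_def by simp
qed

lemma positive_definite_norm_le:
  assumes "group G" "positive_definite G \<phi>" "\<phi> \<one>\<^bsub>G\<^esub> = 1" "g \<in> carrier G"
  shows "cmod (\<phi> g) \<le> 1"
proof -
  interpret group G by fact
  have "(cmod (\<phi> (inv\<^bsub>G\<^esub> \<one>\<^bsub>G\<^esub> \<otimes>\<^bsub>G\<^esub> g)))\<^sup>2 \<le> Re (\<phi> (inv\<^bsub>G\<^esub> g \<otimes>\<^bsub>G\<^esub> g)) * Re (\<phi> (inv\<^bsub>G\<^esub> \<one>\<^bsub>G\<^esub> \<otimes>\<^bsub>G\<^esub> \<one>\<^bsub>G\<^esub>))"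
    using pos_kernel_CS_point[OF assms(2)[unfolded positive_definite_iff] assms(4) one_closed] .
  then have "(cmod (\<phi> g))\<^sup>2 \<le> 1" using assms(3,4) by simp
  then show ?thesis by (simp add: power2_le_imp_le abs_square_le_1)
qed

section \<open>Convergence and decay of weighted sums\<close>

context hilbert_algebra
begin

lemma wip_indicator:
  assumes e: "partition I e" and x: "x \<in> N" "y \<in> N" and F: "finite F" "F \<subseteq> I"
  shows "wip I e (\<lambda>i. if i \<in> F then w i else 0) x y = (\<Sum>i\<in>F. w i * ip (x \<cdot> e i) y)"
  unfolding wip_def
proof (rule infsumI)
  have "((\<lambda>i. w i * ip (x \<cdot> e i) y) has_sum (\<Sum>i\<in>F. w i * ip (x \<cdot> e i) y)) F"
    using F by (intro has_sum_finite)
  moreover have "((\<lambda>i. w i * ip (x \<cdot> e i) y) has_sum (\<Sum>i\<in>F. w i * ip (x \<cdot> e i) y)) F \<longleftrightarrow>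
      ((\<lambda>i. (if i \<in> F then w i else 0) * ip (x \<cdot> e i) y) has_sum (\<Sum>i\<in>F. w i * ip (x \<cdot> e i) y)) I"
    using F by (intro has_sum_cong_neutral) auto
  ultimately show "((\<lambda>i. (if i \<in> F then w i else 0) * ip (x \<cdot> e i) y) has_sum (\<Sum>i\<in>F. w i * ip (x \<cdot> e i) y)) I"
    by (rule iffD1[rotated])
qed

lemma wip_point:
  assumes e: "partition I e" and x: "x \<in> N" "y \<in> N" and i: "i \<in> I"
  shows "wip I e w (x \<cdot> e i) y = w i * ip (x \<cdot> e i) y"
proof -
  have *: "w j * ip (x \<cdot> e i \<cdot> e j) y = (if j \<in> {i} then w j else 0) * ip (x \<cdot> e j) y" if j: "j \<in> I" for j
  proof (cases "j = i")
    case True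
    then show ?thesis using partitionD[OF e i] x by (simp add: mul_assoc)
  next
    case False
    then show ?thesis using e i j x unfolding partition_def by simp
  qed
  have "wip I e w (x \<cdot> e i) y = wip I e (\<lambda>j. if j \<in> {i} then w j else 0) x y"
    unfolding wip_def by (rule infsum_cong[OF *])
  also have "\<dots> = w i * ip (x \<cdot> e i) y" using wip_indicator[OF e x, of "{i}" w] i by simp
  finally show ?thesis .
qed

lemma wip_cut_self:
  assumes e: "partition I e" and x: "x \<in> N" "y \<in> N" and w: "\<And>i. i \<in> I \<Longrightarrow> cmod (w i) \<le> C"
    and F: "finite F" "F \<subseteq> I"
  shows "wip I e w x y = wip I e w (cut e F x) y + (\<Sum>i\<in>F. w i * ip (x \<cdot> e i) y)"
proof -
  have "(\<Sum>i\<in>F. wip I e w (x \<cdot> e i) y) = (\<Sum>i\<in>F. w i * ip (x \<cdot> e i) y)"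
    using F(2) by (intro sum.cong refl wip_point[OF e x]) auto
  then show ?thesis using wip_cut_left[OF e e x w F] by simp
qed

text \<open>Dominated convergence along an arbitrary filter. A finite set of indices is chosen
  independently of n: beyond it all weights bounded by C contribute little, and on it the weights
  converge one by one.\<close>

lemma wip_tendsto:
  assumes e: "partition I e" and x: "x \<in> N" "y \<in> N"
    and w: "\<And>n i. i \<in> I \<Longrightarrow> cmod (w n i) \<le> C"
    and lim: "\<And>i. i \<in> I \<Longrightarrow> ((\<lambda>n. w n i) \<longlongrightarrow> w' i) \<F>"
    and w': "\<And>i. i \<in> I \<Longrightarrow> cmod (w' i) \<le> C"
  shows "((\<lambda>n. wip I e (w n) x y) \<longlongrightarrow> wip I e w' x y) \<F>"
proof (rule tendstoI)
  fix \<epsilon> :: real assume \<epsilon>: "\<epsilon> > 0"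
  \<comment> \<open>The factor 2 is for the remainders of the two sums that are compared; the 1
    keeps K positive.\<close>
  define K where "K = 2 * \<bar>C\<bar> * nrm y + 1"
  have K: "K > 0" using x(2) by (simp add: K_def add_nonneg_pos)
  obtain F where F: "finite F" "F \<subseteq> I" "nrm (cut e F x) < \<epsilon> / (2 * K)"
    using nrm_cut_small[OF e x(1), of "\<epsilon> / (2 * K)"] \<epsilon> K by (metis divide_pos_pos mult_pos_pos order_refl zero_less_numeral)
  have cN: "cut e F x \<in> N" using cut(1)[OF e x(1) F(1,2)] .
  have cy: "nrm (cut e F x) * nrm y * (2 * \<bar>C\<bar>) \<le> \<epsilon> / 2"
  proof -
    have "nrm (cut e F x) * nrm y * (2 * \<bar>C\<bar>) = nrm (cut e F x) * (2 * \<bar>C\<bar> * nrm y)" by simp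
    also have "\<dots> \<le> \<epsilon> / (2 * K) * K"
      using F(3) cN x(2) \<epsilon> K by (intro mult_mono) (auto simp: K_def)
    also have "\<dots> = \<epsilon> / 2" using K by simp
    finally show ?thesis .
  qed
  have "((\<lambda>n. \<Sum>i\<in>F. w n i * ip (x \<cdot> e i) y) \<longlongrightarrow> (\<Sum>i\<in>F. w' i * ip (x \<cdot> e i) y)) \<F>"
    using lim F(2) by (intro tendsto_sum tendsto_mult_right) auto
  then have "\<forall>\<^sub>F n in \<F>. dist (\<Sum>i\<in>F. w n i * ip (x \<cdot> e i) y) (\<Sum>i\<in>F. w' i * ip (x \<cdot> e i) y) < \<epsilon> / 2"
    using \<epsilon> by (intro tendstoD) auto
  then show "\<forall>\<^sub>F n in \<F>. dist (wip I e (w n) x y) (wip I e w' x y) < \<epsilon>"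
  proof (rule eventually_mono)
    fix n
    let ?s = "\<Sum>i\<in>F. w n i * ip (x \<cdot> e i) y" and ?s' = "\<Sum>i\<in>F. w' i * ip (x \<cdot> e i) y"
    let ?c = "wip I e (w n) (cut e F x) y" and ?c' = "wip I e w' (cut e F x) y"
    assume s: "dist ?s ?s' < \<epsilon> / 2"
    have 1: "wip I e (w n) x y = ?c + ?s" by (rule wip_cut_self[OF e x w F(1,2)])
    have 2: "wip I e w' x y = ?c' + ?s'" by (rule wip_cut_self[OF e x w' F(1,2)])
    have 3: "cmod ?c \<le> \<bar>C\<bar> * nrm (cut e F x) * nrm y" by (rule wip_bound[OF e cN x(2) w])
    have 4: "cmod ?c' \<le> \<bar>C\<bar> * nrm (cut e F x) * nrm y" by (rule wip_bound[OF e cN x(2) w'])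
    have "dist (wip I e (w n) x y) (wip I e w' x y) \<le> cmod ?c + cmod ?c' + dist ?s ?s'"
      unfolding 1 2 dist_norm
      using norm_triangle_ineq[of "?c - ?c'" "?s - ?s'"] norm_triangle_ineq4[of ?c ?c'] by (simp add: algebra_simps)
    also have "\<dots> < \<epsilon>"
    proof -
      have "\<bar>C\<bar> * nrm (cut e F x) * nrm y \<le> \<epsilon> / 4" using cy by (simp add: mult_ac)
      then show ?thesis using 3 4 s by linarith
    qed
    finally show "dist (wip I e (w n) x y) (wip I e w' x y) < \<epsilon>" .
  qed
qed

text \<open>By Bessel's inequality at most \<open>(nrm x)\<^sup>2 / \<epsilon>\<^sup>2\<close>
  pieces can have norm at least \<epsilon>.\<close>

lemma partition_superlevel_finite:
  assumes e: "partition I e" and x: "x \<in> N" and \<epsilon>: "\<epsilon> > 0"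
  shows "finite {i \<in> I. nrm (x \<cdot> e i) \<ge> \<epsilon>}"
proof (rule ccontr)
  assume inf: "infinite {i \<in> I. nrm (x \<cdot> e i) \<ge> \<epsilon>}"
  obtain n :: nat where n: "(nrm x)\<^sup>2 / \<epsilon>\<^sup>2 < n" using reals_Archimedean2 by blast
  obtain F where F: "F \<subseteq> {i \<in> I. nrm (x \<cdot> e i) \<ge> \<epsilon>}" "card F = n" "finite F"
    using infinite_arbitrarily_large[OF inf, of n] by blast
  have FI: "F \<subseteq> I" using F(1) by auto
  have "real n * \<epsilon>\<^sup>2 = (\<Sum>i\<in>F. \<epsilon>\<^sup>2)" using F by simp
  also have "\<dots> \<le> (\<Sum>i\<in>F. (nrm (x \<cdot> e i))\<^sup>2)" using F \<epsilon> by (intro sum_mono power_mono) auto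
  also have "\<dots> \<le> (nrm x)\<^sup>2"
    using nrm_cut[OF e x F(3) FI] zero_le_power2[of "nrm (cut e F x)"] by linarith
  finally show False using n \<epsilon> by (simp add: field_simps)
qed

end

section \<open>Induced positive definite functions\<close>

context coupling
begin

lemma T_translate_G:
  assumes t: "t \<in> carrier G" and g: "g \<in> carrier G" and u: "u \<in> N" "v \<in> N"
  shows "T w (\<sigma> t u) (\<sigma> t v) (t \<otimes>\<^bsub>G\<^esub> g) = T w u v g"
  unfolding T_def G.wip_def
proof (rule infsum_cong)
  fix l assume l: "l \<in> carrier L"
  have "\<tau> l (\<sigma> (t \<otimes>\<^bsub>G\<^esub> g) q) = \<sigma> t (\<tau> l (\<sigma> g q))"
    using l g t q_N by (simp add: G.act_comp act_commute)
  then show "w l * ip (\<sigma> t u \<cdot> \<tau> l (\<sigma> (t \<otimes>\<^bsub>G\<^esub> g) q)) (\<sigma> t v) = w l * ip (u \<cdot> \<tau> l (\<sigma> g q)) v"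
    using l g t u q_N by (simp add: G.act_mul[symmetric] G.act_ip)
qed

text \<open>On a measure space this is the indicator of the points of q at which the cocycle of g
  takes the value b. The induced kernel at (g, h) is a sum over b and a in L of
  \<open>\<phi> (inv a \<otimes> b)\<close> times the inner product of \<open>vec g b\<close> with
  \<open>vec h a\<close>: a Schur product of two positive kernels, summed over L.\<close>

definition vec :: "'a \<Rightarrow> 'b \<Rightarrow> 'v" where
  "vec g b = \<tau> b (\<sigma> g q) \<cdot> q"

lemma vec_N [simp]: "g \<in> carrier G \<Longrightarrow> b \<in> carrier L \<Longrightarrow> vec g b \<in> N"
  using q_N by (simp add: vec_def)

text \<open>The squared norm is expressed with \<open>q\<close> on the left of the projection,
  because Bessel's inequality for a partition concerns right multiplication by its
  projections.\<close>

lemma vec_orth: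
  assumes g: "g \<in> carrier G" and b: "b \<in> carrier L" "c \<in> carrier L"
  shows "ip (vec g b) (vec g c) = (if b = c then of_real ((G.nrm (q \<cdot> \<tau> b (\<sigma> g q)))\<^sup>2) else 0)"
proof -
  note P = partition_q[OF g]
  define e where "e b = \<tau> b (\<sigma> g q)" for b
  note d = G.partitionD[OF P, folded e_def]
  have e: "e b \<in> N" "e c \<in> N" using d b by auto
  have "ip (vec g b) (vec g c) = ip q (e b \<cdot> (e c \<cdot> q))"
    using G.ip_mul_left[of "e b" q "e c \<cdot> q"] d(2) b e q_N by (simp add: vec_def e_def[symmetric])
  also have "\<dots> = cnj (ip (e b \<cdot> e c \<cdot> q) q)"
    using G.ip_cnj[of "e b \<cdot> e c \<cdot> q" q] e q_N by (simp add: G.mul_assoc)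
  also have "ip (e b \<cdot> e c \<cdot> q) q = ip (e b \<cdot> e c) q"
    using G.ip_mul_right[of "e b \<cdot> e c" q q] e q_proj by simp
  also have "cnj (ip (e b \<cdot> e c) q) = (if b = c then of_real ((G.nrm (q \<cdot> e b))\<^sup>2) else 0)"
  proof (cases "b = c")
    case False
    have "ip (e b \<cdot> e b \<cdot> e c) q = 0"
      using P False b e q_N unfolding G.partition_def e_def[symmetric] by blast
    then show ?thesis using False d(3)[OF b(1)] by simp
  next
    case True
    have "ip (e b) q = ip (q \<cdot> e b) q" using G.ip_mul_left[of q "e b" q] e q_proj by simp
    also have "\<dots> = ip (q \<cdot> e b) (q \<cdot> e b)"
      using G.partition_ip(2)[OF P b(1) q_N q_N] by (simp add: e_def)
    also have "\<dots> = of_real ((G.nrm (q \<cdot> e b))\<^sup>2)" using e q_N by (intro G.ip_self) simp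
    finally show ?thesis using True d(3)[OF b(1)] by (simp del: of_real_power)
  qed
  finally show ?thesis by (simp add: e_def)
qed

definition ker :: "('b \<Rightarrow> 'b \<Rightarrow> complex) \<Rightarrow> 'a \<times> 'b \<Rightarrow> 'a \<times> 'b \<Rightarrow> complex" where
  "ker \<theta> x y = \<theta> (snd x) (snd y) * ip (vec (fst x) (snd x)) (vec (fst y) (snd y))"

lemma pos_kernel_ker:
  assumes "pos_kernel (carrier L) \<theta>"
  shows "pos_kernel (carrier G \<times> carrier L) (ker \<theta>)"
proof -
  have 1: "pos_kernel (carrier G \<times> carrier L) (\<lambda>x y. \<theta> (snd x) (snd y))"
    by (rule pos_kernel_pullback[OF assms]) auto
  have 2: "pos_kernel (carrier G \<times> carrier L)
      (\<lambda>x y. ip ((\<lambda>z. vec (fst z) (snd z)) x) ((\<lambda>z. vec (fst z) (snd z)) y))"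
    by (rule pos_kernel_pullback[OF G.ip_pos]) auto
  have "ker \<theta> = (\<lambda>x y. \<theta> (snd x) (snd y) * ip (vec (fst x) (snd x)) (vec (fst y) (snd y)))"
    by (intro ext) (simp add: ker_def)
  then show ?thesis using pos_kernel_mult[OF 1 2] by simp
qed

text \<open>Both indices are cut to the same finite set, so that every truncation is again a
  positive kernel.\<close>

definition trunc :: "('b \<Rightarrow> 'b \<Rightarrow> complex) \<Rightarrow> 'b set \<Rightarrow> 'a \<Rightarrow> 'a \<Rightarrow> complex" where
  "trunc \<theta> C g h = (\<Sum>b\<in>C. \<Sum>a\<in>C. \<theta> b a * ip (vec g b) (vec h a))"

lemma sesq_trunc:
  "sesq (trunc \<theta> C) S c d = sesq (ker \<theta>) (S \<times> C) (\<lambda>x. c (fst x)) (\<lambda>x. d (fst x))"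
proof -
  have "sesq (ker \<theta>) (S \<times> C) (\<lambda>x. c (fst x)) (\<lambda>x. d (fst x)) =
      (\<Sum>g\<in>S. \<Sum>b\<in>C. \<Sum>h\<in>S. \<Sum>a\<in>C. c g * cnj (d h) * (\<theta> b a * ip (vec g b) (vec h a)))"
    unfolding sesq_def ker_def by (simp add: sum.cartesian_product' case_prod_unfold)
  also have "\<dots> = (\<Sum>g\<in>S. \<Sum>h\<in>S. \<Sum>b\<in>C. \<Sum>a\<in>C. c g * cnj (d h) * (\<theta> b a * ip (vec g b) (vec h a)))"
    by (intro sum.cong refl) (rule sum.swap)
  also have "\<dots> = sesq (trunc \<theta> C) S c d"
    unfolding sesq_def trunc_def by (simp add: sum_distrib_left)
  finally show ?thesis by simp
qed

lemma pos_kernel_trunc: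
  assumes "pos_kernel (carrier L) \<theta>" "finite C" "C \<subseteq> carrier L"
  shows "pos_kernel (carrier G) (trunc \<theta> C)"
  unfolding pos_kernel_def sesq_trunc
proof (intro allI impI)
  fix S c assume S: "finite S" "S \<subseteq> carrier G"
  have "finite (S \<times> C)" "S \<times> C \<subseteq> carrier G \<times> carrier L" using S assms by auto
  from pos_kernelD[OF pos_kernel_ker[OF assms(1)] this]
  show "Im (sesq (ker \<theta>) (S \<times> C) (\<lambda>x. c (fst x)) (\<lambda>x. c (fst x))) = 0 \<and>
      0 \<le> Re (sesq (ker \<theta>) (S \<times> C) (\<lambda>x. c (fst x)) (\<lambda>x. c (fst x)))" by blast
qed

text \<open>A rectangular block of the positive kernel \<open>ker \<theta>\<close> is bounded by two
  diagonal blocks, and there the orthogonality of the vectors \<open>vec g b\<close> for fixed g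
  leaves only squared norms.\<close>

lemma trunc_offdiag_le:
  assumes \<theta>: "pos_kernel (carrier L) \<theta>" "\<And>b. b \<in> carrier L \<Longrightarrow> \<theta> b b = 1"
    and g: "g \<in> carrier G" "h \<in> carrier G"
    and B: "finite B" "B \<subseteq> carrier L" and A: "finite A" "A \<subseteq> carrier L"
  shows "(cmod (\<Sum>b\<in>B. \<Sum>a\<in>A. \<theta> b a * ip (vec g b) (vec h a)))\<^sup>2 \<le>
    (\<Sum>b\<in>B. (G.nrm (q \<cdot> \<tau> b (\<sigma> g q)))\<^sup>2) * (\<Sum>a\<in>A. (G.nrm (q \<cdot> \<tau> a (\<sigma> h q)))\<^sup>2)"
proof -
  have diag: "Re (sesq (ker \<theta>) ({k} \<times> C) (\<lambda>_. 1) (\<lambda>_. 1)) = (\<Sum>b\<in>C. (G.nrm (q \<cdot> \<tau> b (\<sigma> k q)))\<^sup>2)"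
    if k: "k \<in> carrier G" and C: "finite C" "C \<subseteq> carrier L" for k C
  proof -
    have "sesq (ker \<theta>) ({k} \<times> C) (\<lambda>_. 1) (\<lambda>_. 1) = (\<Sum>b\<in>C. \<Sum>a\<in>C. \<theta> b a * ip (vec k b) (vec k a))"
      unfolding sesq_def ker_def by (simp add: sum.cartesian_product' case_prod_unfold)
    also have "\<dots> = (\<Sum>b\<in>C. \<Sum>a\<in>C. if b = a then of_real ((G.nrm (q \<cdot> \<tau> b (\<sigma> k q)))\<^sup>2) else 0)"
    proof (intro sum.cong refl)
      fix b a assume "b \<in> C" "a \<in> C"
      then have "b \<in> carrier L" "a \<in> carrier L" using C by auto
      then show "\<theta> b a * ip (vec k b) (vec k a) = (if b = a then of_real ((G.nrm (q \<cdot> \<tau> b (\<sigma> k q)))\<^sup>2) else 0)"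
        using vec_orth[OF k] \<theta>(2) by simp
    qed
    also have "\<dots> = of_real (\<Sum>b\<in>C. (G.nrm (q \<cdot> \<tau> b (\<sigma> k q)))\<^sup>2)" using C by simp
    finally show ?thesis by (simp only: Re_complex_of_real)
  qed
  have eq: "(\<Sum>b\<in>B. \<Sum>a\<in>A. \<theta> b a * ip (vec g b) (vec h a)) =
      (\<Sum>i\<in>{g} \<times> B. \<Sum>j\<in>{h} \<times> A. 1 * cnj 1 * ker \<theta> i j)"
    by (simp add: sum.cartesian_product' case_prod_unfold ker_def)
  have "(cmod (\<Sum>i\<in>{g} \<times> B. \<Sum>j\<in>{h} \<times> A. 1 * cnj 1 * ker \<theta> i j))\<^sup>2 \<le> Re (sesq (ker \<theta>) ({g} \<times> B) (\<lambda>_. 1) (\<lambda>_. 1)) * Re (sesq (ker \<theta>) ({h} \<times> A) (\<lambda>_. 1) (\<lambda>_. 1))"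
    by (rule pos_kernel_CS[OF pos_kernel_ker[OF \<theta>(1)]]) (use A B g in auto)
  then show ?thesis by (simp only: eq diag[OF g(1) B] diag[OF g(2) A])
qed

text \<open>The vectors \<open>vec g b\<close> (for fixed \<open>g\<close>) are orthogonal with square summable norms; this makes the truncated
  double sums converge although they need not converge absolutely.\<close>

lemma trunc_tendsto:
  assumes \<phi>: "positive_definite L \<phi>" "\<phi> \<one>\<^bsub>L\<^esub> = 1" and g: "g \<in> carrier G" and h: "h \<in> carrier G"
  shows "((\<lambda>C. trunc (\<lambda>b a. \<phi> (inv\<^bsub>L\<^esub> a \<otimes>\<^bsub>L\<^esub> b)) C g h) \<longlongrightarrow> T \<phi> (\<sigma> h q) (\<sigma> h q) g) (finite_subsets_at_top (carrier L))"
proof -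
  define \<theta> where "\<theta> b a = \<phi> (inv\<^bsub>L\<^esub> a \<otimes>\<^bsub>L\<^esub> b)" for b a
  define r where "r = \<sigma> h q"
  have r: "r \<in> N" "star r = r" "r \<cdot> r = r"
    using h q_proj by (simp_all add: r_def flip: G.act_star G.act_mul)
  have \<theta>: "pos_kernel (carrier L) \<theta>" "\<And>b. b \<in> carrier L \<Longrightarrow> \<theta> b b = 1"
    using \<phi>(1) unfolding positive_definite_iff \<theta>_def by (simp_all add: \<phi>(2))
  have \<phi>1: "\<And>l. l \<in> carrier L \<Longrightarrow> cmod (\<phi> l) \<le> 1"
    using positive_definite_norm_le[OF L.is_group \<phi>] .
  note Pg = partition_q[OF g]
  have P1: "G.partition (carrier L) (\<lambda>l. \<tau> l q)" by (rule fund_q)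
  let ?cg = "\<lambda>C. G.cut (\<lambda>l. \<tau> l (\<sigma> g q)) C q" and ?ch = "\<lambda>C. G.cut (\<lambda>l. \<tau> l q) C r"
  let ?inv = "\<lambda>C. (\<lambda>a. inv\<^bsub>L\<^esub> a) ` C"
  \<comment> \<open>For fixed a the sum over b does converge absolutely. The substitution l =
    \<open>inv a \<otimes> b\<close> turns it into a weighted sum along the partition of g, whose
    second argument is cut by a translate of q.\<close>
  have column: "((\<lambda>b. \<theta> b a * ip (vec g b) (vec h a)) has_sum T \<phi> r (r \<cdot> \<tau> (inv\<^bsub>L\<^esub> a) q) g) (carrier L)"
    if a: "a \<in> carrier L" for a
  proof -
    define s where "s = \<tau> (inv\<^bsub>L\<^esub> a) q"
    have s: "s \<in> N" "star s = s" "s \<cdot> s = s"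
      using a q_proj by (simp_all add: s_def flip: L.act_star L.act_mul)
    have bij: "bij_betw (\<lambda>l. inv\<^bsub>L\<^esub> a \<otimes>\<^bsub>L\<^esub> l) (carrier L) (carrier L)"
      by (rule bij_betwI[where g = "\<lambda>l. a \<otimes>\<^bsub>L\<^esub> l"]) (use a in \<open>auto simp: L.m_assoc[symmetric]\<close>)
    have rs: "r \<cdot> s \<in> N" using r s by simp
    have "((\<lambda>l. \<phi> l * ip (r \<cdot> \<tau> l (\<sigma> g q)) (r \<cdot> s)) has_sum T \<phi> r (r \<cdot> s) g) (carrier L)"
      unfolding T_def by (rule G.wip_has_sum[OF Pg r(1) rs \<phi>1])
    then have "((\<lambda>b. \<phi> (inv\<^bsub>L\<^esub> a \<otimes>\<^bsub>L\<^esub> b) * ip (r \<cdot> \<tau> (inv\<^bsub>L\<^esub> a \<otimes>\<^bsub>L\<^esub> b) (\<sigma> g q)) (r \<cdot> s)) has_sum T \<phi> r (r \<cdot> s) g) (carrier L)"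
      using has_sum_reindex_bij_betw[OF bij, of "\<lambda>l. \<phi> l * ip (r \<cdot> \<tau> l (\<sigma> g q)) (r \<cdot> s)"] by simp
    moreover have "\<phi> (inv\<^bsub>L\<^esub> a \<otimes>\<^bsub>L\<^esub> b) * ip (r \<cdot> \<tau> (inv\<^bsub>L\<^esub> a \<otimes>\<^bsub>L\<^esub> b) (\<sigma> g q)) (r \<cdot> s) = \<theta> b a * ip (vec g b) (vec h a)"
      if b: "b \<in> carrier L" for b
    proof -
      define f where "f = \<tau> (inv\<^bsub>L\<^esub> a \<otimes>\<^bsub>L\<^esub> b) (\<sigma> g q)"
      have f: "f \<in> N" "f = \<tau> (inv\<^bsub>L\<^esub> a) (\<tau> b (\<sigma> g q))" using a b g q_N by (simp_all add: f_def L.act_comp)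
      have "ip (vec g b) (vec h a) = ip (\<tau> (inv\<^bsub>L\<^esub> a) (vec g b)) (\<tau> (inv\<^bsub>L\<^esub> a) (vec h a))"
        using a b g h by (simp add: L.act_ip)
      also have "\<tau> (inv\<^bsub>L\<^esub> a) (vec g b) = f \<cdot> s"
        using a b g q_N by (simp add: vec_def f(2) s_def L.act_mul)
      also have "\<tau> (inv\<^bsub>L\<^esub> a) (vec h a) = r \<cdot> s"
        using a h q_N by (simp add: vec_def s_def r_def L.act_mul L.act_inv)
      also have "ip (f \<cdot> s) (r \<cdot> s) = ip f (r \<cdot> s)"
        using G.ip_mul_right[of f s "r \<cdot> s"] f(1) r s by (simp add: G.mul_assoc)
      also have "\<dots> = ip (r \<cdot> f) (r \<cdot> s)"
      proof -
        have "ip (r \<cdot> f) (r \<cdot> s) = ip f (r \<cdot> (r \<cdot> s))" using G.ip_mul_left[of r f "r \<cdot> s"] f(1) r s by simp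
        also have "r \<cdot> (r \<cdot> s) = r \<cdot> s" using r s by (simp flip: G.mul_assoc)
        finally show ?thesis by simp
      qed
      finally show ?thesis by (simp add: \<theta>_def f_def)
    qed
    ultimately show ?thesis unfolding s_def[symmetric] by (simp cong: has_sum_cong)
  qed
  have invC: "finite (?inv C)" "?inv C \<subseteq> carrier L" if "finite C" "C \<subseteq> carrier L" for C
    using that by auto
  \<comment> \<open>Completing the sums over b costs the first term, by the estimate of rectangular
    blocks. Completing the sum over a costs the second, by cutting \<open>r\<close> along translates
    of \<open>q\<close>; their indices are inverted by the substitution in
    \<open>column\<close>.\<close>
  have est: "cmod (trunc \<theta> C g h - T \<phi> r r g) \<le> G.nrm (?cg C) * G.nrm q + G.nrm r * G.nrm (?ch (?inv C))"
    if C: "finite C" "C \<subseteq> carrier L" for C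
  proof -
    have inj: "inj_on (\<lambda>a. inv\<^bsub>L\<^esub> a) C" using C L.inv_inj by (meson inj_on_subset)
    define Z where "Z = (\<Sum>a\<in>C. T \<phi> r (r \<cdot> \<tau> (inv\<^bsub>L\<^esub> a) q) g)"
    note cN = G.cut(1)[OF Pg q_N C] G.cut(1)[OF P1 r(1) invC[OF C]]
    have "T \<phi> r (?ch (?inv C)) g = T \<phi> r r g - (\<Sum>a\<in>?inv C. T \<phi> r (r \<cdot> \<tau> a q) g)"
      unfolding T_def by (rule G.wip_cut_right[OF Pg P1 r(1) r(1) _ invC[OF C]]) (rule \<phi>1)
    also have "(\<Sum>a\<in>?inv C. T \<phi> r (r \<cdot> \<tau> a q) g) = Z" unfolding Z_def by (simp add: sum.reindex[OF inj])
    finally have "Z - T \<phi> r r g = - T \<phi> r (?ch (?inv C)) g" by simp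
    moreover have "cmod (T \<phi> r (?ch (?inv C)) g) \<le> \<bar>1\<bar> * G.nrm r * G.nrm (?ch (?inv C))"
      by (rule T_bound[OF g r(1) cN(2)]) (rule \<phi>1)
    ultimately have 1: "cmod (Z - T \<phi> r r g) \<le> G.nrm r * G.nrm (?ch (?inv C))" by simp
    have lim: "((\<lambda>D. (\<Sum>b\<in>D. \<Sum>a\<in>C. \<theta> b a * ip (vec g b) (vec h a))) \<longlongrightarrow> Z) (finite_subsets_at_top (carrier L))"
      unfolding Z_def has_sum_def[symmetric] using column C by (intro has_sum_finite_sum) auto
    have ev: "\<forall>\<^sub>F D in finite_subsets_at_top (carrier L).
        norm ((\<Sum>b\<in>D. \<Sum>a\<in>C. \<theta> b a * ip (vec g b) (vec h a)) - trunc \<theta> C g h) \<le> G.nrm (?cg C) * G.nrm q"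
      unfolding eventually_finite_subsets_at_top
    proof (intro exI[of _ C] conjI allI impI C)
      fix D assume D: "finite D \<and> C \<subseteq> D \<and> D \<subseteq> carrier L"
      have DC: "finite (D - C)" "D - C \<subseteq> carrier L" using D by auto
      have sq: "(\<Sum>b\<in>E. (G.nrm (q \<cdot> \<tau> b (\<sigma> k q)))\<^sup>2) \<le> (G.nrm q)\<^sup>2" if "finite E" "E \<subseteq> carrier L" "k \<in> carrier G" for E k
        using G.nrm_cut[OF partition_q[OF that(3)] q_N that(1,2)]
          zero_le_power2[of "G.nrm (G.cut (\<lambda>l. \<tau> l (\<sigma> k q)) E q)"] by linarith
      have e1: "(\<Sum>b\<in>D. \<Sum>a\<in>C. \<theta> b a * ip (vec g b) (vec h a)) - trunc \<theta> C g h =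
          (\<Sum>b\<in>D - C. \<Sum>a\<in>C. \<theta> b a * ip (vec g b) (vec h a))"
        unfolding trunc_def using D by (simp add: sum_diff)
      have e2: "(cmod (\<Sum>b\<in>D - C. \<Sum>a\<in>C. \<theta> b a * ip (vec g b) (vec h a)))\<^sup>2 \<le> (G.nrm (?cg C) * G.nrm q)\<^sup>2"
      proof -
        have "(\<Sum>b\<in>D - C. (G.nrm (q \<cdot> \<tau> b (\<sigma> g q)))\<^sup>2) =
            (\<Sum>b\<in>D. (G.nrm (q \<cdot> \<tau> b (\<sigma> g q)))\<^sup>2) - (\<Sum>b\<in>C. (G.nrm (q \<cdot> \<tau> b (\<sigma> g q)))\<^sup>2)"
          using D by (simp add: sum_diff)
        also have "\<dots> \<le> (G.nrm (?cg C))\<^sup>2"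
          using sq[of D g] D g G.nrm_cut[OF Pg q_N C] by simp
        finally have a: "(\<Sum>b\<in>D - C. (G.nrm (q \<cdot> \<tau> b (\<sigma> g q)))\<^sup>2) \<le> (G.nrm (?cg C))\<^sup>2" .
        have "(cmod (\<Sum>b\<in>D - C. \<Sum>a\<in>C. \<theta> b a * ip (vec g b) (vec h a)))\<^sup>2 \<le>
            (\<Sum>b\<in>D - C. (G.nrm (q \<cdot> \<tau> b (\<sigma> g q)))\<^sup>2) * (\<Sum>a\<in>C. (G.nrm (q \<cdot> \<tau> a (\<sigma> h q)))\<^sup>2)"
          by (rule trunc_offdiag_le[OF \<theta> g h DC C])
        also have "\<dots> \<le> (G.nrm (?cg C))\<^sup>2 * (G.nrm q)\<^sup>2"
          by (intro mult_mono a sq C h zero_le_power2 sum_nonneg)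
        finally show ?thesis by (simp add: power_mult_distrib)
      qed
      show "norm ((\<Sum>b\<in>D. \<Sum>a\<in>C. \<theta> b a * ip (vec g b) (vec h a)) - trunc \<theta> C g h) \<le> G.nrm (?cg C) * G.nrm q"
        unfolding e1 by (rule power2_le_imp_le[OF e2]) (use cN q_N in simp)
    qed
    have "norm (Z - trunc \<theta> C g h) \<le> G.nrm (?cg C) * G.nrm q"
      by (rule tendsto_upperbound[OF tendsto_norm[OF tendsto_diff[OF lim tendsto_const]] ev]) simp
    then show ?thesis
      using 1 norm_triangle_ineq[of "trunc \<theta> C g h - Z" "Z - T \<phi> r r g"] by (simp add: norm_minus_commute)
  qed
  show ?thesis
    unfolding \<theta>_def[symmetric] r_def[symmetric]
  proof (rule tendstoI)
    fix \<epsilon> :: real assume \<epsilon>: "\<epsilon> > 0"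
    define \<delta> where "\<delta> = \<epsilon> / (G.nrm q + G.nrm r + 1)"
    have den: "0 < G.nrm q + G.nrm r + 1" using q_N r(1) by (intro add_nonneg_pos add_nonneg_nonneg) auto
    have \<delta>: "\<delta> > 0" using \<epsilon> den by (simp add: \<delta>_def)
    have \<delta>': "\<delta> * (G.nrm q + G.nrm r + 1) = \<epsilon>" using den by (simp add: \<delta>_def)
    obtain F1 where F1: "finite F1" "F1 \<subseteq> carrier L" "\<And>F. finite F \<Longrightarrow> F1 \<subseteq> F \<Longrightarrow> F \<subseteq> carrier L \<Longrightarrow> G.nrm (?cg F) < \<delta>"
      using G.nrm_cut_small[OF Pg q_N \<delta>] by blast
    obtain F2 where F2: "finite F2" "F2 \<subseteq> carrier L" "\<And>F. finite F \<Longrightarrow> F2 \<subseteq> F \<Longrightarrow> F \<subseteq> carrier L \<Longrightarrow> G.nrm (?ch F) < \<delta>"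
      using G.nrm_cut_small[OF P1 r(1) \<delta>] by blast
    show "\<forall>\<^sub>F C in finite_subsets_at_top (carrier L). dist (trunc \<theta> C g h) (T \<phi> r r g) < \<epsilon>"
      unfolding eventually_finite_subsets_at_top
    proof (intro exI[of _ "F1 \<union> ?inv F2"] conjI allI impI)
      fix C assume C: "finite C \<and> F1 \<union> ?inv F2 \<subseteq> C \<and> C \<subseteq> carrier L"
      have "F2 \<subseteq> ?inv C"
      proof
        fix t assume t: "t \<in> F2"
        then have "inv\<^bsub>L\<^esub> t \<in> C" "t = inv\<^bsub>L\<^esub> (inv\<^bsub>L\<^esub> t)" using C F2(2) by auto
        then show "t \<in> ?inv C" by blast
      qed
      then have 2: "G.nrm (?ch (?inv C)) < \<delta>" using F2(3) C invC by simp
      have 1: "G.nrm (?cg C) < \<delta>" using F1(3) C by simp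
      have "dist (trunc \<theta> C g h) (T \<phi> r r g) \<le> G.nrm (?cg C) * G.nrm q + G.nrm r * G.nrm (?ch (?inv C))"
        unfolding dist_norm using est C by simp
      also have "\<dots> \<le> \<delta> * G.nrm q + G.nrm r * \<delta>"
        using 1 2 q_N r(1) by (intro add_mono mult_right_mono mult_left_mono) auto
      also have "\<dots> < \<epsilon>" using \<delta> \<delta>' by (simp add: algebra_simps)
      finally show "dist (trunc \<theta> C g h) (T \<phi> r r g) < \<epsilon>" .
    qed (use F1 F2 in auto)
  qed
qed

text \<open>The normalisation preserves the value at the unit, see
  \<open>induced_one\<close>.\<close>

definition induced :: "('b \<Rightarrow> complex) \<Rightarrow> 'a \<Rightarrow> complex" where
  "induced \<phi> g = T \<phi> q q g / ip q q"

lemma induced_kernel: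
  assumes g: "g \<in> carrier G" and h: "h \<in> carrier G"
  shows "T \<phi> (\<sigma> h q) (\<sigma> h q) g = ip q q * induced \<phi> (inv\<^bsub>G\<^esub> h \<otimes>\<^bsub>G\<^esub> g)"
proof -
  have "h \<otimes>\<^bsub>G\<^esub> (inv\<^bsub>G\<^esub> h \<otimes>\<^bsub>G\<^esub> g) = g" using g h by (simp add: G.m_assoc[symmetric])
  then show ?thesis
    using T_translate_G[OF h _ q_N q_N, of "inv\<^bsub>G\<^esub> h \<otimes>\<^bsub>G\<^esub> g" \<phi>] g h q_nonzero by (simp add: induced_def)
qed

lemma ip_q: "ip q q = of_real ((G.nrm q)\<^sup>2)" "(G.nrm q)\<^sup>2 > 0"
  using G.ip_self[OF q_N] q_nonzero by auto

lemma induced_positive_definite: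
  assumes \<phi>: "positive_definite L \<phi>" "\<phi> \<one>\<^bsub>L\<^esub> = 1"
  shows "positive_definite G (induced \<phi>)"
proof -
  let ?\<theta> = "\<lambda>b a. \<phi> (inv\<^bsub>L\<^esub> a \<otimes>\<^bsub>L\<^esub> b)"
  have \<theta>: "pos_kernel (carrier L) ?\<theta>" using \<phi>(1) by (simp add: positive_definite_iff)
  have 1: "pos_kernel (carrier G) (\<lambda>g h. T \<phi> (\<sigma> h q) (\<sigma> h q) g)"
  proof (rule pos_kernel_limit)
    show "\<forall>\<^sub>F C in finite_subsets_at_top (carrier L). pos_kernel (carrier G) (trunc ?\<theta> C)"
      by (rule eventually_finite_subsets_at_top_weakI) (rule pos_kernel_trunc[OF \<theta>])
    show "((\<lambda>C. trunc ?\<theta> C g h) \<longlongrightarrow> T \<phi> (\<sigma> h q) (\<sigma> h q) g) (finite_subsets_at_top (carrier L))"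
      if "g \<in> carrier G" "h \<in> carrier G" for g h
      by (rule trunc_tendsto[OF \<phi> that])
  qed simp
  have "pos_kernel (carrier G) (\<lambda>g h. of_real (1 / (G.nrm q)\<^sup>2) * T \<phi> (\<sigma> h q) (\<sigma> h q) g)"
    by (rule pos_kernel_scale[OF 1]) simp
  then show ?thesis
    unfolding positive_definite_iff
    by (rule pos_kernel_cong) (use ip_q in \<open>simp add: induced_kernel\<close>)
qed

text \<open>At the unit of G the partition consists of the translates of q itself. Those by other
  elements of L are orthogonal to q, so one term remains.\<close>

lemma induced_one: "induced \<phi> \<one>\<^bsub>G\<^esub> = \<phi> \<one>\<^bsub>L\<^esub>"
proof -
  have "T \<phi> q q \<one>\<^bsub>G\<^esub> = G.wip (carrier L) (\<lambda>l. \<tau> l (\<sigma> \<one>\<^bsub>G\<^esub> q)) \<phi> (q \<cdot> \<tau> \<one>\<^bsub>L\<^esub> (\<sigma> \<one>\<^bsub>G\<^esub> q)) q"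
    using q_proj by (simp add: T_def G.act_one L.act_one)
  also have "\<dots> = \<phi> \<one>\<^bsub>L\<^esub> * ip (q \<cdot> \<tau> \<one>\<^bsub>L\<^esub> (\<sigma> \<one>\<^bsub>G\<^esub> q)) q"
    by (rule G.wip_point[OF partition_q[OF G.one_closed] q_N q_N L.one_closed])
  also have "\<dots> = \<phi> \<one>\<^bsub>L\<^esub> * ip q q" using q_proj by (simp add: G.act_one L.act_one)
  finally show ?thesis using q_nonzero by (simp add: induced_def)
qed

lemma induced_tendsto:
  assumes \<phi>: "\<And>n. positive_definite L (\<phi> n)" "\<And>n. \<phi> n \<one>\<^bsub>L\<^esub> = 1"
    and lim: "\<And>l. l \<in> carrier L \<Longrightarrow> (\<lambda>n. \<phi> n l) \<longlonglongrightarrow> 1" and g: "g \<in> carrier G"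
  shows "(\<lambda>n. induced (\<phi> n) g) \<longlonglongrightarrow> 1"
proof -
  have "(\<lambda>n. T (\<phi> n) q q g) \<longlonglongrightarrow> T (\<lambda>_. 1) q q g"
    unfolding T_def
  proof (rule G.wip_tendsto[OF partition_q[OF g] q_N q_N, where C = 1])
    show "cmod (\<phi> n l) \<le> 1" if "l \<in> carrier L" for n l
      by (rule positive_definite_norm_le[OF L.is_group \<phi> that])
  qed (use lim in auto)
  also have "T (\<lambda>_. 1) q q g = ip q q" unfolding T_def by (rule G.wip_one[OF partition_q[OF g] q_N q_N])
  finally show ?thesis
    unfolding induced_def using q_nonzero tendsto_divide[OF _ tendsto_const[of "ip q q"]] by fastforce
qed

text \<open>The action of \<open>G\<close> on \<open>N\<close> is mixing because it has a fundamental domain.\<close>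

lemma mixing:
  assumes b: "b \<in> N" and \<epsilon>: "\<epsilon> > 0"
  shows "finite {g \<in> carrier G. \<epsilon> \<le> cmod (ip (\<sigma> g b) q)}"
proof -
  define \<delta> where "\<delta> = \<epsilon> / (2 * (G.nrm q + 1))"
  have q0: "0 \<le> G.nrm q" using q_N by simp
  have \<delta>: "\<delta> > 0" "\<delta> * G.nrm q < \<epsilon> / 2 + \<epsilon> / 4" using \<epsilon> q0 by (simp_all add: \<delta>_def field_simps add_pos_nonneg)
  note P = fund_p
  obtain F where F: "finite F" "F \<subseteq> carrier G" "G.nrm (G.cut (\<lambda>g. \<sigma> g p) F b) < \<delta>"
    using G.nrm_cut_small[OF P b \<delta>(1)] by (metis order_refl)
  define c where "c = G.cut (\<lambda>g. \<sigma> g p) F b"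
  have c: "c \<in> N" using G.cut(1)[OF P b F(1,2)] by (simp add: c_def)
  \<comment> \<open>The pieces indexed by F will contribute at most \<epsilon>/4 together, and the
    remainder \<open>c\<close> less than 3\<epsilon>/4.\<close>
  define \<eta> where "\<eta> = \<epsilon> / (4 * (real (card F) * (G.nrm b + 1) + 1))"
  have b0: "0 \<le> G.nrm b" using b by simp
  have den: "0 < real (card F) * (G.nrm b + 1) + 1" using b0 by (intro add_nonneg_pos mult_nonneg_nonneg) auto
  have \<eta>: "\<eta> > 0" using \<epsilon> den by (simp add: \<eta>_def)
  define X where "X = {t \<in> carrier G. \<eta> \<le> G.nrm (q \<cdot> \<sigma> t p)}"
  have "finite X" unfolding X_def by (rule G.partition_superlevel_finite[OF P q_N \<eta>])
  \<comment> \<open>If no product of g with an element of F lies in X, then all pieces of b indexed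
    by F are almost orthogonal to q moved back by g. So every exceptional g is an element of X times
    the inverse of an element of F.\<close>
  then have fin: "finite ((\<lambda>(t, s). t \<otimes>\<^bsub>G\<^esub> inv\<^bsub>G\<^esub> s) ` (X \<times> F))" using F(1) by simp
  have "g \<in> (\<lambda>(t, s). t \<otimes>\<^bsub>G\<^esub> inv\<^bsub>G\<^esub> s) ` (X \<times> F)"
    if g: "g \<in> carrier G" and ge: "\<epsilon> \<le> cmod (ip (\<sigma> g b) q)" for g
  proof (rule ccontr)
    assume no: "g \<notin> (\<lambda>(t, s). t \<otimes>\<^bsub>G\<^esub> inv\<^bsub>G\<^esub> s) ` (X \<times> F)"
    define y where "y = \<sigma> (inv\<^bsub>G\<^esub> g) q"
    have y: "y \<in> N" "G.nrm y = G.nrm q" using g q_N by (simp_all add: y_def G.nrm_act)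
    have eq: "ip (\<sigma> g b) q = ip b y"
      using G.act_ip[of g b y] g b y q_N by (simp add: y_def G.act_inv)
    have small: "cmod (ip (b \<cdot> \<sigma> s p) y) \<le> (G.nrm b + 1) * \<eta>" if s: "s \<in> F" for s
    proof -
      have sG: "s \<in> carrier G" using s F(2) by auto
      have gs: "g \<otimes>\<^bsub>G\<^esub> s \<notin> X"
      proof
        assume "g \<otimes>\<^bsub>G\<^esub> s \<in> X"
        moreover have "g = (g \<otimes>\<^bsub>G\<^esub> s) \<otimes>\<^bsub>G\<^esub> inv\<^bsub>G\<^esub> s" using g sG by (simp add: G.m_assoc)
        ultimately show False using no s by force
      qed
      have "G.nrm (y \<cdot> \<sigma> s p) = G.nrm (\<sigma> g (y \<cdot> \<sigma> s p))" using g sG y p_N by (simp add: G.nrm_act)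
      also have "\<sigma> g (y \<cdot> \<sigma> s p) = q \<cdot> \<sigma> (g \<otimes>\<^bsub>G\<^esub> s) p"
        using g sG y(1) p_N q_N by (simp add: G.act_mul G.act_comp) (simp add: y_def G.act_inv)
      finally have 1: "G.nrm (y \<cdot> \<sigma> s p) < \<eta>" using gs g sG by (simp add: X_def)
      have N: "b \<cdot> \<sigma> s p \<in> N" "y \<cdot> \<sigma> s p \<in> N" using sG b y p_N by auto
      have "ip (b \<cdot> \<sigma> s p) y = ip b (y \<cdot> \<sigma> s p)" by (rule G.partition_ip(1)[OF P sG b y(1)])
      then have "cmod (ip (b \<cdot> \<sigma> s p) y) \<le> G.nrm b * G.nrm (y \<cdot> \<sigma> s p)" using G.ip_CS[OF b N(2)] by simp
      also have "\<dots> \<le> (G.nrm b + 1) * \<eta>" using 1 b0 N by (intro mult_mono) auto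
      finally show ?thesis .
    qed
    have "ip b y = ip c y + (\<Sum>s\<in>F. ip (b \<cdot> \<sigma> s p) y)"
      using G.cut(2)[OF P b F(1,2) y(1)] by (simp add: c_def)
    then have "cmod (ip b y) \<le> cmod (ip c y) + (\<Sum>s\<in>F. cmod (ip (b \<cdot> \<sigma> s p) y))"
      using norm_triangle_ineq[of "ip c y" "\<Sum>s\<in>F. ip (b \<cdot> \<sigma> s p) y"] norm_sum[of "\<lambda>s. ip (b \<cdot> \<sigma> s p) y" F] by simp
    also have "\<dots> \<le> \<delta> * G.nrm q + (\<Sum>s\<in>F. (G.nrm b + 1) * \<eta>)"
    proof (intro add_mono sum_mono small)
      have "cmod (ip c y) \<le> G.nrm c * G.nrm y" by (rule G.ip_CS[OF c y(1)])
      also have "\<dots> \<le> \<delta> * G.nrm q" using F(3) c q0 \<delta>(1) by (intro mult_mono) (auto simp: c_def y(2))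
      finally show "cmod (ip c y) \<le> \<delta> * G.nrm q" .
    qed
    also have "(\<Sum>s\<in>F. (G.nrm b + 1) * \<eta>) \<le> \<epsilon> / 4"
    proof -
      have "(\<Sum>s\<in>F. (G.nrm b + 1) * \<eta>) \<le> (real (card F) * (G.nrm b + 1) + 1) * \<eta>"
        using \<eta> by (simp add: algebra_simps)
      also have "\<dots> = \<epsilon> / 4"
      proof -
        have "x * (\<epsilon> / (4 * x)) = \<epsilon> / 4" if "0 < x" for x using that by simp
        from this[OF den] show ?thesis by (simp only: \<eta>_def)
      qed
      finally show ?thesis .
    qed
    finally show False using ge eq \<delta>(2) by simp
  qed
  then show ?thesis by (intro finite_subset[OF _ fin] subsetI) (elim CollectE conjE)
qed

text \<open>The weight is split at the level \<epsilon>/2. The lower part contributes at most half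
  of the threshold. The upper part has finite support, and each of its terms contains a coefficient
  of the mixing action of G.\<close>

lemma induced_vanishes:
  assumes \<phi>: "positive_definite L \<phi>" "\<phi> \<one>\<^bsub>L\<^esub> = 1" and van: "vanishes_at_infinity L \<phi>"
  shows "vanishes_at_infinity G (induced \<phi>)"
  unfolding vanishes_at_infinity_def
proof (intro allI impI)
  fix \<epsilon> :: real assume \<epsilon>: "\<epsilon> > 0"
  define c where "c = (G.nrm q)\<^sup>2"
  have c: "c > 0" "cmod (ip q q) = c" using ip_q by (simp_all add: c_def norm_power)
  have \<phi>1: "\<And>l. l \<in> carrier L \<Longrightarrow> cmod (\<phi> l) \<le> 1"
    using positive_definite_norm_le[OF L.is_group \<phi>] .
  define A where "A = {l \<in> carrier L. \<epsilon> / 2 \<le> cmod (\<phi> l)}"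
  have A: "finite A" "A \<subseteq> carrier L"
    unfolding A_def by (rule van[unfolded vanishes_at_infinity_def, rule_format]) (use \<epsilon> in auto)
  \<comment> \<open>Leaves to the terms from A together at most a quarter of the threshold
    \<open>\<epsilon> * c\<close>.\<close>
  define \<eta> where "\<eta> = \<epsilon> * c / (4 * (real (card A) + 1))"
  have \<eta>: "\<eta> > 0" using \<epsilon> c by (simp add: \<eta>_def add_nonneg_pos)
  define X where "X = (\<Union>l\<in>A. {g \<in> carrier G. \<eta> \<le> cmod (ip (\<sigma> g (\<tau> l q)) q)})"
  have fin: "finite X" unfolding X_def using A q_N by (intro finite_UN_I mixing \<eta>) auto
  have "g \<in> X" if g: "g \<in> carrier G" and ge: "\<epsilon> \<le> cmod (induced \<phi> g)" for g
  proof (rule ccontr)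
    assume no: "g \<notin> X"
    note P = partition_q[OF g]
    let ?a = "\<lambda>l. if l \<in> A then \<phi> l else 0" and ?b = "\<lambda>l. if l \<in> A then 0 else \<phi> l"
    have b: "cmod (?b l) \<le> \<epsilon> / 2" if "l \<in> carrier L" for l using that \<epsilon> by (auto simp: A_def)
    have a: "cmod (?a l) \<le> 1" if "l \<in> carrier L" for l using that \<phi>1 by auto
    have "T \<phi> q q g = T (\<lambda>l. ?a l + ?b l) q q g" unfolding T_def by (rule G.wip_cong) simp
    also have "\<dots> = T ?a q q g + T ?b q q g" unfolding T_def by (rule G.wip_add[OF P q_N q_N a b])
    finally have "cmod (T \<phi> q q g) \<le> cmod (T ?a q q g) + cmod (T ?b q q g)" by (simp add: norm_triangle_ineq)
    moreover have "cmod (T ?b q q g) \<le> \<epsilon> / 2 * c"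
      using T_bound[OF g q_N q_N b] \<epsilon> by (simp add: c_def power2_eq_square mult.assoc)
    moreover have "cmod (T ?a q q g) \<le> real (card A) * \<eta>"
    proof -
      have "T ?a q q g = (\<Sum>l\<in>A. \<phi> l * ip (q \<cdot> \<tau> l (\<sigma> g q)) q)"
        unfolding T_def by (rule G.wip_indicator[OF P q_N q_N A])
      also have "cmod \<dots> \<le> (\<Sum>l\<in>A. \<eta>)"
      proof (rule sum_norm_le)
        fix l assume l: "l \<in> A"
        then have lL: "l \<in> carrier L" using A by auto
        have "ip (q \<cdot> \<tau> l (\<sigma> g q)) q = ip (\<sigma> g (\<tau> l q)) q"
          using G.ip_mul_left[of q "\<tau> l (\<sigma> g q)" q] lL g q_proj act_commute by simp
        moreover have "cmod (ip (\<sigma> g (\<tau> l q)) q) < \<eta>" using no l g by (auto simp: X_def)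
        ultimately have "cmod (\<phi> l) * cmod (ip (q \<cdot> \<tau> l (\<sigma> g q)) q) \<le> 1 * \<eta>"
          using \<phi>1[OF lL] by (intro mult_mono) auto
        then show "cmod (\<phi> l * ip (q \<cdot> \<tau> l (\<sigma> g q)) q) \<le> \<eta>" by (simp add: norm_mult)
      qed
      finally show ?thesis by simp
    qed
    moreover have "real (card A) * \<eta> < \<epsilon> / 2 * c"
    proof -
      have "real (card A) * \<eta> \<le> (real (card A) + 1) * \<eta>" using \<eta> by simp
      also have "\<dots> = \<epsilon> * c / 4"
      proof -
        have "x * (\<epsilon> * c / (4 * x)) = \<epsilon> * c / 4" if "0 < x" for x using that by simp
        from this[of "real (card A) + 1"] show ?thesis by (simp only: \<eta>_def)
      qed
      also have "\<dots> < \<epsilon> / 2 * c" using \<epsilon> c by simp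
      finally show ?thesis .
    qed
    ultimately have "cmod (T \<phi> q q g) < \<epsilon> * c" by simp
    then have "cmod (induced \<phi> g) < \<epsilon>" using c by (simp add: induced_def norm_divide field_simps)
    then show False using ge by simp
  qed
  then show "finite {g \<in> carrier G. \<epsilon> \<le> cmod (induced \<phi> g)}"
    by (intro finite_subset[OF _ fin] subsetI) (elim CollectE conjE)
qed

lemma haagerup_transfer:
  assumes "haagerup_property L"
  shows "haagerup_property G"
proof -
  obtain \<phi> where \<phi>: "\<And>n. positive_definite L (\<phi> n)" "\<And>n. \<phi> n \<one>\<^bsub>L\<^esub> = 1" "\<And>n. vanishes_at_infinity L (\<phi> n)"
    "\<And>l. l \<in> carrier L \<Longrightarrow> (\<lambda>n :: nat. \<phi> n l) \<longlonglongrightarrow> 1"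
    using assms unfolding haagerup_property_def by blast
  show ?thesis
    unfolding haagerup_property_def
    by (intro exI[of _ "\<lambda>n. induced (\<phi> n)"] conjI allI ballI)
      (simp_all add: induced_positive_definite induced_one induced_vanishes induced_tendsto \<phi>)
qed

end

section \<open>Hilbert spaces\<close>

text \<open>With respect to k, every finite combination of elements of X is represented by a single
  element v of X, so the quadratic form of the combination is the value of k at (v, v).\<close>

lemma pos_kernelI_combination:
  assumes herm: "\<And>x y. x \<in> X \<Longrightarrow> y \<in> X \<Longrightarrow> k y x = cnj (k x y)"
    and nonneg: "\<And>x. x \<in> X \<Longrightarrow> 0 \<le> Re (k x x)"
    and comb: "\<And>x y c. x \<in> X \<Longrightarrow> y \<in> X \<Longrightarrow> \<exists>z\<in>X. \<forall>w\<in>X. k z w = k x w + c * k y w"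
  shows "pos_kernel X k"
  unfolding pos_kernel_def
proof (intro allI impI)
  fix S c assume S: "finite S" "S \<subseteq> X"
  show "Im (sesq k S c c) = 0 \<and> 0 \<le> Re (sesq k S c c)"
  proof (cases "S = {}")
    case False
    then obtain x where x: "x \<in> X" using S by auto
    have "\<exists>v\<in>X. \<forall>w\<in>X. k v w = (\<Sum>i\<in>S. c i * k i w)"
      using S
    proof (induction S rule: finite_induct)
      case empty
      then show ?case using comb[OF x x, of "-1"] by simp
    next
      case (insert i S)
      then obtain v where v: "v \<in> X" "\<forall>w\<in>X. k v w = (\<Sum>i\<in>S. c i * k i w)" by auto
      then obtain z where "z \<in> X" "\<forall>w\<in>X. k z w = k v w + c i * k i w"
        using comb[OF v(1), of i "c i"] insert.prems by auto
      then show ?case using v(2) insert.hyps by (intro bexI[of _ z]) (auto simp: add.commute)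
    qed
    then obtain v where v: "v \<in> X" "\<And>w. w \<in> X \<Longrightarrow> k v w = (\<Sum>i\<in>S. c i * k i w)" by auto
    have "sesq k S c c = (\<Sum>j\<in>S. cnj (c j) * (\<Sum>i\<in>S. c i * k i j))"
      unfolding sesq_def by (subst sum.swap) (simp add: sum_distrib_left mult_ac)
    also have "\<dots> = (\<Sum>j\<in>S. cnj (c j * k j v))"
    proof (rule sum.cong[OF refl])
      fix j assume "j \<in> S"
      then have j: "j \<in> X" using S by auto
      have "k v j = cnj (k j v)" by (rule herm[OF j v(1)])
      then show "cnj (c j) * (\<Sum>i\<in>S. c i * k i j) = cnj (c j * k j v)" using v(2)[OF j] by simp
    qed
    also have "\<dots> = cnj (k v v)" using v(2)[OF v(1)] by simp
    finally have e: "sesq k S c c = cnj (k v v)" .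
    have "k v v = cnj (k v v)" by (rule herm[OF v(1) v(1)])
    then have "Im (k v v) = 0" by (simp add: complex_eq_iff)
    then show ?thesis using nonneg[OF v(1)] by (simp add: e)
  qed (simp add: sesq_def)
qed

lemma complex_ring_simps [simp]:
  "carrier complex_ring = UNIV" "x \<otimes>\<^bsub>complex_ring\<^esub> y = x * y" "\<one>\<^bsub>complex_ring\<^esub> = 1"
  "\<zero>\<^bsub>complex_ring\<^esub> = 0" "x \<oplus>\<^bsub>complex_ring\<^esub> y = x + y"
  by (simp_all add: complex_ring_def)

lemma cring_complex_ring: "cring complex_ring"
proof (rule cringI)
  show "abelian_group complex_ring"
  proof (rule abelian_groupI)
    fix x :: complex
    show "\<exists>y\<in>carrier complex_ring. y \<oplus>\<^bsub>complex_ring\<^esub> x = \<zero>\<^bsub>complex_ring\<^esub>"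
      by (intro bexI[of _ "- x"]) auto
  qed auto
  show "comm_monoid complex_ring" by (rule comm_monoidI) auto
qed (auto simp: algebra_simps)

context hilbert_space
begin

lemma hinner_add_right:
  assumes "x \<in> carrier H" "y \<in> carrier H" "z \<in> carrier H"
  shows "hinner H z (x \<oplus> y) = hinner H z x + hinner H z y"
  using hinner_add[OF assms] hinner_commute[of "x \<oplus> y" z] hinner_commute[of x z] hinner_commute[of y z] assms
  by simp

lemma hinner_smult_right:
  assumes "x \<in> carrier H" "y \<in> carrier H"
  shows "hinner H x (a \<odot> y) = cnj a * hinner H x y"
  using hinner_smult[of y x a] hinner_commute[of "a \<odot> y" x] hinner_commute[of y x] assms by simp

lemma hinner_zero [simp]: "y \<in> carrier H \<Longrightarrow> hinner H \<zero> y = 0" "y \<in> carrier H \<Longrightarrow> hinner H y \<zero> = 0"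
proof -
  assume y: "y \<in> carrier H"
  have "hinner H \<zero> y = hinner H (\<zero> \<oplus> \<zero>) y" by simp
  also have "\<dots> = hinner H \<zero> y + hinner H \<zero> y" using y by (simp only: hinner_add M.zero_closed)
  finally show "hinner H \<zero> y = 0" by simp
  then show "hinner H y \<zero> = 0" using hinner_commute[of \<zero> y] y by simp
qed

lemma hinner_neg:
  assumes "x \<in> carrier H" "y \<in> carrier H"
  shows "hinner H (\<ominus> x) y = - hinner H x y" "hinner H y (\<ominus> x) = - hinner H y x"
proof -
  have "hinner H (x \<oplus> \<ominus> x) y = 0" using assms by (simp add: M.r_neg)
  then show 1: "hinner H (\<ominus> x) y = - hinner H x y" using assms by (simp add: hinner_add eq_neg_iff_add_eq_0 add.commute)
  then show "hinner H y (\<ominus> x) = - hinner H y x"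
    using hinner_commute[of "\<ominus> x" y] hinner_commute[of x y] assms by simp
qed

lemma hinner_minus:
  assumes "x \<in> carrier H" "y \<in> carrier H" "z \<in> carrier H"
  shows "hinner H (x \<ominus> y) z = hinner H x z - hinner H y z" "hinner H z (x \<ominus> y) = hinner H z x - hinner H z y"
  using assms by (simp_all add: M.minus_eq hinner_add hinner_add_right hinner_neg)

lemmas hinner_simps = hinner_add hinner_add_right hinner_smult hinner_smult_right hinner_neg hinner_minus

lemma hinner_ext:
  assumes x: "x \<in> carrier H" "y \<in> carrier H" and eq: "\<And>z. z \<in> carrier H \<Longrightarrow> hinner H x z = hinner H y z"
  shows "x = y"
proof -
  have d: "x \<ominus> y \<in> carrier H" using x by simp
  have "hinner H (x \<ominus> y) (x \<ominus> y) = 0" using hinner_minus(1)[OF x d] eq[OF d] by simp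
  then have "x \<ominus> y = \<zero>" by (rule hinner_eq_zero[OF d])
  moreover have "x = (x \<ominus> y) \<oplus> y" using x by (simp add: M.minus_eq M.a_assoc M.l_neg)
  ultimately show ?thesis using x by simp
qed

lemma pos_kernel_hinner: "pos_kernel (carrier H) (hinner H)"
proof (rule pos_kernelI_combination)
  fix x y c assume "x \<in> carrier H" "y \<in> carrier H"
  then show "\<exists>z\<in>carrier H. \<forall>w\<in>carrier H. hinner H z w = hinner H x w + c * hinner H y w"
    by (intro bexI[of _ "x \<oplus> c \<odot> y"]) (auto simp: hinner_simps)
qed (rule hinner_commute hinner_ge_zero; assumption)+

lemma hnorm_nonneg [simp]: "x \<in> carrier H \<Longrightarrow> 0 \<le> hnorm H x"
  using hinner_ge_zero by (simp add: hnorm_def)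

lemma Re_hinner_self: "x \<in> carrier H \<Longrightarrow> Re (hinner H x x) = (hnorm H x)\<^sup>2"
  using hinner_ge_zero by (simp add: hnorm_def)

lemma Im_hinner_self: "x \<in> carrier H \<Longrightarrow> Im (hinner H x x) = 0"
  using pos_kernel_diag(1)[OF pos_kernel_hinner] .

lemma hinner_self: "x \<in> carrier H \<Longrightarrow> hinner H x x = of_real ((hnorm H x)\<^sup>2)"
  using Re_hinner_self Im_hinner_self by (simp add: complex_eq_iff)

lemma hinner_CS:
  assumes "x \<in> carrier H" "y \<in> carrier H"
  shows "cmod (hinner H x y) \<le> hnorm H x * hnorm H y"
proof (rule power2_le_imp_le)
  show "(cmod (hinner H x y))\<^sup>2 \<le> (hnorm H x * hnorm H y)\<^sup>2"
    using pos_kernel_CS_point[OF pos_kernel_hinner assms] assms by (simp add: Re_hinner_self power_mult_distrib)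
qed (use assms in simp)

lemma hnorm_zero_iff: "x \<in> carrier H \<Longrightarrow> hnorm H x = 0 \<longleftrightarrow> x = \<zero>"
  using hinner_self[of x] hinner_eq_zero[of x] by (auto simp: hnorm_def)

lemma hnorm_add_sq:
  assumes "x \<in> carrier H" "y \<in> carrier H"
  shows "(hnorm H (x \<oplus> a \<odot> y))\<^sup>2 = (hnorm H x)\<^sup>2 + 2 * Re (cnj a * hinner H x y) + (cmod a)\<^sup>2 * (hnorm H y)\<^sup>2"
proof -
  have "hinner H (x \<oplus> a \<odot> y) (x \<oplus> a \<odot> y) =
      hinner H x x + a * hinner H y x + cnj a * hinner H x y + a * cnj a * hinner H y y"
    using assms by (simp add: hinner_simps algebra_simps)
  also have "\<dots> = hinner H x x + cnj (cnj a * hinner H x y) + cnj a * hinner H x y + of_real ((cmod a)\<^sup>2) * hinner H y y"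
    using hinner_commute[OF assms] by (simp only: complex_norm_square complex_cnj_mult complex_cnj_cnj)
  finally have "Re (hinner H (x \<oplus> a \<odot> y) (x \<oplus> a \<odot> y)) =
      Re (hinner H x x + cnj (cnj a * hinner H x y) + cnj a * hinner H x y + of_real ((cmod a)\<^sup>2) * hinner H y y)"
    by simp
  then show ?thesis using assms by (simp add: Re_hinner_self[symmetric] del: of_real_power)
qed

lemma hinner_tendsto:
  assumes X: "\<And>n. X n \<in> carrier H" "l \<in> carrier H" "y \<in> carrier H"
    and lim: "((\<lambda>n. hnorm H (X n \<ominus> l)) \<longlongrightarrow> 0) F"
  shows "((\<lambda>n. hinner H (X n) y) \<longlongrightarrow> hinner H l y) F" "((\<lambda>n. hinner H y (X n)) \<longlongrightarrow> hinner H y l) F"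
proof -
  have "((\<lambda>n. hinner H (X n) y - hinner H l y) \<longlongrightarrow> 0) F"
  proof (rule Lim_null_comparison)
    show "\<forall>\<^sub>F n in F. norm (hinner H (X n) y - hinner H l y) \<le> hnorm H (X n \<ominus> l) * hnorm H y"
      using hinner_CS[of "X _ \<ominus> l" y] X by (intro always_eventually allI) (simp add: hinner_minus(1)[symmetric])
    show "((\<lambda>n. hnorm H (X n \<ominus> l) * hnorm H y) \<longlongrightarrow> 0) F"
      using tendsto_mult_right[OF lim, of "hnorm H y"] by simp
  qed
  then show 1: "((\<lambda>n. hinner H (X n) y) \<longlongrightarrow> hinner H l y) F" by (simp add: LIM_zero_iff)
  show "((\<lambda>n. hinner H y (X n)) \<longlongrightarrow> hinner H y l) F"
    using tendsto_cnj[OF 1] X hinner_commute[of _ y] by simp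
qed

text \<open>The representing vector minimises \<open>\<parallel>x\<parallel>\<^sup>2 - 2 Re (f x)\<close>; the parallelogram law makes minimising sequences Cauchy.\<close>

lemma riesz_representation:
  assumes add: "\<And>x y. x \<in> carrier H \<Longrightarrow> y \<in> carrier H \<Longrightarrow> f (x \<oplus> y) = f x + f y"
    and scale: "\<And>a x. x \<in> carrier H \<Longrightarrow> f (a \<odot> x) = a * f x"
    and bound: "\<And>x. x \<in> carrier H \<Longrightarrow> cmod (f x) \<le> C * hnorm H x"
  shows "\<exists>z\<in>carrier H. \<forall>x\<in>carrier H. f x = hinner H x z"
proof -
  define J where "J x = (hnorm H x)\<^sup>2 - 2 * Re (f x)" for x
  define m where "m = Inf (J ` carrier H)"
  have low: "- C\<^sup>2 \<le> J x" if x: "x \<in> carrier H" for x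
  proof -
    have "Re (f x) \<le> C * hnorm H x" using bound[OF x] complex_Re_le_cmod[of "f x"] by simp
    moreover have "0 \<le> (hnorm H x - C)\<^sup>2" by simp
    ultimately show ?thesis by (simp add: J_def power2_diff algebra_simps)
  qed
  have bdd: "bdd_below (J ` carrier H)" using low by (intro bdd_belowI2)
  have m_le: "m \<le> J x" if "x \<in> carrier H" for x unfolding m_def using that by (intro cInf_lower bdd) auto
  have "\<exists>x\<in>carrier H. J x < m + e" if e: "e > 0" for e
  proof -
    have "Inf (J ` carrier H) < m + e" using e by (simp add: m_def)
    then obtain j where "j \<in> J ` carrier H" "j < m + e" using cInf_lessD[of "J ` carrier H" "m + e"] by auto
    then show ?thesis by auto
  qed
  then have "\<forall>n. \<exists>x\<in>carrier H. J x < m + 1 / real (Suc n)" by simp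
  then obtain X where X: "\<And>n. X n \<in> carrier H" "\<And>n. J (X n) < m + 1 / real (Suc n)" by metis
  have par: "(hnorm H (x \<ominus> y))\<^sup>2 \<le> 2 * J x + 2 * J y - 4 * m" if xy: "x \<in> carrier H" "y \<in> carrier H" for x y
  proof -
    define z where "z = (1/2) \<odot> (x \<oplus> y)"
    have z: "z \<in> carrier H" using xy by (simp add: z_def)
    have "4 * (hnorm H z)\<^sup>2 + (hnorm H (x \<ominus> y))\<^sup>2 = 2 * (hnorm H x)\<^sup>2 + 2 * (hnorm H y)\<^sup>2"
      using xy z by (simp add: Re_hinner_self[symmetric]) (simp add: z_def hinner_simps algebra_simps)
    moreover have "f z = (f x + f y) / 2" using xy by (simp add: z_def add scale)
    then have "Re (f z) = (Re (f x) + Re (f y)) / 2" by (simp only: Re_divide_numeral plus_complex.sel)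
    ultimately show ?thesis using m_le[OF z] unfolding J_def by argo
  qed
  have "\<exists>l\<in>carrier H. (\<lambda>n. hnorm H (X n \<ominus> l)) \<longlonglongrightarrow> 0"
  proof (rule complete[OF X(1)])
    fix e :: real assume e: "e > 0"
    obtain N :: nat where N: "4 / e\<^sup>2 < real N" using reals_Archimedean2 by blast
    show "\<exists>N. \<forall>m\<ge>N. \<forall>n\<ge>N. hnorm H (X m \<ominus> X n) < e"
    proof (intro exI[of _ N] allI impI)
      fix i j assume ij: "i \<ge> N" "j \<ge> N"
      have b: "1 / real (Suc i) < e\<^sup>2 / 4" if "i \<ge> N" for i
      proof -
        have "4 / e\<^sup>2 < real (Suc i)" using N that by simp
        then show ?thesis using e by (simp add: field_simps)
      qed
      have "(hnorm H (X i \<ominus> X j))\<^sup>2 \<le> 2 * J (X i) + 2 * J (X j) - 4 * m" by (rule par[OF X(1) X(1)])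
      also have "\<dots> < e\<^sup>2" using X(2)[of i] X(2)[of j] b[OF ij(1)] b[OF ij(2)] by linarith
      finally show "hnorm H (X i \<ominus> X j) < e" using e by (simp add: power2_less_imp_less)
    qed
  qed
  then obtain z where z: "z \<in> carrier H" "(\<lambda>n. hnorm H (X n \<ominus> z)) \<longlonglongrightarrow> 0" by blast
  have "f y = hinner H y z" if y: "y \<in> carrier H" for y
  proof -
    define d where "d = hinner H y z - f y"
    \<comment> \<open>First variation: J is at least m at the perturbed vectors and less than m +
      1/(n+1) at X n; the limit in n removes the gap.\<close>
    have var: "0 \<le> 2 * Re (t * d) + (cmod t)\<^sup>2 * (hnorm H y)\<^sup>2" for t
    proof -
      have "- (1 / real (Suc n)) \<le> 2 * Re (t * (hinner H y (X n) - f y)) + (cmod t)\<^sup>2 * (hnorm H y)\<^sup>2" for n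
      proof -
        have v: "X n \<oplus> t \<odot> y \<in> carrier H" using X(1) y by simp
        have "Re (cnj t * hinner H (X n) y) = Re (t * hinner H y (X n))"
          using hinner_commute[OF y X(1)] by simp
        then have "J (X n \<oplus> t \<odot> y) = J (X n) + 2 * Re (t * (hinner H y (X n) - f y)) + (cmod t)\<^sup>2 * (hnorm H y)\<^sup>2"
          using X(1) y by (simp add: J_def hnorm_add_sq add scale) (simp add: algebra_simps)
        then show ?thesis using m_le[OF v] X(2)[of n] by linarith
      qed
      moreover have "(\<lambda>n. - (1 / real (Suc n))) \<longlonglongrightarrow> - 0"
        using LIMSEQ_inverse_real_of_nat by (intro tendsto_minus) (simp add: inverse_eq_divide)
      moreover have "(\<lambda>n. 2 * Re (t * (hinner H y (X n) - f y)) + (cmod t)\<^sup>2 * (hnorm H y)\<^sup>2) \<longlonglongrightarrow>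
          2 * Re (t * d) + (cmod t)\<^sup>2 * (hnorm H y)\<^sup>2"
        unfolding d_def by (intro tendsto_intros hinner_tendsto(2) X z y)
      ultimately show ?thesis using LIMSEQ_le[of "\<lambda>n. - (1 / real (Suc n))" "- 0"] by simp
    qed
    have "d = 0"
    proof (rule ccontr)
      assume d: "d \<noteq> 0"
      \<comment> \<open>In the direction - \<open>cnj d\<close> the linear term is negative, and
        this step is short enough for the quadratic term not to compensate it.\<close>
      define r where "r = 1 / ((hnorm H y)\<^sup>2 + 1)"
      have "0 < (hnorm H y)\<^sup>2 + 1" by (intro add_nonneg_pos) auto
      then have r: "r > 0" "r * (hnorm H y)\<^sup>2 < 1" by (auto simp: r_def field_simps)
      have "- of_real r * cnj d * d = - of_real (r * (cmod d)\<^sup>2)"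
        using complex_norm_square[of d] by (simp add: mult.commute)
      then have e: "Re (- of_real r * cnj d * d) = - (r * (cmod d)\<^sup>2)" by (simp only: uminus_complex.sel Re_complex_of_real)
      have "0 \<le> - 2 * (r * (cmod d)\<^sup>2) + (r * cmod d)\<^sup>2 * (hnorm H y)\<^sup>2"
        using var[of "- of_real r * cnj d"] r unfolding e by (simp add: norm_mult)
      also have "\<dots> = r * (cmod d)\<^sup>2 * (r * (hnorm H y)\<^sup>2 - 2)" by (simp add: power2_eq_square algebra_simps)
      also have "\<dots> < 0" using r d by (intro mult_pos_neg) auto
      finally show False by simp
    qed
    then show ?thesis by (simp add: d_def)
  qed
  then show ?thesis using z by blast
qed

section \<open>Bounded operators and adjoints\<close>

lemma bounded_opsD:
  assumes "T \<in> bounded_ops H"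
  shows "x \<in> carrier H \<Longrightarrow> T x \<in> carrier H"
    "x \<in> carrier H \<Longrightarrow> y \<in> carrier H \<Longrightarrow> T (x \<oplus> y) = T x \<oplus> T y"
    "x \<in> carrier H \<Longrightarrow> T (a \<odot> x) = a \<odot> T x"
    "\<exists>C\<ge>0. \<forall>x\<in>carrier H. hnorm H (T x) \<le> C * hnorm H x"
proof -
  obtain C where C: "\<forall>x\<in>carrier H. hnorm H (T x) \<le> C * hnorm H x" using assms unfolding bounded_ops_def by blast
  have "\<forall>x\<in>carrier H. hnorm H (T x) \<le> \<bar>C\<bar> * hnorm H x"
  proof
    fix x assume x: "x \<in> carrier H"
    have "C * hnorm H x \<le> \<bar>C\<bar> * hnorm H x" using x by (intro mult_right_mono) auto
    then show "hnorm H (T x) \<le> \<bar>C\<bar> * hnorm H x" using C x by force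
  qed
  then show "\<exists>C\<ge>0. \<forall>x\<in>carrier H. hnorm H (T x) \<le> C * hnorm H x" by (intro exI[of _ "\<bar>C\<bar>"]) auto
qed (use assms in \<open>auto simp: bounded_ops_def\<close>)

lemma bounded_ops_ext:
  assumes "S \<in> bounded_ops H" "T \<in> bounded_ops H"
    and "\<And>x y. x \<in> carrier H \<Longrightarrow> y \<in> carrier H \<Longrightarrow> hinner H (S x) y = hinner H (T x) y"
  shows "S = T"
proof (rule extensionalityI[of _ "carrier H"])
  show "S x = T x" if "x \<in> carrier H" for x
    using that assms by (intro hinner_ext) (auto simp: bounded_opsD)
qed (use assms in \<open>auto simp: bounded_ops_def PiE_def\<close>)

text \<open>Polarisation: the quadratic forms at x + a y for a = 1 and a = \<i> separate the two
  mixed terms.\<close>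

lemma bounded_ops_quad_ext:
  assumes S: "S \<in> bounded_ops H" and T: "T \<in> bounded_ops H"
    and eq: "\<And>x. x \<in> carrier H \<Longrightarrow> hinner H (S x) x = hinner H (T x) x"
  shows "S = T"
proof (rule bounded_ops_ext[OF S T])
  fix x y assume xy: "x \<in> carrier H" "y \<in> carrier H"
  have *: "hinner H (A (x \<oplus> a \<odot> y)) (x \<oplus> a \<odot> y) =
      hinner H (A x) x + a * hinner H (A y) x + cnj a * hinner H (A x) y + a * cnj a * hinner H (A y) y"
    if "A \<in> bounded_ops H" for A a
    using xy that by (simp add: bounded_opsD hinner_simps algebra_simps)
  have eq': "a * hinner H (S y) x + cnj a * hinner H (S x) y = a * hinner H (T y) x + cnj a * hinner H (T x) y" for a
    using eq[of "x \<oplus> a \<odot> y"] *[OF S, of a] *[OF T, of a] eq[of x] eq[of y] xy by (simp add: algebra_simps)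
  show "hinner H (S x) y = hinner H (T x) y"
    using eq'[of 1] eq'[of \<i>] by (simp add: complex_eq_iff)
qed

lemma adj_unique:
  assumes "S \<in> bounded_ops H" "\<And>x y. x \<in> carrier H \<Longrightarrow> y \<in> carrier H \<Longrightarrow> hinner H (T x) y = hinner H x (S y)"
  shows "adj H T = S"
  unfolding adj_def
proof (rule the_equality)
  fix S' assume S': "S' \<in> bounded_ops H \<and> (\<forall>x\<in>carrier H. \<forall>y\<in>carrier H. hinner H (T x) y = hinner H x (S' y))"
  show "S' = S"
  proof (rule bounded_ops_ext)
    fix x y assume xy: "x \<in> carrier H" "y \<in> carrier H"
    have "hinner H y (S' x) = hinner H y (S x)" using S' assms(2)[OF xy(2,1)] xy by simp
    then show "hinner H (S' x) y = hinner H (S x) y"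
      using hinner_commute[of y "S' x"] hinner_commute[of y "S x"] xy S' assms(1) by (simp add: bounded_opsD)
  qed (use S' assms in auto)
qed (use assms in auto)

text \<open>For each y the Riesz representation theorem is applied to the functional taking x to the
  inner product of T x with y.\<close>

lemma adj_ex:
  assumes T: "T \<in> bounded_ops H"
  shows "\<exists>S\<in>bounded_ops H. \<forall>x\<in>carrier H. \<forall>y\<in>carrier H. hinner H (T x) y = hinner H x (S y)"
proof -
  note t = bounded_opsD[OF T]
  obtain C where C: "C \<ge> 0" "\<And>x. x \<in> carrier H \<Longrightarrow> hnorm H (T x) \<le> C * hnorm H x" using t(4) by auto
  have "\<exists>z\<in>carrier H. \<forall>x\<in>carrier H. hinner H (T x) y = hinner H x z" if y: "y \<in> carrier H" for y
  proof (rule riesz_representation)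
    fix x assume x: "x \<in> carrier H"
    have "cmod (hinner H (T x) y) \<le> hnorm H (T x) * hnorm H y" using hinner_CS t(1) x y by blast
    also have "\<dots> \<le> (C * hnorm H x) * hnorm H y" using C(2)[OF x] y by (intro mult_right_mono) auto
    finally show "cmod (hinner H (T x) y) \<le> (C * hnorm H y) * hnorm H x" by (simp add: mult_ac)
  qed (use y t in \<open>auto simp: hinner_simps\<close>)
  then obtain S where S: "\<And>y. y \<in> carrier H \<Longrightarrow> S y \<in> carrier H"
    "\<And>x y. x \<in> carrier H \<Longrightarrow> y \<in> carrier H \<Longrightarrow> hinner H (T x) y = hinner H x (S y)" by metis
  define S' where "S' = (\<lambda>y\<in>carrier H. S y)"
  have S2: "hinner H (S y) x = hinner H y (T x)" if "x \<in> carrier H" "y \<in> carrier H" for x y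
    using S(2)[OF that] hinner_commute[of x "S y"] hinner_commute[of "T x" y] S(1) t(1) that by simp
  have "S' \<in> bounded_ops H"
    unfolding bounded_ops_def
  proof (intro CollectI conjI ballI allI exI)
    show "S' \<in> carrier H \<rightarrow>\<^sub>E carrier H" using S(1) by (simp add: S'_def)
  next
    fix x y assume "x \<in> carrier H" "y \<in> carrier H"
    then have "S (x \<oplus> y) = S x \<oplus> S y" using S(1) t(1) by (intro hinner_ext) (auto simp: hinner_simps S2)
    then show "S' (x \<oplus> y) = S' x \<oplus> S' y" using \<open>x \<in> carrier H\<close> \<open>y \<in> carrier H\<close> by (simp add: S'_def)
  next
    fix a x assume x: "x \<in> carrier H"
    then have "S (a \<odot> x) = a \<odot> S x" using S(1) t(1) by (intro hinner_ext) (auto simp: hinner_simps S2)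
    then show "S' (a \<odot> x) = a \<odot> S' x" using x by (simp add: S'_def)
  next
    fix y assume y: "y \<in> carrier H"
    have "(hnorm H (S y))\<^sup>2 = Re (hinner H (T (S y)) y)" using S y t by (simp add: Re_hinner_self[symmetric])
    also have "\<dots> \<le> hnorm H (T (S y)) * hnorm H y"
      using hinner_CS[of "T (S y)" y] complex_Re_le_cmod[of "hinner H (T (S y)) y"] S y t by simp
    also have "\<dots> \<le> C * hnorm H (S y) * hnorm H y" using C(2)[of "S y"] S y by (intro mult_right_mono) auto
    finally have "hnorm H (S y) * hnorm H (S y) \<le> (C * hnorm H y) * hnorm H (S y)" by (simp add: power2_eq_square mult_ac)
    moreover have "0 \<le> hnorm H (S y)" using S(1) y by simp
    \<comment> \<open>The common factor can be cancelled only when it is nonzero; otherwise the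
      bound is trivial.\<close>
    ultimately have "hnorm H (S y) \<le> C * hnorm H y \<or> hnorm H (S y) = 0" unfolding mult_le_cancel_right by linarith
    then show "hnorm H (S' y) \<le> C * hnorm H y" using C(1) y by (auto simp: S'_def)
  qed
  then show ?thesis using S(2) by (intro bexI[of _ S']) (auto simp: S'_def)
qed

lemma adj:
  assumes "T \<in> bounded_ops H"
  shows "adj H T \<in> bounded_ops H"
    "x \<in> carrier H \<Longrightarrow> y \<in> carrier H \<Longrightarrow> hinner H (T x) y = hinner H x (adj H T y)"
proof -
  obtain S where S: "S \<in> bounded_ops H" "\<And>x y. x \<in> carrier H \<Longrightarrow> y \<in> carrier H \<Longrightarrow> hinner H (T x) y = hinner H x (S y)"
    using adj_ex[OF assms] by blast
  then have "adj H T = S" by (rule adj_unique)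
  then show "adj H T \<in> bounded_ops H" "x \<in> carrier H \<Longrightarrow> y \<in> carrier H \<Longrightarrow> hinner H (T x) y = hinner H x (adj H T y)"
    using S by auto
qed

lemma adj_left:
  assumes "T \<in> bounded_ops H" "x \<in> carrier H" "y \<in> carrier H"
  shows "hinner H (adj H T x) y = hinner H x (T y)"
  using adj(2)[OF assms(1,3,2)] hinner_commute[of y "adj H T x"] hinner_commute[of "T y" x]
    bounded_opsD(1)[OF assms(1)] bounded_opsD(1)[OF adj(1)[OF assms(1)]] assms by simp

lemma adj_adj: "T \<in> bounded_ops H \<Longrightarrow> adj H (adj H T) = T"
  by (rule adj_unique) (auto simp: adj_left)

end

section \<open>The Hilbert algebra of a semifinite trace\<close>

context semifinite_trace
begin

lemma M_bdd: "T \<in> M \<Longrightarrow> T \<in> bounded_ops H"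
  using M_bounded by blast

lemma M_in [simp]: "T \<in> M \<Longrightarrow> x \<in> carrier H \<Longrightarrow> T x \<in> carrier H"
  using bounded_opsD(1)[OF M_bdd] .

lemma op_apply [simp]:
  assumes "x \<in> carrier H"
  shows "op_add H S T x = S x \<oplus> T x" "op_scale H a T x = a \<odot> T x" "op_mult H S T x = S (T x)"
    "op_one H x = x" "op_zero H x = \<zero>"
  using assms by (simp_all add: op_add_def op_scale_def op_mult_def op_one_def op_zero_def compose_def)

lemma M_ext:
  assumes "S \<in> M" "T \<in> M" "\<And>x. x \<in> carrier H \<Longrightarrow> S x = T x"
  shows "S = T"
  by (rule bounded_ops_ext) (use assms M_bdd in auto)

lemma op_mult_assoc:
  assumes "R \<in> M" "S \<in> M" "T \<in> M"
  shows "op_mult H (op_mult H R S) T = op_mult H R (op_mult H S T)"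
  by (rule M_ext) (use assms in \<open>auto intro: M_mult\<close>)

lemma adj_M:
  assumes "T \<in> M" "x \<in> carrier H" "y \<in> carrier H"
  shows "hinner H (T x) y = hinner H x (adj H T y)" "hinner H (adj H T x) y = hinner H x (T y)"
  using adj(2)[OF M_bdd] adj_left[OF M_bdd] assms by auto

lemma adj_adj_M [simp]: "T \<in> M \<Longrightarrow> adj H (adj H T) = T"
  by (rule adj_adj[OF M_bdd])

lemma adj_mult:
  assumes "S \<in> M" "T \<in> M"
  shows "adj H (op_mult H S T) = op_mult H (adj H T) (adj H S)"
  by (rule adj_unique) (use assms in \<open>auto intro!: M_bdd M_mult M_adj simp: adj_M M_adj\<close>)

definition lin :: "('h \<Rightarrow> 'h) \<Rightarrow> complex \<Rightarrow> ('h \<Rightarrow> 'h) \<Rightarrow> 'h \<Rightarrow> 'h" where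
  "lin x c y = op_add H x (op_scale H c y)"

lemma lin_M [simp]: "x \<in> M \<Longrightarrow> y \<in> M \<Longrightarrow> lin x c y \<in> M"
  by (simp add: lin_def M_add M_scale)

lemma lin_apply [simp]: "v \<in> carrier H \<Longrightarrow> lin x c y v = x v \<oplus> c \<odot> y v"
  by (simp add: lin_def)

lemma adj_lin:
  assumes "x \<in> M" "y \<in> M"
  shows "adj H (lin x c y) = lin (adj H x) (cnj c) (adj H y)"
  by (rule adj_unique) (use assms in \<open>auto intro!: M_bdd simp: adj_M M_adj hinner_simps\<close>)

lemma pos_coneI:
  assumes "T \<in> M" "\<And>v. v \<in> carrier H \<Longrightarrow> hinner H (T v) v = of_real (f v)" "\<And>v. v \<in> carrier H \<Longrightarrow> 0 \<le> f v"
  shows "T \<in> pos_cone H M"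
  using assms M_bdd by (simp add: pos_cone_def positive_op_def)

lemma pos_coneD:
  assumes "T \<in> pos_cone H M" "v \<in> carrier H"
  shows "T \<in> M" "hinner H (T v) v = of_real (Re (hinner H (T v) v))" "0 \<le> Re (hinner H (T v) v)"
  using assms by (auto simp: pos_cone_def positive_op_def complex_eq_iff)

lemma op_le_iff:
  assumes "S \<in> pos_cone H M" "T \<in> pos_cone H M"
  shows "op_le H S T \<longleftrightarrow> (\<forall>v\<in>carrier H. Re (hinner H (S v) v) \<le> Re (hinner H (T v) v))"
proof -
  have *: "hinner H (op_add H T (op_scale H (-1) S) v) v = of_real (Re (hinner H (T v) v) - Re (hinner H (S v) v))"
    if v: "v \<in> carrier H" for v
    using pos_coneD[OF assms(1) v] pos_coneD[OF assms(2) v] v by (simp add: hinner_simps)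
  have "op_add H T (op_scale H (-1) S) \<in> bounded_ops H"
    using assms by (intro M_bdd M_add M_scale) (auto simp: pos_cone_def)
  then show ?thesis unfolding op_le_def positive_op_def by (simp add: * del: op_apply)
qed

text \<open>T is the sum of S and the positive operator T - S, and the trace is additive on positive
  operators.\<close>

lemma Tr_mono:
  assumes S: "S \<in> pos_cone H M" and T: "T \<in> pos_cone H M"
    and le: "\<And>v. v \<in> carrier H \<Longrightarrow> Re (hinner H (S v) v) \<le> Re (hinner H (T v) v)"
  shows "Tr S \<le> Tr T"
proof -
  define D where "D = op_add H T (op_scale H (-1) S)"
  have ST: "S \<in> M" "T \<in> M" using S T by (auto simp: pos_cone_def)
  have DM: "D \<in> M" using ST by (simp add: D_def M_add M_scale)
  have Dv: "hinner H (D v) v = of_real (Re (hinner H (T v) v) - Re (hinner H (S v) v))" if v: "v \<in> carrier H" for v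
    using pos_coneD[OF S v] pos_coneD[OF T v] v by (simp add: D_def hinner_simps)
  have D: "D \<in> pos_cone H M" by (rule pos_coneI[OF DM Dv]) (use le in auto)
  have "op_add H S D = T"
  proof (rule bounded_ops_quad_ext)
    fix v assume v: "v \<in> carrier H"
    have "hinner H (op_add H S D v) v = hinner H (S v) v + hinner H (D v) v"
      using v ST DM by (simp add: hinner_add)
    also have "\<dots> = hinner H (T v) v"
      unfolding Dv[OF v] using pos_coneD(2)[OF S v] pos_coneD(2)[OF T v] by simp
    finally show "hinner H (op_add H S D v) v = hinner H (T v) v" .
  qed (use ST DM in \<open>auto intro!: M_bdd M_add\<close>)
  then show ?thesis using Tr_add[OF S D] by simp
qed

definition Q :: "('h \<Rightarrow> 'h) \<Rightarrow> ennreal" where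
  "Q x = Tr (op_mult H (adj H x) x)"

lemma square_pos:
  assumes "x \<in> M"
  shows "op_mult H (adj H x) x \<in> pos_cone H M"
    "v \<in> carrier H \<Longrightarrow> hinner H (op_mult H (adj H x) x v) v = of_real ((hnorm H (x v))\<^sup>2)"
proof -
  show *: "v \<in> carrier H \<Longrightarrow> hinner H (op_mult H (adj H x) x v) v = of_real ((hnorm H (x v))\<^sup>2)" for v
    using assms by (simp add: adj_M(2) hinner_self)
  show "op_mult H (adj H x) x \<in> pos_cone H M"
    by (rule pos_coneI[OF _ *]) (use assms in \<open>auto intro: M_mult M_adj\<close>)
qed

lemma sum_list_pair_nonneg:
  fixes f :: "'b \<Rightarrow> real"
  assumes "\<And>c x. (c, x) \<in> set xs \<Longrightarrow> 0 \<le> c" "\<And>x. 0 \<le> f x"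
  shows "0 \<le> (\<Sum>(c, x)\<leftarrow>xs. c * f x)"
proof (rule sum_list_nonneg)
  fix y assume "y \<in> set (map (\<lambda>(c, x). c * f x) xs)"
  then obtain c x where "(c, x) \<in> set xs" "y = c * f x" by auto
  then show "0 \<le> y" using assms by simp
qed

text \<open>Positive operators are recorded as lists of weighted squares: the quadratic form can
  then be read off vector by vector, and the trace term by term.\<close>

lemma combination_of_squares:
  assumes "\<And>c x. (c, x) \<in> set xs \<Longrightarrow> 0 \<le> c \<and> x \<in> M"
  shows "\<exists>A\<in>pos_cone H M. (\<forall>v\<in>carrier H. hinner H (A v) v = of_real (\<Sum>(c, x)\<leftarrow>xs. c * (hnorm H (x v))\<^sup>2)) \<and>
    Tr A = (\<Sum>(c, x)\<leftarrow>xs. ennreal c * Q x)"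
  using assms
proof (induction xs)
  case Nil
  \<comment> \<open>The zero operator is written as 0 times the unit so that \<open>Tr_scale\<close>
    gives it trace 0. This holds also when the unit has infinite trace, since 0 times infinity is 0
    in \<open>ennreal\<close>.\<close>
  define Z where "Z = op_scale H 0 (op_one H)"
  have one: "op_one H \<in> pos_cone H M"
    by (rule pos_coneI[where f = "\<lambda>v. (hnorm H v)\<^sup>2"]) (auto simp: M_one hinner_self)
  have "Tr Z = 0" using Tr_scale[OF one, of 0] by (simp add: Z_def)
  moreover have "Z \<in> pos_cone H M"
    by (rule pos_coneI[where f = "\<lambda>_. 0"]) (auto simp: Z_def M_one M_scale hinner_smult)
  moreover have "hinner H (Z v) v = 0" if "v \<in> carrier H" for v using that by (simp add: Z_def hinner_smult)
  ultimately show ?case by (intro bexI[of _ Z]) auto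
next
  case (Cons a xs)
  obtain c x where a: "a = (c, x)" by (cases a)
  have cx: "0 \<le> c" "x \<in> M" using Cons.prems a by auto
  obtain A where A: "A \<in> pos_cone H M" "\<And>v. v \<in> carrier H \<Longrightarrow> hinner H (A v) v = of_real (\<Sum>(c, x)\<leftarrow>xs. c * (hnorm H (x v))\<^sup>2)"
    "Tr A = (\<Sum>(c, x)\<leftarrow>xs. ennreal c * Q x)"
  proof -
    have "\<exists>A\<in>pos_cone H M. (\<forall>v\<in>carrier H. hinner H (A v) v = of_real (\<Sum>(c, x)\<leftarrow>xs. c * (hnorm H (x v))\<^sup>2)) \<and>
        Tr A = (\<Sum>(c, x)\<leftarrow>xs. ennreal c * Q x)"
      by (rule Cons.IH, rule Cons.prems) simp
    then show thesis using that by blast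
  qed
  define B where "B = op_scale H (of_real c) (op_mult H (adj H x) x)"
  have Bv: "hinner H (B v) v = of_real (c * (hnorm H (x v))\<^sup>2)" if v: "v \<in> carrier H" for v
  proof -
    have "B v = of_real c \<odot> op_mult H (adj H x) x v" unfolding B_def by (rule op_apply(2)[OF v])
    then have "hinner H (B v) v = of_real c * hinner H (op_mult H (adj H x) x v) v"
      using hinner_smult[of "op_mult H (adj H x) x v" v] v cx by (simp add: M_adj)
    then show ?thesis using square_pos(2)[OF cx(2) v] by simp
  qed
  have B: "B \<in> pos_cone H M"
    by (rule pos_coneI[OF _ Bv]) (use cx square_pos(1)[OF cx(2)] in \<open>auto simp: B_def pos_cone_def M_scale\<close>)
  have TB: "Tr B = ennreal c * Q x" unfolding B_def Q_def by (rule Tr_scale[OF square_pos(1)[OF cx(2)] cx(1)])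
  have M: "A \<in> M" "B \<in> M" using A(1) B by (auto simp: pos_cone_def)
  have Cv: "hinner H (op_add H B A v) v = of_real (\<Sum>(c, x)\<leftarrow>a # xs. c * (hnorm H (x v))\<^sup>2)" if v: "v \<in> carrier H" for v
    using A(2)[OF v] Bv[OF v] M v by (simp add: hinner_add a)
  have "op_add H B A \<in> pos_cone H M"
  proof (rule pos_coneI[OF _ Cv])
    show "0 \<le> (\<Sum>(c, x)\<leftarrow>a # xs. c * (hnorm H (x v))\<^sup>2)" for v
      by (rule sum_list_pair_nonneg) (simp_all only: Cons.prems zero_le_power2)
  qed (use M in \<open>auto intro: M_add\<close>)
  moreover have "Tr (op_add H B A) = (\<Sum>(c, x)\<leftarrow>a # xs. ennreal c * Q x)"
    using Tr_add[OF B A(1)] TB A(3) a by simp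
  ultimately show ?case using Cv by (intro bexI[of _ "op_add H B A"]) auto
qed

lemma Q_combination_le:
  assumes xs: "\<And>c x. (c, x) \<in> set xs \<Longrightarrow> 0 \<le> c \<and> x \<in> M" and ys: "\<And>c x. (c, x) \<in> set ys \<Longrightarrow> 0 \<le> c \<and> x \<in> M"
    and le: "\<And>v. v \<in> carrier H \<Longrightarrow> (\<Sum>(c, x)\<leftarrow>xs. c * (hnorm H (x v))\<^sup>2) \<le> (\<Sum>(c, x)\<leftarrow>ys. c * (hnorm H (x v))\<^sup>2)"
  shows "(\<Sum>(c, x)\<leftarrow>xs. ennreal c * Q x) \<le> (\<Sum>(c, x)\<leftarrow>ys. ennreal c * Q x)"
proof -
  obtain A where A: "A \<in> pos_cone H M" "\<forall>v\<in>carrier H. hinner H (A v) v = of_real (\<Sum>(c, x)\<leftarrow>xs. c * (hnorm H (x v))\<^sup>2)"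
    "Tr A = (\<Sum>(c, x)\<leftarrow>xs. ennreal c * Q x)" using combination_of_squares[OF xs] by blast
  obtain B where B: "B \<in> pos_cone H M" "\<forall>v\<in>carrier H. hinner H (B v) v = of_real (\<Sum>(c, x)\<leftarrow>ys. c * (hnorm H (x v))\<^sup>2)"
    "Tr B = (\<Sum>(c, x)\<leftarrow>ys. ennreal c * Q x)" using combination_of_squares[OF ys] by blast
  have "Tr A \<le> Tr B" by (rule Tr_mono[OF A(1) B(1)]) (use A(2) B(2) le in auto)
  then show ?thesis using A(3) B(3) by simp
qed

definition L2 :: "('h \<Rightarrow> 'h) set" where
  "L2 = {x \<in> M. Q x < \<infinity>}"

definition r :: "('h \<Rightarrow> 'h) \<Rightarrow> real" where
  "r x = enn2real (Q x)"

lemma L2_M: "x \<in> L2 \<Longrightarrow> x \<in> M"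
  by (simp add: L2_def)

lemma r_nonneg [simp]: "0 \<le> r x"
  by (simp add: r_def)

lemma ennreal_r: "x \<in> L2 \<Longrightarrow> ennreal (r x) = Q x"
  by (simp add: L2_def r_def)

lemma ennreal_sum_r:
  assumes "\<And>c x. (c, x) \<in> set xs \<Longrightarrow> 0 \<le> c \<and> x \<in> L2"
  shows "(\<Sum>(c, x)\<leftarrow>xs. ennreal c * Q x) = ennreal (\<Sum>(c, x)\<leftarrow>xs. c * r x)"
  using assms
proof (induction xs)
  case (Cons a xs)
  obtain c x where a: "a = (c, x)" by (cases a)
  have cx: "0 \<le> c" "x \<in> L2" using Cons.prems a by auto
  have nn: "0 \<le> (\<Sum>(c, x)\<leftarrow>xs. c * r x)"
  proof (rule sum_list_pair_nonneg)
    fix c x assume "(c, x) \<in> set xs"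
    then show "0 \<le> c" using Cons.prems[of c x] by simp
  qed simp
  have IH: "(\<Sum>(c, x)\<leftarrow>xs. ennreal c * Q x) = ennreal (\<Sum>(c, x)\<leftarrow>xs. c * r x)"
    by (rule Cons.IH, rule Cons.prems) simp
  have "ennreal c * Q x = ennreal (c * r x)" using ennreal_r[OF cx(2)] cx(1) by (simp add: ennreal_mult')
  then show ?case using IH nn cx(1) by (simp add: a)
qed simp

lemma r_combination_le:
  assumes xs: "\<And>c x. (c, x) \<in> set xs \<Longrightarrow> 0 \<le> c \<and> x \<in> L2" and ys: "\<And>c x. (c, x) \<in> set ys \<Longrightarrow> 0 \<le> c \<and> x \<in> L2"
    and le: "\<And>v. v \<in> carrier H \<Longrightarrow> (\<Sum>(c, x)\<leftarrow>xs. c * (hnorm H (x v))\<^sup>2) \<le> (\<Sum>(c, x)\<leftarrow>ys. c * (hnorm H (x v))\<^sup>2)"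
  shows "(\<Sum>(c, x)\<leftarrow>xs. c * r x) \<le> (\<Sum>(c, x)\<leftarrow>ys. c * r x)"
proof -
  have "(\<Sum>(c, x)\<leftarrow>xs. ennreal c * Q x) \<le> (\<Sum>(c, x)\<leftarrow>ys. ennreal c * Q x)"
    by (rule Q_combination_le[OF _ _ le]) (simp_all add: xs ys L2_M)
  then have "ennreal (\<Sum>(c, x)\<leftarrow>xs. c * r x) \<le> ennreal (\<Sum>(c, x)\<leftarrow>ys. c * r x)"
    using ennreal_sum_r[of xs, OF xs] ennreal_sum_r[of ys, OF ys] by simp
  moreover have "0 \<le> (\<Sum>(c, x)\<leftarrow>ys. c * r x)"
    by (rule sum_list_pair_nonneg) (simp_all only: ys r_nonneg)
  ultimately show ?thesis by (simp add: ennreal_le_iff)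
qed

text \<open>Identities for the Hilbert-Schmidt inner product of the trace are reduced to identities between squared norms
  of vectors: additivity of the trace on positive operators is all that is needed.\<close>

lemma r_combination_zero:
  assumes xs: "\<And>c x. (c, x) \<in> set xs \<Longrightarrow> x \<in> L2"
    and eq: "\<And>v. v \<in> carrier H \<Longrightarrow> (\<Sum>(c, x)\<leftarrow>xs. c * (hnorm H (x v))\<^sup>2) = 0"
  shows "(\<Sum>(c, x)\<leftarrow>xs. c * r x) = 0"
proof -
  \<comment> \<open>The trace is monotone on positive operators only, so terms with negative
    coefficients are moved to the other side. Equality then follows from the inequalities in both
    directions.\<close>
  define ps where "ps = map (\<lambda>(c, x). (max c 0, x)) xs"
  define ns where "ns = map (\<lambda>(c, x). (max (- c) 0, x)) xs"
  have split: "(\<Sum>(c, x)\<leftarrow>xs. c * f x) = (\<Sum>(c, x)\<leftarrow>ps. c * f x) - (\<Sum>(c, x)\<leftarrow>ns. c * f x)" for f :: "('h \<Rightarrow> 'h) \<Rightarrow> real"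
  proof -
    have "max (c :: real) 0 - max (- c) 0 = c" for c by auto
    then have e: "c * d = max c 0 * d - max (- c) 0 * d" for c d :: real by (metis left_diff_distrib)
    show ?thesis unfolding ps_def ns_def
    proof (induction xs)
      case (Cons a xs)
      obtain c x where a: "a = (c, x)" by (cases a)
      show ?case using Cons.IH e[of c "f x"] unfolding a list.map sum_list.Cons prod.case by linarith
    qed simp
  qed
  have p: "0 \<le> c \<and> x \<in> L2" if "(c, x) \<in> set ps" for c x using that xs by (auto simp: ps_def)
  have n: "0 \<le> c \<and> x \<in> L2" if "(c, x) \<in> set ns" for c x using that xs by (auto simp: ns_def)
  have e: "(\<Sum>(c, x)\<leftarrow>ps. c * (hnorm H (x v))\<^sup>2) = (\<Sum>(c, x)\<leftarrow>ns. c * (hnorm H (x v))\<^sup>2)" if "v \<in> carrier H" for v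
    using eq[OF that] split[of "\<lambda>x. (hnorm H (x v))\<^sup>2"] by simp
  have "(\<Sum>(c, x)\<leftarrow>ps. c * r x) \<le> (\<Sum>(c, x)\<leftarrow>ns. c * r x)" by (rule r_combination_le[OF p n]) (simp_all add: e)
  moreover have "(\<Sum>(c, x)\<leftarrow>ns. c * r x) \<le> (\<Sum>(c, x)\<leftarrow>ps. c * r x)" by (rule r_combination_le[OF n p]) (simp_all add: e)
  ultimately show ?thesis using split[of r] by simp
qed

lemma L2_lin [simp]:
  assumes "x \<in> L2" "y \<in> L2"
  shows "lin x c y \<in> L2"
proof -
  have M: "x \<in> M" "y \<in> M" using assms L2_M by auto
  have "(\<Sum>(c, x)\<leftarrow>[(1, lin x c y)]. ennreal c * Q x) \<le> (\<Sum>(c, x)\<leftarrow>[(2, x), (2 * (cmod c)\<^sup>2, y)]. ennreal c * Q x)"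
  proof (rule Q_combination_le)
    fix v assume v: "v \<in> carrier H"
    \<comment> \<open>By the parallelogram law this square is the difference between the two
      sides.\<close>
    have "0 \<le> (hnorm H (x v \<oplus> (- c) \<odot> y v))\<^sup>2" by simp
    then show "(\<Sum>(c, x)\<leftarrow>[(1, lin x c y)]. c * (hnorm H (x v))\<^sup>2) \<le> (\<Sum>(c, x)\<leftarrow>[(2, x), (2 * (cmod c)\<^sup>2, y)]. c * (hnorm H (x v))\<^sup>2)"
      using v M by (simp add: hnorm_add_sq)
  qed (use M in auto)
  then have "Q (lin x c y) \<le> ennreal 2 * Q x + ennreal (2 * (cmod c)\<^sup>2) * Q y" by simp
  also have "\<dots> < \<infinity>" using assms by (auto simp: L2_def ennreal_mult_less_top)
  finally show ?thesis using M by (simp add: L2_def)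
qed

lemma Q_adj: "x \<in> M \<Longrightarrow> Q (adj H x) = Q x"
  using Tr_tracial[of x] by (simp add: Q_def)

lemma L2_adj [simp]: "x \<in> L2 \<Longrightarrow> adj H x \<in> L2"
  by (simp add: L2_def Q_adj M_adj)

lemma r_adj: "x \<in> L2 \<Longrightarrow> r (adj H x) = r x"
  by (simp add: r_def Q_adj L2_M)

text \<open>If a is bounded by C then the square of \<open>op_mult H a x\<close> is at most
  \<open>C\<^sup>2\<close> times the square of x.\<close>

lemma L2_mult_left [simp]:
  assumes a: "a \<in> M" and x: "x \<in> L2"
  shows "op_mult H a x \<in> L2"
proof -
  have xM: "x \<in> M" using x L2_M by simp
  obtain C where C: "C \<ge> 0" "\<And>v. v \<in> carrier H \<Longrightarrow> hnorm H (a v) \<le> C * hnorm H v"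
    using bounded_opsD(4)[OF M_bdd[OF a]] by auto
  have "(\<Sum>(c, x)\<leftarrow>[(1, op_mult H a x)]. ennreal c * Q x) \<le> (\<Sum>(c, x)\<leftarrow>[(C\<^sup>2, x)]. ennreal c * Q x)"
  proof (rule Q_combination_le)
    fix v assume v: "v \<in> carrier H"
    have "(hnorm H (a (x v)))\<^sup>2 \<le> (C * hnorm H (x v))\<^sup>2"
      using C(2)[of "x v"] xM a v by (intro power_mono) auto
    then show "(\<Sum>(c, x)\<leftarrow>[(1, op_mult H a x)]. c * (hnorm H (x v))\<^sup>2) \<le> (\<Sum>(c, x)\<leftarrow>[(C\<^sup>2, x)]. c * (hnorm H (x v))\<^sup>2)"
      using v by (simp add: power_mult_distrib)
  qed (use a xM in \<open>auto simp: M_mult\<close>)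
  then have "Q (op_mult H a x) \<le> ennreal (C\<^sup>2) * Q x" by simp
  also have "\<dots> < \<infinity>" using x by (auto simp: L2_def ennreal_mult_less_top)
  finally show ?thesis using a xM by (simp add: L2_def M_mult)
qed

text \<open>Polarisation, because the trace is given on positive operators only and the product of
  \<open>adj H y\<close> with x is in general not positive. The signs in the imaginary part are
  those for a form linear in its first argument.\<close>

definition ip :: "('h \<Rightarrow> 'h) \<Rightarrow> ('h \<Rightarrow> 'h) \<Rightarrow> complex" where
  "ip x y = Complex ((r (lin x 1 y) - r (lin x (-1) y)) / 4) ((r (lin x \<i> y) - r (lin x (-\<i>) y)) / 4)"

lemma ip_self_r:
  assumes x: "x \<in> L2"
  shows "ip x x = of_real (r x)"
proof -
  have M: "x \<in> M" using x L2_M by simp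
  have "(\<Sum>(c, x)\<leftarrow>[(1, lin x 1 x), (-1, lin x (-1) x), (-4, x)]. c * r x) = 0"
    by (rule r_combination_zero) (use x M in \<open>auto simp: hnorm_add_sq Re_hinner_self\<close>)
  moreover have "(\<Sum>(c, x)\<leftarrow>[(1, lin x \<i> x), (-1, lin x (-\<i>) x)]. c * r x) = 0"
    by (rule r_combination_zero) (use x M in \<open>auto simp: hnorm_add_sq Im_hinner_self\<close>)
  ultimately show ?thesis by (simp add: ip_def complex_eq_iff field_simps)
qed

lemma ip_hermitian:
  assumes x: "x \<in> L2" and y: "y \<in> L2"
  shows "ip y x = cnj (ip x y)"
proof -
  have M: "x \<in> M" "y \<in> M" using x y L2_M by auto
  have h: "hinner H (y v) (x v) = cnj (hinner H (x v) (y v))" if "v \<in> carrier H" for v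
    using hinner_commute[of "x v" "y v"] that M by simp
  have "(\<Sum>(c, x)\<leftarrow>[(1, lin y 1 x), (-1, lin y (-1) x), (-1, lin x 1 y), (1, lin x (-1) y)]. c * r x) = 0"
    by (rule r_combination_zero) (use x y M in \<open>auto simp: hnorm_add_sq h\<close>)
  moreover have "(\<Sum>(c, x)\<leftarrow>[(1, lin y \<i> x), (-1, lin y (-\<i>) x), (1, lin x \<i> y), (-1, lin x (-\<i>) y)]. c * r x) = 0"
    by (rule r_combination_zero) (use x y M in \<open>auto simp: hnorm_add_sq h\<close>)
  ultimately show ?thesis by (simp add: ip_def complex_eq_iff field_simps)
qed

lemma ip_lin:
  assumes x: "x \<in> L2" and y: "y \<in> L2" and w: "w \<in> L2"
  shows "ip (lin x c y) w = ip x w + c * ip y w"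
proof -
  have M: "x \<in> M" "y \<in> M" "w \<in> M" using x y w L2_M by auto
  \<comment> \<open>This list is four times the real part of the claim, brought to one side;
    \<open>Re c\<close> and \<open>Im c\<close> stem from the real part of c times
    \<open>ip y w\<close>. The second list is the imaginary part.\<close>
  have "(\<Sum>(c, x)\<leftarrow>[(1, lin (lin x c y) 1 w), (-1, lin (lin x c y) (-1) w), (-1, lin x 1 w), (1, lin x (-1) w),
      (- Re c, lin y 1 w), (Re c, lin y (-1) w), (Im c, lin y \<i> w), (- Im c, lin y (-\<i>) w)]. c * r x) = 0"
    by (rule r_combination_zero) (use x y w M in \<open>auto simp: hnorm_add_sq hinner_simps algebra_simps\<close>)
  moreover have "(\<Sum>(c, x)\<leftarrow>[(1, lin (lin x c y) \<i> w), (-1, lin (lin x c y) (-\<i>) w), (-1, lin x \<i> w), (1, lin x (-\<i>) w),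
      (- Re c, lin y \<i> w), (Re c, lin y (-\<i>) w), (- Im c, lin y 1 w), (Im c, lin y (-1) w)]. c * r x) = 0"
    by (rule r_combination_zero) (use x y w M in \<open>auto simp: hnorm_add_sq hinner_simps algebra_simps\<close>)
  ultimately show ?thesis by (simp add: ip_def complex_eq_iff field_simps)
qed

lemma ip_mult_left:
  assumes a: "a \<in> M" and x: "x \<in> L2" and y: "y \<in> L2"
  shows "ip (op_mult H a x) y = ip x (op_mult H (adj H a) y)"
proof -
  let ?y = "op_mult H (adj H a) y"
  have M: "x \<in> M" "y \<in> M" "adj H a \<in> M" using x y a L2_M M_adj by auto
  have h: "hinner H (a (x v)) (y v) = hinner H (x v) (adj H a (y v))" if "v \<in> carrier H" for v
    using that M a by (simp add: adj_M)
  have "(\<Sum>(c, x)\<leftarrow>[(1, lin (op_mult H a x) c y), (-1, lin (op_mult H a x) (-c) y), (-1, lin x c ?y), (1, lin x (-c) ?y)]. c * r x) = 0" for c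
    by (rule r_combination_zero) (use x y a M in \<open>auto simp: hnorm_add_sq h\<close>)
  from this[of 1] this[of \<i>] show ?thesis by (simp add: ip_def complex_eq_iff field_simps)
qed

text \<open>Traciality enters here: an operator and its adjoint have the same norm in
  \<open>L2\<close>, and polarisation passes this on to inner products.\<close>

lemma ip_adj:
  assumes x: "x \<in> L2" and y: "y \<in> L2"
  shows "ip (adj H y) (adj H x) = ip x y"
proof -
  have "r (lin (adj H y) c (adj H x)) = r (lin y (cnj c) x)" for c
    using r_adj[of "lin y (cnj c) x"] adj_lin[of y x "cnj c"] x y L2_M by simp
  then have "ip (adj H y) (adj H x) = cnj (ip y x)" by (simp add: ip_def complex_eq_iff field_simps)
  then show ?thesis using ip_hermitian[OF x y] by simp
qed

text \<open>Adjoints exchange right and left multiplication, and \<open>L2\<close> is closed under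
  them because Tr is a trace.\<close>

lemma L2_mult_right:
  assumes "a \<in> M" "x \<in> L2"
  shows "op_mult H x a \<in> L2"
proof -
  have "op_mult H (adj H a) (adj H x) \<in> L2" using assms by (simp add: M_adj)
  then have "adj H (op_mult H (adj H a) (adj H x)) \<in> L2" by simp
  then show ?thesis using assms L2_M by (simp add: adj_mult M_adj)
qed

lemma ip_mult_right:
  assumes a: "a \<in> M" and x: "x \<in> L2" and y: "y \<in> L2"
  shows "ip (op_mult H x a) y = ip x (op_mult H y (adj H a))"
proof -
  have M: "x \<in> M" "y \<in> M" "adj H a \<in> M" using x y a L2_M M_adj by auto
  have "ip (op_mult H x a) y = ip (adj H y) (op_mult H (adj H a) (adj H x))"
    using ip_adj[of "op_mult H x a" y] a x y M by (simp add: adj_mult L2_mult_right)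
  also have "\<dots> = ip (op_mult H a (adj H y)) (adj H x)"
    using ip_mult_left[of a "adj H y" "adj H x"] a x y by simp
  also have "op_mult H a (adj H y) = adj H (op_mult H y (adj H a))"
    using a M by (simp add: adj_mult)
  also have "ip (adj H (op_mult H y (adj H a))) (adj H x) = ip x (op_mult H y (adj H a))"
    using x y M by (intro ip_adj) (auto simp: L2_mult_right)
  finally show ?thesis .
qed

lemma hilbert_algebra_L2: "hilbert_algebra L2 (op_mult H) (adj H) ip"
proof
  show "pos_kernel L2 ip"
  proof (rule pos_kernelI_combination)
    fix x y c assume "x \<in> L2" "y \<in> L2"
    then show "\<exists>z\<in>L2. \<forall>w\<in>L2. ip z w = ip x w + c * ip y w"
      by (intro bexI[of _ "lin x c y"]) (auto simp: ip_lin)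
  qed (auto simp: ip_self_r intro: ip_hermitian)
  fix x y assume "x \<in> L2" "y \<in> L2"
  then show "\<exists>z\<in>L2. \<forall>w\<in>L2. ip z w = ip x w - ip y w"
    by (intro bexI[of _ "lin x (-1) y"]) (auto simp: ip_lin)
qed (auto simp: L2_M op_mult_assoc adj_mult intro: ip_mult_left ip_mult_right)

end

section \<open>Fundamental domains as partitions of unity\<close>

lemma (in hilbert_space) hinner_finsum:
  assumes "finite F" "f \<in> F \<rightarrow> carrier H" "w \<in> carrier H"
  shows "hinner H (\<Oplus>\<^bsub>H\<^esub>i\<in>F. f i) w = (\<Sum>i\<in>F. hinner H (f i) w)"
  using assms
proof (induction F rule: finite_induct)
  case (insert i F)
  then have "f i \<in> carrier H" "f \<in> F \<rightarrow> carrier H" by auto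
  then show ?case using insert by (simp add: hinner_add M.finsum_closed)
qed simp

context semifinite_trace
begin

interpretation HA: hilbert_algebra L2 "op_mult H" "adj H" ip
  by (rule hilbert_algebra_L2)

lemma isometric_action_L2:
  assumes \<sigma>: "vN_action G H M \<sigma>" and tp: "trace_preserving G H M Tr \<sigma>"
  shows "isometric_action L2 (op_mult H) (adj H) ip G \<sigma>"
proof -
  interpret A: vN_action G H M \<sigma> by fact
  have G: "group G" using A.group_hom by (simp add: group_hom_def)
  interpret group G by (rule G)
  have closed: "\<sigma> g x \<in> M" if "g \<in> carrier G" "x \<in> M" for g x
    using A.surj_prop[OF that(1)] that(2) by blast
  have Q: "Q (\<sigma> g x) = Q x" if g: "g \<in> carrier G" and x: "x \<in> M" for g x
  proof -
    have "op_mult H (adj H (\<sigma> g x)) (\<sigma> g x) = \<sigma> g (op_mult H (adj H x) x)"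
      using g x by (simp add: A.act_mult A.act_adj M_adj)
    moreover have "Tr (\<sigma> g (op_mult H (adj H x) x)) = Tr (op_mult H (adj H x) x)"
      using tp square_pos(1)[OF x] g unfolding trace_preserving_def by blast
    ultimately show ?thesis by (simp add: Q_def)
  qed
  have lin: "\<sigma> g (lin x c y) = lin (\<sigma> g x) c (\<sigma> g y)" if "g \<in> carrier G" "x \<in> M" "y \<in> M" for g x y c
    using that by (simp add: lin_def A.act_add A.act_scale M_scale)
  show ?thesis
  proof
    fix g x assume g: "g \<in> carrier G" and x: "x \<in> L2"
    show "\<sigma> g x \<in> L2" using g x Q closed by (simp add: L2_def)
    show "\<sigma> g (adj H x) = adj H (\<sigma> g x)" using g x by (simp add: A.act_adj L2_M)
    fix y assume y: "y \<in> L2"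
    show "\<sigma> g (op_mult H x y) = op_mult H (\<sigma> g x) (\<sigma> g y)" using g x y by (simp add: A.act_mult L2_M)
    have "r (lin (\<sigma> g x) c (\<sigma> g y)) = r (lin x c y)" for c
      using lin[OF g, of x y c] Q[OF g, of "lin x c y"] x y by (simp add: r_def L2_M)
    then show "ip (\<sigma> g x) (\<sigma> g y) = ip x y" by (simp add: ip_def)
  next
    fix g h x assume "g \<in> carrier G" "h \<in> carrier G" "x \<in> L2"
    then show "\<sigma> (g \<otimes>\<^bsub>G\<^esub> h) x = \<sigma> g (\<sigma> h x)" by (intro A.composition_rule) (simp_all add: L2_M)
  next
    fix x assume "x \<in> L2"
    then show "\<sigma> \<one>\<^bsub>G\<^esub> x = x" using fun_cong[OF A.id_eq_one, of x] by (simp add: L2_M)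
  qed
qed

text \<open>Strong convergence of the sums of projections is paired with w: for a projection e, the
  inner product of e w with w is the squared norm of e w.\<close>

lemma fundamental_domain_vector_has_sum:
  assumes \<sigma>: "vN_action G H M \<sigma>" and p: "fundamental_domain G H M \<sigma> p" and w: "w \<in> carrier H"
  shows "((\<lambda>g. (hnorm H (\<sigma> g p w))\<^sup>2) has_sum (hnorm H w)\<^sup>2) (carrier G)"
proof -
  interpret A: vN_action G H M \<sigma> by fact
  have p': "p \<in> M" "adj H p = p" "op_mult H p p = p" using p unfolding fundamental_domain_def by auto
  have e: "\<sigma> g p \<in> M" "adj H (\<sigma> g p) = \<sigma> g p" "op_mult H (\<sigma> g p) (\<sigma> g p) = \<sigma> g p" if "g \<in> carrier G" for g
    using A.surj_prop[OF that] p' that by (auto simp flip: A.act_adj A.act_mult)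
  have sq: "hinner H (\<sigma> g p w) w = of_real ((hnorm H (\<sigma> g p w))\<^sup>2)" if g: "g \<in> carrier G" for g
    using square_pos(2)[OF e(1)[OF g] w] e[OF g] by simp
  have lim: "((\<lambda>F. hnorm H ((\<Oplus>\<^bsub>H\<^esub>g\<in>F. \<sigma> g p w) \<ominus> w)) \<longlongrightarrow> 0) (finite_subsets_at_top (carrier G))"
    using p w unfolding fundamental_domain_def by blast
  have "((\<lambda>F. (\<Sum>g\<in>F. (hnorm H (\<sigma> g p w))\<^sup>2) - (hnorm H w)\<^sup>2) \<longlongrightarrow> 0) (finite_subsets_at_top (carrier G))"
  proof (rule Lim_null_comparison)
    show "((\<lambda>F. hnorm H ((\<Oplus>\<^bsub>H\<^esub>g\<in>F. \<sigma> g p w) \<ominus> w) * hnorm H w) \<longlongrightarrow> 0) (finite_subsets_at_top (carrier G))"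
      using tendsto_mult_right[OF lim, of "hnorm H w"] by simp
    show "\<forall>\<^sub>F F in finite_subsets_at_top (carrier G). norm ((\<Sum>g\<in>F. (hnorm H (\<sigma> g p w))\<^sup>2) - (hnorm H w)\<^sup>2) \<le>
        hnorm H ((\<Oplus>\<^bsub>H\<^esub>g\<in>F. \<sigma> g p w) \<ominus> w) * hnorm H w"
    proof (rule eventually_finite_subsets_at_top_weakI)
      fix F assume F: "finite F" "F \<subseteq> carrier G"
      have f: "(\<lambda>g. \<sigma> g p w) \<in> F \<rightarrow> carrier H" using F e w by auto
      let ?s = "\<Oplus>\<^bsub>H\<^esub>g\<in>F. \<sigma> g p w"
      have s: "?s \<in> carrier H" using f by (rule M.finsum_closed)
      have "hinner H (?s \<ominus> w) w = (\<Sum>g\<in>F. hinner H (\<sigma> g p w) w) - hinner H w w"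
        using s w hinner_finsum[OF F(1) f w] by (simp add: hinner_minus)
      also have "(\<Sum>g\<in>F. hinner H (\<sigma> g p w) w) = (\<Sum>g\<in>F. of_real ((hnorm H (\<sigma> g p w))\<^sup>2))"
        using F(2) by (intro sum.cong refl sq) auto
      finally have "hinner H (?s \<ominus> w) w = of_real ((\<Sum>g\<in>F. (hnorm H (\<sigma> g p w))\<^sup>2) - (hnorm H w)\<^sup>2)"
        using w by (simp add: hinner_self)
      then show "norm ((\<Sum>g\<in>F. (hnorm H (\<sigma> g p w))\<^sup>2) - (hnorm H w)\<^sup>2) \<le> hnorm H (?s \<ominus> w) * hnorm H w"
        using hinner_CS[of "?s \<ominus> w" w] s w by (simp only: norm_of_real M.minus_closed real_norm_def)
    qed
  qed
  then show ?thesis unfolding has_sum_def by (simp add: LIM_zero_iff)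
qed

text \<open>Normality of the trace is applied to the increasing net of sums, over finite sets of g,
  of the squares of the operators e_g y, where e_g is the translate of p. Its least upper bound is
  the square of y.\<close>

lemma Q_fundamental_domain:
  assumes \<sigma>: "vN_action G H M \<sigma>" and p: "fundamental_domain G H M \<sigma> p" and y: "y \<in> M"
  shows "Q y = (SUP F\<in>{F. finite F \<and> F \<subseteq> carrier G}. \<Sum>g\<in>F. Q (op_mult H (\<sigma> g p) y))"
proof -
  interpret A: vN_action G H M \<sigma> by fact
  let ?I = "{F. finite F \<and> F \<subseteq> carrier G}"
  have e: "\<sigma> g p \<in> M" if "g \<in> carrier G" for g
    using A.surj_prop[OF that] p unfolding fundamental_domain_def by auto
  define q where "q F v = (\<Sum>g\<in>F. (hnorm H (\<sigma> g p (y v)))\<^sup>2)" for F v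
  have ex: "\<exists>A\<in>pos_cone H M. (\<forall>v\<in>carrier H. hinner H (A v) v = of_real (q F v)) \<and>
      Tr A = (\<Sum>g\<in>F. Q (op_mult H (\<sigma> g p) y))" if F: "F \<in> ?I" for F
  proof -
    obtain gs where gs: "set gs = F" "distinct gs" using F finite_distinct_list by blast
    let ?xs = "map (\<lambda>g. (1 :: real, op_mult H (\<sigma> g p) y)) gs"
    have "\<exists>A\<in>pos_cone H M. (\<forall>v\<in>carrier H. hinner H (A v) v = of_real (\<Sum>(c, x)\<leftarrow>?xs. c * (hnorm H (x v))\<^sup>2)) \<and>
      Tr A = (\<Sum>(c, x)\<leftarrow>?xs. ennreal c * Q x)"
      by (rule combination_of_squares) (use F gs e y in \<open>auto simp: M_mult\<close>)
    moreover have "(\<Sum>(c, x)\<leftarrow>?xs. c * (hnorm H (x v))\<^sup>2) = q F v" if "v \<in> carrier H" for v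
      using gs that by (simp add: o_def sum_list_distinct_conv_sum_set q_def)
    moreover have "(\<Sum>(c, x)\<leftarrow>?xs. ennreal c * Q x) = (\<Sum>g\<in>F. Q (op_mult H (\<sigma> g p) y))"
      using gs by (simp add: o_def sum_list_distinct_conv_sum_set)
    ultimately show ?thesis by auto
  qed
  define A where "A F = (SOME A. A \<in> pos_cone H M \<and> (\<forall>v\<in>carrier H. hinner H (A v) v = of_real (q F v)) \<and>
      Tr A = (\<Sum>g\<in>F. Q (op_mult H (\<sigma> g p) y)))" for F
  have A: "A F \<in> pos_cone H M" "\<And>v. v \<in> carrier H \<Longrightarrow> hinner H (A F v) v = of_real (q F v)"
    "Tr (A F) = (\<Sum>g\<in>F. Q (op_mult H (\<sigma> g p) y))" if "F \<in> ?I" for F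
    using someI_ex[OF ex[OF that, unfolded Bex_def]] unfolding A_def[symmetric] by auto
  define s where "s = op_mult H (adj H y) y"
  have s: "s \<in> pos_cone H M" "\<And>v. v \<in> carrier H \<Longrightarrow> hinner H (s v) v = of_real ((hnorm H (y v))\<^sup>2)"
    using square_pos[OF y] unfolding s_def by auto
  have hs: "((\<lambda>g. (hnorm H (\<sigma> g p (y v)))\<^sup>2) has_sum (hnorm H (y v))\<^sup>2) (carrier G)" if "v \<in> carrier H" for v
    by (rule fundamental_domain_vector_has_sum[OF \<sigma> p]) (use y that in simp)
  have q_mono: "q F v \<le> q F' v" if "F \<subseteq> F'" "finite F'" for F F' v
    unfolding q_def by (rule sum_mono2) (use that in auto)
  have "Tr s = (SUP T\<in>A ` ?I. Tr T)"
  proof (rule Tr_normal)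
    show "A ` ?I \<subseteq> pos_cone H M" using A(1) by auto
    show "A ` ?I \<noteq> {}" by auto
    show "s \<in> pos_cone H M" by (rule s(1))
    show "\<exists>R\<in>A ` ?I. op_le H S R \<and> op_le H T R" if "S \<in> A ` ?I" "T \<in> A ` ?I" for S T
    proof -
      from that(1) obtain F where F1: "S = A F" "F \<in> ?I" by (rule imageE)
      from that(2) obtain F' where F2: "T = A F'" "F' \<in> ?I" by (rule imageE)
      note F = F1 F2
      then have U: "F \<union> F' \<in> ?I" by simp
      have "op_le H (A F) (A (F \<union> F'))" "op_le H (A F') (A (F \<union> F'))"
        using F U q_mono[of F "F \<union> F'"] q_mono[of F' "F \<union> F'"] by (simp_all add: op_le_iff[OF A(1) A(1)] A(2))
      then show ?thesis unfolding F1(1) F2(1) by (intro bexI[OF _ imageI[OF U]] conjI)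
    qed
    show "op_le H T s" if "T \<in> A ` ?I" for T
    proof -
      from that obtain F where F: "T = A F" "F \<in> ?I" by (rule imageE)
      have "q F v \<le> (hnorm H (y v))\<^sup>2" if "v \<in> carrier H" for v
        unfolding q_def by (rule finite_sum_le_has_sum[OF hs[OF that]]) (use F in auto)
      then show ?thesis using F by (simp add: op_le_iff[OF A(1) s(1)] A(2) s(2))
    qed
    \<comment> \<open>An upper bound dominates all finite partial sums of the quadratic form, hence
      also their limit.\<close>
    show "op_le H s t" if t: "t \<in> pos_cone H M" and ub: "\<And>T. T \<in> A ` ?I \<Longrightarrow> op_le H T t" for t
      unfolding op_le_iff[OF s(1) t]
    proof
      fix v assume v: "v \<in> carrier H"
      have "(hnorm H (y v))\<^sup>2 \<le> Re (hinner H (t v) v)"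
      proof (rule has_sum_le_finite_sums[OF hs[OF v]])
        fix F assume F: "finite F" "F \<subseteq> carrier G"
        then have I: "F \<in> ?I" by simp
        then have "op_le H (A F) t" using ub by blast
        then have "Re (hinner H (A F v) v) \<le> Re (hinner H (t v) v)" using v unfolding op_le_iff[OF A(1)[OF I] t] by blast
        then show "(\<Sum>g\<in>F. (hnorm H (\<sigma> g p (y v)))\<^sup>2) \<le> Re (hinner H (t v) v)" using A(2)[OF I v] by (simp add: q_def)
      qed
      then show "Re (hinner H (s v) v) \<le> Re (hinner H (t v) v)" using s(2)[OF v] by simp
    qed
  qed
  also have "\<dots> = (SUP F\<in>?I. Tr (A F))" by (simp add: image_image)
  also have "\<dots> = (SUP F\<in>?I. \<Sum>g\<in>F. Q (op_mult H (\<sigma> g p) y))" by (rule SUP_cong[OF refl A(3)])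
  finally show ?thesis by (simp add: Q_def s_def)
qed

text \<open>Finite trace puts p into \<open>L2\<close>. Convergence of the sum in the norm of
  \<open>L2\<close> is not contained in strong convergence on H; it comes from normality.\<close>

lemma fundamental_domain_partition:
  assumes \<sigma>: "vN_action G H M \<sigma>" and p: "fundamental_domain G H M \<sigma> p"
    and tp: "trace_preserving G H M Tr \<sigma>" and fin: "Tr p < \<infinity>"
  shows "p \<in> L2" "HA.partition (carrier G) (\<lambda>g. \<sigma> g p)"
proof -
  interpret A: isometric_action L2 "op_mult H" "adj H" ip G \<sigma> by (rule isometric_action_L2[OF \<sigma> tp])
  have p': "p \<in> M" "adj H p = p" "op_mult H p p = p"
    "\<And>g h. g \<in> carrier G \<Longrightarrow> h \<in> carrier G \<Longrightarrow> g \<noteq> h \<Longrightarrow> op_mult H (\<sigma> g p) (\<sigma> h p) = op_zero H"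
    using p unfolding fundamental_domain_def by auto
  show pL: "p \<in> L2" using p' fin by (simp add: L2_def Q_def)
  have e: "\<sigma> g p \<in> L2" "adj H (\<sigma> g p) = \<sigma> g p" "op_mult H (\<sigma> g p) (\<sigma> g p) = \<sigma> g p" if "g \<in> carrier G" for g
    using that pL p' by (auto simp flip: A.act_star A.act_mul)
  have orth: "ip (op_mult H (op_mult H x (\<sigma> g p)) (\<sigma> h p)) y = 0"
    if gh: "g \<in> carrier G" "h \<in> carrier G" "g \<noteq> h" and x: "x \<in> L2" "y \<in> L2" for g h x y
  proof -
    let ?z = "op_mult H (op_mult H x (\<sigma> g p)) (\<sigma> h p)"
    have z: "?z \<in> L2" using gh x e by simp
    have eM: "\<sigma> g p \<in> M" "\<sigma> h p \<in> M" "x \<in> M" using e(1)[OF gh(1)] e(1)[OF gh(2)] x L2_M by auto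
    have zv: "?z v = \<zero>" if v: "v \<in> carrier H" for v
    proof -
      have "?z v = x (op_mult H (\<sigma> g p) (\<sigma> h p) v)" using v eM by simp
      also have "\<dots> = x \<zero>" using p'(4)[OF gh] v by simp
      also have "\<dots> = \<zero>"
      proof -
        have "x (0 \<odot> \<zero>) = 0 \<odot> x \<zero>" by (rule bounded_opsD(3)[OF M_bdd[OF eM(3)]]) simp
        then show ?thesis using smult_l_null[of \<zero>] smult_l_null[of "x \<zero>"] eM(3) by simp
      qed
      finally show ?thesis .
    qed
    \<comment> \<open>The operator is zero, hence equal to its difference with itself, and linearity
      makes its inner product with everything vanish.\<close>
    have "lin ?z (-1) ?z = ?z"
    proof (rule M_ext)
      fix v assume v: "v \<in> carrier H"
      have "lin ?z (-1) ?z v = ?z v \<oplus> (-1) \<odot> ?z v" by (rule lin_apply[OF v])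
      then show "lin ?z (-1) ?z v = ?z v" unfolding zv[OF v] using smult_r_null[of "-1"] by simp
    qed (use z L2_M in auto)
    then have "ip ?z y = ip ?z y + (-1) * ip ?z y" using ip_lin[OF z z x(2), of "-1"] by simp
    then show ?thesis by simp
  qed
  have parseval: "((\<lambda>g. ip (op_mult H x (\<sigma> g p)) x) has_sum ip x x) (carrier G)" if x: "x \<in> L2" for x
  proof -
    let ?I = "{F. finite F \<and> F \<subseteq> carrier G}"
    \<comment> \<open>Normality concerned products with the projection on the left, whereas a
      partition has it on the right; the adjoint exchanges the sides and preserves norms.\<close>
    define y where "y = adj H x"
    have y: "y \<in> L2" using x by (simp add: y_def)
    have ey: "op_mult H (\<sigma> g p) y \<in> L2" if "g \<in> carrier G" for g using that e y by simp
    have "ennreal (r y) = (SUP F\<in>?I. \<Sum>g\<in>F. Q (op_mult H (\<sigma> g p) y))"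
      using Q_fundamental_domain[OF \<sigma> p L2_M[OF y]] ennreal_r[OF y] by simp
    also have "\<dots> = (SUP F\<in>?I. ennreal (\<Sum>g\<in>F. r (op_mult H (\<sigma> g p) y)))"
    proof (rule SUP_cong[OF refl])
      fix F assume "F \<in> ?I"
      then have "(\<Sum>g\<in>F. Q (op_mult H (\<sigma> g p) y)) = (\<Sum>g\<in>F. ennreal (r (op_mult H (\<sigma> g p) y)))"
        using ey ennreal_r by (intro sum.cong refl) auto
      then show "(\<Sum>g\<in>F. Q (op_mult H (\<sigma> g p) y)) = ennreal (\<Sum>g\<in>F. r (op_mult H (\<sigma> g p) y))" by simp
    qed
    finally have sup: "ennreal (r y) = (SUP F\<in>?I. ennreal (\<Sum>g\<in>F. r (op_mult H (\<sigma> g p) y)))" .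
    have "((\<lambda>g. r (op_mult H (\<sigma> g p) y)) has_sum r y) (carrier G)"
      unfolding has_sum_def
    proof (rule order_tendstoI)
      fix a assume a: "a < r y"
      show "\<forall>\<^sub>F F in finite_subsets_at_top (carrier G). a < (\<Sum>g\<in>F. r (op_mult H (\<sigma> g p) y))"
      \<comment> \<open>\<open>ennreal\<close> sends negative numbers to 0, so they cannot be
        compared there.\<close>
      proof (cases "a < 0")
        case True
        then show ?thesis
          by (intro eventually_finite_subsets_at_top_weakI) (meson r_nonneg sum_nonneg less_le_trans)
      next
        case False
        then have "ennreal a < (SUP F\<in>?I. ennreal (\<Sum>g\<in>F. r (op_mult H (\<sigma> g p) y)))"
          using a unfolding sup[symmetric] by (simp add: ennreal_lessI)
        then obtain F where F: "F \<in> ?I" "ennreal a < ennreal (\<Sum>g\<in>F. r (op_mult H (\<sigma> g p) y))"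
          unfolding less_SUP_iff by blast
        have aF: "a < (\<Sum>g\<in>F. r (op_mult H (\<sigma> g p) y))" using F(2) False by (simp add: ennreal_less_iff)
        show ?thesis
          unfolding eventually_finite_subsets_at_top
        proof (intro exI[of _ F] conjI allI impI)
          fix F' assume F': "finite F' \<and> F \<subseteq> F' \<and> F' \<subseteq> carrier G"
          have "(\<Sum>g\<in>F. r (op_mult H (\<sigma> g p) y)) \<le> (\<Sum>g\<in>F'. r (op_mult H (\<sigma> g p) y))"
            by (rule sum_mono2) (use F' in auto)
          then show "a < (\<Sum>g\<in>F'. r (op_mult H (\<sigma> g p) y))" using aF by simp
        qed (use F in auto)
      qed
    next
      fix a assume a: "r y < a"
      show "\<forall>\<^sub>F F in finite_subsets_at_top (carrier G). (\<Sum>g\<in>F. r (op_mult H (\<sigma> g p) y)) < a"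
      proof (rule eventually_finite_subsets_at_top_weakI)
        fix F assume "finite F" "F \<subseteq> carrier G"
        then have "ennreal (\<Sum>g\<in>F. r (op_mult H (\<sigma> g p) y)) \<le> ennreal (r y)"
          unfolding sup by (intro SUP_upper) simp
        then show "(\<Sum>g\<in>F. r (op_mult H (\<sigma> g p) y)) < a" using a by (simp add: ennreal_le_iff)
      qed
    qed
    then have "((\<lambda>g. complex_of_real (r (op_mult H (\<sigma> g p) y))) has_sum of_real (r y)) (carrier G)"
      by (rule has_sum_of_real)
    moreover have "complex_of_real (r (op_mult H (\<sigma> g p) y)) = ip (op_mult H x (\<sigma> g p)) x" if g: "g \<in> carrier G" for g
    proof -
      have M: "\<sigma> g p \<in> M" "x \<in> M" using e(1)[OF g] x L2_M by auto
      have xe: "op_mult H x (\<sigma> g p) \<in> L2" using e(1)[OF g] x by simp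
      have "adj H (op_mult H x (\<sigma> g p)) = op_mult H (\<sigma> g p) y"
        using M e(2)[OF g] by (simp add: adj_mult y_def)
      then have "r (op_mult H (\<sigma> g p) y) = r (op_mult H x (\<sigma> g p))" using r_adj[OF xe] by simp
      also have "of_real (r (op_mult H x (\<sigma> g p))) = ip (op_mult H x (\<sigma> g p)) (op_mult H x (\<sigma> g p))"
        by (rule ip_self_r[OF xe, symmetric])
      also have "\<dots> = ip (op_mult H (op_mult H x (\<sigma> g p)) (\<sigma> g p)) x"
        using ip_mult_right[OF M(1) xe x] e(2)[OF g] by simp
      also have "op_mult H (op_mult H x (\<sigma> g p)) (\<sigma> g p) = op_mult H x (\<sigma> g p)"
        using M e(3)[OF g] by (simp add: op_mult_assoc)
      finally show ?thesis .
    qed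
    ultimately have "((\<lambda>g. ip (op_mult H x (\<sigma> g p)) x) has_sum of_real (r y)) (carrier G)" by (simp cong: has_sum_cong)
    also have "complex_of_real (r y) = ip x x" using r_adj[OF x] ip_self_r[OF x] by (simp add: y_def)
    finally show ?thesis .
  qed
  show "HA.partition (carrier G) (\<lambda>g. \<sigma> g p)"
    unfolding HA.partition_def using e orth parseval by blast
qed

text \<open>Otherwise faithfulness of the trace makes p zero, hence all its translates; but these
  sum to the unit.\<close>

lemma fundamental_domain_nonzero:
  assumes \<sigma>: "vN_action G H M \<sigma>" and p: "fundamental_domain G H M \<sigma> p"
    and tp: "trace_preserving G H M Tr \<sigma>" and fin: "Tr p < \<infinity>" and nz: "op_one H \<noteq> op_zero H"
  shows "ip p p \<noteq> 0"
proof
  assume 0: "ip p p = 0"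
  interpret A: vN_action G H M \<sigma> by fact
  have p': "p \<in> M" "adj H p = p" "op_mult H p p = p"
    using p unfolding fundamental_domain_def by auto
  have pL: "p \<in> L2" by (rule fundamental_domain_partition(1)[OF \<sigma> p tp fin])
  have "r p = 0" using 0 ip_self_r[OF pL] by simp
  then have "Tr p = 0" using ennreal_r[OF pL] p' by (simp add: Q_def)
  moreover have "p \<in> pos_cone H M" using square_pos(1)[OF p'(1)] p' by simp
  ultimately have p0: "p = op_zero H" by (simp add: Tr_faithful)
  \<comment> \<open>Written as 0 times p, the zero operator is seen to be preserved in form by a
    linear map.\<close>
  have "op_scale H 0 p = p"
    by (rule M_ext) (use p' smult_l_null[of \<zero>] in \<open>auto simp: M_scale p0\<close>)
  then have \<sigma>0: "\<sigma> g p = op_scale H 0 (\<sigma> g p)" if "g \<in> carrier G" for g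
    using A.act_scale[OF that p'(1), of 0] by simp
  have "w = \<zero>" if w: "w \<in> carrier H" for w
  proof -
    have "hnorm H (\<sigma> g p w) = 0" if g: "g \<in> carrier G" for g
    proof -
      have "\<sigma> g p \<in> M" using A.surj_prop[OF g] p'(1) by auto
      then have x: "\<sigma> g p w \<in> carrier H" using w by simp
      have "\<sigma> g p w = 0 \<odot> \<sigma> g p w" using fun_cong[OF \<sigma>0[OF g], of w] w by simp
      then have "\<sigma> g p w = \<zero>" using smult_l_null[OF x] by simp
      then show ?thesis by (simp add: hnorm_def)
    qed
    then have "((\<lambda>g. 0) has_sum (hnorm H w)\<^sup>2) (carrier G)"
      using fundamental_domain_vector_has_sum[OF \<sigma> p w] by (simp cong: has_sum_cong)
    then have "(hnorm H w)\<^sup>2 = 0" using has_sum_unique has_sum_0_simp by blast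
    then show ?thesis using hnorm_zero_iff[OF w] by simp
  qed
  then have "op_one H = op_zero H" by (auto simp: op_one_def op_zero_def restrict_def)
  then show False using nz by simp
qed

end

lemma vN_equivalent_coupling:
  assumes "vN_equivalent TYPE('h) \<Gamma> \<Lambda>"
  shows "\<exists>(N :: ('h \<Rightarrow> 'h) set) mul star ip \<sigma> \<tau> p q. coupling N mul star ip \<Gamma> \<sigma> \<Lambda> \<tau> p q"
proof -
  obtain H :: "'h inner_module" and M Tr \<sigma> \<tau> p q where
    st: "semifinite_trace H M Tr" and nz: "op_one H \<noteq> op_zero H"
    and \<sigma>: "vN_action \<Gamma> H M \<sigma>" "trace_preserving \<Gamma> H M Tr \<sigma>"
    and \<tau>: "vN_action \<Lambda> H M \<tau>" "trace_preserving \<Lambda> H M Tr \<tau>"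
    and comm: "\<And>g l T. g \<in> carrier \<Gamma> \<Longrightarrow> l \<in> carrier \<Lambda> \<Longrightarrow> T \<in> M \<Longrightarrow> \<sigma> g (\<tau> l T) = \<tau> l (\<sigma> g T)"
    and p: "fundamental_domain \<Gamma> H M \<sigma> p" "Tr p < \<infinity>"
    and q: "fundamental_domain \<Lambda> H M \<tau> q" "Tr q < \<infinity>"
    using assms unfolding vN_equivalent_def by blast
  interpret semifinite_trace H M Tr by (rule st)
  note pp = fundamental_domain_partition[OF \<sigma>(1) p(1) \<sigma>(2) p(2)]
  note qq = fundamental_domain_partition[OF \<tau>(1) q(1) \<tau>(2) q(2)]
  have "coupling L2 (op_mult H) (adj H) ip \<Gamma> \<sigma> \<Lambda> \<tau> p q"
    unfolding coupling_def coupling_axioms_def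
    using isometric_action_L2[OF \<sigma>] isometric_action_L2[OF \<tau>] pp qq comm L2_M
      fundamental_domain_nonzero[OF \<sigma>(1) p(1) \<sigma>(2) p(2) nz] fundamental_domain_nonzero[OF \<tau>(1) q(1) \<tau>(2) q(2) nz]
    by simp
  then show ?thesis by blast
qed

section \<open>Representations associated with kernels\<close>

locale gns =
  fixes X :: "'i set" and k :: "'i \<Rightarrow> 'i \<Rightarrow> complex"
  assumes pos: "pos_kernel X k"
begin

definition Fin :: "('i \<Rightarrow> complex) set" where
  "Fin = {c. finite {i. c i \<noteq> 0} \<and> {i. c i \<noteq> 0} \<subseteq> X}"

text \<open>\<open>sesq\<close> needs an explicit finite index set; by \<open>B_eq\<close> every
  larger one gives the same value.\<close>

definition B :: "('i \<Rightarrow> complex) \<Rightarrow> ('i \<Rightarrow> complex) \<Rightarrow> complex" where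
  "B c d = sesq k ({i. c i \<noteq> 0} \<union> {i. d i \<noteq> 0}) c d"

text \<open>A single operation for sums, multiples and differences, the last with a = -1.\<close>

definition cm :: "('i \<Rightarrow> complex) \<Rightarrow> complex \<Rightarrow> ('i \<Rightarrow> complex) \<Rightarrow> 'i \<Rightarrow> complex" where
  "cm c a d = (\<lambda>i. c i + a * d i)"

definition \<delta> :: "'i \<Rightarrow> 'i \<Rightarrow> complex" where
  "\<delta> i = (\<lambda>j. if j = i then 1 else 0)"

lemma B_eq:
  assumes S: "finite S" "{i. c i \<noteq> 0} \<subseteq> S" "{i. d i \<noteq> 0} \<subseteq> S"
  shows "B c d = sesq k S c d"
proof -
  let ?U = "{i. c i \<noteq> 0} \<union> {i. d i \<noteq> 0}"
  have "(\<lambda>i. if i \<in> ?U then c i else 0) = c" "(\<lambda>i. if i \<in> ?U then d i else 0) = d" by auto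
  then show ?thesis using sesq_extend[of S ?U k c d] S by (simp add: B_def)
qed

lemma Fin_cm [simp]: "c \<in> Fin \<Longrightarrow> d \<in> Fin \<Longrightarrow> cm c a d \<in> Fin"
proof -
  assume cd: "c \<in> Fin" "d \<in> Fin"
  have "{i. cm c a d i \<noteq> 0} \<subseteq> {i. c i \<noteq> 0} \<union> {i. d i \<noteq> 0}" by (auto simp: cm_def)
  then show "cm c a d \<in> Fin" using cd unfolding Fin_def by (auto intro: finite_subset)
qed

lemma Fin_\<delta> [simp]: "i \<in> X \<Longrightarrow> \<delta> i \<in> Fin"
  by (simp add: Fin_def \<delta>_def)

lemma B_cm_left:
  assumes "c \<in> Fin" "d \<in> Fin" "e \<in> Fin"
  shows "B (cm c a d) e = B c e + a * B d e"
proof -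
  let ?S = "{i. c i \<noteq> 0} \<union> {i. d i \<noteq> 0} \<union> {i. e i \<noteq> 0}"
  have S: "finite ?S" using assms by (simp add: Fin_def)
  have "B (cm c a d) e = sesq k ?S (cm c a d) e" "B c e = sesq k ?S c e" "B d e = sesq k ?S d e"
    by (rule B_eq[OF S]; auto simp: cm_def)+
  moreover have "sesq k ?S (cm c a d) e = sesq k ?S c e + a * sesq k ?S d e"
    unfolding sesq_def cm_def sum_distrib_left sum.distrib[symmetric]
    by (intro sum.cong refl) (simp add: algebra_simps)
  ultimately show ?thesis by simp
qed

lemma B_herm: "c \<in> Fin \<Longrightarrow> d \<in> Fin \<Longrightarrow> B d c = cnj (B c d)"
  unfolding B_def by (subst Un_commute, rule sesq_cnj[OF pos]) (auto simp: Fin_def)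

lemma B_cm_right:
  assumes "c \<in> Fin" "d \<in> Fin" "e \<in> Fin"
  shows "B e (cm c a d) = B e c + cnj a * B e d"
  using B_cm_left[OF assms, of a] B_herm[of "cm c a d" e] B_herm[of c e] B_herm[of d e] assms by simp

lemma B_nonneg: "c \<in> Fin \<Longrightarrow> 0 \<le> Re (B c c)"
  unfolding B_def by (rule pos_kernelD(2)[OF pos]) (auto simp: Fin_def)

lemma pos_kernel_B: "pos_kernel Fin B"
proof (rule pos_kernelI_combination)
  fix c d a assume "c \<in> Fin" "d \<in> Fin"
  then show "\<exists>z\<in>Fin. \<forall>w\<in>Fin. B z w = B c w + a * B d w"
    by (intro bexI[of _ "cm c a d"]) (simp_all add: B_cm_left)
qed (erule B_herm B_nonneg; assumption)+

definition nB :: "('i \<Rightarrow> complex) \<Rightarrow> real" where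
  "nB c = sqrt (Re (B c c))"

lemma nB_nonneg [simp]: "c \<in> Fin \<Longrightarrow> 0 \<le> nB c"
  by (simp add: nB_def B_nonneg)

lemma nB_sq: "c \<in> Fin \<Longrightarrow> (nB c)\<^sup>2 = Re (B c c)"
  by (simp add: nB_def B_nonneg)

lemma B_CS:
  assumes "c \<in> Fin" "d \<in> Fin"
  shows "cmod (B c d) \<le> nB c * nB d"
proof (rule power2_le_imp_le)
  show "(cmod (B c d))\<^sup>2 \<le> (nB c * nB d)\<^sup>2"
    using pos_kernel_CS_point[OF pos_kernel_B assms] assms by (simp add: nB_sq power_mult_distrib)
qed (use assms in simp)

lemma nB_cm:
  assumes "c \<in> Fin" "d \<in> Fin"
  shows "nB (cm c a d) \<le> nB c + cmod a * nB d"
proof (rule power2_le_imp_le)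
  have "B (cm c a d) (cm c a d) = B c c + a * B d c + cnj a * B c d + (a * cnj a) * B d d"
    using assms by (simp add: B_cm_left B_cm_right algebra_simps)
  also have "\<dots> = B c c + cnj (cnj a * B c d) + cnj a * B c d + of_real ((cmod a)\<^sup>2) * B d d"
    using B_herm[OF assms] by (simp only: complex_norm_square complex_cnj_mult complex_cnj_cnj)
  finally have "(nB (cm c a d))\<^sup>2 = (nB c)\<^sup>2 + 2 * Re (cnj a * B c d) + (cmod a)\<^sup>2 * (nB d)\<^sup>2"
    using assms by (simp add: nB_sq del: of_real_power)
  moreover have "Re (cnj a * B c d) \<le> nB c * (cmod a * nB d)"
  proof -
    have "Re (cnj a * B c d) \<le> cmod (cnj a * B c d)" by (rule complex_Re_le_cmod)
    also have "\<dots> = cmod a * cmod (B c d)" by (simp add: norm_mult)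
    also have "\<dots> \<le> cmod a * (nB c * nB d)" by (intro mult_left_mono B_CS assms) simp
    finally show ?thesis by (simp only: mult.left_commute)
  qed
  ultimately show "(nB (cm c a d))\<^sup>2 \<le> (nB c + cmod a * nB d)\<^sup>2"
    unfolding power2_sum power_mult_distrib by linarith
qed (use assms in simp)

definition cauchy :: "(nat \<Rightarrow> 'i \<Rightarrow> complex) \<Rightarrow> bool" where
  "cauchy z \<longleftrightarrow> (\<forall>n. z n \<in> Fin) \<and> (\<forall>e>0. \<exists>N. \<forall>m\<ge>N. \<forall>n\<ge>N. nB (cm (z m) (-1) (z n)) < e)"

lemma cauchy_Fin [simp]: "cauchy z \<Longrightarrow> z n \<in> Fin"
  by (simp add: cauchy_def)

lemma cauchy_const: "c \<in> Fin \<Longrightarrow> cauchy (\<lambda>_. c)"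
proof -
  assume c: "c \<in> Fin"
  have "nB (cm c (-1) c) = 0" using c by (simp add: nB_def B_cm_left B_cm_right)
  then show ?thesis using c by (simp add: cauchy_def)
qed

lemma cauchy_cm:
  assumes z: "cauchy z" and w: "cauchy w"
  shows "cauchy (\<lambda>n. cm (z n) a (w n))"
  unfolding cauchy_def
proof (intro conjI allI impI)
  fix e :: real assume e: "e > 0"
  have e': "e / (2 * (cmod a + 1)) > 0" "e / 2 > 0" using e by (auto intro!: divide_pos_pos add_nonneg_pos)
  obtain N1 where N1: "\<forall>m\<ge>N1. \<forall>n\<ge>N1. nB (cm (z m) (-1) (z n)) < e / 2"
    using z e'(2) unfolding cauchy_def by blast
  obtain N2 where N2: "\<forall>m\<ge>N2. \<forall>n\<ge>N2. nB (cm (w m) (-1) (w n)) < e / (2 * (cmod a + 1))"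
    using w e'(1) unfolding cauchy_def by blast
  show "\<exists>N. \<forall>m\<ge>N. \<forall>n\<ge>N. nB (cm (cm (z m) a (w m)) (- 1) (cm (z n) a (w n))) < e"
  proof (intro exI[of _ "max N1 N2"] allI impI)
    fix m n assume mn: "max N1 N2 \<le> m" "max N1 N2 \<le> n"
    have "cm (cm (z m) a (w m)) (- 1) (cm (z n) a (w n)) = cm (cm (z m) (-1) (z n)) a (cm (w m) (-1) (w n))"
      by (simp add: cm_def algebra_simps)
    then have "nB (cm (cm (z m) a (w m)) (- 1) (cm (z n) a (w n))) \<le>
        nB (cm (z m) (-1) (z n)) + cmod a * nB (cm (w m) (-1) (w n))"
      using z w by (simp add: nB_cm)
    also have "cmod a * nB (cm (w m) (-1) (w n)) \<le> (cmod a + 1) * (e / (2 * (cmod a + 1)))"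
      using N2 mn w e' by (intro mult_mono) (auto intro: less_imp_le)
    also have "\<dots> = e / 2"
    proof -
      have "x * (e / (2 * x)) = e / 2" if "x > 0" for x using that by simp
      from this[of "cmod a + 1"] show ?thesis by (simp add: add_nonneg_pos)
    qed
    finally show "nB (cm (cm (z m) a (w m)) (- 1) (cm (z n) a (w n))) < e" using N1 mn by fastforce
  qed
qed (use z w in simp)

lemma cauchy_bounded:
  assumes z: "cauchy z"
  obtains K where "K > 0" "\<And>n. nB (z n) \<le> K"
proof -
  have d: "\<bar>nB c - nB d\<bar> \<le> nB (cm c (-1) d)" if cd: "c \<in> Fin" "d \<in> Fin" for c d
  proof -
    have "cm (cm c (-1) d) 1 d = c" "cm c (-1) (cm c (-1) d) = d" by (auto simp: cm_def)
    then show ?thesis using nB_cm[of "cm c (-1) d" d 1] nB_cm[of c "cm c (-1) d" "-1"] cd by auto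
  qed
  have "Cauchy (\<lambda>n. nB (z n))"
  proof (rule metric_CauchyI)
    fix e :: real assume "e > 0"
    then obtain N where N: "\<forall>m\<ge>N. \<forall>n\<ge>N. nB (cm (z m) (-1) (z n)) < e" using z unfolding cauchy_def by blast
    show "\<exists>M. \<forall>m\<ge>M. \<forall>n\<ge>M. dist (nB (z m)) (nB (z n)) < e"
    proof (intro exI[of _ N] allI impI)
      fix m n assume "N \<le> m" "N \<le> n"
      then have "nB (cm (z m) (-1) (z n)) < e" using N by blast
      then show "dist (nB (z m)) (nB (z n)) < e" using d[of "z m" "z n"] z by (simp add: dist_real_def)
    qed
  qed
  then have "Bseq (\<lambda>n. nB (z n))" by (simp add: Cauchy_Bseq)
  then obtain K where "K > 0" "\<forall>n. norm (nB (z n)) \<le> K" by (rule BseqE)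
  then show ?thesis using that[of K] by (metis abs_le_D1 real_norm_def)
qed

lemma B_convergent:
  assumes z: "cauchy z" and w: "cauchy w"
  shows "convergent (\<lambda>n. B (z n) (w n))"
proof -
  obtain K where K: "K > 0" "\<And>n. nB (z n) \<le> K" using cauchy_bounded[OF z] by blast
  obtain K' where K': "K' > 0" "\<And>n. nB (w n) \<le> K'" using cauchy_bounded[OF w] by blast
  have "Cauchy (\<lambda>n. B (z n) (w n))"
  proof (rule metric_CauchyI)
    fix e :: real assume e: "e > 0"
    obtain N1 where N1: "\<forall>m\<ge>N1. \<forall>n\<ge>N1. nB (cm (z m) (-1) (z n)) < e / (2 * K')"
      using z e K'(1) unfolding cauchy_def by (metis divide_pos_pos mult_pos_pos zero_less_numeral)
    obtain N2 where N2: "\<forall>m\<ge>N2. \<forall>n\<ge>N2. nB (cm (w m) (-1) (w n)) < e / (2 * K)"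
      using w e K(1) unfolding cauchy_def by (metis divide_pos_pos mult_pos_pos zero_less_numeral)
    show "\<exists>M. \<forall>m\<ge>M. \<forall>n\<ge>M. dist (B (z m) (w m)) (B (z n) (w n)) < e"
    proof (intro exI[of _ "max N1 N2"] allI impI)
      fix m n assume mn: "max N1 N2 \<le> m" "max N1 N2 \<le> n"
      let ?dz = "cm (z m) (-1) (z n)" and ?dw = "cm (w m) (-1) (w n)"
      have dF: "?dz \<in> Fin" "?dw \<in> Fin" using z w by auto
      have n1: "nB ?dz < e / (2 * K')" and n2: "nB ?dw < e / (2 * K)" using N1 N2 mn by auto
      have "B (z m) (w m) - B (z n) (w n) = B ?dz (w m) + B (z n) ?dw"
        using z w by (simp add: B_cm_left B_cm_right)
      then have "dist (B (z m) (w m)) (B (z n) (w n)) \<le> cmod (B ?dz (w m)) + cmod (B (z n) ?dw)"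
        by (simp add: dist_norm norm_triangle_ineq)
      also have "\<dots> \<le> nB ?dz * nB (w m) + nB (z n) * nB ?dw"
        using z w dF by (intro add_mono B_CS) auto
      also have "\<dots> \<le> nB ?dz * K' + K * nB ?dw"
        using K K' z w dF by (intro add_mono mult_mono) auto
      also have "\<dots> < e / (2 * K') * K' + K * (e / (2 * K))"
        using n1 n2 K(1) K'(1) by (intro add_strict_mono mult_strict_right_mono mult_strict_left_mono)
      also have "\<dots> = e" using K(1) K'(1) by simp
      finally show "dist (B (z m) (w m)) (B (z n) (w n)) < e" .
    qed
  qed
  then show ?thesis by (rule Cauchy_convergent)
qed

lemma B_expand:
  assumes "c \<in> Fin" "d \<in> Fin"
  shows "B c d = (\<Sum>j\<in>{j. d j \<noteq> 0}. cnj (d j) * B c (\<delta> j))"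
proof -
  let ?S = "{i. c i \<noteq> 0} \<union> {i. d i \<noteq> 0}"
  have S: "finite ?S" using assms by (simp add: Fin_def)
  have b: "B c (\<delta> j) = (\<Sum>i\<in>?S. c i * k i j)" if j: "j \<in> ?S" for j
  proof -
    have "B c (\<delta> j) = sesq k ?S c (\<delta> j)" by (rule B_eq[OF S]) (use j in \<open>auto simp: \<delta>_def\<close>)
    also have "\<dots> = (\<Sum>i\<in>?S. \<Sum>l\<in>?S. if l = j then c i * k i l else 0)"
      unfolding sesq_def \<delta>_def by (intro sum.cong refl) auto
    also have "\<dots> = (\<Sum>i\<in>?S. c i * k i j)" using j by (simp only: sum.delta[OF S] if_True)
    finally show ?thesis .
  qed
  have "B c d = (\<Sum>j\<in>?S. \<Sum>i\<in>?S. c i * cnj (d j) * k i j)"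
    unfolding B_def sesq_def by (rule sum.swap)
  also have "\<dots> = (\<Sum>j\<in>?S. cnj (d j) * B c (\<delta> j))"
  proof (rule sum.cong[OF refl])
    fix j assume "j \<in> ?S"
    then show "(\<Sum>i\<in>?S. c i * cnj (d j) * k i j) = cnj (d j) * B c (\<delta> j)"
      unfolding b[OF \<open>j \<in> ?S\<close>] sum_distrib_left by (intro sum.cong refl) simp
  qed
  also have "\<dots> = (\<Sum>j\<in>{j. d j \<noteq> 0}. cnj (d j) * B c (\<delta> j))"
    by (rule sum.mono_neutral_right[OF S]) auto
  finally show ?thesis .
qed

text \<open>A Cauchy sequence that tends to 0 against every point tends to 0 in norm: its squared
  norm at n is \<open>B (w n) (w N)\<close>, which tends to 0 in n, plus a term that is small for
  large N by the Cauchy property. So a vector of the completion is determined by its values at the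
  points.\<close>

lemma cauchy_null:
  assumes w: "cauchy w" and lim: "\<And>i. i \<in> X \<Longrightarrow> (\<lambda>n. B (w n) (\<delta> i)) \<longlonglongrightarrow> 0" and z: "cauchy z"
  shows "(\<lambda>n. B (w n) (z n)) \<longlonglongrightarrow> 0"
proof -
  obtain K where K: "K > 0" "\<And>n. nB (w n) \<le> K" using cauchy_bounded[OF w] by blast
  obtain K' where K': "K' > 0" "\<And>n. nB (z n) \<le> K'" using cauchy_bounded[OF z] by blast
  have fin: "(\<lambda>n. B (w n) d) \<longlonglongrightarrow> 0" if d: "d \<in> Fin" for d
  proof -
    have "(\<lambda>n. \<Sum>j\<in>{j. d j \<noteq> 0}. cnj (d j) * B (w n) (\<delta> j)) \<longlonglongrightarrow> (\<Sum>j\<in>{j. d j \<noteq> 0}. cnj (d j) * 0)"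
      using lim d by (intro tendsto_sum tendsto_mult_left) (auto simp: Fin_def)
    then show ?thesis using B_expand[OF _ d] w by simp
  qed
  have "(\<lambda>n. (nB (w n))\<^sup>2) \<longlonglongrightarrow> 0"
  proof (rule LIMSEQ_I)
    fix e :: real assume e: "e > 0"
    obtain N where N: "\<forall>m\<ge>N. \<forall>n\<ge>N. nB (cm (w m) (-1) (w n)) < e / (2 * K)"
      using w e K(1) unfolding cauchy_def by (metis divide_pos_pos mult_pos_pos zero_less_numeral)
    obtain N' where N': "\<forall>n\<ge>N'. norm (B (w n) (w N) - 0) < e / 2"
      using LIMSEQ_D[OF fin[of "w N"], of "e / 2"] w e by auto
    show "\<exists>M. \<forall>n\<ge>M. norm ((nB (w n))\<^sup>2 - 0) < e"
    proof (intro exI[of _ "max N N'"] allI impI)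
      fix n assume n: "max N N' \<le> n"
      let ?d = "cm (w n) (-1) (w N)"
      have d: "?d \<in> Fin" "nB ?d < e / (2 * K)" using w N n by auto
      have "B (w n) (w n) = B (w n) (w N) + B (w n) ?d" using w by (simp add: B_cm_right)
      then have "(nB (w n))\<^sup>2 = Re (B (w n) (w N)) + Re (B (w n) ?d)" using w by (simp add: nB_sq)
      also have "\<dots> \<le> cmod (B (w n) (w N)) + nB (w n) * nB ?d"
        using complex_Re_le_cmod[of "B (w n) (w N)"] complex_Re_le_cmod[of "B (w n) ?d"] B_CS[of "w n" ?d] w d by simp
      also have "\<dots> < e / 2 + K * (e / (2 * K))"
      proof (rule add_less_le_mono)
        show "cmod (B (w n) (w N)) < e / 2" using N' n by simp
        show "nB (w n) * nB ?d \<le> K * (e / (2 * K))" using K d w by (intro mult_mono) auto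
      qed
      also have "\<dots> = e" using K(1) by simp
      finally show "norm ((nB (w n))\<^sup>2 - 0) < e" by simp
    qed
  qed
  then have "(\<lambda>n. sqrt ((nB (w n))\<^sup>2)) \<longlonglongrightarrow> sqrt 0" by (rule tendsto_real_sqrt)
  then have "(\<lambda>n. nB (w n)) \<longlonglongrightarrow> 0" using w by simp
  from tendsto_mult_right[OF this, of K'] have 0: "(\<lambda>n. nB (w n) * K') \<longlonglongrightarrow> 0" by simp
  show ?thesis
  proof (rule Lim_null_comparison[OF always_eventually 0], rule allI)
    fix n
    have "norm (B (w n) (z n)) \<le> nB (w n) * nB (z n)" using B_CS w z by simp
    also have "\<dots> \<le> nB (w n) * K'" using K' w by (intro mult_left_mono) auto
    finally show "norm (B (w n) (z n)) \<le> nB (w n) * K'" .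
  qed
qed

text \<open>A vector of the completion is encoded by the function of its inner products with the points \<open>\<delta> i\<close>, which
  determines it; hence no quotient by null sequences is taken and the linear operations are pointwise.\<close>

definition ev :: "(nat \<Rightarrow> 'i \<Rightarrow> complex) \<Rightarrow> 'i \<Rightarrow> complex" where
  "ev z = (\<lambda>i. if i \<in> X then lim (\<lambda>n. B (z n) (\<delta> i)) else 0)"

lemma ev_tendsto: "cauchy z \<Longrightarrow> i \<in> X \<Longrightarrow> (\<lambda>n. B (z n) (\<delta> i)) \<longlonglongrightarrow> ev z i"
  using B_convergent[OF _ cauchy_const[OF Fin_\<delta>]] by (simp add: ev_def convergent_LIMSEQ_iff)

lemma ev_cm:
  assumes "cauchy z" "cauchy w"
  shows "ev (\<lambda>n. cm (z n) a (w n)) = (\<lambda>i. ev z i + a * ev w i)"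
proof
  fix i
  show "ev (\<lambda>n. cm (z n) a (w n)) i = ev z i + a * ev w i"
  proof (cases "i \<in> X")
    case True
    have "(\<lambda>n. B (z n) (\<delta> i) + a * B (w n) (\<delta> i)) \<longlonglongrightarrow> ev z i + a * ev w i"
      by (intro tendsto_intros ev_tendsto assms True)
    moreover have "(\<lambda>n. B (cm (z n) a (w n)) (\<delta> i)) \<longlonglongrightarrow> ev (\<lambda>n. cm (z n) a (w n)) i"
      by (intro ev_tendsto[OF _ True] cauchy_cm assms)
    ultimately show ?thesis using assms True by (simp add: B_cm_left LIMSEQ_unique)
  qed (simp add: ev_def)
qed

definition space :: "('i \<Rightarrow> complex) set" where
  "space = ev ` {z. cauchy z}"

text \<open>The choice of representatives is immaterial: by \<open>inner_tendsto\<close> any Cauchy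
  sequences representing f and g have this limit.\<close>

definition inner :: "('i \<Rightarrow> complex) \<Rightarrow> ('i \<Rightarrow> complex) \<Rightarrow> complex" where
  "inner f g = lim (\<lambda>n. B ((SOME z. cauchy z \<and> ev z = f) n) ((SOME z. cauchy z \<and> ev z = g) n))"

lemma spaceE:
  assumes "f \<in> space"
  obtains z where "cauchy z" "f = ev z"
  using assms by (auto simp: space_def)

lemma ev_eq_tendsto:
  assumes "cauchy z" "cauchy z'" "ev z = ev z'" "cauchy w"
  shows "(\<lambda>n. B (z n) (w n) - B (z' n) (w n)) \<longlonglongrightarrow> 0"
proof -
  have "(\<lambda>n. B (cm (z n) (-1) (z' n)) (w n)) \<longlonglongrightarrow> 0"
  proof (rule cauchy_null)
    fix i assume i: "i \<in> X"
    show "(\<lambda>n. B (cm (z n) (-1) (z' n)) (\<delta> i)) \<longlonglongrightarrow> 0"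
      using ev_tendsto[OF cauchy_cm[OF assms(1,2), of "-1"] i] ev_cm[OF assms(1,2), of "-1"] assms(3) by simp
  qed (use assms in \<open>auto intro: cauchy_cm\<close>)
  then show ?thesis using assms by (simp add: B_cm_left)
qed

lemma inner_tendsto:
  assumes z: "cauchy z" and w: "cauchy w"
  shows "(\<lambda>n. B (z n) (w n)) \<longlonglongrightarrow> inner (ev z) (ev w)"
proof -
  define z' where "z' = (SOME y. cauchy y \<and> ev y = ev z)"
  define w' where "w' = (SOME y. cauchy y \<and> ev y = ev w)"
  have z': "cauchy z'" "ev z' = ev z" unfolding z'_def using someI_ex[of "\<lambda>y. cauchy y \<and> ev y = ev z"] z by blast+
  have w': "cauchy w'" "ev w' = ev w" unfolding w'_def using someI_ex[of "\<lambda>y. cauchy y \<and> ev y = ev w"] w by blast+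
  have 1: "(\<lambda>n. B (z' n) (w' n)) \<longlonglongrightarrow> inner (ev z) (ev w)"
    using B_convergent[OF z'(1) w'(1)] unfolding inner_def z'_def w'_def by (simp add: convergent_LIMSEQ_iff)
  have 2: "(\<lambda>n. B (z n) (w n) - B (z' n) (w n)) \<longlonglongrightarrow> 0" using ev_eq_tendsto[OF z z'(1) _ w] z'(2) by simp
  have "(\<lambda>n. cnj (B (w n) (z' n) - B (w' n) (z' n))) \<longlonglongrightarrow> cnj 0"
    by (rule tendsto_cnj[OF ev_eq_tendsto[OF w w'(1) _ z'(1)]]) (simp add: w')
  then have 3: "(\<lambda>n. B (z' n) (w n) - B (z' n) (w' n)) \<longlonglongrightarrow> 0"
    using B_herm[of "w _" "z' _"] B_herm[of "w' _" "z' _"] w w' z' by simp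
  from tendsto_add[OF tendsto_add[OF 2 3] 1] show ?thesis by simp
qed

lemma space_cm: "f \<in> space \<Longrightarrow> g \<in> space \<Longrightarrow> (\<lambda>i. f i + a * g i) \<in> space"
  by (elim spaceE) (auto simp: space_def simp flip: ev_cm intro: cauchy_cm)

lemma inner_cm:
  assumes "f \<in> space" "g \<in> space" "h \<in> space"
  shows "inner (\<lambda>i. f i + a * g i) h = inner f h + a * inner g h"
proof -
  obtain x where x: "cauchy x" "f = ev x" using assms(1) by (rule spaceE)
  obtain y where y: "cauchy y" "g = ev y" using assms(2) by (rule spaceE)
  obtain z where z: "cauchy z" "h = ev z" using assms(3) by (rule spaceE)
  have "(\<lambda>n. B (cm (x n) a (y n)) (z n)) \<longlonglongrightarrow> inner (\<lambda>i. f i + a * g i) h"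
    using inner_tendsto[OF cauchy_cm[OF x(1) y(1), of a] z(1)] ev_cm[OF x(1) y(1), of a] x(2) y(2) z(2) by simp
  moreover have "(\<lambda>n. B (x n) (z n) + a * B (y n) (z n)) \<longlonglongrightarrow> inner f h + a * inner g h"
    unfolding x(2) y(2) z(2) by (intro tendsto_intros inner_tendsto x y z)
  ultimately show ?thesis using x y z by (simp add: B_cm_left LIMSEQ_unique)
qed

lemma inner_commute:
  assumes "f \<in> space" "g \<in> space"
  shows "inner g f = cnj (inner f g)"
proof -
  obtain x where x: "cauchy x" "f = ev x" using assms(1) by (rule spaceE)
  obtain y where y: "cauchy y" "g = ev y" using assms(2) by (rule spaceE)
  have "(\<lambda>n. B (y n) (x n)) = (\<lambda>n. cnj (B (x n) (y n)))" using x y by (intro ext B_herm) auto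
  then show ?thesis
    using tendsto_cnj[OF inner_tendsto[OF x(1) y(1)]] inner_tendsto[OF y(1) x(1)] x(2) y(2) by (simp add: LIMSEQ_unique)
qed

lemma inner_nonneg:
  assumes "f \<in> space"
  shows "0 \<le> Re (inner f f)"
proof -
  obtain x where x: "cauchy x" "f = ev x" using assms by (rule spaceE)
  show ?thesis
    using LIMSEQ_le_const[OF tendsto_Re[OF inner_tendsto[OF x(1) x(1)]], of 0] B_nonneg x by auto
qed

text \<open>The reproducing property: the completion is the Hilbert space of functions with
  reproducing kernel \<open>k\<close>.\<close>

lemma inner_point:
  assumes "f \<in> space" "i \<in> X"
  shows "inner f (ev (\<lambda>_. \<delta> i)) = f i"
proof -
  obtain x where x: "cauchy x" "f = ev x" using assms(1) by (rule spaceE)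
  show ?thesis
    using inner_tendsto[OF x(1) cauchy_const[OF Fin_\<delta>[OF assms(2)]]] ev_tendsto[OF x(1) assms(2)] x(2)
    by (simp add: LIMSEQ_unique)
qed

lemma space_outside: "f \<in> space \<Longrightarrow> i \<notin> X \<Longrightarrow> f i = 0"
  by (auto simp: space_def ev_def)

lemma point_space: "i \<in> X \<Longrightarrow> ev (\<lambda>_. \<delta> i) \<in> space"
  unfolding space_def by (intro imageI CollectI cauchy_const Fin_\<delta>)

lemma pos_kernel_inner: "pos_kernel space inner"
proof (rule pos_kernelI_combination)
  fix f g c assume "f \<in> space" "g \<in> space"
  then show "\<exists>z\<in>space. \<forall>w\<in>space. inner z w = inner f w + c * inner g w"
    by (intro bexI[of _ "\<lambda>i. f i + c * g i"]) (simp_all add: inner_cm space_cm)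
qed (erule inner_commute inner_nonneg; assumption)+

lemma inner_eq_zero:
  assumes f: "f \<in> space" and 0: "inner f f = 0"
  shows "f = (\<lambda>_. 0)"
proof
  fix i
  show "f i = 0"
  proof (cases "i \<in> X")
    case True
    have "(cmod (inner f (ev (\<lambda>_. \<delta> i))))\<^sup>2 \<le> Re (inner f f) * Re (inner (ev (\<lambda>_. \<delta> i)) (ev (\<lambda>_. \<delta> i)))"
      by (rule pos_kernel_CS_point[OF pos_kernel_inner f point_space[OF True]])
    then show ?thesis using 0 inner_point[OF f True] by simp
  qed (rule space_outside[OF f])
qed

definition nI :: "('i \<Rightarrow> complex) \<Rightarrow> real" where
  "nI f = sqrt (Re (inner f f))"

lemma nI_tendsto:
  assumes z: "cauchy z" and w: "cauchy w"
  shows "(\<lambda>n. nB (cm (z n) (-1) (w n))) \<longlonglongrightarrow> nI (\<lambda>i. ev z i - ev w i)"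
proof -
  have "(\<lambda>i. ev z i - ev w i) = ev (\<lambda>n. cm (z n) (-1) (w n))" using ev_cm[OF z w, of "-1"] by simp
  then show ?thesis unfolding nI_def nB_def
    using tendsto_real_sqrt[OF tendsto_Re[OF inner_tendsto[OF cauchy_cm[OF z w] cauchy_cm[OF z w], of "-1" "-1"]]] by simp
qed

lemma nI_triangle:
  assumes "f \<in> space" "g \<in> space" "h \<in> space"
  shows "nI (\<lambda>i. f i - h i) \<le> nI (\<lambda>i. f i - g i) + nI (\<lambda>i. g i - h i)"
proof -
  obtain x where x: "cauchy x" "f = ev x" using assms(1) by (rule spaceE)
  obtain y where y: "cauchy y" "g = ev y" using assms(2) by (rule spaceE)
  obtain z where z: "cauchy z" "h = ev z" using assms(3) by (rule spaceE)
  have le: "nB (cm (x n) (-1) (z n)) \<le> nB (cm (x n) (-1) (y n)) + nB (cm (y n) (-1) (z n))" for n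
  proof -
    have "cm (x n) (-1) (z n) = cm (cm (x n) (-1) (y n)) 1 (cm (y n) (-1) (z n))" by (simp add: cm_def)
    then show ?thesis using nB_cm[of "cm (x n) (-1) (y n)" "cm (y n) (-1) (z n)" 1] x y z by simp
  qed
  show ?thesis unfolding x(2) y(2) z(2)
    by (rule LIMSEQ_le[OF nI_tendsto[OF x(1) z(1)] tendsto_add[OF nI_tendsto[OF x(1) y(1)] nI_tendsto[OF y(1) z(1)]]])
      (use le in blast)
qed

lemma nI_commute:
  assumes "f \<in> space" "g \<in> space"
  shows "nI (\<lambda>i. f i - g i) = nI (\<lambda>i. g i - f i)"
proof -
  obtain x where x: "cauchy x" "f = ev x" using assms(1) by (rule spaceE)
  obtain y where y: "cauchy y" "g = ev y" using assms(2) by (rule spaceE)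
  have "nB (cm (x n) (-1) (y n)) = nB (cm (y n) (-1) (x n))" for n
    using x y by (simp add: nB_def B_cm_left B_cm_right algebra_simps)
  then show ?thesis using nI_tendsto[OF x(1) y(1)] nI_tendsto[OF y(1) x(1)] x(2) y(2) by (simp add: LIMSEQ_unique)
qed

text \<open>The n-th member is approximated within 1/(n+1) by an element of \<open>Fin\<close>.
  These approximations form a Cauchy sequence in \<open>Fin\<close>, and the vector that it
  represents is the limit.\<close>

lemma space_complete:
  assumes F: "\<And>n. F n \<in> space" and C: "\<And>e. e > 0 \<Longrightarrow> \<exists>N. \<forall>m\<ge>N. \<forall>n\<ge>N. nI (\<lambda>i. F m i - F n i) < e"
  shows "\<exists>l\<in>space. (\<lambda>n. nI (\<lambda>i. F n i - l i)) \<longlonglongrightarrow> 0"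
proof -
  have dense: "\<exists>c\<in>Fin. nI (\<lambda>i. f i - ev (\<lambda>_. c) i) < e" if f: "f \<in> space" and e: "e > 0" for f and e :: real
  proof -
    obtain x where x: "cauchy x" "f = ev x" using f by (rule spaceE)
    obtain N where N: "\<forall>m\<ge>N. \<forall>n\<ge>N. nB (cm (x m) (-1) (x n)) < e / 2"
      using x(1) e unfolding cauchy_def by (meson half_gt_zero)
    have "nI (\<lambda>i. ev x i - ev (\<lambda>_. x N) i) \<le> e / 2"
    proof (rule LIMSEQ_le_const2[OF nI_tendsto[OF x(1) cauchy_const]])
      show "x N \<in> Fin" using x by simp
      show "\<exists>M. \<forall>n\<ge>M. nB (cm (x n) (- 1) (x N)) \<le> e / 2" using N by (intro exI[of _ N]) (auto intro: less_imp_le)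
    qed
    then show ?thesis using x e by (intro bexI[of _ "x N"]) auto
  qed
  have "\<forall>n. \<exists>c. c \<in> Fin \<and> nI (\<lambda>i. F n i - ev (\<lambda>_. c) i) < 1 / real (Suc n)"
    using dense[OF F] by (simp add: Bex_def)
  then obtain c where c: "\<And>n. c n \<in> Fin" "\<And>n. nI (\<lambda>i. F n i - ev (\<lambda>_. c n) i) < 1 / real (Suc n)" by metis
  have sp: "ev (\<lambda>_. c n) \<in> space" for n unfolding space_def by (intro imageI CollectI cauchy_const c(1))
  have nBI: "nI (\<lambda>i. ev (\<lambda>_. c m) i - ev (\<lambda>_. c n) i) = nB (cm (c m) (-1) (c n))" for m n
    using nI_tendsto[OF cauchy_const[OF c(1)] cauchy_const[OF c(1)], of m n] by (simp add: LIMSEQ_const_iff)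
  have small: "\<exists>N. \<forall>n\<ge>N. 1 / real (Suc n) < e" if e0: "e > 0" for e :: real
  proof -
    obtain N where N: "1 / real (Suc N) < e" using reals_Archimedean[OF e0] by (auto simp: inverse_eq_divide)
    have "1 / real (Suc n) < e" if n: "n \<ge> N" for n
    proof -
      have "1 / real (Suc n) \<le> 1 / real (Suc N)" using n by (intro divide_left_mono) auto
      then show ?thesis using N by simp
    qed
    then show ?thesis by blast
  qed
  have cau: "cauchy c"
    unfolding cauchy_def
  proof (intro conjI allI impI c(1))
    fix e :: real assume e: "e > 0"
    obtain N1 where N1: "\<forall>m\<ge>N1. \<forall>n\<ge>N1. nI (\<lambda>i. F m i - F n i) < e / 3" using C[of "e / 3"] e by auto
    obtain N2 where N2: "\<forall>n\<ge>N2. 1 / real (Suc n) < e / 3" using small[of "e / 3"] e by auto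
    show "\<exists>N. \<forall>m\<ge>N. \<forall>n\<ge>N. nB (cm (c m) (- 1) (c n)) < e"
    proof (intro exI[of _ "max N1 N2"] allI impI)
      fix m n assume mn: "max N1 N2 \<le> m" "max N1 N2 \<le> n"
      have "nI (\<lambda>i. ev (\<lambda>_. c m) i - ev (\<lambda>_. c n) i) \<le> nI (\<lambda>i. ev (\<lambda>_. c m) i - F m i) + nI (\<lambda>i. F m i - ev (\<lambda>_. c n) i)"
        by (rule nI_triangle[OF sp F sp])
      also have "nI (\<lambda>i. F m i - ev (\<lambda>_. c n) i) \<le> nI (\<lambda>i. F m i - F n i) + nI (\<lambda>i. F n i - ev (\<lambda>_. c n) i)"
        by (rule nI_triangle[OF F F sp])
      also have "nI (\<lambda>i. ev (\<lambda>_. c m) i - F m i) = nI (\<lambda>i. F m i - ev (\<lambda>_. c m) i)" by (rule nI_commute[OF sp F])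
      finally show "nB (cm (c m) (- 1) (c n)) < e"
        using N1[rule_format, of m n] N2[rule_format, of m] N2[rule_format, of n] c(2)[of m] c(2)[of n] mn by (simp add: nBI)
    qed
  qed
  define l where "l = ev c"
  have l: "l \<in> space" unfolding l_def space_def by (intro imageI CollectI cau)
  have "(\<lambda>n. nI (\<lambda>i. F n i - l i)) \<longlonglongrightarrow> 0"
  proof (rule LIMSEQ_I)
    fix e :: real assume e: "e > 0"
    obtain N1 where N1: "\<forall>m\<ge>N1. \<forall>n\<ge>N1. nB (cm (c m) (- 1) (c n)) < e / 3"
      using cau e unfolding cauchy_def by (metis divide_pos_pos zero_less_numeral)
    obtain N2 where N2: "\<forall>n\<ge>N2. 1 / real (Suc n) < e / 3" using small[of "e / 3"] e by auto
    show "\<exists>M. \<forall>n\<ge>M. norm (nI (\<lambda>i. F n i - l i) - 0) < e"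
    proof (intro exI[of _ "max N1 N2"] allI impI)
      fix n assume n: "max N1 N2 \<le> n"
      have "nI (\<lambda>i. F n i - l i) \<le> nI (\<lambda>i. F n i - ev (\<lambda>_. c n) i) + nI (\<lambda>i. ev (\<lambda>_. c n) i - l i)"
        by (rule nI_triangle[OF F sp l])
      also have "nI (\<lambda>i. ev (\<lambda>_. c n) i - l i) \<le> e / 3"
        unfolding l_def
      proof (rule LIMSEQ_le_const2[OF nI_tendsto[OF cauchy_const[OF c(1)] cau]])
        show "\<exists>M. \<forall>m\<ge>M. nB (cm (c n) (- 1) (c m)) \<le> e / 3" using N1 n by (intro exI[of _ N1]) (auto intro: less_imp_le)
      qed
      finally have "nI (\<lambda>i. F n i - l i) < e" using c(2)[of n] N2[rule_format, of n] n e by simp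
      moreover have "0 \<le> nI (\<lambda>i. F n i - l i)"
        using inner_nonneg[OF space_cm[OF F l, of n "-1"]] by (simp add: nI_def)
      ultimately show "norm (nI (\<lambda>i. F n i - l i) - 0) < e" by simp
    qed
  qed
  then show ?thesis using l by blast
qed

definition Hil :: "('i \<Rightarrow> complex) inner_module" where
  "Hil = \<lparr>carrier = space, monoid.mult = (\<lambda>f g. undefined), one = undefined, zero = (\<lambda>_. 0), add = (\<lambda>f g i. f i + g i),
    module.smult = (\<lambda>a f i. a * f i), hinner = inner\<rparr>"

lemma Hil_simps [simp]:
  "carrier Hil = space" "\<zero>\<^bsub>Hil\<^esub> = (\<lambda>_. 0)" "f \<oplus>\<^bsub>Hil\<^esub> g = (\<lambda>i. f i + g i)" "a \<odot>\<^bsub>Hil\<^esub> f = (\<lambda>i. a * f i)"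
  "hinner Hil = inner"
  by (simp_all add: Hil_def)

lemma zero_space: "(\<lambda>_. 0) \<in> space"
proof -
  have "(\<lambda>_. 0) \<in> Fin" by (simp add: Fin_def)
  then have c: "cauchy (\<lambda>_ _. 0)" by (rule cauchy_const)
  have "ev (\<lambda>_ _. 0) = (\<lambda>_. 0)" by (auto simp: ev_def B_def sesq_def)
  moreover have "ev (\<lambda>_ _. 0) \<in> space" unfolding space_def by (intro imageI CollectI c)
  ultimately show ?thesis by simp
qed

lemma add_space: "f \<in> space \<Longrightarrow> g \<in> space \<Longrightarrow> (\<lambda>i. f i + g i) \<in> space"
  using space_cm[of f g 1] by simp

lemma smult_space: "f \<in> space \<Longrightarrow> (\<lambda>i. a * f i) \<in> space"
  using space_cm[OF zero_space, of f a] by simp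

lemma inner_zero: "f \<in> space \<Longrightarrow> inner (\<lambda>_. 0) f = 0"
  using inner_cm[OF zero_space zero_space, of f "-1"] by simp

lemma module_Hil: "Module.module complex_ring Hil"
proof (rule moduleI)
  show "cring complex_ring" by (rule cring_complex_ring)
  show "abelian_group Hil"
  proof (rule abelian_groupI)
    fix f assume "f \<in> carrier Hil"
    then show "\<exists>g\<in>carrier Hil. g \<oplus>\<^bsub>Hil\<^esub> f = \<zero>\<^bsub>Hil\<^esub>"
      using smult_space[of f "-1"] by (intro bexI[of _ "\<lambda>i. (-1) * f i"]) simp_all
  qed (auto simp: add_space zero_space algebra_simps)
qed (auto simp: smult_space algebra_simps)

lemma a_minus_Hil: "f \<in> space \<Longrightarrow> g \<in> space \<Longrightarrow> f \<ominus>\<^bsub>Hil\<^esub> g = (\<lambda>i. f i - g i)"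
proof -
  assume f: "f \<in> space" and g: "g \<in> space"
  interpret Module.module complex_ring Hil by (rule module_Hil)
  have "\<ominus>\<^bsub>Hil\<^esub> g = (\<lambda>i. - g i)"
    using smult_space[OF g, of "-1"] g by (intro M.minus_equality) simp_all
  then show ?thesis by (simp add: a_minus_def)
qed

lemma hilbert_space_Hil: "hilbert_space Hil"
proof (intro hilbert_space.intro hilbert_space_axioms.intro)
  show "Module.module complex_ring Hil" by (rule module_Hil)
  fix f g assume f: "f \<in> carrier Hil" and g: "g \<in> carrier Hil"
  show "hinner Hil (f \<oplus>\<^bsub>Hil\<^esub> g) h = hinner Hil f h + hinner Hil g h" if "h \<in> carrier Hil" for h
    using inner_cm[of f g h 1] f g that by simp
  show "hinner Hil (a \<odot>\<^bsub>Hil\<^esub> f) g = a * hinner Hil f g" for a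
    using inner_cm[OF zero_space, of f g a] inner_zero f g by simp
  show "hinner Hil g f = cnj (hinner Hil f g)" using inner_commute[of f g] f g by simp
next
  fix f assume f: "f \<in> carrier Hil"
  show "0 \<le> Re (hinner Hil f f)" using inner_nonneg f by simp
  show "f = \<zero>\<^bsub>Hil\<^esub>" if "hinner Hil f f = 0" using inner_eq_zero f that by simp
next
  fix F :: "nat \<Rightarrow> 'i \<Rightarrow> complex"
  assume F: "\<And>n. F n \<in> carrier Hil"
    and C: "\<And>e. e > 0 \<Longrightarrow> \<exists>N. \<forall>m\<ge>N. \<forall>n\<ge>N. hnorm Hil (F m \<ominus>\<^bsub>Hil\<^esub> F n) < e"
  have n: "hnorm Hil (f \<ominus>\<^bsub>Hil\<^esub> g) = nI (\<lambda>i. f i - g i)" if "f \<in> space" "g \<in> space" for f g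
    using that by (simp add: hnorm_def nI_def a_minus_Hil)
  have "\<exists>l\<in>space. (\<lambda>n. nI (\<lambda>i. F n i - l i)) \<longlonglongrightarrow> 0"
    using C F by (intro space_complete) (simp_all add: n)
  then show "\<exists>l\<in>carrier Hil. (\<lambda>n. hnorm Hil (F n \<ominus>\<^bsub>Hil\<^esub> l)) \<longlonglongrightarrow> 0"
    using F by (auto simp: n)
qed

end

section \<open>Unitary representations from invariant kernels\<close>

lemma group_actionI:
  assumes G: "group G"
    and ext: "\<And>g. g \<in> carrier G \<Longrightarrow> \<pi> g \<in> extensional E"
    and closed: "\<And>g x. g \<in> carrier G \<Longrightarrow> x \<in> E \<Longrightarrow> \<pi> g x \<in> E"
    and comp: "\<And>g h x. g \<in> carrier G \<Longrightarrow> h \<in> carrier G \<Longrightarrow> x \<in> E \<Longrightarrow> \<pi> (g \<otimes>\<^bsub>G\<^esub> h) x = \<pi> g (\<pi> h x)"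
    and one: "\<And>x. x \<in> E \<Longrightarrow> \<pi> \<one>\<^bsub>G\<^esub> x = x"
  shows "group_action G E \<pi>"
proof -
  interpret group G by (rule G)
  have Bij: "\<pi> g \<in> Bij E" if g: "g \<in> carrier G" for g
  proof -
    have "bij_betw (\<pi> g) E E"
    proof (rule bij_betwI[where g = "\<pi> (inv\<^bsub>G\<^esub> g)"])
      show "\<pi> (inv\<^bsub>G\<^esub> g) (\<pi> g x) = x" if "x \<in> E" for x using comp[of "inv\<^bsub>G\<^esub> g" g x] one that g by simp
      show "\<pi> g (\<pi> (inv\<^bsub>G\<^esub> g) x) = x" if "x \<in> E" for x using comp[of g "inv\<^bsub>G\<^esub> g" x] one that g by simp
    qed (use closed g in auto)
    then show ?thesis using ext[OF g] by (simp add: Bij_def)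
  qed
  have "\<pi> \<in> hom G (BijGroup E)"
  proof (rule homI)
    fix g h assume gh: "g \<in> carrier G" "h \<in> carrier G"
    have "\<pi> (g \<otimes>\<^bsub>G\<^esub> h) = compose E (\<pi> g) (\<pi> h)"
      using ext[of "g \<otimes>\<^bsub>G\<^esub> h"] gh by (intro extensionalityI[of _ E]) (auto simp: compose_def comp)
    then show "\<pi> (g \<otimes>\<^bsub>G\<^esub> h) = \<pi> g \<otimes>\<^bsub>BijGroup E\<^esub> \<pi> h" using Bij gh by (simp add: BijGroup_def)
  qed (use Bij in \<open>simp add: BijGroup_def\<close>)
  then show ?thesis
    by (intro group_action.intro group_hom.intro group_hom_axioms.intro G group_BijGroup)
qed

locale gns_action = gns X k + group G
  for X :: "'i set" and k and G :: "'g monoid" (structure) +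
  fixes act :: "'g \<Rightarrow> 'i \<Rightarrow> 'i"
  assumes act_closed [simp]: "g \<in> carrier G \<Longrightarrow> i \<in> X \<Longrightarrow> act g i \<in> X"
    and act_comp: "g \<in> carrier G \<Longrightarrow> h \<in> carrier G \<Longrightarrow> i \<in> X \<Longrightarrow> act (g \<otimes> h) i = act g (act h i)"
    and act_one: "i \<in> X \<Longrightarrow> act \<one> i = i"
    and act_kernel: "g \<in> carrier G \<Longrightarrow> i \<in> X \<Longrightarrow> j \<in> X \<Longrightarrow> k (act g i) (act g j) = k i j"
begin

lemma act_inv: "g \<in> carrier G \<Longrightarrow> i \<in> X \<Longrightarrow> act g (act (inv g) i) = i"
  "g \<in> carrier G \<Longrightarrow> i \<in> X \<Longrightarrow> act (inv g) (act g i) = i"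
  by (simp_all flip: act_comp add: act_one)

lemma act_inj: "g \<in> carrier G \<Longrightarrow> inj_on (act g) X"
  by (rule inj_on_inverseI[where g = "act (inv g)"]) (simp add: act_inv)

text \<open>The same formula acts on coefficients in \<open>Fin\<close> and on vectors of the
  completion; invariance of the kernel makes the two actions compatible, see
  \<open>ev_shift\<close>.\<close>

definition shift :: "'g \<Rightarrow> ('i \<Rightarrow> complex) \<Rightarrow> 'i \<Rightarrow> complex" where
  "shift g f = (\<lambda>i. if i \<in> X then f (act (inv g) i) else 0)"

lemma shift_act: "g \<in> carrier G \<Longrightarrow> i \<in> X \<Longrightarrow> shift g f (act g i) = f i"
  by (simp add: shift_def act_inv)

lemma shift_support:
  assumes "g \<in> carrier G" "{i. c i \<noteq> 0} \<subseteq> S" "S \<subseteq> X"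
  shows "{i. shift g c i \<noteq> 0} \<subseteq> act g ` S"
proof
  fix i assume "i \<in> {i. shift g c i \<noteq> 0}"
  then have i: "i \<in> X" "c (act (inv g) i) \<noteq> 0" by (auto simp: shift_def split: if_splits)
  then have "act (inv g) i \<in> S" using assms by auto
  then show "i \<in> act g ` S" using i act_inv(1)[OF assms(1) i(1)] by (metis imageI)
qed

lemma shift_Fin:
  assumes g: "g \<in> carrier G" and c: "c \<in> Fin"
  shows "shift g c \<in> Fin"
proof -
  have S: "finite {i. c i \<noteq> 0}" "{i. c i \<noteq> 0} \<subseteq> X" using c by (auto simp: Fin_def)
  have "{i. shift g c i \<noteq> 0} \<subseteq> act g ` {i. c i \<noteq> 0}" by (rule shift_support[OF g order_refl S(2)])
  moreover have "act g ` {i. c i \<noteq> 0} \<subseteq> X" using S(2) g by auto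
  ultimately show ?thesis using S(1) unfolding Fin_def by (auto intro: finite_subset)
qed

lemma shift_shift: "g \<in> carrier G \<Longrightarrow> h \<in> carrier G \<Longrightarrow> shift (g \<otimes> h) f = shift g (shift h f)"
  by (auto simp: shift_def inv_mult_group act_comp)

lemma B_shift:
  assumes g: "g \<in> carrier G" and c: "c \<in> Fin" and d: "d \<in> Fin"
  shows "B (shift g c) (shift g d) = B c d"
proof -
  let ?S = "{i. c i \<noteq> 0} \<union> {i. d i \<noteq> 0}"
  have S: "finite ?S" "?S \<subseteq> X" using c d by (auto simp: Fin_def)
  have inj: "inj_on (act g) ?S" using act_inj[OF g] S(2) by (rule inj_on_subset)
  have "B (shift g c) (shift g d) = sesq k (act g ` ?S) (shift g c) (shift g d)"
    by (intro B_eq finite_imageI S(1) shift_support[OF g _ S(2)]) auto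
  also have "\<dots> = (\<Sum>i\<in>?S. \<Sum>j\<in>?S. shift g c (act g i) * cnj (shift g d (act g j)) * k (act g i) (act g j))"
    unfolding sesq_def by (simp only: sum.reindex[OF inj] o_def)
  also have "\<dots> = B c d"
    unfolding B_def sesq_def
  proof (intro sum.cong refl)
    fix i j assume "i \<in> ?S" "j \<in> ?S"
    then have "i \<in> X" "j \<in> X" using S(2) by auto
    then show "shift g c (act g i) * cnj (shift g d (act g j)) * k (act g i) (act g j) = c i * cnj (d j) * k i j"
      using g by (simp add: shift_act act_kernel)
  qed
  finally show ?thesis .
qed

lemma shift_cm: "shift g (cm c a d) = cm (shift g c) a (shift g d)"
  by (auto simp: shift_def cm_def)

lemma shift_cauchy:
  assumes g: "g \<in> carrier G" and z: "cauchy z"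
  shows "cauchy (\<lambda>n. shift g (z n))"
proof -
  have "nB (cm (shift g (z m)) (-1) (shift g (z n))) = nB (cm (z m) (-1) (z n))" for m n
    using B_shift[OF g, of "cm (z m) (-1) (z n)" "cm (z m) (-1) (z n)"] z by (simp add: nB_def shift_cm)
  then show ?thesis using z shift_Fin[OF g] unfolding cauchy_def by simp
qed

lemma shift_\<delta>:
  assumes "g \<in> carrier G" "i \<in> X"
  shows "shift g (\<delta> i) = \<delta> (act g i)"
proof
  fix j
  show "shift g (\<delta> i) j = \<delta> (act g i) j"
  proof (cases "j \<in> X")
    case True
    have "act (inv g) j = i \<longleftrightarrow> j = act g i"
      using act_inv[OF assms(1) True] act_inv[OF assms] by metis
    then show ?thesis using True by (simp add: shift_def \<delta>_def)
  next
    case False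
    then have "j \<noteq> act g i" using assms act_closed by metis
    then show ?thesis using False by (simp add: shift_def \<delta>_def)
  qed
qed

lemma ev_shift:
  assumes g: "g \<in> carrier G" and z: "cauchy z"
  shows "ev (\<lambda>n. shift g (z n)) = shift g (ev z)"
proof
  fix i
  show "ev (\<lambda>n. shift g (z n)) i = shift g (ev z) i"
  proof (cases "i \<in> X")
    case True
    have j: "act (inv g) i \<in> X" using True g by simp
    have "\<delta> i = shift g (\<delta> (act (inv g) i))" using shift_\<delta>[OF g j] act_inv(1)[OF g True] by simp
    then have "B (shift g (z n)) (\<delta> i) = B (z n) (\<delta> (act (inv g) i))" for n
      using B_shift[OF g, of "z n" "\<delta> (act (inv g) i)"] z j by simp
    then show ?thesis using True j by (simp add: ev_def shift_def)
  qed (simp add: ev_def shift_def)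
qed

lemma shift_space: "g \<in> carrier G \<Longrightarrow> f \<in> space \<Longrightarrow> shift g f \<in> space"
  by (elim spaceE) (simp add: space_def flip: ev_shift, intro imageI CollectI shift_cauchy)

lemma inner_shift:
  assumes g: "g \<in> carrier G" and f: "f \<in> space" and h: "h \<in> space"
  shows "inner (shift g f) (shift g h) = inner f h"
proof -
  obtain x where x: "cauchy x" "f = ev x" using f by (rule spaceE)
  obtain y where y: "cauchy y" "h = ev y" using h by (rule spaceE)
  have "(\<lambda>n. B (x n) (y n)) \<longlonglongrightarrow> inner (shift g f) (shift g h)"
    using inner_tendsto[OF shift_cauchy[OF g x(1)] shift_cauchy[OF g y(1)]] ev_shift[OF g] x y
    by (simp add: B_shift[OF g])
  then show ?thesis using inner_tendsto[OF x(1) y(1)] x(2) y(2) by (simp add: LIMSEQ_unique)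
qed

definition rep :: "'g \<Rightarrow> ('i \<Rightarrow> complex) \<Rightarrow> 'i \<Rightarrow> complex" where
  "rep g = (\<lambda>f\<in>space. shift g f)"

lemma unitary_rep_Hil: "unitary_rep G Hil rep"
proof (intro unitary_rep.intro unitary_rep_axioms.intro)
  show H: "hilbert_space Hil" by (rule hilbert_space_Hil)
  show "group_action G (carrier Hil) rep"
  proof (rule group_actionI)
    show "rep (g \<otimes> h) x = rep g (rep h x)" if "g \<in> carrier G" "h \<in> carrier G" "x \<in> carrier Hil" for g h x
      using that by (simp add: rep_def shift_space shift_shift)
    show "rep \<one> x = x" if "x \<in> carrier Hil" for x
      using that space_outside[of x] by (auto simp: rep_def shift_def act_one)
  qed (auto simp: rep_def shift_space is_group)
  show "rep g \<in> bounded_ops Hil" if g: "g \<in> carrier G" for g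
    unfolding bounded_ops_def
  proof (intro CollectI conjI ballI allI exI[of _ 1])
    show "rep g \<in> carrier Hil \<rightarrow>\<^sub>E carrier Hil" using shift_space[OF g] by (simp add: rep_def)
    show "rep g (x \<oplus>\<^bsub>Hil\<^esub> y) = rep g x \<oplus>\<^bsub>Hil\<^esub> rep g y" if "x \<in> carrier Hil" "y \<in> carrier Hil" for x y
      using that by (auto simp: rep_def shift_def add_space)
    show "rep g (a \<odot>\<^bsub>Hil\<^esub> x) = a \<odot>\<^bsub>Hil\<^esub> rep g x" if "x \<in> carrier Hil" for a x
      using that by (auto simp: rep_def shift_def smult_space)
    show "hnorm Hil (rep g x) \<le> 1 * hnorm Hil x" if "x \<in> carrier Hil" for x
      using that g by (simp add: hnorm_def rep_def inner_shift)
  qed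
  show "hinner Hil (rep g x) (rep g y) = hinner Hil x y"
    if "g \<in> carrier G" "x \<in> carrier Hil" "y \<in> carrier Hil" for g x y
    using that by (simp add: rep_def inner_shift)
qed

definition pt :: "'i \<Rightarrow> 'i \<Rightarrow> complex" where
  "pt i = ev (\<lambda>_. \<delta> i)"

lemma pt_in: "i \<in> X \<Longrightarrow> pt i \<in> carrier Hil"
  by (simp add: pt_def point_space)

lemma hinner_pt: "f \<in> carrier Hil \<Longrightarrow> i \<in> X \<Longrightarrow> hinner Hil f (pt i) = f i"
  by (simp add: pt_def inner_point)

lemma pt_kernel:
  assumes "i \<in> X" "j \<in> X"
  shows "hinner Hil (pt i) (pt j) = k i j"
proof -
  have "(\<lambda>n :: nat. B (\<delta> i) (\<delta> j)) \<longlonglongrightarrow> hinner Hil (pt i) (pt j)"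
    using inner_tendsto[OF cauchy_const[OF Fin_\<delta>[OF assms(1)]] cauchy_const[OF Fin_\<delta>[OF assms(2)]]] by (simp add: pt_def)
  moreover have "B (\<delta> i) (\<delta> j) = sesq k {i, j} (\<delta> i) (\<delta> j)" by (rule B_eq) (auto simp: \<delta>_def)
  moreover have "sesq k {i, j} (\<delta> i) (\<delta> j) = k i j" by (cases "i = j") (auto simp: sesq_def \<delta>_def)
  ultimately show ?thesis by (simp add: LIMSEQ_const_iff)
qed

lemma rep_pt: "g \<in> carrier G \<Longrightarrow> i \<in> X \<Longrightarrow> rep g (pt i) = pt (act g i)"
  using ev_shift[of g "\<lambda>_. \<delta> i"] by (simp add: rep_def pt_def point_space shift_\<delta> cauchy_const)

end

text \<open>Each real number is coded by a set of naturals, and countably many such sets are packed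
  into one, so sequences of complex numbers inject into the continuum.\<close>

lemma nat_complex_inj: "\<exists>\<iota> :: (nat \<Rightarrow> complex) \<Rightarrow> complex. inj \<iota>"
proof -
  have "(UNIV :: nat set set) \<approx> (UNIV :: real set)" by (rule nat_sets_eqpoll_reals)
  then obtain b :: "nat set \<Rightarrow> real" where b: "bij b" unfolding eqpoll_def by blast
  define e where "e = inv_into UNIV b"
  have e: "inj e" using b by (simp add: e_def bij_is_surj surj_imp_inj_inv)
  \<comment> \<open>The outer component is the position in the sequence; the tags 0 and 1 separate
    real and imaginary parts.\<close>
  define F where "F f = {prod_encode (n, prod_encode (0, m)) | n m. m \<in> e (Re (f n))} \<union>
      {prod_encode (n, prod_encode (1, m)) | n m. m \<in> e (Im (f n))}" for f :: "nat \<Rightarrow> complex"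
  have F: "m \<in> e (Re (f n)) \<longleftrightarrow> prod_encode (n, prod_encode (0, m)) \<in> F f"
    "m \<in> e (Im (f n)) \<longleftrightarrow> prod_encode (n, prod_encode (1, m)) \<in> F f" for f n m
    by (auto simp: F_def)
  have "inj F"
  proof (rule injI)
    fix f g assume "F f = F g"
    then have "e (Re (f n)) = e (Re (g n))" "e (Im (f n)) = e (Im (g n))" for n using F by blast+
    then show "f = g" using e by (auto simp: complex_eq_iff inj_def)
  qed
  then have "inj (\<lambda>f. complex_of_real (b (F f)))" using b by (auto simp: inj_def bij_def)
  then show ?thesis by blast
qed

text \<open>The complex line through a nonzero vector already gives the type at least the
  cardinality of the continuum, which is enough for all complex functions on a countable set. This
  bridges the fixed universe of \<open>property_T\<close>.\<close>

lemma (in hilbert_space) function_space_inj: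
  assumes x: "x \<in> carrier H" "x \<noteq> \<zero>" and X: "countable X"
  shows "\<exists>\<iota> :: ('i \<Rightarrow> complex) \<Rightarrow> 'h. inj_on \<iota> {f. \<forall>i. i \<notin> X \<longrightarrow> f i = 0}"
proof -
  obtain \<iota>0 :: "(nat \<Rightarrow> complex) \<Rightarrow> complex" where \<iota>0: "inj \<iota>0" using nat_complex_inj by blast
  have a: "inj (\<lambda>a. a \<odot> x)"
  proof (rule injI)
    fix a b assume "a \<odot> x = b \<odot> x"
    then have "hinner H (a \<odot> x) x = hinner H (b \<odot> x) x" by simp
    then have "a * hinner H x x = b * hinner H x x" using x by (simp add: hinner_smult)
    then show "a = b" using x hinner_eq_zero by auto
  qed
  define \<iota> where "\<iota> f = \<iota>0 (\<lambda>n. f (from_nat_into X n)) \<odot> x" for f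
  have "inj_on \<iota> {f. \<forall>i. i \<notin> X \<longrightarrow> f i = 0}"
  proof (rule inj_onI)
    fix f g assume f: "f \<in> {f. \<forall>i. i \<notin> X \<longrightarrow> f i = 0}" and g: "g \<in> {f. \<forall>i. i \<notin> X \<longrightarrow> f i = 0}" and eq: "\<iota> f = \<iota> g"
    have "\<iota>0 (\<lambda>n. f (from_nat_into X n)) = \<iota>0 (\<lambda>n. g (from_nat_into X n))"
      using injD[OF a] eq unfolding \<iota>_def by blast
    then have n: "(\<lambda>n. f (from_nat_into X n)) = (\<lambda>n. g (from_nat_into X n))" using \<iota>0 by (rule injD[rotated])
    show "f = g"
    proof
      fix i
      show "f i = g i"
      proof (cases "i \<in> X")
        case True
        then show ?thesis using fun_cong[OF n, of "to_nat_on X i"] X by simp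
      qed (use f g in auto)
    qed
  qed
  then show ?thesis by blast
qed

section \<open>Property (T)\<close>

text \<open>Representations built from kernels live on a type of functions, whereas
  \<open>property_T\<close> refers to a given type; the Hilbert space structure is copied along an
  injection.\<close>

locale transported = hilbert_space H for H :: "'f inner_module" (structure) +
  fixes \<iota> :: "'f \<Rightarrow> 'u"
  assumes inj: "inj_on \<iota> (carrier H)"
begin

definition \<kappa> :: "'u \<Rightarrow> 'f" where
  "\<kappa> = the_inv_into (carrier H) \<iota>"

lemma \<kappa>_\<iota> [simp]: "x \<in> carrier H \<Longrightarrow> \<kappa> (\<iota> x) = x"
  unfolding \<kappa>_def by (rule the_inv_into_f_f[OF inj])

definition K :: "'u inner_module" where
  "K = \<lparr>carrier = \<iota> ` carrier H, monoid.mult = (\<lambda>f g. undefined), one = undefined, zero = \<iota> \<zero>,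
    add = (\<lambda>x y. \<iota> (\<kappa> x \<oplus> \<kappa> y)), module.smult = (\<lambda>a x. \<iota> (a \<odot> \<kappa> x)), hinner = (\<lambda>x y. hinner H (\<kappa> x) (\<kappa> y))\<rparr>"

lemma K_simps [simp]:
  "carrier K = \<iota> ` carrier H" "\<zero>\<^bsub>K\<^esub> = \<iota> \<zero>" "x \<oplus>\<^bsub>K\<^esub> y = \<iota> (\<kappa> x \<oplus> \<kappa> y)" "a \<odot>\<^bsub>K\<^esub> x = \<iota> (a \<odot> \<kappa> x)"
  "hinner K x y = hinner H (\<kappa> x) (\<kappa> y)"
  by (simp_all add: K_def)

lemma module_K: "Module.module complex_ring K"
proof (rule moduleI)
  show "cring complex_ring" by (rule cring_complex_ring)
  show "abelian_group K"
  proof (rule abelian_groupI)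
    fix x assume "x \<in> carrier K"
    then obtain v where "v \<in> carrier H" "x = \<iota> v" by auto
    then show "\<exists>y\<in>carrier K. y \<oplus>\<^bsub>K\<^esub> x = \<zero>\<^bsub>K\<^esub>"
      by (intro bexI[of _ "\<iota> (\<ominus> v)"]) (simp_all add: M.l_neg)
  qed (auto simp: M.a_ac)
qed (use smult_l_distr smult_assoc1 smult_one in \<open>auto simp: smult_r_distr\<close>)

lemma a_minus_K: "x \<in> carrier H \<Longrightarrow> y \<in> carrier H \<Longrightarrow> \<iota> x \<ominus>\<^bsub>K\<^esub> \<iota> y = \<iota> (x \<ominus> y)"
proof -
  assume x: "x \<in> carrier H" and y: "y \<in> carrier H"
  interpret K: Module.module complex_ring K by (rule module_K)
  have "\<ominus>\<^bsub>K\<^esub> (\<iota> y) = \<iota> (\<ominus> y)"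
    using y by (intro K.M.minus_equality) (simp_all add: M.l_neg)
  then show ?thesis using x y by (simp add: a_minus_def)
qed

lemma hnorm_K: "x \<in> carrier H \<Longrightarrow> hnorm K (\<iota> x) = hnorm H x"
  by (simp add: hnorm_def)

lemma hilbert_space_K: "hilbert_space K"
proof (intro hilbert_space.intro hilbert_space_axioms.intro)
  show "Module.module complex_ring K" by (rule module_K)
  fix x y assume "x \<in> carrier K" "y \<in> carrier K"
  then obtain v w where v: "v \<in> carrier H" "x = \<iota> v" and w: "w \<in> carrier H" "y = \<iota> w" by auto
  show "hinner K (x \<oplus>\<^bsub>K\<^esub> y) z = hinner K x z + hinner K y z" if "z \<in> carrier K" for z
    using v w that by (auto simp: hinner_add)
  show "hinner K (a \<odot>\<^bsub>K\<^esub> x) y = a * hinner K x y" for a using v w by (simp add: hinner_smult)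
  show "hinner K y x = cnj (hinner K x y)" using hinner_commute[OF v(1) w(1)] v w by simp
next
  fix x assume "x \<in> carrier K"
  then obtain v where v: "v \<in> carrier H" "x = \<iota> v" by auto
  show "0 \<le> Re (hinner K x x)" using v hinner_ge_zero by simp
  show "x = \<zero>\<^bsub>K\<^esub>" if "hinner K x x = 0" using v that hinner_eq_zero by simp
next
  fix F :: "nat \<Rightarrow> 'u"
  assume F: "\<And>n. F n \<in> carrier K"
    and C: "\<And>e. e > 0 \<Longrightarrow> \<exists>N. \<forall>m\<ge>N. \<forall>n\<ge>N. hnorm K (F m \<ominus>\<^bsub>K\<^esub> F n) < e"
  define f where "f n = \<kappa> (F n)" for n
  have f: "f n \<in> carrier H" "F n = \<iota> (f n)" for n
  proof -
    obtain v where "v \<in> carrier H" "F n = \<iota> v" using F[of n] by auto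
    then show "f n \<in> carrier H" "F n = \<iota> (f n)" by (simp_all add: f_def)
  qed
  have "\<exists>l\<in>carrier H. (\<lambda>n. hnorm H (f n \<ominus> l)) \<longlonglongrightarrow> 0"
    by (rule complete[OF f(1)]) (use C f in \<open>simp add: a_minus_K hnorm_K\<close>)
  then show "\<exists>l\<in>carrier K. (\<lambda>n. hnorm K (F n \<ominus>\<^bsub>K\<^esub> l)) \<longlonglongrightarrow> 0"
    using f by (auto simp: a_minus_K hnorm_K)
qed

end

context unitary_rep
begin

lemma rep_in [simp]: "g \<in> carrier G \<Longrightarrow> x \<in> carrier H \<Longrightarrow> \<pi> g x \<in> carrier H"
  using surj_prop by blast

lemma rep_mult: "g \<in> carrier G \<Longrightarrow> h \<in> carrier G \<Longrightarrow> x \<in> carrier H \<Longrightarrow> \<pi> (g \<otimes>\<^bsub>G\<^esub> h) x = \<pi> g (\<pi> h x)"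
  by (rule composition_rule)

lemma rep_one: "x \<in> carrier H \<Longrightarrow> \<pi> \<one>\<^bsub>G\<^esub> x = x"
  using fun_cong[OF id_eq_one, of x] by simp

lemma group_G: "group G"
  using group_hom by (simp add: group_hom_def)

lemma rep_hnorm: "g \<in> carrier G \<Longrightarrow> x \<in> carrier H \<Longrightarrow> hnorm H (\<pi> g x) = hnorm H x"
  by (simp add: hnorm_def rep_hinner)

end

lemma property_T_transport:
  fixes \<iota> :: "'f \<Rightarrow> 'u" and H :: "'f inner_module"
  assumes T: "property_T TYPE('u) G" and rep: "unitary_rep G H \<pi>" and ai: "almost_invariant_vectors G H \<pi>"
    and inj: "inj_on \<iota> (carrier H)"
  shows "invariant_vector G H \<pi>"
proof -
  interpret unitary_rep G H \<pi> by (rule rep)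
  interpret transported H \<iota> by unfold_locales (rule inj)
  define \<pi>' where "\<pi>' g = (\<lambda>y\<in>\<iota> ` carrier H. \<iota> (\<pi> g (\<kappa> y)))" for g
  have \<pi>': "\<pi>' g (\<iota> x) = \<iota> (\<pi> g x)" if "x \<in> carrier H" for g x using that by (simp add: \<pi>'_def)
  have "unitary_rep G K \<pi>'"
  proof (intro unitary_rep.intro unitary_rep_axioms.intro hilbert_space_K)
    show "group_action G (carrier K) \<pi>'"
    proof (rule group_actionI[OF group_G])
      show "\<pi>' g \<in> extensional (carrier K)" for g by (simp add: \<pi>'_def)
    qed (auto simp: \<pi>' rep_mult rep_one)
    show "\<pi>' g \<in> bounded_ops K" if g: "g \<in> carrier G" for g
      unfolding bounded_ops_def
    proof (intro CollectI conjI ballI allI exI[of _ 1])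
      note b = bounded_opsD[OF rep_bounded[OF g]]
      show "\<pi>' g \<in> carrier K \<rightarrow>\<^sub>E carrier K" using g by (auto simp: \<pi>'_def)
      show "\<pi>' g (x \<oplus>\<^bsub>K\<^esub> y) = \<pi>' g x \<oplus>\<^bsub>K\<^esub> \<pi>' g y" if "x \<in> carrier K" "y \<in> carrier K" for x y
        using that g b(2) by (auto simp: \<pi>')
      show "\<pi>' g (a \<odot>\<^bsub>K\<^esub> x) = a \<odot>\<^bsub>K\<^esub> \<pi>' g x" if "x \<in> carrier K" for a x
        using that g b(3) by (auto simp: \<pi>')
      show "hnorm K (\<pi>' g x) \<le> 1 * hnorm K x" if "x \<in> carrier K" for x
        using that g by (auto simp: \<pi>' hnorm_K rep_hnorm)
    qed
    show "hinner K (\<pi>' g x) (\<pi>' g y) = hinner K x y"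
      if "g \<in> carrier G" "x \<in> carrier K" "y \<in> carrier K" for g x y
      using that by (auto simp: \<pi>' rep_hinner)
  qed
  moreover have "almost_invariant_vectors G K \<pi>'"
    unfolding almost_invariant_vectors_def
  proof (intro allI impI)
    fix F :: "'a set" and e :: real assume F: "finite F" "F \<subseteq> carrier G" "e > 0"
    obtain \<xi> where \<xi>: "\<xi> \<in> carrier H" "hnorm H \<xi> = 1" "\<forall>g\<in>F. hnorm H (\<pi> g \<xi> \<ominus>\<^bsub>H\<^esub> \<xi>) < e"
      using ai F unfolding almost_invariant_vectors_def by blast
    have "hnorm K (\<pi>' g (\<iota> \<xi>) \<ominus>\<^bsub>K\<^esub> \<iota> \<xi>) < e" if g: "g \<in> F" for g
    proof -
      have "g \<in> carrier G" using g F by auto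
      then show ?thesis using \<xi> g by (simp add: \<pi>' a_minus_K hnorm_K)
    qed
    then show "\<exists>\<xi>\<in>carrier K. hnorm K \<xi> = 1 \<and> (\<forall>g\<in>F. hnorm K (\<pi>' g \<xi> \<ominus>\<^bsub>K\<^esub> \<xi>) < e)"
      using \<xi> by (intro bexI[of _ "\<iota> \<xi>"]) (auto simp: hnorm_K)
  qed
  ultimately have "invariant_vector G K \<pi>'" using T unfolding property_T_def by blast
  then obtain y where y: "y \<in> carrier K" "y \<noteq> \<zero>\<^bsub>K\<^esub>" "\<forall>g\<in>carrier G. \<pi>' g y = y" unfolding invariant_vector_def by blast
  then obtain x where x: "x \<in> carrier H" "y = \<iota> x" by auto
  have "\<pi> g x = x" if g: "g \<in> carrier G" for g
  proof -
    have "\<iota> (\<pi> g x) = \<iota> x" using y(3) g x by (simp add: \<pi>')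
    then show ?thesis using x g inj by (simp add: inj_on_eq_iff)
  qed
  moreover have "x \<noteq> \<zero>\<^bsub>H\<^esub>" using x y(2) by auto
  ultimately show ?thesis using x(1) unfolding invariant_vector_def by blast
qed

section \<open>Convex combinations and averages over orbits\<close>

definition prob :: "'i set \<Rightarrow> ('i \<Rightarrow> complex) set" where
  "prob X = {c. finite {i. c i \<noteq> 0} \<and> {i. c i \<noteq> 0} \<subseteq> X \<and> (\<forall>i. c i = of_real (Re (c i)) \<and> 0 \<le> Re (c i)) \<and>
    (\<Sum>i\<in>{i. c i \<noteq> 0}. c i) = 1}"

lemma sum_support:
  fixes c :: "'i \<Rightarrow> complex"
  assumes "finite S" "{i. c i \<noteq> 0} \<subseteq> S"
  shows "(\<Sum>i\<in>{i. c i \<noteq> 0}. c i * f i) = (\<Sum>i\<in>S. c i * f i)"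
  using assms by (intro sum.mono_neutral_left) auto

context gns
begin

lemma prob_Fin: "c \<in> prob X \<Longrightarrow> c \<in> Fin"
  by (simp add: prob_def Fin_def)

lemma \<delta>_prob: "i \<in> X \<Longrightarrow> \<delta> i \<in> prob X"
proof -
  have "{j. \<delta> i j \<noteq> 0} = {i}" by (auto simp: \<delta>_def)
  then show "i \<in> X \<Longrightarrow> \<delta> i \<in> prob X" by (simp add: prob_def) (simp add: \<delta>_def)
qed

definition mid :: "('i \<Rightarrow> complex) \<Rightarrow> ('i \<Rightarrow> complex) \<Rightarrow> 'i \<Rightarrow> complex" where
  "mid c d = (\<lambda>i. (c i + d i) / 2)"

lemma mid_prob:
  assumes c: "c \<in> prob X" and d: "d \<in> prob X"
  shows "mid c d \<in> prob X"
proof -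
  let ?S = "{i. c i \<noteq> 0} \<union> {i. d i \<noteq> 0}"
  have S: "finite ?S" "?S \<subseteq> X" using c d by (auto simp: prob_def)
  have sub: "{i. mid c d i \<noteq> 0} \<subseteq> ?S" by (auto simp: mid_def)
  have "(\<Sum>i\<in>{i. mid c d i \<noteq> 0}. mid c d i) = (\<Sum>i\<in>?S. mid c d i)"
    using sum_support[OF S(1) sub, of "\<lambda>_. 1"] by simp
  also have "\<dots> = ((\<Sum>i\<in>?S. c i) + (\<Sum>i\<in>?S. d i)) / 2"
    by (simp add: mid_def sum.distrib flip: sum_divide_distrib)
  also have "\<dots> = 1"
    using sum_support[OF S(1), of c "\<lambda>_. 1"] sum_support[OF S(1), of d "\<lambda>_. 1"] c d by (simp add: prob_def)
  finally have "(\<Sum>i\<in>{i. mid c d i \<noteq> 0}. mid c d i) = 1" .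
  moreover have "mid c d i = of_real (Re (mid c d i)) \<and> 0 \<le> Re (mid c d i)" for i
    using c d by (auto simp: prob_def mid_def complex_eq_iff)
  moreover have "finite {i. mid c d i \<noteq> 0}" using sub S(1) by (rule finite_subset)
  ultimately show ?thesis using sub S(2) unfolding prob_def by blast
qed

lemma parallelogram:
  assumes c: "c \<in> prob X" and d: "d \<in> prob X"
  shows "(nB (cm c (-1) d))\<^sup>2 = 2 * (nB c)\<^sup>2 + 2 * (nB d)\<^sup>2 - 4 * (nB (mid c d))\<^sup>2"
proof -
  have F: "c \<in> Fin" "d \<in> Fin" "mid c d \<in> Fin" using c d mid_prob prob_Fin by auto
  have "cm (mid c d) 1 (mid c d) = cm c 1 d" by (auto simp: cm_def mid_def)
  then have "B (cm (mid c d) 1 (mid c d)) (cm (mid c d) 1 (mid c d)) = B (cm c 1 d) (cm c 1 d)" by simp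
  then have "4 * B (mid c d) (mid c d) = B c c + B c d + B d c + B d d"
    using F by (simp add: B_cm_left B_cm_right)
  moreover have "B (cm c (-1) d) (cm c (-1) d) = B c c - B c d - B d c + B d d"
    using F by (simp add: B_cm_left B_cm_right)
  ultimately have "B (cm c (-1) d) (cm c (-1) d) = 2 * B c c + 2 * B d d - 4 * B (mid c d) (mid c d)" by simp
  then have "Re (B (cm c (-1) d) (cm c (-1) d)) = Re (2 * B c c + 2 * B d d - 4 * B (mid c d) (mid c d))" by simp
  then show ?thesis using F by (simp add: nB_sq)
qed

end

context gns_action
begin

lemma shift_prob:
  assumes g: "g \<in> carrier G" and c: "c \<in> prob X"
  shows "shift g c \<in> prob X"
proof -
  let ?S = "{i. c i \<noteq> 0}"
  have S: "finite ?S" "?S \<subseteq> X" using c by (auto simp: prob_def)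
  have inj: "inj_on (act g) ?S" using act_inj[OF g] S(2) by (rule inj_on_subset)
  have sub: "{i. shift g c i \<noteq> 0} \<subseteq> act g ` ?S" by (rule shift_support[OF g order_refl S(2)])
  have "(\<Sum>i\<in>{i. shift g c i \<noteq> 0}. shift g c i) = (\<Sum>i\<in>act g ` ?S. shift g c i)"
    using sum_support[of "act g ` ?S" "shift g c" "\<lambda>_. 1"] sub S by simp
  also have "\<dots> = (\<Sum>i\<in>?S. shift g c (act g i))" by (simp add: sum.reindex[OF inj])
  also have "\<dots> = (\<Sum>i\<in>?S. c i)" using S g by (intro sum.cong refl shift_act) auto
  also have "\<dots> = 1" using c by (simp add: prob_def)
  finally have "(\<Sum>i\<in>{i. shift g c i \<noteq> 0}. shift g c i) = 1" .
  moreover have "shift g c i = of_real (Re (shift g c i)) \<and> 0 \<le> Re (shift g c i)" for i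
  proof (cases "i \<in> X")
    case True
    have "c (act (inv g) i) = of_real (Re (c (act (inv g) i))) \<and> 0 \<le> Re (c (act (inv g) i))"
      using c unfolding prob_def by blast
    then show ?thesis using True by (simp add: shift_def)
  qed (simp add: shift_def)
  moreover have "shift g c \<in> Fin" by (rule shift_Fin[OF g prob_Fin[OF c]])
  ultimately show ?thesis unfolding prob_def Fin_def by blast
qed

text \<open>A sequence of convex combinations whose norms converge to the distance of the convex hull from \<open>0\<close> is Cauchy,
  and asymptotically invariant since its translates have the same norms.\<close>

lemma average_ex:
  assumes "x0 \<in> X"
  shows "\<exists>z. cauchy z \<and> (\<forall>j. z j \<in> prob X) \<and> (\<forall>t\<in>carrier G. (\<lambda>j. nB (cm (shift t (z j)) (-1) (z j))) \<longlonglongrightarrow> 0)"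
proof -
  define m where "m = Inf ((\<lambda>c. (nB c)\<^sup>2) ` prob X)"
  have ne: "prob X \<noteq> {}" using \<delta>_prob[OF assms] by auto
  have bdd: "bdd_below ((\<lambda>c. (nB c)\<^sup>2) ` prob X)" by (intro bdd_belowI2[of _ 0]) simp
  have m_le: "m \<le> (nB c)\<^sup>2" if "c \<in> prob X" for c unfolding m_def using that by (intro cInf_lower bdd) auto
  have "\<exists>c. c \<in> prob X \<and> (nB c)\<^sup>2 < m + 1 / real (Suc n)" for n
  proof -
    have "Inf ((\<lambda>c. (nB c)\<^sup>2) ` prob X) < m + 1 / real (Suc n)" by (simp add: m_def)
    then obtain y where "y \<in> (\<lambda>c. (nB c)\<^sup>2) ` prob X" "y < m + 1 / real (Suc n)"
      using cInf_lessD[of "(\<lambda>c. (nB c)\<^sup>2) ` prob X"] ne by blast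
    then show ?thesis by auto
  qed
  then obtain z where z: "\<And>n. z n \<in> prob X" "\<And>n. (nB (z n))\<^sup>2 < m + 1 / real (Suc n)" by metis
  have par: "(nB (cm c (-1) d))\<^sup>2 \<le> 2 * (nB c)\<^sup>2 + 2 * (nB d)\<^sup>2 - 4 * m" if "c \<in> prob X" "d \<in> prob X" for c d
    using parallelogram[OF that] m_le[OF mid_prob[OF that]] by linarith
  \<comment> \<open>The squared distance of the i-th and the j-th combination is below 2/(i+1) +
    2/(j+1), so bounding both 4/(i+1) and 4/(j+1) by \<open>e\<^sup>2\<close> suffices.\<close>
  have small: "\<exists>N. \<forall>n\<ge>N. 4 / real (Suc n) < e\<^sup>2" if e: "e > 0" for e :: real
  proof -
    obtain N where N: "inverse (real (Suc N)) < e\<^sup>2 / 4" using reals_Archimedean[of "e\<^sup>2 / 4"] e by auto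
    have "4 / real (Suc n) < e\<^sup>2" if n: "n \<ge> N" for n
    proof -
      have "4 / real (Suc n) \<le> 4 / real (Suc N)" using n by (intro divide_left_mono) auto
      also have "4 / real (Suc N) = 4 * inverse (real (Suc N))" by (rule divide_inverse)
      also have "\<dots> < e\<^sup>2" using N by linarith
      finally show ?thesis .
    qed
    then show ?thesis by blast
  qed
  have F: "z n \<in> Fin" for n using z(1) prob_Fin by auto
  have "cauchy z"
    unfolding cauchy_def
  proof (intro conjI allI impI F)
    fix e :: real assume e: "e > 0"
    obtain N where N: "\<forall>n\<ge>N. 4 / real (Suc n) < e\<^sup>2" using small[OF e] by blast
    show "\<exists>N. \<forall>m\<ge>N. \<forall>n\<ge>N. nB (cm (z m) (- 1) (z n)) < e"
    proof (intro exI[of _ N] allI impI)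
      fix i j assume ij: "N \<le> i" "N \<le> j"
      have "(nB (cm (z i) (- 1) (z j)))\<^sup>2 \<le> 2 * (nB (z i))\<^sup>2 + 2 * (nB (z j))\<^sup>2 - 4 * m" by (rule par[OF z(1) z(1)])
      also have "\<dots> < e\<^sup>2"
        using z(2)[of i] z(2)[of j] N[rule_format, OF ij(1)] N[rule_format, OF ij(2)] by simp
      finally show "nB (cm (z i) (- 1) (z j)) < e" using e by (simp add: power2_less_imp_less)
    qed
  qed
  moreover have "(\<lambda>j. nB (cm (shift t (z j)) (-1) (z j))) \<longlonglongrightarrow> 0" if t: "t \<in> carrier G" for t
  proof (rule LIMSEQ_I)
    fix e :: real assume e: "e > 0"
    obtain N where N: "\<forall>n\<ge>N. 4 / real (Suc n) < e\<^sup>2" using small[OF e] by blast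
    show "\<exists>N. \<forall>n\<ge>N. norm (nB (cm (shift t (z n)) (-1) (z n)) - 0) < e"
    proof (intro exI[of _ N] allI impI)
      fix j assume j: "N \<le> j"
      have eq: "nB (shift t (z j)) = nB (z j)" using B_shift[OF t F F] by (simp add: nB_def)
      have "(nB (cm (shift t (z j)) (- 1) (z j)))\<^sup>2 \<le> 2 * (nB (shift t (z j)))\<^sup>2 + 2 * (nB (z j))\<^sup>2 - 4 * m"
        by (rule par[OF shift_prob[OF t z(1)] z(1)])
      also have "\<dots> < e\<^sup>2" using z(2)[of j] N[rule_format, OF j] by (simp add: eq)
      finally have "nB (cm (shift t (z j)) (- 1) (z j)) < e" using e by (simp add: power2_less_imp_less)
      moreover have "0 \<le> nB (cm (shift t (z j)) (- 1) (z j))" using shift_Fin[OF t F] F by simp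
      ultimately show "norm (nB (cm (shift t (z j)) (-1) (z j)) - 0) < e" by simp
    qed
  qed
  ultimately show ?thesis using z(1) by blast
qed

end

context gns
begin

lemma B_\<delta>: "i \<in> X \<Longrightarrow> j \<in> X \<Longrightarrow> B (\<delta> i) (\<delta> j) = k i j"
proof -
  have "B (\<delta> i) (\<delta> j) = sesq k {i, j} (\<delta> i) (\<delta> j)" by (rule B_eq) (auto simp: \<delta>_def)
  also have "\<dots> = k i j" by (cases "i = j") (auto simp: sesq_def \<delta>_def)
  finally show ?thesis .
qed

lemma B_expand_left:
  assumes "c \<in> Fin" "y \<in> Fin"
  shows "B c y = (\<Sum>i\<in>{i. c i \<noteq> 0}. c i * B (\<delta> i) y)"
proof -
  have "B c y = cnj (B y c)" by (rule B_herm[OF assms(2,1)])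
  also have "\<dots> = (\<Sum>i\<in>{i. c i \<noteq> 0}. cnj (cnj (c i) * B y (\<delta> i)))" by (simp add: B_expand[OF assms(2,1)])
  also have "\<dots> = (\<Sum>i\<in>{i. c i \<noteq> 0}. c i * B (\<delta> i) y)"
  proof (rule sum.cong[OF refl])
    fix i assume "i \<in> {i. c i \<noteq> 0}"
    then have "\<delta> i \<in> Fin" using assms(1) by (auto simp: Fin_def \<delta>_def)
    then show "cnj (cnj (c i) * B y (\<delta> i)) = c i * B (\<delta> i) y" using B_herm[OF assms(2)] by simp
  qed
  finally show ?thesis .
qed

text \<open>Since the weights sum to 1, combining the vectors \<open>\<delta> i\<close> minus z
  gives c minus z.\<close>

lemma B_prob_left:
  assumes c: "c \<in> prob X" and z: "z \<in> Fin" and y: "y \<in> Fin"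
  shows "(\<Sum>i\<in>{i. c i \<noteq> 0}. c i * B (cm (\<delta> i) (-1) z) y) = B (cm c (-1) z) y"
proof -
  have F: "\<delta> i \<in> Fin" if "c i \<noteq> 0" for i using that c by (auto simp: prob_def)
  have "(\<Sum>i\<in>{i. c i \<noteq> 0}. c i * B (cm (\<delta> i) (-1) z) y) = (\<Sum>i\<in>{i. c i \<noteq> 0}. c i * B (\<delta> i) y - c i * B z y)"
    using F z y by (intro sum.cong refl) (simp add: B_cm_left algebra_simps)
  also have "\<dots> = B c y - (\<Sum>i\<in>{i. c i \<noteq> 0}. c i) * B z y"
    using B_expand_left[OF prob_Fin[OF c] y] by (simp add: sum_subtractf sum_distrib_right)
  also have "\<dots> = B (cm c (-1) z) y" using c z y prob_Fin[OF c] by (simp add: prob_def B_cm_left)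
  finally show ?thesis .
qed

lemma sesq_prob:
  assumes c: "c \<in> prob X" and z: "z \<in> Fin"
  shows "sesq (\<lambda>i j. B (cm (\<delta> i) (-1) z) (cm (\<delta> j) (-1) z)) {i. c i \<noteq> 0} c c = B (cm c (-1) z) (cm c (-1) z)"
proof -
  let ?S = "{i. c i \<noteq> 0}"
  have F: "cm (\<delta> i) (-1) z \<in> Fin" if "i \<in> ?S" for i using that c z by (auto simp: prob_def)
  have cF: "cm c (-1) z \<in> Fin" using prob_Fin[OF c] z by simp
  have "sesq (\<lambda>i j. B (cm (\<delta> i) (-1) z) (cm (\<delta> j) (-1) z)) ?S c c =
      (\<Sum>j\<in>?S. cnj (c j) * (\<Sum>i\<in>?S. c i * B (cm (\<delta> i) (-1) z) (cm (\<delta> j) (-1) z)))"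
    unfolding sesq_def by (subst sum.swap) (simp add: sum_distrib_left mult_ac)
  also have "\<dots> = (\<Sum>j\<in>?S. cnj (c j) * B (cm c (-1) z) (cm (\<delta> j) (-1) z))"
    using B_prob_left[OF c z F] by (intro sum.cong refl) simp
  also have "\<dots> = (\<Sum>j\<in>?S. cnj (c j * B (cm (\<delta> j) (-1) z) (cm c (-1) z)))"
    using B_herm[OF F cF] by (intro sum.cong refl) simp
  also have "\<dots> = cnj (\<Sum>j\<in>?S. c j * B (cm (\<delta> j) (-1) z) (cm c (-1) z))" by simp
  also have "\<dots> = cnj (B (cm c (-1) z) (cm c (-1) z))" using B_prob_left[OF c z cF] by simp
  also have "\<dots> = B (cm c (-1) z) (cm c (-1) z)" by (rule B_herm[OF cF cF, symmetric])
  finally show ?thesis .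
qed

end

context gns_action
begin

text \<open>\<open>\<psi>\<close> is the Gram kernel of the orbit minus its projection to the invariant vectors.\<close>

lemma average_kernel:
  assumes x0: "x0 \<in> X"
  shows "\<exists>\<psi> z. pos_kernel X \<psi> \<and> (\<forall>t\<in>carrier G. \<forall>i\<in>X. \<forall>j\<in>X. \<psi> (act t i) (act t j) = \<psi> i j) \<and>
    cauchy z \<and> (\<forall>n. z n \<in> prob X) \<and> (\<forall>t\<in>carrier G. (\<lambda>n. nB (cm (shift t (z n)) (-1) (z n))) \<longlonglongrightarrow> 0) \<and>
    (\<lambda>n. Re (sesq \<psi> {i. z n i \<noteq> 0} (z n) (z n))) \<longlonglongrightarrow> 0 \<and>
    (\<forall>i\<in>X. \<forall>j\<in>X. \<psi> i i + \<psi> j j - \<psi> i j - \<psi> j i = k i i + k j j - k i j - k j i) \<and>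
    (\<forall>i\<in>X. (\<lambda>n. (nB (cm (\<delta> i) (-1) (z n)))\<^sup>2) \<longlonglongrightarrow> Re (\<psi> i i))"
proof -
  obtain z where z: "cauchy z" "\<And>n. z n \<in> prob X"
    "\<And>t. t \<in> carrier G \<Longrightarrow> (\<lambda>n. nB (cm (shift t (z n)) (-1) (z n))) \<longlonglongrightarrow> 0"
    using average_ex[OF x0] by blast
  have zF: "z n \<in> Fin" for n using z(1) by simp
  \<comment> \<open>The limit of z is the vector of least norm in the closed convex hull of the
    points, and \<open>U i\<close> represents the point i minus this vector.\<close>
  define U where "U i = (\<lambda>n. cm (\<delta> i) (-1) (z n))" for i
  define \<psi> where "\<psi> i j = inner (ev (U i)) (ev (U j))" for i j
  have U: "cauchy (U i)" if "i \<in> X" for i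
    unfolding U_def by (intro cauchy_cm cauchy_const z(1) Fin_\<delta> that)
  have lim: "(\<lambda>n. B (U i n) (U j n)) \<longlonglongrightarrow> \<psi> i j" if "i \<in> X" "j \<in> X" for i j
    unfolding \<psi>_def by (intro inner_tendsto U that)
  have 1: "pos_kernel X \<psi>"
    unfolding \<psi>_def by (rule pos_kernel_pullback[OF pos_kernel_inner]) (use U in \<open>auto simp: space_def\<close>)
  have 2: "\<psi> (act t i) (act t j) = \<psi> i j" if t: "t \<in> carrier G" and ij: "i \<in> X" "j \<in> X" for t i j
  proof -
    \<comment> \<open>The minimal vector is invariant because the translates of z are asymptotic to
      z.\<close>
    have "ev (\<lambda>n. shift t (z n)) = ev z"
    proof
      fix l
      show "ev (\<lambda>n. shift t (z n)) l = ev z l"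
      proof (cases "l \<in> X")
        case True
        have "(\<lambda>n. B (cm (shift t (z n)) (-1) (z n)) (\<delta> l)) \<longlonglongrightarrow> 0"
        proof (rule Lim_null_comparison)
          show "(\<lambda>n. nB (cm (shift t (z n)) (-1) (z n)) * nB (\<delta> l)) \<longlonglongrightarrow> 0"
            using tendsto_mult_right[OF z(3)[OF t], of "nB (\<delta> l)"] by simp
          show "\<forall>\<^sub>F n in sequentially. norm (B (cm (shift t (z n)) (-1) (z n)) (\<delta> l)) \<le> nB (cm (shift t (z n)) (-1) (z n)) * nB (\<delta> l)"
            using shift_Fin[OF t zF] zF True by (intro always_eventually allI B_CS) auto
        qed
        moreover have "(\<lambda>n. B (cm (shift t (z n)) (-1) (z n)) (\<delta> l)) \<longlonglongrightarrow> ev (\<lambda>n. shift t (z n)) l - ev z l"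
          using ev_tendsto[OF cauchy_cm[OF shift_cauchy[OF t z(1)] z(1), of "-1"] True]
            ev_cm[OF shift_cauchy[OF t z(1)] z(1), of "-1"] by simp
        ultimately have "ev (\<lambda>n. shift t (z n)) l - ev z l = 0" by (rule LIMSEQ_unique[rotated])
        then show ?thesis by simp
      qed (simp add: ev_def)
    qed
    then have "ev (U (act t i)) = shift t (ev (U i))" if i: "i \<in> X" for i
    proof -
      have ti: "act t i \<in> X" using t i by simp
      have "ev (U (act t i)) = (\<lambda>l. ev (\<lambda>_. \<delta> (act t i)) l + (-1) * ev z l)"
        unfolding U_def by (rule ev_cm[OF cauchy_const[OF Fin_\<delta>[OF ti]] z(1)])
      also have "\<dots> = (\<lambda>l. ev (\<lambda>_. \<delta> (act t i)) l + (-1) * ev (\<lambda>n. shift t (z n)) l)"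
        using \<open>ev (\<lambda>n. shift t (z n)) = ev z\<close> by simp
      also have "\<dots> = ev (\<lambda>n. cm (\<delta> (act t i)) (-1) (shift t (z n)))"
        by (rule ev_cm[OF cauchy_const[OF Fin_\<delta>[OF ti]] shift_cauchy[OF t z(1)], symmetric])
      also have "\<dots> = ev (\<lambda>n. shift t (U i n))" using shift_\<delta>[OF t i] by (simp add: U_def shift_cm)
      also have "\<dots> = shift t (ev (U i))" by (rule ev_shift[OF t U[OF i]])
      finally show ?thesis .
    qed
    then show ?thesis using ij inner_shift[OF t] U unfolding \<psi>_def by (simp add: space_def)
  qed
  have sq: "sesq \<psi> {i. c i \<noteq> 0} c c = inner (ev (\<lambda>n. cm c (-1) (z n))) (ev (\<lambda>n. cm c (-1) (z n)))"
    if c: "c \<in> prob X" for c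
  proof -
    have S: "{i. c i \<noteq> 0} \<subseteq> X" using c by (simp add: prob_def)
    have "(\<lambda>n. sesq (\<lambda>i j. B (U i n) (U j n)) {i. c i \<noteq> 0} c c) \<longlonglongrightarrow> sesq \<psi> {i. c i \<noteq> 0} c c"
      unfolding sesq_def using lim S by (intro tendsto_sum tendsto_mult_left) auto
    moreover have "sesq (\<lambda>i j. B (U i n) (U j n)) {i. c i \<noteq> 0} c c = B (cm c (-1) (z n)) (cm c (-1) (z n))" for n
      unfolding U_def by (rule sesq_prob[OF c zF])
    moreover have "(\<lambda>n. B (cm c (-1) (z n)) (cm c (-1) (z n))) \<longlonglongrightarrow>
        inner (ev (\<lambda>n. cm c (-1) (z n))) (ev (\<lambda>n. cm c (-1) (z n)))"
      by (intro inner_tendsto cauchy_cm cauchy_const prob_Fin c z(1))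
    ultimately show ?thesis by (simp add: LIMSEQ_unique)
  qed
  \<comment> \<open>The form of \<psi> at \<open>z m\<close> is the squared distance of
    \<open>z m\<close> from the limit of z.\<close>
  have 3: "(\<lambda>n. Re (sesq \<psi> {i. z n i \<noteq> 0} (z n) (z n))) \<longlonglongrightarrow> 0"
  proof (rule LIMSEQ_I)
    fix e :: real assume e: "e > 0"
    then have "sqrt (e / 2) > 0" by simp
    then obtain N where N: "\<forall>m\<ge>N. \<forall>n\<ge>N. nB (cm (z m) (-1) (z n)) < sqrt (e / 2)" using z(1) unfolding cauchy_def by blast
    show "\<exists>N. \<forall>n\<ge>N. norm (Re (sesq \<psi> {i. z n i \<noteq> 0} (z n) (z n)) - 0) < e"
    proof (intro exI[of _ N] allI impI)
      fix m assume m: "N \<le> m"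
      have l: "(\<lambda>n. (nB (cm (z m) (-1) (z n)))\<^sup>2) \<longlonglongrightarrow> Re (sesq \<psi> {i. z m i \<noteq> 0} (z m) (z m))"
        using tendsto_Re[OF inner_tendsto[OF cauchy_cm[OF cauchy_const[OF zF] z(1)] cauchy_cm[OF cauchy_const[OF zF] z(1)]], of m "-1" m "-1"]
          sq[OF z(2), of m] zF by (simp add: nB_sq)
      have "Re (sesq \<psi> {i. z m i \<noteq> 0} (z m) (z m)) \<le> e / 2"
      proof (rule LIMSEQ_le_const2[OF l], intro exI[of _ N] allI impI)
        fix n assume "N \<le> n"
        then have "nB (cm (z m) (-1) (z n)) \<le> sqrt (e / 2)" using N m by (simp add: less_imp_le)
        then have "(nB (cm (z m) (-1) (z n)))\<^sup>2 \<le> (sqrt (e / 2))\<^sup>2" using zF by (intro power_mono) auto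
        then show "(nB (cm (z m) (-1) (z n)))\<^sup>2 \<le> e / 2" using e by simp
      qed
      moreover have "0 \<le> Re (sesq \<psi> {i. z m i \<noteq> 0} (z m) (z m))"
        by (rule LIMSEQ_le_const[OF l]) simp
      ultimately show "norm (Re (sesq \<psi> {i. z m i \<noteq> 0} (z m) (z m)) - 0) < e" using e by simp
    qed
  qed
  \<comment> \<open>The common vector that was subtracted cancels in differences of points, so the
    two kernels define the same distances.\<close>
  have 4: "\<psi> i i + \<psi> j j - \<psi> i j - \<psi> j i = k i i + k j j - k i j - k j i" if ij: "i \<in> X" "j \<in> X" for i j
  proof -
    have "(\<lambda>n. B (U i n) (U i n) + B (U j n) (U j n) - B (U i n) (U j n) - B (U j n) (U i n)) \<longlonglongrightarrow>
        \<psi> i i + \<psi> j j - \<psi> i j - \<psi> j i" by (intro tendsto_intros lim ij)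
    moreover have "B (U i n) (U i n) + B (U j n) (U j n) - B (U i n) (U j n) - B (U j n) (U i n) =
        k i i + k j j - k i j - k j i" for n
      using ij zF by (simp add: U_def B_cm_left B_cm_right B_\<delta> algebra_simps)
    ultimately show ?thesis by (simp add: LIMSEQ_const_iff)
  qed
  have 5: "(\<lambda>n. (nB (cm (\<delta> i) (-1) (z n)))\<^sup>2) \<longlonglongrightarrow> Re (\<psi> i i)" if i: "i \<in> X" for i
    using tendsto_Re[OF lim[OF i i]] zF i by (simp add: nB_sq U_def)
  show ?thesis using 1 2 z 3 4 5 by blast
qed

end

text \<open>Otherwise the normalised kernels would define a representation (a direct sum over \<open>n\<close>) with almost
  invariant vectors, but without invariant vectors because the averages of each orbit tend to \<open>0\<close>.\<close>

lemma kazhdan_small: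
  fixes G :: "'g monoid" (structure) and \<iota> :: "(nat \<times> 'g \<Rightarrow> complex) \<Rightarrow> 'u"
  assumes G: "group G" and T: "property_T TYPE('u) G"
    and \<iota>: "inj_on \<iota> {f. \<forall>i. i \<notin> UNIV \<times> carrier G \<longrightarrow> f i = 0}"
    and pos: "\<And>n. pos_kernel (carrier G) (\<psi> n)"
    and inv: "\<And>n t g h. t \<in> carrier G \<Longrightarrow> g \<in> carrier G \<Longrightarrow> h \<in> carrier G \<Longrightarrow> \<psi> n (t \<otimes> g) (t \<otimes> h) = \<psi> n g h"
    and z: "\<And>n j. z n j \<in> prob (carrier G)"
    and avg: "\<And>n. (\<lambda>j :: nat. Re (sesq (\<psi> n) {i. z n j i \<noteq> 0} (z n j) (z n j))) \<longlonglongrightarrow> 0"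
    and diff: "\<And>g. g \<in> carrier G \<Longrightarrow> (\<lambda>n. Re (\<psi> n g g + \<psi> n \<one> \<one> - \<psi> n g \<one> - \<psi> n \<one> g)) \<longlonglongrightarrow> 0"
    and \<delta>: "\<delta> > 0"
  shows "\<exists>n. Re (\<psi> n \<one> \<one>) < \<delta>"
proof (rule ccontr)
  interpret group G by (rule G)
  assume "\<not> (\<exists>n. Re (\<psi> n \<one> \<one>) < \<delta>)"
  then have r: "Re (\<psi> n \<one> \<one>) \<ge> \<delta>" for n by (simp add: not_less)
  define r where "r n = Re (\<psi> n \<one> \<one>)" for n
  have r\<delta>: "r n \<ge> \<delta>" "r n > 0" for n using r[of n] \<delta> by (auto simp: r_def)
  have one: "\<psi> n \<one> \<one> = of_real (r n)" for n
    using pos_kernel_diag(1)[OF pos, of \<one> n] by (simp add: r_def complex_eq_iff)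
  have diag: "\<psi> n g g = of_real (r n)" if "g \<in> carrier G" for n g
    using inv[OF that one_closed one_closed, of n] that one by simp
  define X where "X = (UNIV :: nat set) \<times> carrier G"
  \<comment> \<open>One block for each n, normalised so that all points become unit vectors. The
    lower bound \<open>\<delta>\<close> for the diagonal ensures that the division does not destroy
    almost invariance.\<close>
  define \<kappa> where "\<kappa> i j = (if fst i = fst j then of_real (1 / r (fst i)) * \<psi> (fst i) (snd i) (snd j) else 0)" for i j :: "nat \<times> 'g"
  define act where "act g i = (fst i, g \<otimes> snd i)" for g :: 'g and i :: "nat \<times> 'g"
  have "pos_kernel X \<kappa>"
    unfolding pos_kernel_def
  proof (intro allI impI)
    fix S and c :: "nat \<times> 'g \<Rightarrow> complex" assume S: "finite S" "S \<subseteq> X"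
    \<comment> \<open>Sorting the coefficients by blocks writes the form as a sum of forms of the
      single kernels.\<close>
    define C where "C n i = (if fst i = n then c i else (0 :: complex))" for n and i :: "nat \<times> 'g"
    define kk :: "nat \<Rightarrow> _ \<Rightarrow> _ \<Rightarrow> complex" where "kk n i j = of_real (1 / r n) * \<psi> n (snd i) (snd j)" for n and i j :: "nat \<times> 'g"
    have "sesq \<kappa> S c c = (\<Sum>n\<in>fst ` S. sesq (kk n) S (C n) (C n))"
    proof -
      have "(\<Sum>n\<in>fst ` S. sesq (kk n) S (C n) (C n)) =
          (\<Sum>i\<in>S. \<Sum>n\<in>fst ` S. \<Sum>j\<in>S. C n i * cnj (C n j) * kk n i j)"
        unfolding sesq_def by (rule sum.swap)
      also have "\<dots> = (\<Sum>i\<in>S. \<Sum>j\<in>S. \<Sum>n\<in>fst ` S. C n i * cnj (C n j) * kk n i j)"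
        by (intro sum.cong refl sum.swap)
      also have "\<dots> = (\<Sum>i\<in>S. \<Sum>j\<in>S. c i * cnj (c j) * \<kappa> i j)"
      proof (intro sum.cong refl)
        fix i j assume i: "i \<in> S" and j: "j \<in> S"
        have "(\<Sum>n\<in>fst ` S. C n i * cnj (C n j) * kk n i j) =
            (\<Sum>n\<in>fst ` S. if fst i = n then c i * cnj (C n j) * kk n i j else 0)"
          by (intro sum.cong refl) (simp add: C_def)
        also have "\<dots> = c i * cnj (C (fst i) j) * kk (fst i) i j"
          using S(1) i by (simp add: sum.delta')
        also have "\<dots> = c i * cnj (c j) * \<kappa> i j" by (simp add: \<kappa>_def C_def kk_def)
        finally show "(\<Sum>n\<in>fst ` S. C n i * cnj (C n j) * kk n i j) = c i * cnj (c j) * \<kappa> i j" .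
      qed
      finally show ?thesis by (simp add: sesq_def)
    qed
    moreover have "Im (sesq (kk n) S (C n) (C n)) = 0 \<and> 0 \<le> Re (sesq (kk n) S (C n) (C n))" for n
    proof -
      have "pos_kernel X (kk n)"
        unfolding kk_def by (intro pos_kernel_scale pos_kernel_pullback[OF pos]) (use r\<delta>(2)[of n] in \<open>auto simp: X_def less_imp_le\<close>)
      from pos_kernelD[OF this S, of "C n"] show ?thesis by blast
    qed
    ultimately show "Im (sesq \<kappa> S c c) = 0 \<and> 0 \<le> Re (sesq \<kappa> S c c)" by (simp add: sum_nonneg)
  qed
  then interpret gns_action X \<kappa> G act
    by unfold_locales (auto simp: X_def act_def \<kappa>_def m_assoc inv)
  interpret R: unitary_rep G Hil rep by (rule unitary_rep_Hil)
  have ptX: "(n, g) \<in> X" if "g \<in> carrier G" for n g using that by (simp add: X_def)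
  have "almost_invariant_vectors G Hil rep"
    unfolding almost_invariant_vectors_def
  proof (intro allI impI)
    fix F :: "'g set" and e :: real assume F: "finite F" "F \<subseteq> carrier G" and e: "e > 0"
    let ?D = "\<lambda>n g. Re (\<psi> n g g + \<psi> n \<one> \<one> - \<psi> n g \<one> - \<psi> n \<one> g)"
    \<comment> \<open>Division by the diagonal entry, which is at least \<open>\<delta>\<close>,
      will turn this into the bound \<open>e\<^sup>2\<close> for squared distances of unit
      vectors.\<close>
    have "\<forall>\<^sub>F n in sequentially. \<forall>g\<in>F. ?D n g < e\<^sup>2 * \<delta>"
    proof (rule eventually_ball_finite[OF F(1)], rule ballI)
      fix g assume "g \<in> F"
      then show "\<forall>\<^sub>F n in sequentially. ?D n g < e\<^sup>2 * \<delta>" using order_tendstoD(2)[OF diff, of g "e\<^sup>2 * \<delta>"] F e \<delta> by auto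
    qed
    then obtain n where n: "\<forall>g\<in>F. ?D n g < e\<^sup>2 * \<delta>" using eventually_happens'[OF sequentially_bot] by blast
    define \<xi> where "\<xi> = pt (n, \<one>)"
    have \<xi>: "\<xi> \<in> carrier Hil" unfolding \<xi>_def by (rule pt_in[OF ptX[OF one_closed]])
    have "hinner Hil \<xi> \<xi> = 1"
      unfolding \<xi>_def pt_kernel[OF ptX[OF one_closed] ptX[OF one_closed]] using r\<delta>(2)[of n] by (simp add: \<kappa>_def one)
    then have "hnorm Hil \<xi> = 1" by (simp add: hnorm_def)
    moreover have "hnorm Hil (rep g \<xi> \<ominus>\<^bsub>Hil\<^esub> \<xi>) < e" if g: "g \<in> F" for g
    proof -
      have gG: "g \<in> carrier G" using g F by auto
      have rg: "rep g \<xi> = pt (n, g)" using rep_pt[OF gG ptX[OF one_closed]] gG by (simp add: \<xi>_def act_def)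
      note P = ptX[OF gG, of n] ptX[OF one_closed, of n]
      have "(hnorm Hil (rep g \<xi> \<ominus>\<^bsub>Hil\<^esub> \<xi>))\<^sup>2 = Re (hinner Hil (pt (n, g) \<ominus>\<^bsub>Hil\<^esub> pt (n, \<one>)) (pt (n, g) \<ominus>\<^bsub>Hil\<^esub> pt (n, \<one>)))"
        unfolding rg unfolding \<xi>_def by (rule R.Re_hinner_self[symmetric]) (use pt_in[OF P(1)] pt_in[OF P(2)] in \<open>simp only: R.M.minus_closed\<close>)
      also have "\<dots> = Re (\<kappa> (n, g) (n, g) - \<kappa> (n, \<one>) (n, g) - (\<kappa> (n, g) (n, \<one>) - \<kappa> (n, \<one>) (n, \<one>)))"
        using pt_in[OF P(1)] pt_in[OF P(2)] R.M.minus_closed[OF pt_in[OF P(1)] pt_in[OF P(2)]]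
        by (simp only: R.hinner_minus pt_kernel P)
      also have "\<dots> = ?D n g / r n" by (simp add: \<kappa>_def diff_divide_distrib add_divide_distrib)
      also have "\<dots> < e\<^sup>2"
      proof -
        have "?D n g < e\<^sup>2 * r n" using n g r\<delta>(1)[of n] e by (smt (verit) mult_left_mono zero_le_power2)
        then show ?thesis using r\<delta>(2)[of n] by (simp add: divide_less_eq)
      qed
      finally show ?thesis using e by (simp add: power2_less_imp_less)
    qed
    ultimately show "\<exists>\<xi>\<in>carrier Hil. hnorm Hil \<xi> = 1 \<and> (\<forall>g\<in>F. hnorm Hil (rep g \<xi> \<ominus>\<^bsub>Hil\<^esub> \<xi>) < e)"
      using \<xi> by blast
  qed
  moreover have "inj_on \<iota> (carrier Hil)"
  proof (rule inj_on_subset[OF \<iota>], rule subsetI)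
    fix f assume "f \<in> carrier Hil"
    then have "f \<in> space" by simp
    then show "f \<in> {f. \<forall>i. i \<notin> UNIV \<times> carrier G \<longrightarrow> f i = 0}"
      unfolding X_def[symmetric] using space_outside by simp
  qed
  ultimately have "invariant_vector G Hil rep"
    by (intro property_T_transport[OF T unitary_rep_Hil])
  then obtain f where f: "f \<in> carrier Hil" "f \<noteq> \<zero>\<^bsub>Hil\<^esub>" "\<And>g. g \<in> carrier G \<Longrightarrow> rep g f = f"
    unfolding invariant_vector_def by blast
  \<comment> \<open>A vector is the function of its inner products with the points, so invariance
    means that it is constant on each block.\<close>
  have const: "f (n, g) = f (n, \<one>)" if g: "g \<in> carrier G" for n g
  proof -
    have "rep g f (n, g) = f (act (inv g) (n, g))" using f(1) ptX[OF g] by (simp add: rep_def shift_def)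
    then have "rep g f (n, g) = f (n, \<one>)" using g by (simp add: act_def)
    then show ?thesis using f(3)[OF g] by simp
  qed
  have zero: "f (n, \<one>) = 0" for n
  proof -
    \<comment> \<open>By constancy this value is, up to conjugation, also the inner product of f
      with any average of the points of the block, and the averages \<open>z n j\<close> have norms
      tending to 0.\<close>
    have le: "(cmod (f (n, \<one>)))\<^sup>2 \<le> Re (sesq (\<psi> n) {i. z n j i \<noteq> 0} (z n j) (z n j)) * (Re (hinner Hil f f) / r n)" for j
    proof -
      define c where "c = z n j"
      define S where "S = {i. c i \<noteq> 0}"
      have c: "finite S" "S \<subseteq> carrier G" "(\<Sum>i\<in>S. c i) = 1" using z[of n j] by (auto simp: prob_def c_def S_def)
      \<comment> \<open>\<open>None\<close> stands for f and \<open>Some g\<close> for the points of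
        the orbit, so that Cauchy-Schwarz can be used for one kernel containing both.\<close>
      define w where "w x = (case x of None \<Rightarrow> f | Some g \<Rightarrow> pt (n, g))" for x
      have w: "w ` (insert None (Some ` carrier G)) \<subseteq> carrier Hil" using f(1) pt_in ptX by (auto simp: w_def)
      have "(cmod (\<Sum>x\<in>Some ` S. c (the x) * hinner Hil (w x) (w None)))\<^sup>2 \<le>
          Re (sesq (\<lambda>x y. hinner Hil (w x) (w y)) (Some ` S) (\<lambda>x. c (the x)) (\<lambda>x. c (the x))) * Re (hinner Hil (w None) (w None))"
        by (rule pos_kernel_CS_single[OF pos_kernel_pullback[OF R.pos_kernel_hinner w]]) (use c in auto)
      also have "(\<Sum>x\<in>Some ` S. c (the x) * hinner Hil (w x) (w None)) = (\<Sum>g\<in>S. c g * hinner Hil (pt (n, g)) f)"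
        by (simp add: sum.reindex w_def)
      also have "\<dots> = (\<Sum>g\<in>S. c g * cnj (f (n, \<one>)))"
      proof (rule sum.cong[OF refl])
        fix g assume "g \<in> S"
        then have g: "g \<in> carrier G" using c by auto
        have "hinner Hil (pt (n, g)) f = cnj (hinner Hil f (pt (n, g)))"
          by (rule R.hinner_commute[OF f(1) pt_in[OF ptX[OF g]]])
        also have "\<dots> = cnj (f (n, \<one>))" using hinner_pt[OF f(1) ptX[OF g]] const[OF g] by simp
        finally show "c g * hinner Hil (pt (n, g)) f = c g * cnj (f (n, \<one>))" by simp
      qed
      also have "\<dots> = cnj (f (n, \<one>))" using c(3) by (simp flip: sum_distrib_right)
      also have "sesq (\<lambda>x y. hinner Hil (w x) (w y)) (Some ` S) (\<lambda>x. c (the x)) (\<lambda>x. c (the x)) =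
          (\<Sum>g\<in>S. \<Sum>h\<in>S. c g * cnj (c h) * hinner Hil (pt (n, g)) (pt (n, h)))"
        by (simp add: sesq_def sum.reindex w_def)
      also have "\<dots> = (\<Sum>g\<in>S. \<Sum>h\<in>S. of_real (1 / r n) * (c g * cnj (c h) * \<psi> n g h))"
      proof (intro sum.cong refl)
        fix g h assume "g \<in> S" "h \<in> S"
        then have "g \<in> carrier G" "h \<in> carrier G" using c by auto
        then have "hinner Hil (pt (n, g)) (pt (n, h)) = \<kappa> (n, g) (n, h)" by (intro pt_kernel ptX)
        then show "c g * cnj (c h) * hinner Hil (pt (n, g)) (pt (n, h)) = of_real (1 / r n) * (c g * cnj (c h) * \<psi> n g h)"
          by (simp add: \<kappa>_def)
      qed
      also have "\<dots> = of_real (1 / r n) * sesq (\<psi> n) S c c" unfolding sesq_def by (simp only: sum_distrib_left)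
      finally show ?thesis by (simp add: w_def c_def S_def)
    qed
    have "(\<lambda>j. Re (sesq (\<psi> n) {i. z n j i \<noteq> 0} (z n j) (z n j)) * (Re (hinner Hil f f) / r n)) \<longlonglongrightarrow> 0 * (Re (hinner Hil f f) / r n)"
      by (intro tendsto_intros avg)
    then have "(cmod (f (n, \<one>)))\<^sup>2 \<le> 0" using LIMSEQ_le_const[of _ 0 "(cmod (f (n, \<one>)))\<^sup>2"] le by auto
    then show ?thesis by simp
  qed
  have "f = (\<lambda>_. 0)"
  proof
    fix i :: "nat \<times> 'g"
    show "f i = 0"
    proof (cases "i \<in> X")
      case True
      then obtain n g where "i = (n, g)" "g \<in> carrier G" by (auto simp: X_def)
      then show ?thesis using const zero by simp
    qed (use f(1) space_outside in auto)
  qed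
  then show False using f(2) by simp
qed

text \<open>For nonzero k this is \<open>(hnorm H k)\<^sup>2\<close> times the Gram kernel of the
  components orthogonal to k. Its positivity is Cauchy-Schwarz against k.\<close>

lemma (in hilbert_space) pos_kernel_projection:
  assumes k: "k \<in> carrier H"
  shows "pos_kernel (carrier H) (\<lambda>x y. of_real ((hnorm H k)\<^sup>2) * hinner H x y - hinner H x k * cnj (hinner H y k))"
  unfolding pos_kernel_def
proof (intro allI impI)
  fix S c assume S: "finite S" "S \<subseteq> carrier H"
  let ?r = "complex_of_real ((hnorm H k)\<^sup>2)"
  have e: "sesq (\<lambda>x y. ?r * hinner H x y - hinner H x k * cnj (hinner H y k)) S c c =
      ?r * sesq (hinner H) S c c - of_real ((cmod (\<Sum>i\<in>S. c i * hinner H i k))\<^sup>2)"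
    unfolding sesq_rank_one[symmetric] unfolding sesq_def sum_distrib_left sum_subtractf[symmetric]
    by (intro sum.cong refl) (simp add: algebra_simps)
  note p = pos_kernelD[OF pos_kernel_hinner S, of c]
  have "(cmod (\<Sum>i\<in>S. c i * hinner H i k))\<^sup>2 \<le> Re (sesq (hinner H) S c c) * Re (hinner H k k)"
    by (rule pos_kernel_CS_single[OF pos_kernel_hinner S k])
  then show "Im (sesq (\<lambda>x y. ?r * hinner H x y - hinner H x k * cnj (hinner H y k)) S c c) = 0 \<and>
      0 \<le> Re (sesq (\<lambda>x y. ?r * hinner H x y - hinner H x k * cnj (hinner H y k)) S c c)"
    unfolding e using p k by (simp add: Re_hinner_self mult.commute del: of_real_power)
qed

section \<open>Averages of functions\<close>

definition pair :: "('i \<Rightarrow> complex) \<Rightarrow> ('i \<Rightarrow> complex) \<Rightarrow> complex" where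
  "pair c F = (\<Sum>i\<in>{i. c i \<noteq> 0}. c i * F i)"

lemma pair_diff:
  assumes "finite {i. c i \<noteq> 0}" "finite {i. d i \<noteq> 0}"
  shows "pair (\<lambda>i. c i + (-1) * d i) F = pair c F - pair d F"
proof -
  let ?S = "{i. c i \<noteq> 0} \<union> {i. d i \<noteq> 0}"
  have S: "finite ?S" using assms by simp
  have "pair (\<lambda>i. c i + (-1) * d i) F = (\<Sum>i\<in>?S. (c i + (-1) * d i) * F i)"
    unfolding pair_def by (rule sum_support[OF S]) auto
  moreover have "pair c F = (\<Sum>i\<in>?S. c i * F i)" "pair d F = (\<Sum>i\<in>?S. d i * F i)"
    unfolding pair_def by (rule sum_support[OF S]; auto)+
  ultimately show ?thesis by (simp add: sum_subtractf[symmetric] algebra_simps)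
qed

lemma prob_abs_sum:
  assumes "c \<in> prob X" "finite S"
  shows "(\<Sum>i\<in>S. cmod (c i)) \<le> 1"
proof -
  let ?T = "{i. c i \<noteq> 0}"
  have T: "finite ?T" using assms by (simp add: prob_def)
  have a: "cmod (c i) = Re (c i)" for i
  proof -
    have "c i = of_real (Re (c i))" "0 \<le> Re (c i)" using assms(1) by (auto simp: prob_def)
    then show ?thesis by (metis norm_of_real abs_of_nonneg)
  qed
  have "(\<Sum>i\<in>S. cmod (c i)) \<le> (\<Sum>i\<in>S \<union> ?T. cmod (c i))" by (rule sum_mono2) (use assms T in auto)
  also have "\<dots> = (\<Sum>i\<in>?T. cmod (c i))" by (rule sum.mono_neutral_right) (use assms T in auto)
  also have "\<dots> = Re (\<Sum>i\<in>?T. c i)" by (simp add: a)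
  also have "\<dots> = 1" using assms(1) by (simp add: prob_def)
  finally show ?thesis .
qed

lemma prob_diff_abs_sum:
  assumes "c \<in> prob X" "d \<in> prob X" "finite S"
  shows "(\<Sum>i\<in>S. cmod (c i + (-1) * d i)) \<le> 2"
proof -
  have "(\<Sum>i\<in>S. cmod (c i + (-1) * d i)) \<le> (\<Sum>i\<in>S. cmod (c i) + cmod (d i))"
    by (intro sum_mono) (use norm_triangle_ineq4 in auto)
  then show ?thesis using prob_abs_sum[OF assms(1,3)] prob_abs_sum[OF assms(2,3)] by (simp add: sum.distrib)
qed

lemma pair_norm_le:
  assumes "\<And>i. i \<in> X \<Longrightarrow> cmod (F i) \<le> C" "c \<in> prob X" "0 \<le> C"
  shows "cmod (pair c F) \<le> C"
proof -
  have c: "finite {i. c i \<noteq> 0}" "{i. c i \<noteq> 0} \<subseteq> X" using assms(2) by (auto simp: prob_def)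
  have "cmod (pair c F) \<le> (\<Sum>i\<in>{i. c i \<noteq> 0}. cmod (c i) * C)"
    unfolding pair_def by (rule sum_norm_le) (use assms(1) c in \<open>auto simp: norm_mult intro!: mult_left_mono\<close>)
  also have "\<dots> \<le> 1 * C" unfolding sum_distrib_right[symmetric]
    by (intro mult_right_mono prob_abs_sum[OF assms(2) c(1)] assms(3))
  finally show ?thesis by simp
qed

text \<open>This is the norm \<open>nB\<close> of the locale \<open>gns\<close>, with the kernel as
  an argument because it will vary with a sequence of functions.\<close>

definition seminorm :: "('i \<Rightarrow> 'i \<Rightarrow> complex) \<Rightarrow> ('i \<Rightarrow> complex) \<Rightarrow> real" where
  "seminorm k d = sqrt (Re (sesq k {i. d i \<noteq> 0} d d))"

text \<open>The average for left translations on G, freed from the vocabulary of the completion.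
  \<open>2 - \<Phi> g - \<Phi> (inv g)\<close> is the squared distance of the points g and
  \<open>\<one>\<close>, and \<open>z'\<close> is the translate of z by t, described through its
  effect on functions.\<close>

lemma positive_definite_average:
  fixes G :: "'g monoid" (structure)
  assumes "group G" and \<Phi>: "positive_definite G \<Phi>" "\<Phi> \<one> = 1"
  defines "k \<equiv> \<lambda>b a. \<Phi> (inv a \<otimes> b)"
  shows "\<exists>\<psi> z. pos_kernel (carrier G) \<psi> \<and>
    (\<forall>t\<in>carrier G. \<forall>g\<in>carrier G. \<forall>h\<in>carrier G. \<psi> (t \<otimes> g) (t \<otimes> h) = \<psi> g h) \<and>
    (\<forall>n. z n \<in> prob (carrier G)) \<and>
    (\<lambda>n :: nat. Re (sesq \<psi> {i. z n i \<noteq> 0} (z n) (z n))) \<longlonglongrightarrow> 0 \<and>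
    (\<forall>g\<in>carrier G. \<psi> g g + \<psi> \<one> \<one> - \<psi> g \<one> - \<psi> \<one> g = 2 - \<Phi> g - \<Phi> (inv g)) \<and>
    (\<lambda>n. (seminorm k (\<lambda>i. (if i = \<one> then 1 else 0) + (-1) * z n i))\<^sup>2) \<longlonglongrightarrow> Re (\<psi> \<one> \<one>) \<and>
    (\<forall>e>0. \<exists>N. \<forall>m\<ge>N. \<forall>n\<ge>N. seminorm k (\<lambda>i. z m i + (-1) * z n i) < e) \<and>
    (\<forall>t\<in>carrier G. \<exists>z'. (\<forall>n. z' n \<in> prob (carrier G)) \<and> (\<lambda>n. seminorm k (\<lambda>i. z' n i + (-1) * z n i)) \<longlonglongrightarrow> 0 \<and>
      (\<forall>n F. pair (z' n) F = pair (z n) (\<lambda>g. F (t \<otimes> g))))"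
proof -
  interpret group G by fact
  interpret gns_action "carrier G" k G "(\<otimes>)"
  proof
    show "pos_kernel (carrier G) k" using \<Phi>(1) by (simp add: positive_definite_iff k_def)
    show "k (g \<otimes> i) (g \<otimes> j) = k i j" if "g \<in> carrier G" "i \<in> carrier G" "j \<in> carrier G" for g i j
      using that by (simp add: k_def inv_mult_group m_assoc) (simp add: m_assoc[symmetric])
  qed (auto simp: m_assoc)
  have nB: "nB d = seminorm k d" for d by (simp add: nB_def seminorm_def B_def)
  obtain \<psi> z where A: "pos_kernel (carrier G) \<psi>"
    "\<forall>t\<in>carrier G. \<forall>g\<in>carrier G. \<forall>h\<in>carrier G. \<psi> (t \<otimes> g) (t \<otimes> h) = \<psi> g h"
    "cauchy z" "\<forall>n. z n \<in> prob (carrier G)" "\<forall>t\<in>carrier G. (\<lambda>n. nB (cm (shift t (z n)) (-1) (z n))) \<longlonglongrightarrow> 0"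
    "(\<lambda>n. Re (sesq \<psi> {i. z n i \<noteq> 0} (z n) (z n))) \<longlonglongrightarrow> 0"
    "\<forall>i\<in>carrier G. \<forall>j\<in>carrier G. \<psi> i i + \<psi> j j - \<psi> i j - \<psi> j i = k i i + k j j - k i j - k j i"
    "\<forall>i\<in>carrier G. (\<lambda>n. (nB (cm (\<delta> i) (-1) (z n)))\<^sup>2) \<longlonglongrightarrow> Re (\<psi> i i)"
    using average_kernel[OF one_closed] by blast
  have 1: "\<forall>g\<in>carrier G. \<psi> g g + \<psi> \<one> \<one> - \<psi> g \<one> - \<psi> \<one> g = 2 - \<Phi> g - \<Phi> (inv g)"
    using A(7) \<Phi>(2) by (simp add: k_def)
  have 2: "(\<lambda>n. (seminorm k (\<lambda>i. (if i = \<one> then 1 else 0) + (-1) * z n i))\<^sup>2) \<longlonglongrightarrow> Re (\<psi> \<one> \<one>)"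
    using A(8) by (auto simp: nB cm_def \<delta>_def)
  have 3: "\<forall>e>0. \<exists>N. \<forall>m\<ge>N. \<forall>n\<ge>N. seminorm k (\<lambda>i. z m i + (-1) * z n i) < e"
    using A(3) unfolding cauchy_def nB cm_def by blast
  have 4: "\<exists>z'. (\<forall>n. z' n \<in> prob (carrier G)) \<and> (\<lambda>n. seminorm k (\<lambda>i. z' n i + (-1) * z n i)) \<longlonglongrightarrow> 0 \<and>
      (\<forall>n F. pair (z' n) F = pair (z n) (\<lambda>g. F (t \<otimes> g)))" if t: "t \<in> carrier G" for t
  proof (intro exI[of _ "\<lambda>n. shift t (z n)"] conjI allI)
    show "shift t (z n) \<in> prob (carrier G)" for n using shift_prob[OF t] A(4) by blast
    show "(\<lambda>n. seminorm k (\<lambda>i. shift t (z n) i + (-1) * z n i)) \<longlonglongrightarrow> 0"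
      using A(5) t unfolding nB cm_def by blast
    fix n F
    let ?S = "{i. z n i \<noteq> 0}"
    have S: "finite ?S" "?S \<subseteq> carrier G" using A(4) by (auto simp: prob_def)
    have inj: "inj_on ((\<otimes>) t) ?S" using act_inj[OF t] S(2) by (rule inj_on_subset)
    have "pair (shift t (z n)) F = (\<Sum>i\<in>(\<otimes>) t ` ?S. shift t (z n) i * F i)"
      unfolding pair_def by (rule sum_support[OF finite_imageI[OF S(1)] shift_support[OF t order_refl S(2)]])
    also have "\<dots> = (\<Sum>i\<in>?S. shift t (z n) (t \<otimes> i) * F (t \<otimes> i))" by (simp add: sum.reindex[OF inj])
    also have "\<dots> = pair (z n) (\<lambda>g. F (t \<otimes> g))"
      unfolding pair_def using S(2) t by (intro sum.cong refl) (auto simp: shift_act)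
    finally show "pair (shift t (z n)) F = pair (z n) (\<lambda>g. F (t \<otimes> g))" .
  qed
  show ?thesis
    by (intro exI[of _ \<psi>] exI[of _ z] conjI A(1) A(2) A(4) A(6) 1 2 3 ballI 4)
qed

section \<open>Averages of coefficients dominated by a positive definite function\<close>

context coupling
begin

text \<open>Cutting v by \<open>\<tau> a q\<close> and substituting \<open>a \<otimes> b\<close> for
  the summation index brings in the vectors \<open>vec g b\<close>, paired with a vector that
  depends on neither g nor b. In this form the induced kernel can control T.\<close>

lemma T_column:
  assumes a: "a \<in> carrier L" and g: "g \<in> carrier G" and u: "u \<in> N" "v \<in> N"
    and w: "\<And>l. l \<in> carrier L \<Longrightarrow> cmod (w l) \<le> C"
  shows "((\<lambda>b. w (a \<otimes>\<^bsub>L\<^esub> b) * ip (vec g b) (\<tau> (inv\<^bsub>L\<^esub> a) (star u \<cdot> v))) has_sum T w u (v \<cdot> \<tau> a q) g) (carrier L)"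
proof -
  define s where "s = \<tau> a q"
  have s: "s \<in> N" "star s = s" using a q_proj by (simp_all add: s_def flip: L.act_star)
  have vs: "v \<cdot> s \<in> N" using u s by simp
  have bij: "bij_betw (\<lambda>b. a \<otimes>\<^bsub>L\<^esub> b) (carrier L) (carrier L)"
    by (rule bij_betwI[where g = "\<lambda>l. inv\<^bsub>L\<^esub> a \<otimes>\<^bsub>L\<^esub> l"]) (use a in \<open>auto simp: L.m_assoc[symmetric]\<close>)
  have "((\<lambda>l. w l * ip (u \<cdot> \<tau> l (\<sigma> g q)) (v \<cdot> s)) has_sum T w u (v \<cdot> s) g) (carrier L)"
    unfolding T_def by (rule G.wip_has_sum[OF partition_q[OF g] u(1) vs]) (rule w)
  then have "((\<lambda>b. w (a \<otimes>\<^bsub>L\<^esub> b) * ip (u \<cdot> \<tau> (a \<otimes>\<^bsub>L\<^esub> b) (\<sigma> g q)) (v \<cdot> s)) has_sum T w u (v \<cdot> s) g) (carrier L)"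
    using has_sum_reindex_bij_betw[OF bij, of "\<lambda>l. w l * ip (u \<cdot> \<tau> l (\<sigma> g q)) (v \<cdot> s)"] by simp
  moreover have "ip (u \<cdot> \<tau> (a \<otimes>\<^bsub>L\<^esub> b) (\<sigma> g q)) (v \<cdot> s) = ip (vec g b) (\<tau> (inv\<^bsub>L\<^esub> a) (star u \<cdot> v))"
    if b: "b \<in> carrier L" for b
  proof -
    define f where "f = \<tau> (a \<otimes>\<^bsub>L\<^esub> b) (\<sigma> g q)"
    have f: "f \<in> N" "f = \<tau> a (\<tau> b (\<sigma> g q))" using a b g q_N by (simp_all add: f_def L.act_comp)
    have "ip (u \<cdot> f) (v \<cdot> s) = ip f ((star u \<cdot> v) \<cdot> s)"
      using G.ip_mul_left[of u f "v \<cdot> s"] u f(1) s by (simp add: G.mul_assoc)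
    also have "\<dots> = ip (f \<cdot> s) (star u \<cdot> v)"
      using G.ip_mul_right[of f s "star u \<cdot> v"] u f(1) s by simp
    also have "f \<cdot> s = \<tau> a (vec g b)" using a b g q_N by (simp add: f(2) s_def vec_def L.act_mul)
    also have "ip (\<tau> a (vec g b)) (star u \<cdot> v) = ip (vec g b) (\<tau> (inv\<^bsub>L\<^esub> a) (star u \<cdot> v))"
      using L.act_ip[of a "vec g b" "\<tau> (inv\<^bsub>L\<^esub> a) (star u \<cdot> v)"] a b g u by (simp add: L.act_inv)
    finally show ?thesis by (simp add: f_def)
  qed
  ultimately show ?thesis unfolding s_def[symmetric] by (simp cong: has_sum_cong)
qed

text \<open>Satisfied by the coefficients \<open>l \<mapsto> \<langle>\<pi>\<^sub>l \<xi>, k\<rangle>\<close> when \<open>\<phi> l = \<langle>\<pi>\<^sub>l \<xi>, \<xi>\<rangle>\<close> and \<open>\<kappa> = \<parallel>k\<parallel>\<close>, by the Cauchy--Schwarz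
  inequality in the form of positive kernels.\<close>

definition dominated :: "('b \<Rightarrow> complex) \<Rightarrow> real \<Rightarrow> ('b \<Rightarrow> complex) \<Rightarrow> bool" where
  "dominated \<phi> \<kappa> w \<longleftrightarrow> positive_definite L \<phi> \<and> \<phi> \<one>\<^bsub>L\<^esub> = 1 \<and> 0 \<le> \<kappa> \<and>
    pos_kernel (carrier L) (\<lambda>b a. of_real (\<kappa>\<^sup>2) * \<phi> (inv\<^bsub>L\<^esub> a \<otimes>\<^bsub>L\<^esub> b) - w b * cnj (w a))"

lemma dominatedD:
  assumes "dominated \<phi> \<kappa> w"
  shows "positive_definite L \<phi>" "\<phi> \<one>\<^bsub>L\<^esub> = 1" "0 \<le> \<kappa>"
    "pos_kernel (carrier L) (\<lambda>b a. of_real (\<kappa>\<^sup>2) * \<phi> (inv\<^bsub>L\<^esub> a \<otimes>\<^bsub>L\<^esub> b) - w b * cnj (w a))"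
  using assms by (simp_all only: dominated_def)

lemma dominated_bound:
  assumes d: "dominated \<phi> \<kappa> w" and l: "l \<in> carrier L"
  shows "cmod (w l) \<le> \<kappa>"
proof -
  have "0 \<le> Re (of_real (\<kappa>\<^sup>2) * \<phi> (inv\<^bsub>L\<^esub> l \<otimes>\<^bsub>L\<^esub> l) - w l * cnj (w l))"
    by (rule pos_kernel_diag(2)[OF dominatedD(4)[OF d] l])
  then have "(cmod (w l))\<^sup>2 \<le> \<kappa>\<^sup>2"
    using l dominatedD(2)[OF d] unfolding complex_norm_square[symmetric] by simp
  then show ?thesis using dominatedD(3)[OF d] by (rule power2_le_imp_le)
qed

definition ind_kernel :: "('b \<Rightarrow> complex) \<Rightarrow> 'a \<Rightarrow> 'a \<Rightarrow> complex" where
  "ind_kernel \<phi> g h = induced \<phi> (inv\<^bsub>G\<^esub> h \<otimes>\<^bsub>G\<^esub> g)"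

text \<open>The key estimate: averages of T are continuous in the norm of the induced kernel when
  the weight is dominated by \<phi>. The part of v outside finitely many translates of q is bounded
  crudely by the sum of the absolute coefficients. Each remaining part is an inner product with one
  fixed vector, to which Cauchy-Schwarz applies.\<close>

lemma T_combination_le:
  assumes dom: "dominated \<phi> \<kappa> w"
    and S: "finite S" "S \<subseteq> carrier G" and u: "u \<in> N" "v \<in> N" and A: "finite A" "A \<subseteq> carrier L"
  defines "k \<equiv> ind_kernel \<phi>"
  shows "cmod (\<Sum>g\<in>S. d g * T w u v g) \<le>
    \<kappa> * ((\<Sum>g\<in>S. cmod (d g)) * G.nrm u * G.nrm (G.cut (\<lambda>a. \<tau> a q) A v) +
      card A * (G.nrm (star u \<cdot> v) * G.nrm q * sqrt (Re (sesq k S d d))))"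
proof -
  note \<phi> = dominatedD(1,2)[OF dom] and \<kappa> = dominatedD(3)[OF dom] and w = dominatedD(4)[OF dom]
  define \<theta> where "\<theta> = (\<lambda>b a. \<phi> (inv\<^bsub>L\<^esub> a \<otimes>\<^bsub>L\<^esub> b))"
  have \<theta>: "pos_kernel (carrier L) \<theta>" using \<phi>(1) by (simp add: positive_definite_iff \<theta>_def)
  note wb = dominated_bound[OF dom]
  note P = fund_q
  let ?c = "G.cut (\<lambda>a. \<tau> a q) A v"
  have c: "?c \<in> N" by (rule G.cut(1)[OF P u(2) A])
  define y where "y a = \<tau> (inv\<^bsub>L\<^esub> a) (star u \<cdot> v)" for a
  have y: "y a \<in> N" "G.nrm (y a) = G.nrm (star u \<cdot> v)" if "a \<in> carrier L" for a
    using that u by (simp_all add: y_def L.nrm_act)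
  have part: "cmod (\<Sum>g\<in>S. d g * T w u (v \<cdot> \<tau> a q) g) \<le> \<kappa> * (G.nrm (star u \<cdot> v) * G.nrm q * sqrt (Re (sesq k S d d)))"
    if a: "a \<in> A" for a
  proof -
    have aL: "a \<in> carrier L" using a A by auto
    define w' where "w' b = w (a \<otimes>\<^bsub>L\<^esub> b)" for b
    define \<theta>' where "\<theta>' b c = w' b * cnj (w' c)" for b c
    \<comment> \<open>Domination survives left translation of the weight, because the kernel of
      \<phi> is left invariant.\<close>
    have K: "pos_kernel (carrier L) (\<lambda>b c. of_real (\<kappa>\<^sup>2) * \<theta> b c - \<theta>' b c)"
    proof -
      have "pos_kernel (carrier L) (\<lambda>b c. (\<lambda>b a. of_real (\<kappa>\<^sup>2) * \<phi> (inv\<^bsub>L\<^esub> a \<otimes>\<^bsub>L\<^esub> b) - w b * cnj (w a)) (a \<otimes>\<^bsub>L\<^esub> b) (a \<otimes>\<^bsub>L\<^esub> c))"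
        by (rule pos_kernel_pullback[OF w]) (use aL in auto)
      then show ?thesis
      proof (rule pos_kernel_cong)
        fix b c assume bc: "b \<in> carrier L" "c \<in> carrier L"
        have "inv\<^bsub>L\<^esub> (a \<otimes>\<^bsub>L\<^esub> c) \<otimes>\<^bsub>L\<^esub> (a \<otimes>\<^bsub>L\<^esub> b) = inv\<^bsub>L\<^esub> c \<otimes>\<^bsub>L\<^esub> (inv\<^bsub>L\<^esub> a \<otimes>\<^bsub>L\<^esub> a) \<otimes>\<^bsub>L\<^esub> b"
          using aL bc by (simp only: L.inv_mult_group L.m_assoc L.inv_closed L.m_closed)
        also have "\<dots> = inv\<^bsub>L\<^esub> c \<otimes>\<^bsub>L\<^esub> b" using aL bc by simp
        finally show "of_real (\<kappa>\<^sup>2) * \<theta> b c - \<theta>' b c =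
            of_real (\<kappa>\<^sup>2) * \<phi> (inv\<^bsub>L\<^esub> (a \<otimes>\<^bsub>L\<^esub> c) \<otimes>\<^bsub>L\<^esub> (a \<otimes>\<^bsub>L\<^esub> b)) - w (a \<otimes>\<^bsub>L\<^esub> b) * cnj (w (a \<otimes>\<^bsub>L\<^esub> c))"
          by (simp add: \<theta>_def \<theta>'_def w'_def)
      qed
    qed
    \<comment> \<open>Cauchy-Schwarz in \<open>N\<close> produces the truncated form for
      \<open>\<theta>'\<close>. The Schur product of the kernel in \<open>K\<close> with the Gram
      kernel of the vectors \<open>vec g b\<close> is positive, so \<open>\<theta>'\<close> may be
      replaced by \<open>\<kappa>\<^sup>2\<close> times \<theta>.\<close>
    have bound: "(cmod (\<Sum>g\<in>S. d g * (\<Sum>b\<in>C. w' b * ip (vec g b) (y a))))\<^sup>2 \<le>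
        \<kappa>\<^sup>2 * Re (sesq (trunc \<theta> C) S d d) * (G.nrm (y a))\<^sup>2" if C: "finite C" "C \<subseteq> carrier L" for C
    proof -
      define f where "f x = (case x of None \<Rightarrow> y a | Some (g, b) \<Rightarrow> vec g b)" for x
      have f: "f ` insert None (Some ` (carrier G \<times> carrier L)) \<subseteq> N" using y(1)[OF aL] by (auto simp: f_def)
      define c where "c x = d (fst (the x)) * w' (snd (the x))" for x :: "('a \<times> 'b) option"
      have "(cmod (\<Sum>x\<in>Some ` (S \<times> C). c x * ip (f x) (f None)))\<^sup>2 \<le>
          Re (sesq (\<lambda>x y. ip (f x) (f y)) (Some ` (S \<times> C)) c c) * Re (ip (f None) (f None))"
        by (rule pos_kernel_CS_single[OF pos_kernel_pullback[OF G.ip_pos f]]) (use S C in auto)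
      moreover have "(\<Sum>x\<in>Some ` (S \<times> C). c x * ip (f x) (f None)) = (\<Sum>g\<in>S. d g * (\<Sum>b\<in>C. w' b * ip (vec g b) (y a)))"
        by (simp add: sum.reindex c_def f_def sum.cartesian_product' case_prod_unfold sum_distrib_left mult.assoc)
      moreover have "sesq (\<lambda>x y. ip (f x) (f y)) (Some ` (S \<times> C)) c c = sesq (trunc \<theta>' C) S d d"
        unfolding sesq_trunc unfolding sesq_def
        by (simp add: sum.reindex c_def f_def ker_def \<theta>'_def case_prod_unfold mult_ac)
      moreover have "Re (ip (f None) (f None)) = (G.nrm (y a))\<^sup>2" using G.Re_ip_self[OF y(1)[OF aL]] by (simp add: f_def)
      moreover have "Re (sesq (trunc \<theta>' C) S d d) \<le> \<kappa>\<^sup>2 * Re (sesq (trunc \<theta> C) S d d)"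
      proof -
        have tr: "trunc (\<lambda>b c. of_real (\<kappa>\<^sup>2) * \<theta> b c - \<theta>' b c) C g h = of_real (\<kappa>\<^sup>2) * trunc \<theta> C g h - trunc \<theta>' C g h" for g h
          unfolding trunc_def sum_distrib_left sum_subtractf[symmetric] by (intro sum.cong refl) (simp add: algebra_simps)
        have "sesq (trunc (\<lambda>b c. of_real (\<kappa>\<^sup>2) * \<theta> b c - \<theta>' b c) C) S d d =
            of_real (\<kappa>\<^sup>2) * sesq (trunc \<theta> C) S d d - sesq (trunc \<theta>' C) S d d"
          unfolding sesq_def tr sum_distrib_left sum_subtractf[symmetric] by (intro sum.cong refl) (simp add: algebra_simps)
        then show ?thesis using pos_kernelD(2)[OF pos_kernel_trunc[OF K C] S, of d] by simp
      qed
      ultimately show ?thesis by (smt (verit) mult_right_mono zero_le_power2)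
    qed
    have lim1: "((\<lambda>C. \<Sum>g\<in>S. d g * (\<Sum>b\<in>C. w' b * ip (vec g b) (y a))) \<longlongrightarrow>
        (\<Sum>g\<in>S. d g * T w u (v \<cdot> \<tau> a q) g)) (finite_subsets_at_top (carrier L))"
    proof (intro tendsto_sum tendsto_mult_left)
      fix g assume "g \<in> S"
      then have "g \<in> carrier G" using S by auto
      from T_column[OF aL this u wb]
      show "((\<lambda>C. \<Sum>b\<in>C. w' b * ip (vec g b) (y a)) \<longlongrightarrow> T w u (v \<cdot> \<tau> a q) g) (finite_subsets_at_top (carrier L))"
        unfolding has_sum_def w'_def y_def .
    qed
    \<comment> \<open>The truncated forms of \<theta> converge to the form of the induced kernel;
      the factor undoes its normalisation.\<close>
    have lim2: "((\<lambda>C. sesq (trunc \<theta> C) S d d) \<longlongrightarrow> ip q q * sesq k S d d) (finite_subsets_at_top (carrier L))"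
    proof -
      have "ip q q * sesq k S d d = sesq (\<lambda>g h. T \<phi> (\<sigma> h q) (\<sigma> h q) g) S d d"
        unfolding sesq_def sum_distrib_left k_def ind_kernel_def
        using S(2) by (intro sum.cong refl) (simp add: induced_kernel subset_iff)
      then show ?thesis
        unfolding sesq_def \<theta>_def using S(2) by (auto intro!: tendsto_sum tendsto_mult_left trunc_tendsto[OF \<phi>])
    qed
    have "(cmod (\<Sum>g\<in>S. d g * T w u (v \<cdot> \<tau> a q) g))\<^sup>2 \<le> \<kappa>\<^sup>2 * Re (ip q q * sesq k S d d) * (G.nrm (y a))\<^sup>2"
    proof (rule tendsto_le[OF finite_subsets_at_top_neq_bot])
      show "((\<lambda>C. (cmod (\<Sum>g\<in>S. d g * (\<Sum>b\<in>C. w' b * ip (vec g b) (y a))))\<^sup>2) \<longlongrightarrow>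
          (cmod (\<Sum>g\<in>S. d g * T w u (v \<cdot> \<tau> a q) g))\<^sup>2) (finite_subsets_at_top (carrier L))"
        by (intro tendsto_power tendsto_norm lim1)
      show "((\<lambda>C. \<kappa>\<^sup>2 * Re (sesq (trunc \<theta> C) S d d) * (G.nrm (y a))\<^sup>2) \<longlongrightarrow>
          \<kappa>\<^sup>2 * Re (ip q q * sesq k S d d) * (G.nrm (y a))\<^sup>2) (finite_subsets_at_top (carrier L))"
        by (intro tendsto_intros lim2)
      show "\<forall>\<^sub>F C in finite_subsets_at_top (carrier L). (cmod (\<Sum>g\<in>S. d g * (\<Sum>b\<in>C. w' b * ip (vec g b) (y a))))\<^sup>2 \<le>
          \<kappa>\<^sup>2 * Re (sesq (trunc \<theta> C) S d d) * (G.nrm (y a))\<^sup>2"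
        by (rule eventually_finite_subsets_at_top_weakI) (rule bound)
    qed
    also have "Re (ip q q * sesq k S d d) = (G.nrm q)\<^sup>2 * Re (sesq k S d d)" by (simp add: ip_q(1) del: of_real_power)
    finally have "(cmod (\<Sum>g\<in>S. d g * T w u (v \<cdot> \<tau> a q) g))\<^sup>2 \<le> (\<kappa> * G.nrm q * G.nrm (star u \<cdot> v))\<^sup>2 * Re (sesq k S d d)"
      using y(2)[OF aL] by (simp add: power_mult_distrib mult_ac)
    then have "sqrt ((cmod (\<Sum>g\<in>S. d g * T w u (v \<cdot> \<tau> a q) g))\<^sup>2) \<le> sqrt ((\<kappa> * G.nrm q * G.nrm (star u \<cdot> v))\<^sup>2 * Re (sesq k S d d))"
      by (rule real_sqrt_le_mono)
    then show ?thesis using \<kappa> q_N u by (simp add: real_sqrt_mult mult_ac)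
  qed
  have "(\<Sum>g\<in>S. d g * T w u v g) = (\<Sum>g\<in>S. d g * T w u ?c g) + (\<Sum>a\<in>A. \<Sum>g\<in>S. d g * T w u (v \<cdot> \<tau> a q) g)"
  proof -
    have "T w u v g = T w u ?c g + (\<Sum>a\<in>A. T w u (v \<cdot> \<tau> a q) g)" if g: "g \<in> S" for g
    proof -
      have "g \<in> carrier G" using g S by auto
      then have "T w u ?c g = T w u v g - (\<Sum>a\<in>A. T w u (v \<cdot> \<tau> a q) g)"
        unfolding T_def by (intro G.wip_cut_right[OF partition_q P u wb A])
      then show ?thesis by simp
    qed
    then have "(\<Sum>g\<in>S. d g * T w u v g) = (\<Sum>g\<in>S. d g * T w u ?c g + (\<Sum>a\<in>A. d g * T w u (v \<cdot> \<tau> a q) g))"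
      by (intro sum.cong refl) (simp add: algebra_simps sum_distrib_left)
    then show ?thesis by (simp add: sum.distrib sum.swap[of _ A S])
  qed
  then have "cmod (\<Sum>g\<in>S. d g * T w u v g) \<le> cmod (\<Sum>g\<in>S. d g * T w u ?c g) + cmod (\<Sum>a\<in>A. \<Sum>g\<in>S. d g * T w u (v \<cdot> \<tau> a q) g)"
    by (simp add: norm_triangle_ineq)
  also have "\<dots> \<le> (\<Sum>g\<in>S. cmod (d g) * (\<kappa> * G.nrm u * G.nrm ?c)) +
      (\<Sum>a\<in>A. \<kappa> * (G.nrm (star u \<cdot> v) * G.nrm q * sqrt (Re (sesq k S d d))))"
  proof (intro add_mono sum_norm_le part)
    fix g assume "g \<in> S"
    then have "g \<in> carrier G" using S by auto
    then have "cmod (T w u ?c g) \<le> \<bar>\<kappa>\<bar> * G.nrm u * G.nrm ?c" by (intro T_bound u c wb)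
    then show "cmod (d g * T w u ?c g) \<le> cmod (d g) * (\<kappa> * G.nrm u * G.nrm ?c)"
      using \<kappa> by (simp add: norm_mult mult_left_mono)
  qed
  also have "\<dots> = \<kappa> * ((\<Sum>g\<in>S. cmod (d g)) * G.nrm u * G.nrm ?c +
      card A * (G.nrm (star u \<cdot> v) * G.nrm q * sqrt (Re (sesq k S d d))))"
    unfolding sum_distrib_right[symmetric] sum_constant by (simp add: algebra_simps)
  finally show ?thesis .
qed

text \<open>The number \<eta> depends on u, v and \<epsilon> only. This uniformity permits fixing it
  before property (T) of G selects one out of a sequence of functions \<phi>.\<close>

lemma T_combination_small:
  assumes u: "u \<in> N" "v \<in> N" and \<epsilon>: "\<epsilon> > 0"
  obtains \<eta> where "\<eta> > 0"
    "\<And>\<phi> \<kappa> w c d. dominated \<phi> \<kappa> w \<Longrightarrow> c \<in> prob (carrier G) \<Longrightarrow> d \<in> prob (carrier G) \<Longrightarrow>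
      seminorm (ind_kernel \<phi>) (\<lambda>i. c i + (-1) * d i) \<le> \<eta> \<Longrightarrow>
      cmod (pair c (T w u v) - pair d (T w u v)) \<le> \<kappa> * \<epsilon>"
proof -
  have u0: "0 \<le> G.nrm u" using u by simp
  \<comment> \<open>The difference of two probabilities has absolute sum at most 2, so a remainder
    of this size contributes at most \<epsilon>/2.\<close>
  have "\<epsilon> / (4 * (G.nrm u + 1)) > 0" using \<epsilon> u0 by (intro divide_pos_pos) auto
  then obtain A where A: "finite A" "A \<subseteq> carrier L" "G.nrm (G.cut (\<lambda>a. \<tau> a q) A v) < \<epsilon> / (4 * (G.nrm u + 1))"
    using G.nrm_cut_small[OF fund_q u(2)] by (metis order_refl)
  define M where "M = real (card A) * (G.nrm (star u \<cdot> v) * G.nrm q)"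
  have M: "0 \<le> M" using u q_N by (simp add: M_def)
  define \<eta> where "\<eta> = \<epsilon> / (2 * (M + 1))"
  have \<eta>: "\<eta> > 0" using \<epsilon> M by (simp add: \<eta>_def)
  have "cmod (pair c (T w u v) - pair d (T w u v)) \<le> \<kappa> * \<epsilon>"
    if dom: "dominated \<phi> \<kappa> w" and c: "c \<in> prob (carrier G)" and d: "d \<in> prob (carrier G)"
      and s: "seminorm (ind_kernel \<phi>) (\<lambda>i. c i + (-1) * d i) \<le> \<eta>" for \<phi> \<kappa> w c d
  proof -
    let ?d = "\<lambda>i. c i + (-1) * d i"
    let ?S = "{i. ?d i \<noteq> 0}"
    have fin: "finite {i. c i \<noteq> 0}" "finite {i. d i \<noteq> 0}" "{i. c i \<noteq> 0} \<subseteq> carrier G" "{i. d i \<noteq> 0} \<subseteq> carrier G"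
      using c d by (auto simp: prob_def)
    have sub: "?S \<subseteq> {i. c i \<noteq> 0} \<union> {i. d i \<noteq> 0}" by auto
    have S: "finite ?S" "?S \<subseteq> carrier G" using sub fin by (auto intro: finite_subset)
    have "cmod (pair c (T w u v) - pair d (T w u v)) = cmod (\<Sum>g\<in>?S. ?d g * T w u v g)"
      using pair_diff[OF fin(1,2), of "T w u v"] by (simp add: pair_def)
    also have "\<dots> \<le> \<kappa> * ((\<Sum>g\<in>?S. cmod (?d g)) * G.nrm u * G.nrm (G.cut (\<lambda>a. \<tau> a q) A v) +
      card A * (G.nrm (star u \<cdot> v) * G.nrm q * sqrt (Re (sesq (ind_kernel \<phi>) ?S ?d ?d))))"
      by (rule T_combination_le[OF dom S u A(1,2)])
    also have "\<dots> \<le> \<kappa> * \<epsilon>"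
    proof (intro mult_left_mono dominatedD(3)[OF dom])
      have "(\<Sum>g\<in>?S. cmod (?d g)) * G.nrm u * G.nrm (G.cut (\<lambda>a. \<tau> a q) A v) \<le> 2 * (G.nrm u + 1) * (\<epsilon> / (4 * (G.nrm u + 1)))"
        using A(3) u0 G.cut(1)[OF fund_q u(2) A(1,2)] prob_diff_abs_sum[OF c d S(1)]
        by (intro mult_mono) auto
      also have "\<dots> = \<epsilon> / 2"
      proof -
        have "2 * x * (\<epsilon> / (4 * x)) = \<epsilon> / 2" if "0 < x" for x using that by simp
        from this[of "G.nrm u + 1"] show ?thesis using u0 by simp
      qed
      finally have 1: "(\<Sum>g\<in>?S. cmod (?d g)) * G.nrm u * G.nrm (G.cut (\<lambda>a. \<tau> a q) A v) \<le> \<epsilon> / 2" .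
      have "card A * (G.nrm (star u \<cdot> v) * G.nrm q * sqrt (Re (sesq (ind_kernel \<phi>) ?S ?d ?d))) = M * seminorm (ind_kernel \<phi>) ?d"
        by (simp add: M_def seminorm_def)
      also have "\<dots> \<le> (M + 1) * \<eta>"
      proof -
        have "M * seminorm (ind_kernel \<phi>) ?d \<le> M * \<eta>" using s M by (rule mult_left_mono)
        also have "\<dots> \<le> (M + 1) * \<eta>" using \<eta> by (simp add: mult_right_mono)
        finally show ?thesis .
      qed
      also have "\<dots> = \<epsilon> / 2"
      proof -
        have "x * (\<epsilon> / (2 * x)) = \<epsilon> / 2" if "0 < x" for x using that by simp
        from this[of "M + 1"] show ?thesis using M by (simp add: \<eta>_def)
      qed
      finally have 2: "card A * (G.nrm (star u \<cdot> v) * G.nrm q * sqrt (Re (sesq (ind_kernel \<phi>) ?S ?d ?d))) \<le> \<epsilon> / 2" .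
      from 1 2 show "(\<Sum>g\<in>?S. cmod (?d g)) * G.nrm u * G.nrm (G.cut (\<lambda>a. \<tau> a q) A v) +
          card A * (G.nrm (star u \<cdot> v) * G.nrm q * sqrt (Re (sesq (ind_kernel \<phi>) ?S ?d ?d))) \<le> \<epsilon>" by linarith
    qed
    finally show ?thesis .
  qed
  then show thesis using \<eta> by (intro that[of \<eta>])
qed

end

lemma pair_cong: "c \<in> prob X \<Longrightarrow> (\<And>i. i \<in> X \<Longrightarrow> F i = F' i) \<Longrightarrow> pair c F = pair c F'"
  unfolding pair_def prob_def by (intro sum.cong refl) auto

lemma pair_simps:
  "pair c (\<lambda>i. F i + F' i) = pair c F + pair c F'"
  "pair c (\<lambda>i. F i - F' i) = pair c F - pair c F'"
  "pair c (\<lambda>i. a * F i) = a * pair c F"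
  "pair c (\<lambda>i. \<Sum>t\<in>B. E t i) = (\<Sum>t\<in>B. pair c (E t))"
proof -
  show "pair c (\<lambda>i. \<Sum>t\<in>B. E t i) = (\<Sum>t\<in>B. pair c (E t))"
    unfolding pair_def sum_distrib_left by (rule sum.swap)
qed (simp_all add: pair_def sum.distrib sum_subtractf sum_distrib_left algebra_simps)

lemma point_prob:
  assumes "x \<in> X"
  shows "(\<lambda>i. if i = x then 1 else 0) \<in> prob X" "pair (\<lambda>i. if i = x then 1 else 0) F = F x"
proof -
  have "{i. (if i = x then 1 else 0 :: complex) \<noteq> 0} = {x}" by auto
  then show "(\<lambda>i. if i = x then 1 else 0) \<in> prob X" "pair (\<lambda>i. if i = x then 1 else 0) F = F x"
    using assms by (simp_all add: prob_def pair_def)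
qed

context coupling
begin

lemma pair_T_diff_tendsto:
  assumes dom: "dominated \<phi> \<kappa> w" and u: "u \<in> N" "v \<in> N"
    and c: "\<And>j. c j \<in> prob (carrier G)" and d: "\<And>j. d j \<in> prob (carrier G)"
    and lim: "(\<lambda>j. seminorm (ind_kernel \<phi>) (\<lambda>i. c j i + (-1) * d j i)) \<longlonglongrightarrow> 0"
  shows "(\<lambda>j. pair (c j) (T w u v) - pair (d j) (T w u v)) \<longlonglongrightarrow> 0"
proof (rule tendstoI)
  fix \<epsilon> :: real assume \<epsilon>: "\<epsilon> > 0"
  note \<kappa> = dominatedD(3)[OF dom]
  have "\<epsilon> / (\<kappa> + 1) > 0" using \<epsilon> \<kappa> by simp
  note small = T_combination_small[OF u this]
  obtain \<eta> where \<eta>: "\<eta> > 0" "\<And>\<phi> \<kappa>' w c d. dominated \<phi> \<kappa>' w \<Longrightarrow> c \<in> prob (carrier G) \<Longrightarrow> d \<in> prob (carrier G) \<Longrightarrow>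
      seminorm (ind_kernel \<phi>) (\<lambda>i. c i + (-1) * d i) \<le> \<eta> \<Longrightarrow>
      cmod (pair c (T w u v) - pair d (T w u v)) \<le> \<kappa>' * (\<epsilon> / (\<kappa> + 1))"
    using small by blast
  have less: "\<kappa> * (\<epsilon> / (\<kappa> + 1)) < \<epsilon>" using \<epsilon> \<kappa> by (simp add: field_simps)
  show "\<forall>\<^sub>F j in sequentially. dist (pair (c j) (T w u v) - pair (d j) (T w u v)) 0 < \<epsilon>"
    using order_tendstoD(2)[OF lim \<eta>(1)]
  proof (rule eventually_mono)
    fix j assume "seminorm (ind_kernel \<phi>) (\<lambda>i. c j i + (-1) * d j i) < \<eta>"
    then have "cmod (pair (c j) (T w u v) - pair (d j) (T w u v)) \<le> \<kappa> * (\<epsilon> / (\<kappa> + 1))"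
      by (intro \<eta>(2)[OF dom c d] less_imp_le)
    then show "dist (pair (c j) (T w u v) - pair (d j) (T w u v)) 0 < \<epsilon>"
      using less by (simp only: dist_norm diff_zero)
  qed
qed

lemma pair_T_convergent:
  assumes dom: "dominated \<phi> \<kappa> w" and u: "u \<in> N" "v \<in> N" and z: "\<And>j. z j \<in> prob (carrier G)"
    and cau: "\<And>\<epsilon>. \<epsilon> > 0 \<Longrightarrow> \<exists>N. \<forall>m\<ge>N. \<forall>n\<ge>N. seminorm (ind_kernel \<phi>) (\<lambda>i. z m i + (-1) * z n i) < \<epsilon>"
  shows "convergent (\<lambda>j :: nat. pair (z j) (T w u v))"
  unfolding Cauchy_convergent_iff[symmetric]
proof (rule metric_CauchyI)
  fix \<epsilon> :: real assume \<epsilon>: "\<epsilon> > 0"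
  note \<kappa> = dominatedD(3)[OF dom]
  have "\<epsilon> / (\<kappa> + 1) > 0" using \<epsilon> \<kappa> by simp
  note small = T_combination_small[OF u this]
  obtain \<eta> where \<eta>: "\<eta> > 0" "\<And>\<phi> \<kappa>' w c d. dominated \<phi> \<kappa>' w \<Longrightarrow> c \<in> prob (carrier G) \<Longrightarrow> d \<in> prob (carrier G) \<Longrightarrow>
      seminorm (ind_kernel \<phi>) (\<lambda>i. c i + (-1) * d i) \<le> \<eta> \<Longrightarrow>
      cmod (pair c (T w u v) - pair d (T w u v)) \<le> \<kappa>' * (\<epsilon> / (\<kappa> + 1))"
    using small by blast
  have less: "\<kappa> * (\<epsilon> / (\<kappa> + 1)) < \<epsilon>" using \<epsilon> \<kappa> by (simp add: field_simps)
  obtain M where M: "\<And>m n. m \<ge> M \<Longrightarrow> n \<ge> M \<Longrightarrow> seminorm (ind_kernel \<phi>) (\<lambda>i. z m i + (-1) * z n i) < \<eta>"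
    using cau[OF \<eta>(1)] by blast
  have "dist (pair (z m) (T w u v)) (pair (z n) (T w u v)) < \<epsilon>" if "m \<ge> M" "n \<ge> M" for m n
  proof -
    have "cmod (pair (z m) (T w u v) - pair (z n) (T w u v)) \<le> \<kappa> * (\<epsilon> / (\<kappa> + 1))"
      by (rule \<eta>(2)[OF dom z z less_imp_le[OF M[OF that]]])
    then show ?thesis using less by (simp only: dist_norm)
  qed
  then show "\<exists>M. \<forall>m\<ge>M. \<forall>n\<ge>M. dist (pair (z m) (T w u v)) (pair (z n) (T w u v)) < \<epsilon>" by blast
qed

text \<open>The combinations \<open>z j\<close> act like an invariant mean, though only in the limit
  and only on functions \<open>T w u v\<close> with w dominated by \<phi>. The differences produced
  by \<open>T_change_domain\<close> are of this kind, with the same w.\<close>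

lemma pair_T_invariant:
  assumes dom: "dominated \<phi> \<kappa> w" and s: "s \<in> carrier L" and z: "\<And>j. z j \<in> prob (carrier G)"
    and inv: "\<And>t. t \<in> carrier G \<Longrightarrow> \<exists>z'. (\<forall>j. z' j \<in> prob (carrier G)) \<and>
      (\<lambda>j. seminorm (ind_kernel \<phi>) (\<lambda>i. z' j i + (-1) * z j i)) \<longlonglongrightarrow> 0 \<and>
      (\<forall>j F. pair (z' j) F = pair (z j) (\<lambda>g. F (t \<otimes>\<^bsub>G\<^esub> g)))"
  shows "(\<lambda>j :: nat. pair (z j) (T (\<lambda>l. w (s \<otimes>\<^bsub>L\<^esub> l)) p p) - pair (z j) (T w p p)) \<longlonglongrightarrow> 0"
proof (rule tendstoI)
  fix \<epsilon> :: real assume \<epsilon>: "\<epsilon> > 0"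
  note \<kappa> = dominatedD(3)[OF dom] and wb = dominated_bound[OF dom]
  define \<delta> where "\<delta> = \<epsilon> / (2 * (\<kappa> + 1))"
  have \<delta>: "\<delta> > 0" "\<kappa> * \<delta> < \<epsilon> / 2" using \<epsilon> \<kappa> by (auto simp: \<delta>_def field_simps)
  obtain B where B: "finite B" "B \<subseteq> carrier G" and
    est: "\<And>w C g. \<lbrakk>\<And>l. l \<in> carrier L \<Longrightarrow> cmod (w l) \<le> C; g \<in> carrier G\<rbrakk> \<Longrightarrow>
      cmod (T (\<lambda>l. w (s \<otimes>\<^bsub>L\<^esub> l)) p p g - T w p p g -
        (\<Sum>t\<in>B. T w p (p \<cdot> \<sigma> t (\<tau> s p)) (t \<otimes>\<^bsub>G\<^esub> g) - T w p (p \<cdot> \<sigma> t (\<tau> s p)) g)) \<le> \<bar>C\<bar> * \<delta>"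
    using T_change_domain[OF s \<delta>(1)] by blast
  define A where "A t = T w p (p \<cdot> \<sigma> t (\<tau> s p))" for t
  define D where "D j t = pair (z j) (\<lambda>g. A t (t \<otimes>\<^bsub>G\<^esub> g)) - pair (z j) (A t)" for j t
  have "(\<lambda>j. D j t) \<longlonglongrightarrow> 0" if t: "t \<in> B" for t
  proof -
    have tG: "t \<in> carrier G" using t B by auto
    obtain z' where z': "\<And>j. z' j \<in> prob (carrier G)"
      "(\<lambda>j. seminorm (ind_kernel \<phi>) (\<lambda>i. z' j i + (-1) * z j i)) \<longlonglongrightarrow> 0"
      "\<And>j F. pair (z' j) F = pair (z j) (\<lambda>g. F (t \<otimes>\<^bsub>G\<^esub> g))" using inv[OF tG] by blast
    have v: "p \<cdot> \<sigma> t (\<tau> s p) \<in> N" using tG s p_N by simp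
    show ?thesis
      unfolding D_def A_def z'(3)[symmetric] by (rule pair_T_diff_tendsto[OF dom p_N v z'(1) z z'(2)])
  qed
  then have "(\<lambda>j. \<Sum>t\<in>B. D j t) \<longlonglongrightarrow> (\<Sum>t\<in>B. 0)" by (rule tendsto_sum)
  then have "\<forall>\<^sub>F j in sequentially. dist (\<Sum>t\<in>B. D j t) 0 < \<epsilon> / 2"
    using \<epsilon> by (intro tendstoD) auto
  then show "\<forall>\<^sub>F j in sequentially. dist (pair (z j) (T (\<lambda>l. w (s \<otimes>\<^bsub>L\<^esub> l)) p p) - pair (z j) (T w p p)) 0 < \<epsilon>"
  proof (rule eventually_mono)
    fix j assume D: "dist (\<Sum>t\<in>B. D j t) 0 < \<epsilon> / 2"
    let ?X = "pair (z j) (T (\<lambda>l. w (s \<otimes>\<^bsub>L\<^esub> l)) p p) - pair (z j) (T w p p)"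
    have "cmod (pair (z j) (\<lambda>g. T (\<lambda>l. w (s \<otimes>\<^bsub>L\<^esub> l)) p p g - T w p p g - (\<Sum>t\<in>B. A t (t \<otimes>\<^bsub>G\<^esub> g) - A t g))) \<le> \<bar>\<kappa>\<bar> * \<delta>"
    proof (rule pair_norm_le[OF _ z])
      fix g assume "g \<in> carrier G"
      then show "cmod (T (\<lambda>l. w (s \<otimes>\<^bsub>L\<^esub> l)) p p g - T w p p g - (\<Sum>t\<in>B. A t (t \<otimes>\<^bsub>G\<^esub> g) - A t g)) \<le> \<bar>\<kappa>\<bar> * \<delta>"
        unfolding A_def by (intro est wb)
    qed (use \<delta> in simp)
    also have "pair (z j) (\<lambda>g. T (\<lambda>l. w (s \<otimes>\<^bsub>L\<^esub> l)) p p g - T w p p g - (\<Sum>t\<in>B. A t (t \<otimes>\<^bsub>G\<^esub> g) - A t g)) =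
        ?X - (\<Sum>t\<in>B. D j t)"
      by (simp only: pair_simps D_def)
    finally have "cmod (?X - (\<Sum>t\<in>B. D j t)) < \<epsilon> / 2" using \<kappa> \<delta>(2) by simp
    then show "dist ?X 0 < \<epsilon>"
      using D norm_triangle_ineq[of "?X - (\<Sum>t\<in>B. D j t)" "\<Sum>t\<in>B. D j t"] by (simp add: dist_norm)
  qed
qed

lemma invariant_vector_of_functional:
  assumes rep: "unitary_rep L K \<pi>" and \<xi>: "\<xi> \<in> carrier K" "hnorm K \<xi> = 1"
    and dom: "\<And>k. k \<in> carrier K \<Longrightarrow> dominated \<phi> (hnorm K k) (\<lambda>l. hinner K (\<pi> l \<xi>) k)"
    and z: "\<And>j. z j \<in> prob (carrier G)"
    and cau: "\<And>\<epsilon>. \<epsilon> > 0 \<Longrightarrow> \<exists>N. \<forall>m\<ge>N. \<forall>n\<ge>N. seminorm (ind_kernel \<phi>) (\<lambda>i. z m i + (-1) * z n i) < \<epsilon>"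
    and inv: "\<And>t. t \<in> carrier G \<Longrightarrow> \<exists>z'. (\<forall>j. z' j \<in> prob (carrier G)) \<and>
      (\<lambda>j. seminorm (ind_kernel \<phi>) (\<lambda>i. z' j i + (-1) * z j i)) \<longlonglongrightarrow> 0 \<and>
      (\<forall>j F. pair (z' j) F = pair (z j) (\<lambda>g. F (t \<otimes>\<^bsub>G\<^esub> g)))"
    and nz: "\<not> (\<lambda>j :: nat. pair (z j) (T (\<lambda>l. hinner K (\<pi> l \<xi>) \<xi>) p p)) \<longlonglongrightarrow> 0"
  shows "invariant_vector L K \<pi>"
proof -
  interpret R: unitary_rep L K \<pi> by (rule rep)
  define w where "w k = (\<lambda>l. hinner K (\<pi> l \<xi>) k)" for k
  have dom: "dominated \<phi> (hnorm K k) (w k)" if "k \<in> carrier K" for k using dom[OF that] by (simp add: w_def)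
  have wb: "\<And>l. l \<in> carrier L \<Longrightarrow> cmod (w k l) \<le> hnorm K k" if "k \<in> carrier K" for k
    by (rule dominated_bound[OF dom[OF that]])
  define \<Phi> where "\<Phi> k = lim (\<lambda>j. pair (z j) (T (w k) p p))" for k
  have lim: "(\<lambda>j. pair (z j) (T (w k) p p)) \<longlonglongrightarrow> \<Phi> k" if "k \<in> carrier K" for k
    unfolding \<Phi>_def convergent_LIMSEQ_iff[symmetric]
    by (rule pair_T_convergent[OF dom[OF that] p_N p_N z cau])
  \<comment> \<open>The coefficient of \<open>\<pi> l \<xi>\<close> against k is conjugate linear in
    k, hence the conjugation before the representation theorem is applied.\<close>
  have "\<exists>\<zeta>\<in>carrier K. \<forall>k\<in>carrier K. cnj (\<Phi> k) = hinner K k \<zeta>"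
  proof (rule R.riesz_representation)
    fix k k' assume k: "k \<in> carrier K" "k' \<in> carrier K"
    have "pair (z j) (T (w (k \<oplus>\<^bsub>K\<^esub> k')) p p) = pair (z j) (T (w k) p p) + pair (z j) (T (w k') p p)" for j
      unfolding pair_simps(1)[symmetric]
    proof (rule pair_cong[OF z])
      fix g assume g: "g \<in> carrier G"
      have "T (w (k \<oplus>\<^bsub>K\<^esub> k')) p p g = T (\<lambda>l. w k l + w k' l) p p g"
        unfolding T_def by (rule G.wip_cong) (use k \<xi> in \<open>simp add: w_def R.hinner_add_right\<close>)
      also have "\<dots> = T (w k) p p g + T (w k') p p g"
        unfolding T_def by (rule G.wip_add[OF partition_q[OF g] p_N p_N wb[OF k(1)] wb[OF k(2)]])
      finally show "T (w (k \<oplus>\<^bsub>K\<^esub> k')) p p g = T (w k) p p g + T (w k') p p g" .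
    qed
    then have "(\<lambda>j. pair (z j) (T (w (k \<oplus>\<^bsub>K\<^esub> k')) p p)) \<longlonglongrightarrow> \<Phi> k + \<Phi> k'"
      using tendsto_add[OF lim[OF k(1)] lim[OF k(2)]] by simp
    with lim[of "k \<oplus>\<^bsub>K\<^esub> k'"] k have "\<Phi> (k \<oplus>\<^bsub>K\<^esub> k') = \<Phi> k + \<Phi> k'" by (intro LIMSEQ_unique) auto
    then show "cnj (\<Phi> (k \<oplus>\<^bsub>K\<^esub> k')) = cnj (\<Phi> k) + cnj (\<Phi> k')" by simp
  next
    fix a k assume k: "k \<in> carrier K"
    have "pair (z j) (T (w (a \<odot>\<^bsub>K\<^esub> k)) p p) = cnj a * pair (z j) (T (w k) p p)" for j
      unfolding pair_simps(3)[symmetric]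
    proof (rule pair_cong[OF z])
      fix g assume g: "g \<in> carrier G"
      have "T (w (a \<odot>\<^bsub>K\<^esub> k)) p p g = T (\<lambda>l. cnj a * w k l) p p g"
        unfolding T_def by (rule G.wip_cong) (use k \<xi> in \<open>simp add: w_def R.hinner_smult_right\<close>)
      also have "\<dots> = cnj a * T (w k) p p g" unfolding T_def by (rule G.wip_cmult)
      finally show "T (w (a \<odot>\<^bsub>K\<^esub> k)) p p g = cnj a * T (w k) p p g" .
    qed
    then have "(\<lambda>j. pair (z j) (T (w (a \<odot>\<^bsub>K\<^esub> k)) p p)) \<longlonglongrightarrow> cnj a * \<Phi> k"
      using tendsto_mult_left[OF lim[OF k]] by simp
    with lim[of "a \<odot>\<^bsub>K\<^esub> k"] k have "\<Phi> (a \<odot>\<^bsub>K\<^esub> k) = cnj a * \<Phi> k" by (intro LIMSEQ_unique) auto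
    then show "cnj (\<Phi> (a \<odot>\<^bsub>K\<^esub> k)) = a * cnj (\<Phi> k)" by simp
  next
    fix k assume k: "k \<in> carrier K"
    have "cmod (pair (z j) (T (w k) p p)) \<le> hnorm K k * (G.nrm p)\<^sup>2" for j
    proof (rule pair_norm_le[OF _ z])
      fix g assume "g \<in> carrier G"
      then have "cmod (T (w k) p p g) \<le> \<bar>hnorm K k\<bar> * G.nrm p * G.nrm p" by (intro T_bound p_N wb k)
      then show "cmod (T (w k) p p g) \<le> hnorm K k * (G.nrm p)\<^sup>2" using k by (simp add: power2_eq_square mult_ac)
    qed (use k in simp)
    then have "cmod (\<Phi> k) \<le> hnorm K k * (G.nrm p)\<^sup>2"
      using tendsto_norm[OF lim[OF k]] by (intro LIMSEQ_le_const2) auto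
    then show "cmod (cnj (\<Phi> k)) \<le> (G.nrm p)\<^sup>2 * hnorm K k" by (simp add: mult.commute)
  qed
  then obtain \<zeta> where \<zeta>: "\<zeta> \<in> carrier K" "\<And>k. k \<in> carrier K \<Longrightarrow> cnj (\<Phi> k) = hinner K k \<zeta>" by blast
  \<comment> \<open>The weight of \<open>\<pi> s k\<close> at the product of s and l is the weight
    of k at l. So moving k by s amounts to translating the weight, which the limit of the averages
    does not see.\<close>
  have \<Phi>_inv: "\<Phi> (\<pi> s k) = \<Phi> k" if s: "s \<in> carrier L" and k: "k \<in> carrier K" for s k
  proof -
    have sk: "\<pi> s k \<in> carrier K" using s k by (rule R.rep_in)
    have "T (\<lambda>l. w (\<pi> s k) (s \<otimes>\<^bsub>L\<^esub> l)) p p = T (w k) p p"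
      unfolding T_def
      by (intro ext G.wip_cong) (use s k \<xi> in \<open>simp add: w_def R.rep_mult R.rep_hinner R.rep_in\<close>)
    then have "(\<lambda>j. pair (z j) (T (w k) p p) - pair (z j) (T (w (\<pi> s k)) p p)) \<longlonglongrightarrow> 0"
      using pair_T_invariant[OF dom[OF sk] s z inv] by simp
    moreover have "(\<lambda>j. pair (z j) (T (w k) p p) - pair (z j) (T (w (\<pi> s k)) p p)) \<longlonglongrightarrow> \<Phi> k - \<Phi> (\<pi> s k)"
      by (intro tendsto_diff lim k sk)
    ultimately have "\<Phi> k - \<Phi> (\<pi> s k) = 0" using LIMSEQ_unique by blast
    then show ?thesis by simp
  qed
  have "\<pi> s \<zeta> = \<zeta>" if s: "s \<in> carrier L" for s
  proof (rule R.hinner_ext)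
    show "\<pi> s \<zeta> \<in> carrier K" using s \<zeta>(1) by (rule R.rep_in)
    fix y assume y: "y \<in> carrier K"
    define x where "x = \<pi> (inv\<^bsub>L\<^esub> s) y"
    have x: "x \<in> carrier K" "y = \<pi> s x"
      using s y R.rep_mult[of s "inv\<^bsub>L\<^esub> s" y] by (simp_all add: x_def R.rep_in R.rep_one)
    have "hinner K y \<zeta> = cnj (\<Phi> y)" using \<zeta>(2)[OF y] by simp
    also have "\<dots> = hinner K x \<zeta>" using \<Phi>_inv[OF s x(1)] \<zeta>(2)[OF x(1)] by (simp add: x(2))
    also have "\<dots> = hinner K y (\<pi> s \<zeta>)" using s x \<zeta>(1) by (simp add: R.rep_hinner)
    finally show "hinner K (\<pi> s \<zeta>) y = hinner K \<zeta> y"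
      using R.hinner_commute[of y \<zeta>] R.hinner_commute[of y "\<pi> s \<zeta>"] s y \<zeta>(1) by (simp add: R.rep_in)
  qed (rule \<zeta>(1))
  moreover have "\<zeta> \<noteq> \<zero>\<^bsub>K\<^esub>"
  proof
    assume "\<zeta> = \<zero>\<^bsub>K\<^esub>"
    then have "\<Phi> \<xi> = 0" using \<zeta>(2)[OF \<xi>(1)] \<xi>(1) by simp
    then show False using lim[OF \<xi>(1)] nz by (simp add: w_def)
  qed
  ultimately show ?thesis using \<zeta>(1) unfolding invariant_vector_def by blast
qed

lemma property_T_transfer:
  assumes countable: "countable (carrier G)" "countable (carrier L)" and T: "property_T TYPE('u) G"
  shows "property_T TYPE('u) L"
  unfolding property_T_def
proof (intro allI impI)
  fix K :: "'u inner_module" and \<pi>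
  assume rep: "unitary_rep L K \<pi>" and ai: "almost_invariant_vectors L K \<pi>"
  interpret R: unitary_rep L K \<pi> by (rule rep)
  \<comment> \<open>Countability of L turns almost invariance into a sequence: the n-th vector is
    moved by less than 1/(n+1) by the elements enumerated up to n.\<close>
  define e where "e = from_nat_into (carrier L)"
  have e: "e i \<in> carrier L" for i unfolding e_def by (rule from_nat_into) auto
  have "\<forall>n. \<exists>\<xi>. \<xi> \<in> carrier K \<and> hnorm K \<xi> = 1 \<and> (\<forall>l\<in>e ` {..n}. hnorm K (\<pi> l \<xi> \<ominus>\<^bsub>K\<^esub> \<xi>) < 1 / real (Suc n))"
  proof
    fix n
    have "finite (e ` {..n})" "e ` {..n} \<subseteq> carrier L" "0 < 1 / real (Suc n)" using e by auto
    then show "\<exists>\<xi>. \<xi> \<in> carrier K \<and> hnorm K \<xi> = 1 \<and> (\<forall>l\<in>e ` {..n}. hnorm K (\<pi> l \<xi> \<ominus>\<^bsub>K\<^esub> \<xi>) < 1 / real (Suc n))"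
      using ai unfolding almost_invariant_vectors_def by blast
  qed
  then obtain \<xi> where \<xi>: "\<And>n. \<xi> n \<in> carrier K" "\<And>n. hnorm K (\<xi> n) = 1"
    "\<And>n. \<forall>l\<in>e ` {..n}. hnorm K (\<pi> l (\<xi> n) \<ominus>\<^bsub>K\<^esub> \<xi> n) < 1 / real (Suc n)" by metis
  define \<phi> where "\<phi> n l = hinner K (\<pi> l (\<xi> n)) (\<xi> n)" for n l
  have \<phi>_kernel: "\<phi> n (inv\<^bsub>L\<^esub> a \<otimes>\<^bsub>L\<^esub> b) = hinner K (\<pi> b (\<xi> n)) (\<pi> a (\<xi> n))"
    if a: "a \<in> carrier L" and b: "b \<in> carrier L" for n a b
  proof -
    have ab: "inv\<^bsub>L\<^esub> a \<otimes>\<^bsub>L\<^esub> b \<in> carrier L" using a b by simp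
    have "\<pi> a (\<pi> (inv\<^bsub>L\<^esub> a \<otimes>\<^bsub>L\<^esub> b) (\<xi> n)) = \<pi> b (\<xi> n)"
      using R.rep_mult[OF a ab \<xi>(1)] a b by (simp add: L.m_assoc[symmetric])
    then show ?thesis
      using R.rep_hinner[OF a R.rep_in[OF ab \<xi>(1)] \<xi>(1), of n n] by (simp add: \<phi>_def)
  qed
  have \<phi>1: "\<phi> n \<one>\<^bsub>L\<^esub> = 1" for n using \<xi>(1,2)[of n] by (simp add: \<phi>_def R.rep_one R.hinner_self)
  have \<phi>pd: "positive_definite L (\<phi> n)" for n
    unfolding positive_definite_iff
  proof (rule pos_kernel_cong)
    show "pos_kernel (carrier L) (\<lambda>b a. hinner K (\<pi> b (\<xi> n)) (\<pi> a (\<xi> n)))"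
      by (rule pos_kernel_pullback[OF R.pos_kernel_hinner]) (use \<xi>(1) R.rep_in in auto)
  qed (rule \<phi>_kernel)
  have dom: "dominated (\<phi> n) (hnorm K k) (\<lambda>l. hinner K (\<pi> l (\<xi> n)) k)" if k: "k \<in> carrier K" for n k
    unfolding dominated_def
  proof (intro conjI \<phi>pd \<phi>1 R.hnorm_nonneg k)
    have "pos_kernel (carrier L) (\<lambda>b a. (\<lambda>x y. of_real ((hnorm K k)\<^sup>2) * hinner K x y - hinner K x k * cnj (hinner K y k))
        (\<pi> b (\<xi> n)) (\<pi> a (\<xi> n)))"
      by (rule pos_kernel_pullback[OF R.pos_kernel_projection[OF k]]) (use \<xi>(1) R.rep_in in auto)
    then show "pos_kernel (carrier L) (\<lambda>b a. of_real ((hnorm K k)\<^sup>2) * \<phi> n (inv\<^bsub>L\<^esub> a \<otimes>\<^bsub>L\<^esub> b) -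
        hinner K (\<pi> b (\<xi> n)) k * cnj (hinner K (\<pi> a (\<xi> n)) k))"
      by (rule pos_kernel_cong) (simp add: \<phi>_kernel)
  qed
  have \<phi>lim: "(\<lambda>n. \<phi> n l) \<longlonglongrightarrow> 1" if l: "l \<in> carrier L" for l
  proof -
    obtain i where i: "e i = l" using from_nat_into_surj[OF countable(2) l] by (auto simp: e_def)
    have "(\<lambda>n. \<phi> n l - 1) \<longlonglongrightarrow> 0"
    proof (rule Lim_null_comparison)
      show "(\<lambda>n. 1 / real (Suc n)) \<longlonglongrightarrow> 0" using LIMSEQ_inverse_real_of_nat by (simp add: inverse_eq_divide)
      show "\<forall>\<^sub>F n in sequentially. norm (\<phi> n l - 1) \<le> 1 / real (Suc n)"
        using eventually_ge_at_top[of i]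
      proof (rule eventually_mono)
        fix n assume "n \<ge> i"
        then have "hnorm K (\<pi> l (\<xi> n) \<ominus>\<^bsub>K\<^esub> \<xi> n) < 1 / real (Suc n)" using \<xi>(3)[of n] i by auto
        moreover have pl: "\<pi> l (\<xi> n) \<in> carrier K" using l \<xi>(1) by (rule R.rep_in)
        have "\<phi> n l - 1 = hinner K (\<pi> l (\<xi> n) \<ominus>\<^bsub>K\<^esub> \<xi> n) (\<xi> n)"
          using pl \<xi>(1,2)[of n] by (simp add: \<phi>_def R.hinner_minus R.hinner_self)
        then have "norm (\<phi> n l - 1) \<le> hnorm K (\<pi> l (\<xi> n) \<ominus>\<^bsub>K\<^esub> \<xi> n)"
          using R.hinner_CS[of "\<pi> l (\<xi> n) \<ominus>\<^bsub>K\<^esub> \<xi> n" "\<xi> n"] pl \<xi>(1,2)[of n] by simp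
        ultimately show "norm (\<phi> n l - 1) \<le> 1 / real (Suc n)" by linarith
      qed
    qed
    then show ?thesis by (simp add: LIM_zero_iff)
  qed
  \<comment> \<open>A nonzero vector shows that \<open>'u\<close> has room for a representation of G
    on functions on \<open>nat \<times> carrier G\<close>.\<close>
  have "\<xi> 0 \<noteq> \<zero>\<^bsub>K\<^esub>" using \<xi>(1,2)[of 0] R.hnorm_zero_iff[of "\<xi> 0"] by auto
  then have "\<exists>\<iota> :: (nat \<times> 'a \<Rightarrow> complex) \<Rightarrow> 'u. inj_on \<iota> {f. \<forall>i. i \<notin> UNIV \<times> carrier G \<longrightarrow> f i = 0}"
    using countable(1) by (intro R.function_space_inj[OF \<xi>(1)]) auto
  then obtain \<iota> :: "(nat \<times> 'a \<Rightarrow> complex) \<Rightarrow> 'u"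
    where \<iota>: "inj_on \<iota> {f. \<forall>i. i \<notin> UNIV \<times> carrier G \<longrightarrow> f i = 0}" by blast
  define c0 where "c0 = (G.nrm p)\<^sup>2"
  have c0: "c0 > 0" "ip p p = of_real c0" using G.ip_self[OF p_N] p_nonzero by (auto simp: c0_def)
  have c4: "c0 / 4 > 0" using c0(1) by simp
  \<comment> \<open>The values of T at the unit of G tend to \<open>c0\<close>. An error of c0/4 is
    allowed for the index n and another for replacing the unit by an average, so averages keep
    absolute value at least c0/2. The same \<eta> serves for all n.\<close>
  obtain \<eta> where \<eta>: "\<eta> > 0" "\<And>\<phi> \<kappa> w c d. dominated \<phi> \<kappa> w \<Longrightarrow> c \<in> prob (carrier G) \<Longrightarrow> d \<in> prob (carrier G) \<Longrightarrow>
      seminorm (ind_kernel \<phi>) (\<lambda>i. c i + (-1) * d i) \<le> \<eta> \<Longrightarrow>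
      cmod (pair c (T w p p) - pair d (T w p p)) \<le> \<kappa> * (c0 / 4)"
    using T_combination_small[OF p_N p_N c4] by blast
  have "(\<lambda>n. T (\<phi> n) p p \<one>\<^bsub>G\<^esub>) \<longlonglongrightarrow> T (\<lambda>_. 1) p p \<one>\<^bsub>G\<^esub>"
    unfolding T_def
    by (rule G.wip_tendsto[OF partition_q p_N p_N, where C = 1])
      (use \<phi>lim positive_definite_norm_le[OF L.is_group \<phi>pd \<phi>1] in auto)
  also have "T (\<lambda>_. 1) p p \<one>\<^bsub>G\<^esub> = of_real c0"
    unfolding T_def c0(2)[symmetric] by (rule G.wip_one[OF partition_q p_N p_N]) simp
  finally have "\<forall>\<^sub>F n in sequentially. dist (T (\<phi> n) p p \<one>\<^bsub>G\<^esub>) (of_real c0) < c0 / 4"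
    using c0(1) by (intro tendstoD) auto
  then obtain M where M: "\<And>n. n \<ge> M \<Longrightarrow> dist (T (\<phi> n) p p \<one>\<^bsub>G\<^esub>) (of_real c0) < c0 / 4"
    unfolding eventually_sequentially by blast
  \<comment> \<open>There is no control over the n that property (T) selects; after the shift by M
    every n satisfies the bound just obtained.\<close>
  define \<Phi> where "\<Phi> n = induced (\<phi> (n + M))" for n
  \<comment> \<open>One predicate for all data at n, so that kernels and averages can be chosen for
    all n simultaneously.\<close>
  define P where "P n \<psi> z \<longleftrightarrow> pos_kernel (carrier G) \<psi> \<and>
    (\<forall>t\<in>carrier G. \<forall>g\<in>carrier G. \<forall>h\<in>carrier G. \<psi> (t \<otimes>\<^bsub>G\<^esub> g) (t \<otimes>\<^bsub>G\<^esub> h) = \<psi> g h) \<and>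
    (\<forall>n. z n \<in> prob (carrier G)) \<and>
    (\<lambda>n :: nat. Re (sesq \<psi> {i. z n i \<noteq> 0} (z n) (z n))) \<longlonglongrightarrow> 0 \<and>
    (\<forall>g\<in>carrier G. \<psi> g g + \<psi> \<one>\<^bsub>G\<^esub> \<one>\<^bsub>G\<^esub> - \<psi> g \<one>\<^bsub>G\<^esub> - \<psi> \<one>\<^bsub>G\<^esub> g = 2 - \<Phi> n g - \<Phi> n (inv\<^bsub>G\<^esub> g)) \<and>
    (\<lambda>j. (seminorm (ind_kernel (\<phi> (n + M))) (\<lambda>i. (if i = \<one>\<^bsub>G\<^esub> then 1 else 0) + (-1) * z j i))\<^sup>2) \<longlonglongrightarrow> Re (\<psi> \<one>\<^bsub>G\<^esub> \<one>\<^bsub>G\<^esub>) \<and>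
    (\<forall>\<epsilon>>0. \<exists>N. \<forall>i\<ge>N. \<forall>j\<ge>N. seminorm (ind_kernel (\<phi> (n + M))) (\<lambda>g. z i g + (-1) * z j g) < \<epsilon>) \<and>
    (\<forall>t\<in>carrier G. \<exists>z'. (\<forall>j. z' j \<in> prob (carrier G)) \<and>
      (\<lambda>j. seminorm (ind_kernel (\<phi> (n + M))) (\<lambda>i. z' j i + (-1) * z j i)) \<longlonglongrightarrow> 0 \<and>
      (\<forall>j F. pair (z' j) F = pair (z j) (\<lambda>g. F (t \<otimes>\<^bsub>G\<^esub> g))))" for n \<psi> z
  have "\<exists>\<psi> z. P n \<psi> z" for n
  proof -
    have k: "ind_kernel (\<phi> (n + M)) = (\<lambda>b a. \<Phi> n (inv\<^bsub>G\<^esub> a \<otimes>\<^bsub>G\<^esub> b))"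
      by (intro ext) (simp add: ind_kernel_def \<Phi>_def)
    show ?thesis unfolding P_def k
      by (rule positive_definite_average[OF G.is_group])
        (simp_all add: \<Phi>_def induced_positive_definite induced_one \<phi>pd \<phi>1)
  qed
  then obtain \<psi> z where P: "\<And>n. P n (\<psi> n) (z n)" by metis
  \<comment> \<open>This diagonal value is the limit of squared seminorms of the unit minus its
    averages, hence the square of \<eta>.\<close>
  have "\<exists>n. Re (\<psi> n \<one>\<^bsub>G\<^esub> \<one>\<^bsub>G\<^esub>) < \<eta>\<^sup>2"
  proof (rule kazhdan_small[OF G.is_group T \<iota>, of \<psi> z])
    show "pos_kernel (carrier G) (\<psi> n)" for n using P[of n] unfolding P_def by (elim conjE)
    show "\<psi> n (t \<otimes>\<^bsub>G\<^esub> g) (t \<otimes>\<^bsub>G\<^esub> h) = \<psi> n g h" if "t \<in> carrier G" "g \<in> carrier G" "h \<in> carrier G" for n t g h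
      using P[of n] that unfolding P_def by (elim conjE) simp
    show "z n j \<in> prob (carrier G)" for n j using P[of n] unfolding P_def by (elim conjE) simp
    show "(\<lambda>j. Re (sesq (\<psi> n) {i. z n j i \<noteq> 0} (z n j) (z n j))) \<longlonglongrightarrow> 0" for n
      using P[of n] unfolding P_def by (elim conjE)
    fix g assume g: "g \<in> carrier G"
    have "(\<lambda>n. induced (\<phi> n) h) \<longlonglongrightarrow> 1" if "h \<in> carrier G" for h
      by (rule induced_tendsto[OF \<phi>pd \<phi>1 \<phi>lim that])
    then have \<Phi>: "(\<lambda>n. \<Phi> n h) \<longlonglongrightarrow> 1" if "h \<in> carrier G" for h
      unfolding \<Phi>_def using that by (intro LIMSEQ_ignore_initial_segment)
    have "(\<lambda>n. Re (2 - \<Phi> n g - \<Phi> n (inv\<^bsub>G\<^esub> g))) \<longlonglongrightarrow> Re (2 - 1 - 1)"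
      using g by (intro tendsto_intros \<Phi>) auto
    moreover have "\<psi> n g g + \<psi> n \<one>\<^bsub>G\<^esub> \<one>\<^bsub>G\<^esub> - \<psi> n g \<one>\<^bsub>G\<^esub> - \<psi> n \<one>\<^bsub>G\<^esub> g = 2 - \<Phi> n g - \<Phi> n (inv\<^bsub>G\<^esub> g)" for n
      using P[of n] g unfolding P_def by (elim conjE) simp
    ultimately show "(\<lambda>n. Re (\<psi> n g g + \<psi> n \<one>\<^bsub>G\<^esub> \<one>\<^bsub>G\<^esub> - \<psi> n g \<one>\<^bsub>G\<^esub> - \<psi> n \<one>\<^bsub>G\<^esub> g)) \<longlonglongrightarrow> 0" by simp
  qed (use \<eta>(1) in simp)
  then obtain n where n: "Re (\<psi> n \<one>\<^bsub>G\<^esub> \<one>\<^bsub>G\<^esub>) < \<eta>\<^sup>2" by blast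
  let ?\<phi> = "\<phi> (n + M)" and ?\<delta> = "\<lambda>i. if i = \<one>\<^bsub>G\<^esub> then 1 else 0"
  have z: "z n j \<in> prob (carrier G)" for j using P[of n] unfolding P_def by (elim conjE) simp
  have "(\<lambda>j. (seminorm (ind_kernel ?\<phi>) (\<lambda>i. ?\<delta> i + (-1) * z n j i))\<^sup>2) \<longlonglongrightarrow> Re (\<psi> n \<one>\<^bsub>G\<^esub> \<one>\<^bsub>G\<^esub>)"
    using P[of n] unfolding P_def by (elim conjE)
  from order_tendstoD(2)[OF this n]
  have near: "\<forall>\<^sub>F j in sequentially. c0 / 2 \<le> cmod (pair (z n j) (T ?\<phi> p p))"
  proof (rule eventually_mono)
    fix j assume "(seminorm (ind_kernel ?\<phi>) (\<lambda>i. ?\<delta> i + (-1) * z n j i))\<^sup>2 < \<eta>\<^sup>2"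
    then have s: "seminorm (ind_kernel ?\<phi>) (\<lambda>i. ?\<delta> i + (-1) * z n j i) \<le> \<eta>"
      using power_less_imp_less_base[of _ 2 \<eta>] \<eta>(1) by (simp add: less_eq_real_def)
    \<comment> \<open>The positive definite function is itself the coefficient against k =
      \<open>\<xi> (n + M)\<close>, a unit vector, hence the constant 1.\<close>
    have d: "dominated ?\<phi> 1 ?\<phi>" using dom[OF \<xi>(1), of "n + M" "n + M"] by (simp add: \<xi>(2) \<phi>_def[abs_def])
    have "cmod (pair ?\<delta> (T ?\<phi> p p) - pair (z n j) (T ?\<phi> p p)) \<le> 1 * (c0 / 4)"
      by (rule \<eta>(2)[OF d point_prob(1)[OF G.one_closed] z s])
    then have "cmod (T ?\<phi> p p \<one>\<^bsub>G\<^esub> - pair (z n j) (T ?\<phi> p p)) \<le> c0 / 4"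
      by (simp add: point_prob(2)[OF G.one_closed])
    moreover have "cmod (T ?\<phi> p p \<one>\<^bsub>G\<^esub> - of_real c0) < c0 / 4" using M[of "n + M"] by (simp add: dist_norm)
    moreover have "c0 \<le> cmod (T ?\<phi> p p \<one>\<^bsub>G\<^esub>) + cmod (T ?\<phi> p p \<one>\<^bsub>G\<^esub> - of_real c0)"
      using norm_triangle_ineq4[of "T ?\<phi> p p \<one>\<^bsub>G\<^esub>" "T ?\<phi> p p \<one>\<^bsub>G\<^esub> - of_real c0"] c0(1) by simp
    moreover have "cmod (T ?\<phi> p p \<one>\<^bsub>G\<^esub>) \<le> cmod (T ?\<phi> p p \<one>\<^bsub>G\<^esub> - pair (z n j) (T ?\<phi> p p)) + cmod (pair (z n j) (T ?\<phi> p p))"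
      using norm_triangle_ineq[of "T ?\<phi> p p \<one>\<^bsub>G\<^esub> - pair (z n j) (T ?\<phi> p p)" "pair (z n j) (T ?\<phi> p p)"] by simp
    ultimately show "c0 / 2 \<le> cmod (pair (z n j) (T ?\<phi> p p))" by linarith
  qed
  show "invariant_vector L K \<pi>"
  proof (rule invariant_vector_of_functional[OF rep \<xi>(1) \<xi>(2) dom z])
    show "\<exists>N. \<forall>i\<ge>N. \<forall>j\<ge>N. seminorm (ind_kernel ?\<phi>) (\<lambda>g. z n i g + (-1) * z n j g) < \<epsilon>" if "\<epsilon> > 0" for \<epsilon>
      using P[of n] that unfolding P_def by (elim conjE) simp
    show "\<exists>z'. (\<forall>j. z' j \<in> prob (carrier G)) \<and>
      (\<lambda>j. seminorm (ind_kernel ?\<phi>) (\<lambda>i. z' j i + (-1) * z n j i)) \<longlonglongrightarrow> 0 \<and>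
      (\<forall>j F. pair (z' j) F = pair (z n j) (\<lambda>g. F (t \<otimes>\<^bsub>G\<^esub> g)))" if "t \<in> carrier G" for t
      using P[of n] that unfolding P_def by (elim conjE) (rule bspec)
    show "\<not> (\<lambda>j. pair (z n j) (T (\<lambda>l. hinner K (\<pi> l (\<xi> (n + M))) (\<xi> (n + M))) p p)) \<longlonglongrightarrow> 0"
    proof
      assume "(\<lambda>j. pair (z n j) (T (\<lambda>l. hinner K (\<pi> l (\<xi> (n + M))) (\<xi> (n + M))) p p)) \<longlonglongrightarrow> 0"
      then have "(\<lambda>j. pair (z n j) (T ?\<phi> p p)) \<longlonglongrightarrow> 0" by (simp add: \<phi>_def[abs_def])
      from tendsto_lowerbound[OF tendsto_norm[OF this] near] show False using c0(1) by simp
    qed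
  qed
qed

end

theorem theorem1p2:
  fixes \<Gamma> :: "'a monoid" and \<Lambda> :: "'b monoid"
  assumes "group \<Gamma>" and "countable (carrier \<Gamma>)"
    and "group \<Lambda>" and "countable (carrier \<Lambda>)"
    and "vN_equivalent TYPE('h) \<Gamma> \<Lambda>"
  shows "(amenable \<Gamma> \<longleftrightarrow> amenable \<Lambda>) \<and>
    (property_T TYPE('u) \<Gamma> \<longleftrightarrow> property_T TYPE('u) \<Lambda>) \<and>
    (haagerup_property \<Gamma> \<longleftrightarrow> haagerup_property \<Lambda>)"
proof -
  obtain N :: "('h \<Rightarrow> 'h) set" and mul star ip \<sigma> \<tau> p q where c: "coupling N mul star ip \<Gamma> \<sigma> \<Lambda> \<tau> p q"
    using vN_equivalent_coupling[OF assms(5)] by blast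
  note c' = coupling.coupling_swap[OF c]
  show ?thesis
    using coupling.amenable_transfer[OF c] coupling.amenable_transfer[OF c']
      coupling.property_T_transfer[OF c assms(2,4)] coupling.property_T_transfer[OF c' assms(4,2)]
      coupling.haagerup_transfer[OF c] coupling.haagerup_transfer[OF c'] by blast
qed

end
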